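(* Assume the coefficients $(Q_n,M_n)_{n\in\mathbb Z}$ are induced by a C-chain $(X_n)_{n\in\mathbb Z}$ with finite alphabet $\mathcal D$, and that: (i) $|Q_0|<q_0$ and $m_0^{-1}<|M_0|<m_0$ a.s. for some constants $q_0>0$, $m_0>0$; (ii) $\Lambda(\beta):=\limsup_{n\to\infty}\frac1n\log E\big(\prod_{i=0}^{n-1}|M_i|^\beta\big)$ changes sign in $(0,\infty)$; (iii) for every $\delta>0$, $P(\log|M_0|\in\delta\mathbb Z\mid M_0\ne0)<1$. Then the $\limsup$ defining $\Lambda(\beta)$ is a limit, and there is a unique $\alpha>0$ with $\Lambda(\alpha)=0$. Let $\mathcal X=(X_n)_{n\ge0}$ and let $R=Q_0+\sum_{n\ge1}Q_{-n}\prod_{i=0}^{n-1}M_{-i}$. Then: (a) for $\eta\in\{-1,1\}$ there are bounded functions $K_\eta:\mathcal D^{\mathbb Z_+}\to\mathbb R_+$ such that $\lim_{t\to\infty}t^\alpha P(\eta R>t\mid\mathcal X)=K_\eta(\mathcal X)$, the convergence being uniform in $\mathcal X$; (b) if $P(M_0<0)>0$ then $P(K_1(\mathcal X)=K_{-1}(\mathcal X))=1$; (c) if $P(Q_0>0,M_0>0)=1$ then $P(K_1(\mathcal X)>0)=1$; (d) for $\eta\in\{-1,1\}$, if $P(K_\eta(\mathcal X)>0)>0$ then $P(K_\eta(\mathcal X)>0)=1$; (e) $P(K_1(\mathcal X)=K_{-1}(\mathcal X)=0)=1$ if and only if there is a function $\Gamma:\mathcal D\to\mathbb R$ with $P(Q_0+\Gamma(X_0)M_0=\Gamma(X_1))=1$.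 Moreover, if $P(Q_{0,i}=q,M_{0,i}=m)<1$ for all $(q,m)\in\mathbb R^2$ and all $i\in\mathcal D$, then $P(K_1(\mathcal X)=K_{-1}(\mathcal X)=0)=1$ if and only if $P(Q_0+cM_0=c)=1$ for some $c\in\mathbb R$.
   Context: A C-chain is a stationary process $(X_n)_{n\in\mathbb Z}$ with values in a finite set $\mathcal D$ such that: (1) $P(X_1=i_1,\dots,X_n=i_n)>0$ for all $n$ and $i_1,\dots,i_n\in\mathcal D$; (2) for every $i_0\in\mathcal D$ and $(i_n)_{n\ge1}\in\mathcal D^{\mathbb N}$ the limit $\lim_{n\to\infty}P(X_0=i_0\mid X_{-k}=i_k,1\le k\le n)$ exists and equals (a regular version of) $P(X_0=i_0\mid X_{-k}=i_k,k\ge1)$; (3) with $\gamma_n=\sup\{|P(X_0=i_0\mid X_{-k}=i_k,k\ge1)/P(X_0=j_0\mid X_{-k}=j_k,k\ge1)-1|: i_k=j_k,\ k=1,\dots,n\}$, all $\gamma_n$ are finite and $\limsup_n\frac1n\log\gamma_n<0$. Coefficients induced by $(X_n)$: there are independent $\mathbb R^2$-valued random pairs $(Q_{n,i},M_{n,i})_{n\in\mathbb Z,i\in\mathcal D}$, independent of $(X_n)$, i.i.d. in $n$ for each fixed $i$, and $Q_n=Q_{n,X_n}$, $M_n=M_{n,X_n}$. $\delta\mathbb Z=\{k\delta:k\in\mathbb Z\}$. *)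

theory Defs
  imports "HOL-Probability.Probability"
begin

definition seqM :: "(nat \<Rightarrow> 'd) measure" where
  "seqM = PiM UNIV (\<lambda>_. count_space UNIV)"

definition cond_prob_version ::
  "'a measure \<Rightarrow> ('a \<Rightarrow> 'b) \<Rightarrow> 'b measure \<Rightarrow> ('a \<Rightarrow> bool) \<Rightarrow> ('b \<Rightarrow> real) \<Rightarrow> bool" where
  "cond_prob_version P Y S E F \<longleftrightarrow>
     F \<in> borel_measurable S \<and> integrable P (\<lambda>\<omega>. F (Y \<omega>)) \<and>
     (\<forall>B\<in>sets S. (\<integral>\<omega>. indicator {\<omega>\<in>space P. Y \<omega> \<in> B} \<omega> * F (Y \<omega>) \<partial>P)
                  = measure P {\<omega>\<in>space P. E \<omega> \<and> Y \<omega> \<in> B})"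

definition stationary_chain :: "'a measure \<Rightarrow> (int \<Rightarrow> 'a \<Rightarrow> 'd) \<Rightarrow> bool" where
  "stationary_chain P X \<longleftrightarrow>
     (\<forall>(k::int) (m::nat) (f::nat \<Rightarrow> 'd).
        measure P {\<omega>\<in>space P. \<forall>j<m. X (k + int j) \<omega> = f j}
      = measure P {\<omega>\<in>space P. \<forall>j<m. X (int j) \<omega> = f j})"

definition past :: "(int \<Rightarrow> 'a \<Rightarrow> 'd) \<Rightarrow> 'a \<Rightarrow> nat \<Rightarrow> 'd" where
  "past X \<omega> = (\<lambda>k. X (- int k - 1) \<omega>)"

definition cp_ratio :: "'a measure \<Rightarrow> (int \<Rightarrow> 'a \<Rightarrow> 'd) \<Rightarrow> 'd \<Rightarrow> (nat \<Rightarrow> 'd) \<Rightarrow> nat \<Rightarrow> real" where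
  "cp_ratio P X i0 w n =
     measure P {\<omega>\<in>space P. X 0 \<omega> = i0 \<and> (\<forall>k<n. X (- int k - 1) \<omega> = w k)}
     / measure P {\<omega>\<in>space P. \<forall>k<n. X (- int k - 1) \<omega> = w k}"

definition cond0 :: "'a measure \<Rightarrow> (int \<Rightarrow> 'a \<Rightarrow> 'd) \<Rightarrow> 'd \<Rightarrow> (nat \<Rightarrow> 'd) \<Rightarrow> real" where
  "cond0 P X i0 w = lim (cp_ratio P X i0 w)"

definition gamma :: "'a measure \<Rightarrow> (int \<Rightarrow> 'a \<Rightarrow> 'd) \<Rightarrow> nat \<Rightarrow> ereal" where
  "gamma P X n = Sup {\<bar>ereal (cond0 P X i0 w) / ereal (cond0 P X i0 v) - 1\<bar> | i0 w v.
                        \<forall>k<n. w k = v k}"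

definition eln :: "ereal \<Rightarrow> ereal" where
  "eln x = (if x = 0 then -\<infinity> else if x = \<infinity> then \<infinity> else ereal (ln (real_of_ereal x)))"

definition C_chain :: "'a measure \<Rightarrow> (int \<Rightarrow> 'a \<Rightarrow> 'd::finite) \<Rightarrow> bool" where
  "C_chain P X \<longleftrightarrow>
     (\<forall>n. X n \<in> measurable P (count_space UNIV)) \<and>
     stationary_chain P X \<and>
     (\<forall>(m::nat) (f::nat \<Rightarrow> 'd). measure P {\<omega>\<in>space P. \<forall>j<m. X (int j + 1) \<omega> = f j} > 0) \<and>
     (\<forall>i0 w. convergent (cp_ratio P X i0 w)) \<and>
     (\<forall>i0. cond_prob_version P (past X) seqM (\<lambda>\<omega>. X 0 \<omega> = i0) (cond0 P X i0)) \<and>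
     (\<forall>n. gamma P X n < \<infinity>) \<and>
     limsup (\<lambda>n. eln (gamma P X n) / ereal (real n)) < 0"

definition induced_coeffs ::
  "'a measure \<Rightarrow> (int \<Rightarrow> 'a \<Rightarrow> 'd) \<Rightarrow> (int \<Rightarrow> 'd \<Rightarrow> 'a \<Rightarrow> real) \<Rightarrow> (int \<Rightarrow> 'd \<Rightarrow> 'a \<Rightarrow> real) \<Rightarrow> bool" where
  "induced_coeffs P X Qc Mc \<longleftrightarrow>
     prob_space.indep_vars P (\<lambda>_. borel :: (real \<times> real) measure) (\<lambda>p \<omega>. (Qc (fst p) (snd p) \<omega>, Mc (fst p) (snd p) \<omega>)) UNIV \<and>
     prob_space.indep_set P
        (sets (vimage_algebra (space P) (\<lambda>\<omega> n. X n \<omega>) (PiM UNIV (\<lambda>_::int. count_space UNIV))))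
        (sets (vimage_algebra (space P) (\<lambda>\<omega> p. (Qc (fst p) (snd p) \<omega>, Mc (fst p) (snd p) \<omega>))
                 (PiM UNIV (\<lambda>_::int \<times> 'd. borel :: (real \<times> real) measure)))) \<and>
     (\<forall>n i. distr P borel (\<lambda>\<omega>. (Qc n i \<omega>, Mc n i \<omega>)) = distr P borel (\<lambda>\<omega>. (Qc 0 i \<omega>, Mc 0 i \<omega>)))"

definition Lambda_seq :: "'a measure \<Rightarrow> (int \<Rightarrow> 'a \<Rightarrow> 'd) \<Rightarrow> (int \<Rightarrow> 'd \<Rightarrow> 'a \<Rightarrow> real) \<Rightarrow> real \<Rightarrow> nat \<Rightarrow> real" where
  "Lambda_seq P X Mc \<beta> n =
     ln (\<integral>\<omega>. (\<Prod>i<n. \<bar>Mc (int i) (X (int i) \<omega>) \<omega>\<bar> powr \<beta>) \<partial>P) / real n"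

definition Lambda :: "'a measure \<Rightarrow> (int \<Rightarrow> 'a \<Rightarrow> 'd) \<Rightarrow> (int \<Rightarrow> 'd \<Rightarrow> 'a \<Rightarrow> real) \<Rightarrow> real \<Rightarrow> ereal" where
  "Lambda P X Mc \<beta> = limsup (\<lambda>n. ereal (Lambda_seq P X Mc \<beta> n))"

end

theory Submission
 imports Defs "HOL-Probability.Probability"
begin

text \<open>Conditioning on the whole future, the backward chain is a chain with complete connections whose
 transition probabilities depend exponentially little on remote coordinates. The conditional law
 \<open>kap x\<close> of the perpetuity given the future \<open>x\<close> satisfies a recursion along this chain. After
 tilting by the eigenfunction \<open>h\<close> of the transfer operator at the critical exponent, smoothed and
 rescaled tails of \<open>kap x\<close> solve a renewal equation for a Markov-modulated random walk up to
 an integrable defect; the two signs of the perpetuity are carried as an additional state. Bounded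
 uniformly continuous solutions of the equation converge, because a suitable Lyapunov functional together with
 the non-lattice condition forces every limit point to be constant. Positivity of the limit
 is a lower bound for the tail that fails only if \<open>kap x\<close> is concentrated at one point, and then
 \<open>q + c m = c\<close> holds for almost all coefficient pairs.\<close>

text \<open>Uniformity over all futures requires conditional laws that exist at every sequence, not
  just almost surely. Exponential decay of the variations makes past and future nearly independent
  given a long block between them, so their joint law has a density \<open>Psi\<close> with respect
  to the product law, bounded away from 0 and infinity; reweighting by it defines
  \<open>kap x\<close> for each \<open>x\<close>. All \<open>kap x\<close> are therefore comparable
  with one unconditional law. The same near independence makes moments of products multiplicative up
  to a constant factor, so at the critical exponent they stay between two positive constants, which
  is what an eigenfunction needs. Convergence is proved with suprema and one-step averages only,
  without an invariant measure. The limit has the product form \<open>h x\<close> times a constant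
  depending on the sign times a moment of the symbol \<open>x 0\<close>; the alternative between
  vanishing everywhere and nowhere comes from that form. In (e) the function \<Gamma> is forced to
  be constant, because every pair of adjacent symbols has positive probability independently of the
  coefficients.\<close>

abbreviation cons :: "'d \<Rightarrow> (nat \<Rightarrow> 'd) \<Rightarrow> nat \<Rightarrow> 'd" where
 "cons j x \<equiv> case_nat j x"

section \<open>Limits superior uniform in a parameter, and closed subgroups of the real line\<close>

lemma limsup_value:
 fixes g :: "real \<Rightarrow> 's \<Rightarrow> real"
 assumes "\<And>t u. \<bar>g t u\<bar> \<le> B"
 obtains S where "\<And>e. e > 0 \<Longrightarrow> \<exists>T. \<forall>t\<ge>T. \<forall>u. g t u \<le> S + e"
  "\<And>e T. e > 0 \<Longrightarrow> \<exists>t\<ge>T. \<exists>u. S - e \<le> g t u"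
proof
 \<comment> \<open>\<open>A\<close> collects the eventual upper bounds that are uniform in
   \<open>u\<close>; its infimum is the upper limit in \<open>t\<close> of the supremum over
   \<open>u\<close>.\<close>
 define A where "A = {a. \<exists>T. \<forall>t\<ge>T. \<forall>u. g t u \<le> a}"
 have BA: "B \<in> A" using assms unfolding A_def by (auto simp: abs_le_iff)
 have lb: "- B \<le> a" if "a \<in> A" for a
 proof -
  from that obtain T where "\<forall>t\<ge>T. \<forall>u. g t u \<le> a" unfolding A_def by blast
  then have "g T undefined \<le> a" by auto
  then show ?thesis using assms[of T undefined] by linarith
 qed
 have bdd: "bdd_below A" using lb by (meson bdd_belowI)
 fix e :: real assume e: "e > 0"
 have "\<exists>a\<in>A. a < Inf A + e" using cInf_lessD[of A "Inf A + e"] BA e by auto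
 then show "\<exists>T. \<forall>t\<ge>T. \<forall>u. g t u \<le> Inf A + e"
  unfolding A_def by clarsimp (meson less_imp_le order_trans)
 fix T
 show "\<exists>t\<ge>T. \<exists>u. Inf A - e \<le> g t u"
 proof (rule ccontr)
  assume "\<not> ?thesis"
  then have "\<forall>t\<ge>T. \<forall>u. g t u \<le> Inf A - e" by (meson not_le less_imp_le)
  then have "Inf A - e \<in> A" unfolding A_def mem_Collect_eq by blast
  then show False using cInf_lower[OF _ bdd] e by fastforce
 qed
qed

text \<open>Either there are arbitrarily small positive elements, whose multiples are dense, or a
  least positive element generates the group. Closedness is expressed as stability under
  approximation, the form in which a set of asymptotic periods satisfies it.\<close>

lemma real_subgroup_cases:
 fixes A :: "real set"
 assumes zero: "0 \<in> A" and add: "\<And>a b. a \<in> A \<Longrightarrow> b \<in> A \<Longrightarrow> a + b \<in> A"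
  and neg: "\<And>a. a \<in> A \<Longrightarrow> - a \<in> A"
  and closed: "\<And>a. (\<And>d. d > 0 \<Longrightarrow> \<exists>a'\<in>A. \<bar>a - a'\<bar> < d) \<Longrightarrow> a \<in> A"
 shows "A = UNIV \<or> (\<exists>\<delta>>0. \<forall>a\<in>A. \<exists>k::int. a = \<delta> * of_int k)"
proof -
 have nat: "of_nat n * a \<in> A" if "a \<in> A" for a and n :: nat
  by (induction n) (auto simp: zero algebra_simps intro!: add that)
 have int: "of_int k * a \<in> A" if "a \<in> A" for a and k :: int
  using nat[OF that] neg[OF nat[OF that]] by (cases k rule: int_cases2) fastforce+
 have fl: "0 \<le> x - of_int \<lfloor>x / a\<rfloor> * a \<and> x - of_int \<lfloor>x / a\<rfloor> * a < a" if "0 < a" for a x :: real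
  using floor_divide_lower[OF that] floor_divide_upper[OF that] by (auto simp: algebra_simps)
 show ?thesis
 proof (cases "\<forall>d>0. \<exists>a\<in>A. 0 < a \<and> a < d")
  case True
  have "x \<in> A" for x
  proof (rule closed)
   fix d :: real assume "d > 0"
   then obtain a where a: "a \<in> A" "0 < a" "a < d" using True by auto
   show "\<exists>a'\<in>A. \<bar>x - a'\<bar> < d"
    using fl[OF a(2), of x] a int[OF a(1)] by (intro bexI[of _ "of_int \<lfloor>x / a\<rfloor> * a"]) auto
  qed
  then show ?thesis by auto
 next
  case False
  then obtain d where d: "d > 0" "\<And>a. a \<in> A \<Longrightarrow> 0 < a \<Longrightarrow> d \<le> a" by force
  show ?thesis
  proof (cases "\<exists>a\<in>A. 0 < a")
   case False
   have "a = 0" if "a \<in> A" for a using False that neg[OF that] by (smt (verit))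
   \<comment> \<open>The trivial group lies in every lattice, so mesh 1 serves.\<close>
   then show ?thesis by (intro disjI2 exI[of _ 1]) force
  next
   case True
   define D where "D = Inf {a\<in>A. 0 < a}"
   have bdd: "bdd_below {a\<in>A. 0 < a}" by (auto intro!: bdd_belowI[of _ 0])
   have ne: "{a\<in>A. 0 < a} \<noteq> {}" using True by auto
   have Dle: "D \<le> a" if "a \<in> A" "0 < a" for a unfolding D_def using that bdd by (intro cInf_lower) auto
   have dD: "d \<le> D" unfolding D_def using ne d by (intro cInf_greatest) auto
   obtain a where a: "a \<in> A" "0 < a" "a < D + d"
    using cInf_lessD[OF ne, of "D + d"] d(1) unfolding D_def by auto
   \<comment> \<open>The infimum is attained: otherwise some positive element below \<open>a\<close>
     would differ from \<open>a\<close> by less than \<open>d\<close>.\<close>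
   have "a = D"
   proof (rule ccontr)
    assume "a \<noteq> D"
    then have "D < a" using Dle[OF a(1,2)] by simp
    then obtain a' where a': "a' \<in> A" "0 < a'" "a' < a"
     using cInf_lessD[OF ne, of a] unfolding D_def by auto
    have "a - a' \<in> A" using add[OF a(1) neg[OF a'(1)]] by simp
    then have "d \<le> a - a'" using a' d(2) by simp
    then show False using Dle[OF a'(1,2)] a(3) by simp
   qed
   then have D: "D \<in> A" "0 < D" using a by auto
   have "x = D * of_int \<lfloor>x / D\<rfloor>" if "x \<in> A" for x
   proof -
    have "x - of_int \<lfloor>x / D\<rfloor> * D \<in> A" using add[OF that neg[OF int[OF D(1)]]] by simp
    then show ?thesis using fl[OF D(2), of x] Dle by (smt (verit) mult.commute)
   qed
   then show ?thesis using D(2) by blast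
  qed
 qed
qed

section \<open>Markov-modulated walk on the logarithmic scale: averaging operator, maximum
  principle, Lyapunov function\<close>

locale markov_walk =
 fixes p :: "'d::finite \<Rightarrow> (nat \<Rightarrow> 'd) \<Rightarrow> real" and \<zeta> :: "'d \<Rightarrow> real measure"
  and L p0 \<theta> \<kappa> bmax :: real and b :: "(nat \<Rightarrow> 'd) \<Rightarrow> real"
 assumes prob_zeta: "prob_space (\<zeta> j)"
  and sets_zeta [measurable_cong, simp]: "sets (\<zeta> j) = sets borel"
  and jump: "AE m in \<zeta> j. m \<noteq> 0 \<and> \<bar>ln \<bar>m\<bar>\<bar> \<le> L"
  and L_pos: "0 < L"
  and p0_pos: "0 < p0" and p0_le: "p0 \<le> p j x"
  and p_sum: "(\<Sum>j\<in>UNIV. p j x) = 1"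
  and theta_pos: "0 < \<theta>" and kappa_gt: "1 < \<kappa>"
  and b_ge: "1 \<le> b x" and b_le: "b x \<le> bmax"
  and drift: "(\<Sum>j\<in>UNIV. p j x * (\<integral>m. \<bar>m\<bar> powr (- \<theta>) \<partial>\<zeta> j) * b (cons j x)) \<le> b x / \<kappa>"
begin

lemma space_zeta [simp]: "space (\<zeta> j) = UNIV"
 using sets_eq_imp_space_eq[OF sets_zeta, of j] by simp

lemma p_pos: "0 < p j x" using p0_pos p0_le[of j x] by linarith

lemma p_le: "p j x \<le> 1"
 using member_le_sum[of j UNIV "\<lambda>j. p j x"] p_pos[of _ x] by (auto simp: p_sum less_imp_le)

text \<open>One step of the walk: a symbol is prepended, a multiplier \<open>m\<close> is drawn, and
  the level drops by \<open>ln \<bar>m\<bar>\<close>. The Boolean is a sign with \<open>True\<close>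
  for plus, so \<open>s = (0 < m)\<close> is the product of two signs.\<close>

definition Pop :: "(real \<Rightarrow> bool \<Rightarrow> (nat \<Rightarrow> 'd) \<Rightarrow> real) \<Rightarrow> real \<Rightarrow> bool \<Rightarrow> (nat \<Rightarrow> 'd) \<Rightarrow> real" where
 "Pop f t s x = (\<Sum>j\<in>UNIV. p j x * (\<integral>m. f (t - ln \<bar>m\<bar>) (s = (0 < m)) (cons j x) \<partial>\<zeta> j))"

text \<open>The operator integrates over the level only and sums over finitely many symbols; hence
  measurability is asked in \<open>t\<close> alone. Bounds local in \<open>t\<close> suffice because
  a step moves the level by at most \<open>L\<close>.\<close>

definition adm :: "(real \<Rightarrow> bool \<Rightarrow> (nat \<Rightarrow> 'd) \<Rightarrow> real) \<Rightarrow> bool" where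
 "adm f \<longleftrightarrow> (\<forall>s x. (\<lambda>t. f t s x) \<in> borel_measurable borel) \<and>
  (\<forall>A. \<exists>B. \<forall>t s x. \<bar>t\<bar> \<le> A \<longrightarrow> \<bar>f t s x\<bar> \<le> B)"

lemma adm_measurable:
 assumes "adm f"
 shows "(\<lambda>m. f (t - ln \<bar>m\<bar>) (s = (0 < m)) y) \<in> borel_measurable (\<zeta> j)"
proof -
 have [measurable]: "(\<lambda>t. f t s x) \<in> borel_measurable borel" for s x
  using assms by (auto simp: adm_def)
 have "(\<lambda>m. f (t - ln \<bar>m\<bar>) (s = (0 < m)) y) =
   (\<lambda>m::real. if 0 < m then f (t - ln \<bar>m\<bar>) s y else f (t - ln \<bar>m\<bar>) (\<not> s) y)"
  by (auto simp: fun_eq_iff)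
 also have "\<dots> \<in> borel_measurable (\<zeta> j)"
  by measurable
 finally show ?thesis .
qed

lemma adm_integrable:
 assumes "adm f"
 shows "integrable (\<zeta> j) (\<lambda>m. f (t - ln \<bar>m\<bar>) (s = (0 < m)) y)"
proof -
 interpret prob_space "\<zeta> j" by (rule prob_zeta)
 obtain B where B: "\<And>t' s x. \<bar>t'\<bar> \<le> \<bar>t\<bar> + L \<Longrightarrow> \<bar>f t' s x\<bar> \<le> B"
  using assms unfolding adm_def by meson
 show ?thesis
 proof (rule integrable_const_bound[where B=B])
  show "AE m in \<zeta> j. norm (f (t - ln \<bar>m\<bar>) (s = (0 < m)) y) \<le> B"
   using jump[of j] by eventually_elim (auto intro!: B)
 qed (rule adm_measurable[OF assms])
qed

lemma admM: "adm f \<Longrightarrow> (\<lambda>t. f t s x) \<in> borel_measurable borel"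
 by (simp add: adm_def)

lemma adm_const [simp]: "adm (\<lambda>t s x. c)"
 by (auto simp: adm_def)

lemma adm_bounded:
 assumes "\<And>s x. (\<lambda>t. f t s x) \<in> borel_measurable borel" "\<And>t s x. \<bar>f t s x\<bar> \<le> B"
 shows "adm f"
 using assms unfolding adm_def by blast

lemma adm_add [intro]:
 assumes "adm f" "adm g" shows "adm (\<lambda>t s x. f t s x + g t s x)"
 unfolding adm_def
proof (intro conjI allI)
 fix A
 obtain B1 B2 where "\<And>t s x. \<bar>t\<bar> \<le> A \<Longrightarrow> \<bar>f t s x\<bar> \<le> B1" "\<And>t s x. \<bar>t\<bar> \<le> A \<Longrightarrow> \<bar>g t s x\<bar> \<le> B2"
  using assms unfolding adm_def by meson
 then have "\<bar>t\<bar> \<le> A \<Longrightarrow> \<bar>f t s x + g t s x\<bar> \<le> B1 + B2" for t s x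
  by (meson abs_triangle_ineq add_mono order_trans)
 then show "\<exists>B. \<forall>t s x. \<bar>t\<bar> \<le> A \<longrightarrow> \<bar>f t s x + g t s x\<bar> \<le> B" by blast
qed (intro borel_measurable_add admM assms)

lemma adm_cmult [intro]:
 assumes "adm f" shows "adm (\<lambda>t s x. c * f t s x)"
 unfolding adm_def
proof (intro conjI allI)
 fix A
 obtain B1 where "\<And>t s x. \<bar>t\<bar> \<le> A \<Longrightarrow> \<bar>f t s x\<bar> \<le> B1"
  using assms unfolding adm_def by meson
 then have "\<bar>t\<bar> \<le> A \<Longrightarrow> \<bar>c * f t s x\<bar> \<le> \<bar>c\<bar> * B1" for t s x
  by (simp add: abs_mult mult_left_mono)
 then show "\<exists>B. \<forall>t s x. \<bar>t\<bar> \<le> A \<longrightarrow> \<bar>c * f t s x\<bar> \<le> B" by blast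
qed (intro borel_measurable_times borel_measurable_const admM assms)

lemma adm_abs [intro]:
 assumes "adm f" shows "adm (\<lambda>t s x. \<bar>f t s x\<bar>)"
 unfolding adm_def abs_abs
proof (intro conjI allI)
 show "\<exists>B. \<forall>t s x. \<bar>t\<bar> \<le> A \<longrightarrow> \<bar>f t s x\<bar> \<le> B" for A
  using assms unfolding adm_def by blast
qed (intro borel_measurable_abs admM assms)

lemma adm_uminus [intro]: "adm f \<Longrightarrow> adm (\<lambda>t s x. - f t s x)"
 using adm_cmult[of f "-1"] by simp

lemma adm_diff [intro]: "adm f \<Longrightarrow> adm g \<Longrightarrow> adm (\<lambda>t s x. f t s x - g t s x)"
 using adm_add[of f "\<lambda>t s x. - g t s x"] adm_uminus[of g] by simp

lemma adm_shift:
 assumes "adm f" shows "adm (\<lambda>t s x. f (t - a) s x)"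
 unfolding adm_def
proof (intro conjI allI)
 fix s x
 have [measurable]: "(\<lambda>t. f t s x) \<in> borel_measurable borel"
  using assms by (auto simp: adm_def)
 show "(\<lambda>t. f (t - a) s x) \<in> borel_measurable borel" by measurable
next
 fix A
 obtain B1 where "\<And>t s x. \<bar>t\<bar> \<le> A + \<bar>a\<bar> \<Longrightarrow> \<bar>f t s x\<bar> \<le> B1"
  using assms unfolding adm_def by meson
 then have "\<bar>t\<bar> \<le> A \<Longrightarrow> \<bar>f (t - a) s x\<bar> \<le> B1" for t s x
  by (meson abs_triangle_ineq4 add_right_mono order_trans)
 then show "\<exists>B. \<forall>t s x. \<bar>t\<bar> \<le> A \<longrightarrow> \<bar>f (t - a) s x\<bar> \<le> B" by blast
qed

lemma Pop_const [simp]: "Pop (\<lambda>t s x. c) t s x = c"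
 using p_sum[of x] prob_space.prob_space[OF prob_zeta]
 by (simp add: Pop_def sum_distrib_right[symmetric])

lemma Pop_add:
 assumes "adm f" "adm g"
 shows "Pop (\<lambda>t s x. f t s x + g t s x) t s x = Pop f t s x + Pop g t s x"
 by (simp add: Pop_def adm_integrable assms Bochner_Integration.integral_add distrib_left sum.distrib)

lemma Pop_cmult: "Pop (\<lambda>t s x. c * f t s x) t s x = c * Pop f t s x"
 by (simp add: Pop_def sum_distrib_left mult.left_commute)

lemma Pop_uminus: "Pop (\<lambda>t s x. - f t s x) t s x = - Pop f t s x"
 using Pop_cmult[of "-1" f] by simp

lemma Pop_diff:
 assumes "adm f" "adm g"
 shows "Pop (\<lambda>t s x. f t s x - g t s x) t s x = Pop f t s x - Pop g t s x"
 using Pop_add[OF assms(1) adm_uminus[OF assms(2)]] by (simp add: Pop_uminus)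

lemma Pop_shift: "Pop (\<lambda>t s x. f (t - a) s x) t s x = Pop f (t - a) s x"
 by (simp add: Pop_def algebra_simps)

lemma Pop_mono:
 assumes "adm f" "adm g" "\<And>t' s' y. \<bar>t' - t\<bar> \<le> L \<Longrightarrow> f t' s' y \<le> g t' s' y"
 shows "Pop f t s x \<le> Pop g t s x"
 unfolding Pop_def
proof (intro sum_mono mult_left_mono)
 fix j
 show "(\<integral>m. f (t - ln \<bar>m\<bar>) (s = (0 < m)) (cons j x) \<partial>\<zeta> j) \<le> (\<integral>m. g (t - ln \<bar>m\<bar>) (s = (0 < m)) (cons j x) \<partial>\<zeta> j)"
 proof (rule integral_mono_AE)
  show "AE m in \<zeta> j. f (t - ln \<bar>m\<bar>) (s = (0 < m)) (cons j x) \<le> g (t - ln \<bar>m\<bar>) (s = (0 < m)) (cons j x)"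
   using jump[of j] by eventually_elim (auto intro!: assms(3))
 qed (auto intro: adm_integrable assms)
qed (simp add: p_pos less_imp_le)

lemma Pop_abs: "adm f \<Longrightarrow> \<bar>Pop f t s x\<bar> \<le> Pop (\<lambda>t s x. \<bar>f t s x\<bar>) t s x"
 using Pop_mono[of f "\<lambda>t s x. \<bar>f t s x\<bar>" t s x] Pop_mono[of "\<lambda>t s x. - f t s x" "\<lambda>t s x. \<bar>f t s x\<bar>" t s x]
 by (simp add: Pop_uminus adm_abs adm_uminus abs_le_iff)

lemma bmax_ge: "1 \<le> bmax" using b_ge b_le order_trans by blast

lemma adm_exp_b: "adm (\<lambda>t s x. exp (\<theta> * t) * b x)"
 unfolding adm_def
proof (intro conjI allI)
 fix A :: real
 have "\<bar>t\<bar> \<le> A \<Longrightarrow> \<bar>exp (\<theta> * t) * b x\<bar> \<le> exp (\<theta> * A) * bmax" for t x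
  using b_ge[of x] b_le[of x] bmax_ge theta_pos
  unfolding abs_mult by (intro mult_mono) (auto simp: abs_le_iff)
 then show "\<exists>B. \<forall>t (s::bool) x. \<bar>t\<bar> \<le> A \<longrightarrow> \<bar>exp (\<theta> * t) * b x\<bar> \<le> B" by blast
qed auto

text \<open>Lowering the level by \<open>ln \<bar>m\<bar>\<close> multiplies
  \<open>exp (\<theta> * t)\<close> by \<open>\<bar>m\<bar> powr (- \<theta>)\<close>, so this is
  the assumption \<open>drift\<close> read as a strict supersolution of the walk.\<close>

lemma Pop_exp_b: "Pop (\<lambda>t s x. exp (\<theta> * t) * b x) t s x \<le> exp (\<theta> * t) * b x / \<kappa>"
proof -
 have "(\<integral>m. exp (\<theta> * (t - ln \<bar>m\<bar>)) * b (cons j x) \<partial>\<zeta> j) =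
    exp (\<theta> * t) * ((\<integral>m. \<bar>m\<bar> powr (- \<theta>) \<partial>\<zeta> j) * b (cons j x))" for j
 proof -
  have "(\<integral>m. exp (\<theta> * (t - ln \<bar>m\<bar>)) * b (cons j x) \<partial>\<zeta> j) =
     (\<integral>m. exp (\<theta> * t) * (\<bar>m\<bar> powr (- \<theta>)) * b (cons j x) \<partial>\<zeta> j)"
  proof (intro integral_cong_AE)
   show "AE m in \<zeta> j. exp (\<theta> * (t - ln \<bar>m\<bar>)) * b (cons j x) = exp (\<theta> * t) * \<bar>m\<bar> powr - \<theta> * b (cons j x)"
    using jump[of j] by eventually_elim (auto simp: powr_def algebra_simps exp_diff exp_minus divide_inverse)
  qed measurable
  then show ?thesis by simp
 qed
 note eq = this
 have "Pop (\<lambda>t s x. exp (\<theta> * t) * b x) t s x =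
  exp (\<theta> * t) * (\<Sum>j\<in>UNIV. p j x * (\<integral>m. \<bar>m\<bar> powr (- \<theta>) \<partial>\<zeta> j) * b (cons j x))"
  unfolding Pop_def eq by (simp add: sum_distrib_left mult_ac)
 also have "\<dots> \<le> exp (\<theta> * t) * (b x / \<kappa>)"
  by (intro mult_left_mono drift) simp
 finally show ?thesis by simp
qed

text \<open>The inequality \<open>E \<le> Pop E\<close> can be iterated, and each iteration gains a
  factor \<open>1 / \<kappa>\<close> against the supersolution
  \<open>exp (\<theta> * t) * b x\<close>. The growth bound replaces boundary conditions at both
  ends of the line.\<close>

lemma max_principle:
 assumes "adm E" and sub: "\<And>t s x. E t s x \<le> Pop E t s x" and bd: "\<And>t s x. E t s x \<le> B * exp (\<theta> * t)"
 shows "E t s x \<le> 0"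
proof -
 \<comment> \<open>Made nonnegative so that the factor \<open>b x\<close>, which is at least 1, can
   only enlarge the bound.\<close>
 define B' where "B' = max B 0"
 have B': "0 \<le> B'" "\<And>t s x. E t s x \<le> B' * (exp (\<theta> * t) * b x)"
 proof -
  show "0 \<le> B'" by (simp add: B'_def)
  fix t s x
  have "E t s x \<le> B' * exp (\<theta> * t)"
   using bd[of t s x] by (smt (verit) B'_def exp_gt_zero mult_right_mono)
  also have "\<dots> \<le> B' * (exp (\<theta> * t) * b x)"
   using b_ge[of x] by (intro mult_left_mono) (auto simp: B'_def)
  finally show "E t s x \<le> B' * (exp (\<theta> * t) * b x)" .
 qed
 have le: "E t s x \<le> B' * inverse \<kappa> ^ N * (exp (\<theta> * t) * b x)" for N t s x
 proof (induction N arbitrary: t s x)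
  case 0 then show ?case using B' by simp
 next
  case (Suc N)
  have "E t s x \<le> Pop E t s x" by (rule sub)
  also have "\<dots> \<le> Pop (\<lambda>t s x. B' * inverse \<kappa> ^ N * (exp (\<theta> * t) * b x)) t s x"
   by (intro Pop_mono assms(1) adm_cmult adm_exp_b Suc)
  also have "\<dots> = B' * inverse \<kappa> ^ N * Pop (\<lambda>t s x. exp (\<theta> * t) * b x) t s x"
   by (rule Pop_cmult)
  also have "\<dots> \<le> B' * inverse \<kappa> ^ N * (exp (\<theta> * t) * b x / \<kappa>)"
   using B' kappa_gt by (intro mult_left_mono Pop_exp_b) auto
  finally show ?case by (simp add: field_simps)
 qed
 have "(\<lambda>N. B' * inverse \<kappa> ^ N * (exp (\<theta> * t) * b x)) \<longlonglongrightarrow> B' * 0 * (exp (\<theta> * t) * b x)"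
  using kappa_gt by (intro tendsto_intros LIMSEQ_power_zero) (auto simp: field_simps)
 then show ?thesis
  using le by (intro tendsto_lowerbound[where F=sequentially]) auto
qed

text \<open>The Lyapunov function \<open>y / (1 + y)\<close>, \<open>y = exp (\<theta> t) b x\<close>: composing the
 strict supersolution \<open>y\<close> with a bounded concave function keeps a positive defect.\<close>

definition G :: "real \<Rightarrow> (nat \<Rightarrow> 'd) \<Rightarrow> real" where
 "G t x = exp (\<theta> * t) * b x / (1 + exp (\<theta> * t) * b x)"

text \<open>The denominator is the product of the two that occur in \<open>G_super\<close>:
  \<open>2 * (\<kappa> + 1)\<close> comes from levels \<open>t \<ge> 0\<close> and
  \<open>(1 + bmax) * (\<kappa> + bmax)\<close> from \<open>t < 0\<close>, where \<open>y\<close> is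
  at most \<open>bmax\<close>.\<close>

definition cG :: real where
 "cG = (\<kappa> - 1) / (2 * (\<kappa> + 1) * (1 + bmax) * (\<kappa> + bmax))"

lemma y_pos: "0 < exp (\<theta> * t) * b x" using b_ge[of x] by simp

lemma cG_pos: "0 < cG" using kappa_gt bmax_ge by (simp add: cG_def)

lemma G_bounds: "0 \<le> G t x" "G t x \<le> 1"
 using y_pos[of t x] unfolding G_def by (auto intro!: divide_nonneg_pos)

lemma adm_G: "adm (\<lambda>t s x. G t x)"
proof (rule adm_bounded)
 show "\<bar>G t x\<bar> \<le> 1" for t x using G_bounds[of t x] by simp
qed (auto simp: G_def)

text \<open>By concavity the average of \<open>G\<close> is at most \<open>y0 / (1 + y0)\<close>
  with \<open>y0 = y / \<kappa>\<close>. The gap to \<open>y / (1 + y)\<close> is of order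
  \<open>y\<close> for small \<open>y\<close> and of order \<open>1 / y\<close> for large
  \<open>y\<close>, which is the origin of the two-sided rate in \<open>t\<close>.\<close>

lemma G_super: "Pop (\<lambda>t s x. G t x) t s x + cG * exp (- \<theta> * \<bar>t\<bar>) \<le> G t x"
proof -
 define y where "y = exp (\<theta> * t) * b x"
 define y0 where "y0 = y / \<kappa>"
 have y: "0 < y" by (simp add: y_def y_pos)
 have y0: "0 < y0" using y kappa_gt by (simp add: y0_def)
 \<comment> \<open>The tangent is taken at the contracted value \<open>y0\<close> rather than at
   \<open>y\<close>: the mean of the next value is at most \<open>y0\<close>, so the linear term has
   the right sign after averaging.\<close>
 have tangent: "w / (1 + w) \<le> y0 / (1 + y0) + (w - y0) / (1 + y0)\<^sup>2" if "0 < w" for w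
 proof -
  have "y0 / (1 + y0) + (w - y0) / (1 + y0)\<^sup>2 - w / (1 + w) = (w - y0)\<^sup>2 / ((1 + y0)\<^sup>2 * (1 + w))"
   using that y0 by (simp add: divide_simps) (simp add: algebra_simps power2_eq_square)
  also have "\<dots> \<ge> 0" using that by (auto intro!: divide_nonneg_nonneg mult_nonneg_nonneg)
  finally show ?thesis by simp
 qed
 have "Pop (\<lambda>t s x. G t x) t s x
   \<le> Pop (\<lambda>t s x. (y0 / (1 + y0) - y0 / (1 + y0)\<^sup>2) + (1 / (1 + y0)\<^sup>2) * (exp (\<theta> * t) * b x)) t s x"
 proof (rule Pop_mono)
  fix t' y
  show "G t' y \<le> y0 / (1 + y0) - y0 / (1 + y0)\<^sup>2 + 1 / (1 + y0)\<^sup>2 * (exp (\<theta> * t') * b y)"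
   using tangent[OF y_pos[of t' y]] by (simp add: G_def diff_divide_distrib)
 qed (intro adm_G adm_add adm_const adm_cmult adm_exp_b)+
 also have "\<dots> = y0 / (1 + y0) - y0 / (1 + y0)\<^sup>2 + (1 / (1 + y0)\<^sup>2) * Pop (\<lambda>t s x. exp (\<theta> * t) * b x) t s x"
  by (subst Pop_add) (auto simp only: Pop_const Pop_cmult intro!: adm_const adm_cmult adm_exp_b)
 also have "\<dots> \<le> y0 / (1 + y0) - y0 / (1 + y0)\<^sup>2 + (1 / (1 + y0)\<^sup>2) * y0"
  using Pop_exp_b[of t s x] by (intro add_left_mono mult_left_mono) (auto simp: y0_def y_def)
 finally have 1: "Pop (\<lambda>t s x. G t x) t s x \<le> y0 / (1 + y0)" by simp
 have "G t x - y0 / (1 + y0) = y / (1 + y) - y / (\<kappa> + y)"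
 proof -
  have "y0 / (1 + y0) = y / (\<kappa> + y)"
   using kappa_gt y by (simp add: y0_def divide_simps)
  then show ?thesis by (simp add: G_def y_def)
 qed
 also have "\<dots> = y * (\<kappa> - 1) / ((1 + y) * (\<kappa> + y))"
  using y kappa_gt by (simp add: divide_simps) (simp add: algebra_simps)
 finally have 2: "G t x - y0 / (1 + y0) = y * (\<kappa> - 1) / ((1 + y) * (\<kappa> + y))" .
 have 3: "cG * exp (- \<theta> * \<bar>t\<bar>) \<le> y * (\<kappa> - 1) / ((1 + y) * (\<kappa> + y))"
 proof (cases "0 \<le> t")
  case True
  have y1: "1 \<le> y" using True theta_pos b_ge[of x] unfolding y_def
   by (metis exp_ge_zero mult_mono mult_1 one_le_exp_iff zero_le_mult_iff zero_le_one less_imp_le)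
  have "cG * exp (- \<theta> * \<bar>t\<bar>) \<le> (\<kappa> - 1) / (2 * (\<kappa> + 1) * bmax) * exp (- (\<theta> * t))"
   using True bmax_ge kappa_gt unfolding cG_def
   by (auto intro!: mult_mono divide_left_mono mult_pos_pos mult_nonneg_nonneg)
  also have "\<dots> = (\<kappa> - 1) / (2 * (\<kappa> + 1) * (exp (\<theta> * t) * bmax))"
   by (simp add: exp_minus field_simps)
  also have "\<dots> \<le> (\<kappa> - 1) / (2 * (\<kappa> + 1) * y)"
   using b_le[of x] kappa_gt bmax_ge y unfolding y_def
   by (auto intro!: divide_left_mono mult_left_mono mult_pos_pos)
  also have "\<dots> = y * (\<kappa> - 1) / ((y + y) * (\<kappa> * y + y))"
  proof -
   have "(y + y) * (\<kappa> * y + y) = y * (2 * (\<kappa> + 1) * y)" by (simp add: algebra_simps)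
   then show ?thesis using y by simp
  qed
  also have "\<dots> \<le> y * (\<kappa> - 1) / ((1 + y) * (\<kappa> + y))"
   using y y1 kappa_gt by (intro divide_left_mono mult_mono mult_nonneg_nonneg mult_pos_pos add_pos_pos) auto
  finally show ?thesis .
 next
  case False
  have e: "exp (\<theta> * t) \<le> 1" using False theta_pos by (simp add: mult_pos_neg less_imp_le)
  have ym: "y \<le> bmax" unfolding y_def using e b_le[of x] bmax_ge b_ge[of x]
   by (metis mult_mono mult_1 exp_ge_zero order_trans zero_le_one)
  have "cG * exp (- \<theta> * \<bar>t\<bar>) \<le> (\<kappa> - 1) / ((1 + bmax) * (\<kappa> + bmax)) * exp (\<theta> * t)"
   using False kappa_gt bmax_ge unfolding cG_def
   by (auto intro!: mult_mono divide_left_mono mult_pos_pos mult_nonneg_nonneg)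
  also have "\<dots> \<le> (\<kappa> - 1) / ((1 + bmax) * (\<kappa> + bmax)) * y"
   unfolding y_def using b_ge[of x] kappa_gt bmax_ge by (intro mult_left_mono) auto
  also have "\<dots> \<le> (\<kappa> - 1) / ((1 + y) * (\<kappa> + y)) * y"
   using y ym kappa_gt by (intro mult_right_mono divide_left_mono mult_mono mult_pos_pos mult_nonneg_nonneg) auto
  finally show ?thesis by (simp add: mult.commute)
 qed
 from 1 2 3 show ?thesis by linarith
qed

text \<open>The function \<open>\<bar>z\<bar> - (C / cG) * G\<close> is a subsolution, since the
  defect of \<open>G\<close> pays for that of \<open>z\<close>; the maximum principle makes it
  nonpositive, and \<open>G \<le> 1\<close>. The a priori growth constant \<open>B\<close> only
  licenses the maximum principle and disappears from the bound.\<close>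

lemma bounded_of_small_defect:
 assumes "adm z" and bd: "\<And>t s x. \<bar>z t s x\<bar> \<le> B * exp (\<theta> * t)"
  and def: "\<And>t s x. \<bar>z t s x - Pop z t s x\<bar> \<le> C * exp (- \<theta> * \<bar>t\<bar>)"
 shows "\<bar>z t s x\<bar> \<le> C / cG"
proof -
 have C: "0 \<le> C"
  using def[of 0 True "\<lambda>_. undefined"] by simp
 define E where "E = (\<lambda>t s x. \<bar>z t s x\<bar> - (C / cG) * G t x)"
 have admE: "adm E" unfolding E_def by (intro adm_diff adm_abs adm_cmult adm_G assms(1))
 have "E t s x \<le> 0"
 proof (rule max_principle[OF admE])
  fix t s x
  have "\<bar>z t s x\<bar> \<le> \<bar>Pop z t s x\<bar> + C * exp (- \<theta> * \<bar>t\<bar>)" using def[of t s x] by linarith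
  also have "\<dots> \<le> Pop (\<lambda>t s x. \<bar>z t s x\<bar>) t s x + C * exp (- \<theta> * \<bar>t\<bar>)"
   using Pop_abs[OF assms(1)] by simp
  finally have 1: "\<bar>z t s x\<bar> \<le> Pop (\<lambda>t s x. \<bar>z t s x\<bar>) t s x + C * exp (- \<theta> * \<bar>t\<bar>)" .
  have 2: "Pop E t s x = Pop (\<lambda>t s x. \<bar>z t s x\<bar>) t s x - (C / cG) * Pop (\<lambda>t s x. G t x) t s x"
   unfolding E_def by (subst Pop_diff) (auto simp only: Pop_cmult intro!: adm_abs adm_cmult adm_G assms(1))
  have "(C / cG) * (Pop (\<lambda>t s x. G t x) t s x + cG * exp (- \<theta> * \<bar>t\<bar>)) \<le> (C / cG) * G t x"
   using C cG_pos by (intro mult_left_mono G_super) simp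
  then have "(C / cG) * Pop (\<lambda>t s x. G t x) t s x + C * exp (- \<theta> * \<bar>t\<bar>) \<le> (C / cG) * G t x"
   using cG_pos by (simp add: algebra_simps)
  then show "E t s x \<le> Pop E t s x" using 1 2 by (simp add: E_def)
  show "E t s x \<le> B * exp (\<theta> * t)"
   using bd[of t s x] C cG_pos G_bounds[of t x] unfolding E_def
   by (smt (verit) divide_nonneg_pos mult_nonneg_nonneg)
 qed
 then have "\<bar>z t s x\<bar> \<le> (C / cG) * G t x" by (simp add: E_def)
 also have "\<dots> \<le> C / cG" using G_bounds[of t x] C cG_pos by (simp add: divide_right_mono mult_left_le)
 finally show ?thesis .
qed

section \<open>Support points of the steps, propagation of near-maxima, slow variation\<close>

definition near :: "'d \<Rightarrow> real \<Rightarrow> bool" where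
 "near i w \<longleftrightarrow> w \<noteq> 0 \<and> (\<forall>r>0. 0 < measure (\<zeta> i) {m. \<bar>m - w\<bar> < r})"

text \<open>There are only countably many null balls with rational centre and radius, so almost
  every point has no null neighbourhood.\<close>

lemma AE_near: "AE m in \<zeta> i. near i m"
proof -
 interpret prob_space "\<zeta> i" by (rule prob_zeta)
 have "AE m in \<zeta> i. \<bar>m - c\<bar> < r \<longrightarrow> 0 < measure (\<zeta> i) {m. \<bar>m - c\<bar> < r}" for c r
 proof (cases "measure (\<zeta> i) {m. \<bar>m - c\<bar> < r} = 0")
  case True
  have "{m. \<bar>m - c\<bar> < r} \<in> sets (\<zeta> i)" by simp
  then have "AE m in \<zeta> i. m \<notin> {m. \<bar>m - c\<bar> < r}"
   using True by (intro AE_not_in) (auto simp: null_sets_def emeasure_eq_measure)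
  then show ?thesis by eventually_elim simp
 next
  case False
  then show ?thesis by (simp add: zero_less_measure_iff)
 qed
 then have "AE m in \<zeta> i. \<forall>c::rat. \<forall>r::rat. \<bar>m - of_rat c\<bar> < of_rat r \<longrightarrow> 0 < measure (\<zeta> i) {m. \<bar>m - of_rat c\<bar> < of_rat r}"
  by (simp add: AE_all_countable)
 with jump[of i] show ?thesis
 proof eventually_elim
  case (elim m)
  have "0 < measure (\<zeta> i) {m'. \<bar>m' - m\<bar> < r}" if "r > 0" for r
  proof -
   obtain r' :: rat where r': "0 < real_of_rat r'" "real_of_rat r' < r / 2"
    using of_rat_dense[of 0 "r / 2"] \<open>0 < r\<close> half_gt_zero by blast
   obtain c :: rat where c: "m - of_rat r' < of_rat c" "of_rat c < m"
    using of_rat_dense[of "m - of_rat r'" m] r' by auto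
   have "0 < measure (\<zeta> i) {m'. \<bar>m' - of_rat c\<bar> < of_rat r'}"
    using elim(2) c by auto
   also have "\<dots> \<le> measure (\<zeta> i) {m'. \<bar>m' - m\<bar> < r}"
    using c r' by (intro finite_measure_mono) auto
   finally show ?thesis .
  qed
  then show ?case using elim(1) by (auto simp: near_def)
 qed
qed

lemma near_exists: "\<exists>w. near i w"
proof (rule ccontr)
 assume "\<not> ?thesis"
 then have "AE m in \<zeta> i. False" using AE_near[of i] by simp
 then show False using prob_space.AE_False[OF prob_zeta] by blast
qed

lemma near_neg_exists:
 assumes "0 < measure (\<zeta> i) {m. m < 0}" shows "\<exists>w<0. near i w"
proof (rule ccontr)
 interpret prob_space "\<zeta> i" by (rule prob_zeta)
 assume "\<not> ?thesis"
 then have "AE m in \<zeta> i. \<not> m < 0" using AE_near[of i] by (auto elim!: eventually_mono)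
 then have "AE m in \<zeta> i. m \<notin> {m. m < 0}" by simp
 then have "measure (\<zeta> i) {m. m < 0} = 0"
  by (subst (asm) AE_iff_measurable[where N="{m. m < 0}"]) (auto simp: measure_def)
 then show False using assms by simp
qed

text \<open>A quantitative strong maximum principle: an average close to an upper bound forces
  closeness at every successor of positive weight. It matters that \<open>d\<close> depends on
  \<open>i\<close>, \<open>w\<close>, \<open>H\<close>, \<open>e\<close> only and is uniform in the
  function and in the point.\<close>

lemma near_max_step:
 assumes "near i w" "0 \<le> H" "0 < e"
 obtains d where "0 < d"
  "\<And>f S t s x. adm f \<Longrightarrow> (\<And>t t' s x. \<bar>f t s x - f t' s x\<bar> \<le> H * \<bar>t - t'\<bar>) \<Longrightarrow>
   (\<And>t' s' y. \<bar>t' - t\<bar> \<le> L \<Longrightarrow> f t' s' y \<le> S + d) \<Longrightarrow> S - d \<le> Pop f t s x \<Longrightarrow>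
   S - e \<le> f (t - ln \<bar>w\<bar>) (s = (0 < w)) (cons i x)"
proof -
 define r' where "r' = e / (2 * (H + 1))"
 have r': "0 < r'" "H * r' \<le> e / 2" using assms by (auto simp: r'_def field_simps)
 have w: "w \<noteq> 0" using assms by (simp add: near_def)
 have "isCont (\<lambda>m. ln \<bar>m\<bar>) w" using w by (intro continuous_intros) auto
 then obtain r0 where r0: "r0 > 0" "\<And>m. \<bar>m - w\<bar> < r0 \<Longrightarrow> \<bar>ln \<bar>m\<bar> - ln \<bar>w\<bar>\<bar> < r'"
  using r' unfolding continuous_at_eps_delta dist_real_def by blast
 \<comment> \<open>Staying within \<open>\<bar>w\<bar>\<close> of \<open>w\<close> forces
   \<open>m\<close> to have the sign of \<open>w\<close>, so the Boolean coordinate of the successor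
   is determined.\<close>
 define r where "r = min r0 \<bar>w\<bar>"
 define A where "A = {m. \<bar>m - w\<bar> < r}"
 define q where "q = measure (\<zeta> i) A"
 have "0 < r" using r0 w by (simp add: r_def)
 then have q: "0 < q" using assms(1) unfolding q_def A_def near_def by blast
 have Am: "A \<in> sets (\<zeta> i)" by (simp add: A_def)
 \<comment> \<open>A value below \<open>S - e\<close> at the successor stays below
   \<open>S - e / 2\<close> on the ball and would lower the average by
   \<open>p0 * q * e / 2 = 4 * d\<close>, from at most \<open>S + d\<close> to at most
   \<open>S - 3 * d\<close>.\<close>
 define d where "d = p0 * q * e / 8"
 have d: "0 < d" using q p0_pos assms by (simp add: d_def)
 show ?thesis
 proof (rule that[OF d], rule ccontr)
  fix f S t s x
  assume f: "adm f" and lip: "\<And>t t' s x. \<bar>f t s x - f t' s x\<bar> \<le> H * \<bar>t - t'\<bar>"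
   and ub: "\<And>t' s' y. \<bar>t' - t\<bar> \<le> L \<Longrightarrow> f t' s' y \<le> S + d" and lb: "S - d \<le> Pop f t s x"
   and neg: "\<not> S - e \<le> f (t - ln \<bar>w\<bar>) (s = (0 < w)) (cons i x)"
  have I: "(\<integral>m. f (t - ln \<bar>m\<bar>) (s = (0 < m)) (cons j x) \<partial>\<zeta> j) \<le> (S + d) - (if j = i then e / 2 * q else 0)" for j
  proof -
   interpret prob_space "\<zeta> j" by (rule prob_zeta)
   have [measurable]: "A \<in> sets borel" by (simp add: A_def)
   have intA: "integrable (\<zeta> j) (\<lambda>m. c * indicator A m :: real)" for c
    by (intro integrable_mult_right integrable_real_indicator) (simp_all add: emeasure_eq_measure)
   have one: "measure (\<zeta> j) UNIV = 1" using prob_space by simp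
   have "(\<integral>m. f (t - ln \<bar>m\<bar>) (s = (0 < m)) (cons j x) \<partial>\<zeta> j)
     \<le> (\<integral>m. (S + d) - (if j = i then e / 2 else 0) * indicator A m \<partial>\<zeta> j)"
   proof (rule integral_mono_AE)
    show "AE m in \<zeta> j. f (t - ln \<bar>m\<bar>) (s = (0 < m)) (cons j x) \<le> (S + d) - (if j = i then e / 2 else 0) * indicator A m"
     using jump[of j]
    proof eventually_elim
     case (elim m)
     have 1: "f (t - ln \<bar>m\<bar>) (s = (0 < m)) (cons j x) \<le> S + d" by (intro ub) (use elim in auto)
     show ?case
     proof (cases "j = i \<and> m \<in> A")
      case True
      then have m: "\<bar>m - w\<bar> < r0" "\<bar>m - w\<bar> < \<bar>w\<bar>" by (auto simp: A_def r_def)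
      then have sg: "(0 < m) = (0 < w)" by linarith
      have "\<bar>f (t - ln \<bar>m\<bar>) (s = (0 < m)) (cons j x) - f (t - ln \<bar>w\<bar>) (s = (0 < m)) (cons j x)\<bar>
        \<le> H * \<bar>(t - ln \<bar>m\<bar>) - (t - ln \<bar>w\<bar>)\<bar>" by (rule lip)
      also have "\<dots> \<le> H * r'" using r0(2)[OF m(1)] assms by (intro mult_left_mono) auto
      finally have "f (t - ln \<bar>m\<bar>) (s = (0 < m)) (cons j x) \<le> S - e + e / 2"
       using neg True r'(2) unfolding sg by auto
      then show ?thesis using True d by (simp add: field_simps)
     qed (use 1 in auto)
    qed
    show "integrable (\<zeta> j) (\<lambda>m. (S + d) - (if j = i then e / 2 else 0) * indicator A m)"
     by (intro Bochner_Integration.integrable_diff integrable_const intA)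
   qed (rule adm_integrable[OF f])
   also have "\<dots> = (S + d) - (if j = i then e / 2 * q else 0)"
    by (subst Bochner_Integration.integral_diff[OF integrable_const intA]) (simp add: q_def one)
   finally show ?thesis .
  qed
  have "Pop f t s x \<le> (\<Sum>j\<in>UNIV. p j x * ((S + d) - (if j = i then e / 2 * q else 0)))"
   unfolding Pop_def by (intro sum_mono mult_left_mono I) (simp add: p_pos less_imp_le)
  also have "\<dots> = (S + d) - p i x * (e / 2 * q)"
  proof -
   have "(\<Sum>j\<in>UNIV. p j x * ((S + d) - (if j = i then e / 2 * q else 0))) =
     (\<Sum>j\<in>UNIV. p j x * (S + d) - (if j = i then p i x * (e / 2 * q) else 0))"
    by (intro sum.cong refl) (auto simp: right_diff_distrib)
   then show ?thesis
    by (simp add: sum_subtractf sum_distrib_right[symmetric] p_sum)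
  qed
  also have "\<dots> \<le> (S + d) - p0 * (e / 2 * q)"
   using p0_le[of i x] q assms by (simp add: mult_right_mono)
  also have "\<dots> = S - 3 * d" by (simp add: d_def algebra_simps)
  finally show False using lb d by simp
 qed
qed

text \<open>Invariance under \<open>Pop\<close> is demanded only asymptotically, so that differences
  and shifts of solutions can be handled like solutions. The geometric dependence on remote
  coordinates is what lets a long block of one symbol erase the initial sequence.\<close>

definition nice :: "real \<Rightarrow> (real \<Rightarrow> bool \<Rightarrow> (nat \<Rightarrow> 'd) \<Rightarrow> real) \<Rightarrow> bool" where
 "nice \<rho> z \<longleftrightarrow> 0 < \<rho> \<and> \<rho> < 1 \<and> adm z \<and> (\<exists>B. \<forall>t s x. \<bar>z t s x\<bar> \<le> B) \<and>
  (\<exists>H\<ge>0. (\<forall>t t' s x. \<bar>z t s x - z t' s x\<bar> \<le> H * \<bar>t - t'\<bar>) \<and>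
      (\<forall>t s x y n. (\<forall>k<n. x k = y k) \<longrightarrow> \<bar>z t s x - z t s y\<bar> \<le> H * \<rho> ^ n)) \<and>
  (\<forall>e>0. \<exists>T. \<forall>t\<ge>T. \<forall>s x. \<bar>z t s x - Pop z t s x\<bar> \<le> e)"

lemma nice_uminus:
 assumes "nice \<rho> z" shows "nice \<rho> (\<lambda>t s x. - z t s x)"
proof -
 have "\<bar>- a - - b\<bar> = \<bar>a - b\<bar>" for a b :: real by simp
 then show ?thesis using assms unfolding nice_def Pop_uminus abs_minus_cancel
  by (intro conjI; elim conjE; (simp only: adm_uminus)?)
qed

definition pre :: "'d \<Rightarrow> nat \<Rightarrow> (nat \<Rightarrow> 'd) \<Rightarrow> nat \<Rightarrow> 'd" where "pre i n x = (cons i ^^ n) x"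

definition sg :: "real \<Rightarrow> nat \<Rightarrow> bool \<Rightarrow> bool" where "sg w n s = ((\<lambda>s. s = (0 < w)) ^^ n) s"

lemma pre_simps [simp]: "pre i 0 x = x" "pre i (Suc n) x = cons i (pre i n x)"
 by (simp_all add: pre_def)

lemma sg_simps [simp]: "sg w 0 s = s" "sg w (Suc n) s = (sg w n s = (0 < w))"
 by (simp_all add: sg_def)

lemma pre_nth: "k < n \<Longrightarrow> pre i n x k = i"
 by (induction n arbitrary: k) (auto split: nat.split)

lemma sg_even: "sg w (2 * n) s = s"
 by (induction n) auto

text \<open>Suppose the upper limit \<open>S\<close> of
  \<open>g t = z t - z (t - 2 * ln \<bar>w\<bar>)\<close> were positive. Near-maximality of
  \<open>g\<close> then propagates along the path repeating symbol \<open>i\<close> with multiplier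
  \<open>w\<close>. Summed over the even steps of this path the increments of \<open>z\<close>
  telescope, yet each is about \<open>S / 2\<close> or more, which contradicts boundedness. Doubling
  the shift brings the sign back to its initial value even when \<open>w\<close> is
  negative.\<close>

lemma slow_variation_upper:
 assumes z: "nice \<rho> z" and near: "near i w" and e: "0 < e"
 shows "\<exists>T. \<forall>t\<ge>T. \<forall>s x. z t s x - z (t - 2 * ln \<bar>w\<bar>) s x \<le> e"
proof -
 obtain B where B: "\<And>t s x. \<bar>z t s x\<bar> \<le> B" using z unfolding nice_def by blast
 obtain H where H: "0 \<le> H" "\<And>t t' s x. \<bar>z t s x - z t' s x\<bar> \<le> H * \<bar>t - t'\<bar>"
  "\<And>t s x y n. (\<forall>k<n. x k = y k) \<Longrightarrow> \<bar>z t s x - z t s y\<bar> \<le> H * \<rho> ^ n"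
  using z unfolding nice_def by blast
 have adm: "adm z" and rho: "0 < \<rho>" "\<rho> < 1" using z by (auto simp: nice_def)
 have res: "\<And>e. e > 0 \<Longrightarrow> \<exists>T. \<forall>t\<ge>T. \<forall>s x. \<bar>z t s x - Pop z t s x\<bar> \<le> e" using z by (simp add: nice_def)
 define l where "l = ln \<bar>w\<bar>"
 define g where "g t s x = z t s x - z (t - 2 * l) s x" for t s x
 have admg: "adm g" unfolding g_def by (intro adm_diff adm adm_shift)
 have lipg: "\<bar>g t s x - g t' s x\<bar> \<le> (2 * H) * \<bar>t - t'\<bar>" for t t' s x
  using H(2)[of t s x t'] H(2)[of "t - 2 * l" s x "t' - 2 * l"] by (simp add: g_def)
 have "\<bar>g t (fst u) (snd u)\<bar> \<le> 2 * B" for t u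
  using B[of t "fst u" "snd u"] B[of "t - 2 * l" "fst u" "snd u"] by (auto simp: g_def)
 from limsup_value[of "\<lambda>t u. g t (fst u) (snd u)", OF this]
 obtain S where S: "\<And>e. e > 0 \<Longrightarrow> \<exists>T. \<forall>t\<ge>T. \<forall>s x. g t s x \<le> S + e"
  "\<And>e T. e > 0 \<Longrightarrow> \<exists>t\<ge>T. \<exists>s x. S - e \<le> g t s x"
  by (simp only: split_paired_All split_paired_Ex fst_conv snd_conv) blast
 have "S \<le> 0"
 proof (rule ccontr)
  assume "\<not> S \<le> 0"
  then have Sp: "0 < S" by simp
  \<comment> \<open>The tolerance at the start is found by induction on the number of steps, each
    further step asking for a sharper tolerance at the previous ones. One threshold in time serves
    all starting points.\<close>
  have iter: "\<exists>d>0. \<exists>T. \<forall>t\<ge>T. \<forall>s x. S - d \<le> g t s x \<longrightarrow>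
    (\<forall>n\<le>N. S - e \<le> g (t - real n * l) (sg w n s) (pre i n x))" if "0 < e" for N e
   using that
  proof (induction N arbitrary: e)
   case 0
   then show ?case by (intro exI[of _ e]) auto
  next
   case (Suc N)
   obtain d0 where d0: "0 < d0"
    "\<And>f S t s x. adm f \<Longrightarrow> (\<And>t t' s x. \<bar>f t s x - f t' s x\<bar> \<le> (2 * H) * \<bar>t - t'\<bar>) \<Longrightarrow>
     (\<And>t' s' y. \<bar>t' - t\<bar> \<le> L \<Longrightarrow> f t' s' y \<le> S + d0) \<Longrightarrow> S - d0 \<le> Pop f t s x \<Longrightarrow>
     S - e \<le> f (t - ln \<bar>w\<bar>) (s = (0 < w)) (cons i x)"
    by (rule near_max_step[OF near, of "2 * H" e]) (use H(1) Suc.prems in auto)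
   obtain T1 where T1: "\<And>t s x. t \<ge> T1 \<Longrightarrow> g t s x \<le> S + d0" using S(1)[OF d0(1)] by blast
   obtain T2 where T2: "\<And>t s x. t \<ge> T2 \<Longrightarrow> \<bar>z t s x - Pop z t s x\<bar> \<le> d0 / 4"
    using res[of "d0 / 4"] d0(1) by fastforce
   have "0 < min e (d0 / 2)" using Suc.prems d0(1) by simp
   from Suc.IH[OF this] obtain d T where d: "d > 0" "\<And>t s x n. t \<ge> T \<Longrightarrow> S - d \<le> g t s x \<Longrightarrow> n \<le> N \<Longrightarrow>
     S - min e (d0 / 2) \<le> g (t - real n * l) (sg w n s) (pre i n x)"
    by blast
   \<comment> \<open>Late enough that after \<open>N\<close> moves by
     \<open>ln \<bar>w\<bar>\<close> in either direction the upper bound on \<open>g\<close> holds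
     in a window of radius \<open>L\<close> and both terms of \<open>g\<close> are almost
     invariant.\<close>
   define T' where "T' = max T (max (T1 + L) (T2 + 2 * \<bar>l\<bar>) + real N * \<bar>l\<bar>)"
   have "S - e \<le> g (t - real n * l) (sg w n s) (pre i n x)"
    if t: "t \<ge> T'" and gt: "S - d \<le> g t s x" and n: "n \<le> Suc N" for t s x n
   proof (cases "n \<le> N")
    case True
    then show ?thesis using d(2)[of t s x n] t gt by (auto simp: T'_def)
   next
    case False
    then have n: "n = Suc N" using n by simp
    define t' where "t' = t - real N * l"
    have lN: "real N * l \<le> real N * \<bar>l\<bar>" by (intro mult_left_mono) auto
    have t': "T1 + L \<le> t'" "T2 + 2 * \<bar>l\<bar> \<le> t'"
     using t lN by (auto simp: t'_def T'_def)
    have 1: "S - d0 / 2 \<le> g t' (sg w N s) (pre i N x)"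
     using d(2)[of t s x N] t gt by (auto simp: T'_def t'_def)
    have 2: "g t' (sg w N s) (pre i N x) - Pop g t' (sg w N s) (pre i N x) \<le> d0 / 2"
    proof -
     have "Pop g t' (sg w N s) (pre i N x) = Pop z t' (sg w N s) (pre i N x) - Pop z (t' - 2 * l) (sg w N s) (pre i N x)"
      unfolding g_def by (simp add: Pop_diff adm adm_shift Pop_shift)
     moreover have "T2 \<le> t'" "T2 \<le> t' - 2 * l" using t'(2) by linarith+
     ultimately show ?thesis
      using T2[OF \<open>T2 \<le> t'\<close>, of "sg w N s" "pre i N x"] T2[OF \<open>T2 \<le> t' - 2 * l\<close>, of "sg w N s" "pre i N x"]
      unfolding g_def[of t'] by linarith
    qed
    have "S - e \<le> g (t' - ln \<bar>w\<bar>) (sg w N s = (0 < w)) (cons i (pre i N x))"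
     using 1 2 t'(1) by (intro d0(2)[OF admg lipg]) (auto intro!: T1)
    then show ?thesis by (simp add: n t'_def l_def algebra_simps)
   qed
   then show ?case using d(1) by blast
  qed
  \<comment> \<open>Bound for the telescoped sum: \<open>2 * B\<close> for its two ends and a
    geometric series for replacing the prefixed sequence by the constant one.\<close>
  define C where "C = 2 * B + 2 * H / (1 - \<rho>)"
  obtain K :: nat where K: "C < real K * (S / 2)"
   using reals_Archimedean3[of "S / 2"] Sp by auto
  obtain d T where d: "d > 0" "\<And>t s x n. t \<ge> T \<Longrightarrow> S - d \<le> g t s x \<Longrightarrow> n \<le> 2 * K \<Longrightarrow>
    S - S / 2 \<le> g (t - real n * l) (sg w n s) (pre i n x)"
   using iter[of "S / 2" "2 * K"] Sp by (metis half_gt_zero)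
  obtain t s x where tsx: "t \<ge> T" "S - d \<le> g t s x" using S(2)[OF d(1)] by blast
  \<comment> \<open>The values are compared with those at the constant sequence, which no longer
    depends on the number of prepended symbols; only then do the increments telescope
    exactly.\<close>
  define a where "a k = z (t - real (2 * k) * l) s (\<lambda>_. i)" for k
  have "S / 2 \<le> a k - a (Suc k) + 2 * H * \<rho> ^ k" if "k < K" for k
  proof -
   have le: "\<bar>z t' s (pre i (2 * k) x) - z t' s (\<lambda>_. i)\<bar> \<le> H * \<rho> ^ k" for t'
    by (rule H(3)) (simp add: pre_nth)
   have "S / 2 \<le> g (t - real (2 * k) * l) (sg w (2 * k) s) (pre i (2 * k) x)"
    using d(2)[OF tsx, of "2 * k"] that by simp
   then have "S / 2 \<le> z (t - real (2 * k) * l) s (pre i (2 * k) x) - z (t - real (2 * Suc k) * l) s (pre i (2 * k) x)"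
    unfolding g_def sg_even by (simp add: algebra_simps)
   then show ?thesis using le[of "t - real (2 * k) * l"] le[of "t - real (2 * Suc k) * l"]
    unfolding a_def by linarith
  qed
  then have "(\<Sum>k<K. S / 2) \<le> (\<Sum>k<K. a k - a (Suc k) + 2 * H * \<rho> ^ k)"
   by (intro sum_mono) auto
  also have "\<dots> = (a 0 - a K) + 2 * H * (\<Sum>k<K. \<rho> ^ k)"
   by (simp add: sum.distrib sum_lessThan_telescope' sum_distrib_left)
  also have "\<dots> \<le> 2 * B + 2 * H * (1 / (1 - \<rho>))"
  proof (intro add_mono mult_left_mono)
   show "a 0 - a K \<le> 2 * B" using B[of "t - real (2 * 0) * l" s "\<lambda>_. i"] B[of "t - real (2 * K) * l" s "\<lambda>_. i"]
    by (simp add: a_def)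
   have "(\<Sum>k<K. \<rho> ^ k) \<le> (\<Sum>k. \<rho> ^ k)" using rho by (intro sum_le_suminf) auto
   then show "(\<Sum>k<K. \<rho> ^ k) \<le> 1 / (1 - \<rho>)" using rho by (simp add: suminf_geometric)
  qed (use H in auto)
  finally show False using K by (simp add: C_def)
 qed
 then show ?thesis using S(1)[OF e] unfolding g_def l_def by (smt (verit, best))
qed

lemma slow_variation_near:
 assumes "nice \<rho> z" "near i w" "0 < e"
 shows "\<exists>T. \<forall>t\<ge>T. \<forall>s x. \<bar>z t s x - z (t - 2 * ln \<bar>w\<bar>) s x\<bar> \<le> e"
proof -
 obtain T1 where T1: "\<And>t s x. t \<ge> T1 \<Longrightarrow> z t s x - z (t - 2 * ln \<bar>w\<bar>) s x \<le> e"
  using slow_variation_upper[OF assms] by blast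
 obtain T2 where T2: "\<And>t s x. t \<ge> T2 \<Longrightarrow> - z t s x - - z (t - 2 * ln \<bar>w\<bar>) s x \<le> e"
  using slow_variation_upper[OF nice_uminus[OF assms(1)] assms(2,3)] by blast
 have "\<bar>z t s x - z (t - 2 * ln \<bar>w\<bar>) s x\<bar> \<le> e" if "t \<ge> max T1 T2" for t s x
  using T1[of t s x] T2[of t s x] that by auto
 then show ?thesis by blast
qed

definition periodic :: "(real \<Rightarrow> bool \<Rightarrow> (nat \<Rightarrow> 'd) \<Rightarrow> real) \<Rightarrow> real set" where
 "periodic z = {a. \<forall>e>0. \<exists>T. \<forall>t\<ge>T. \<forall>s x. \<bar>z (t + a) s x - z t s x\<bar> \<le> e}"

text \<open>The asymptotic periods form a subgroup, closed by the Lipschitz bound in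
  \<open>t\<close>, and contain \<open>2 * ln \<bar>w\<bar>\<close> for each support point
  \<open>w\<close>. If they are not the whole line they lie in a lattice, and then so do the
  logarithms of almost all multipliers.\<close>

lemma slow_variation:
 assumes z: "nice \<rho> z"
  and nonlattice: "\<And>\<delta>. \<delta> > 0 \<Longrightarrow> \<exists>j. \<not> (AE m in \<zeta> j. \<exists>k::int. ln \<bar>m\<bar> = \<delta> * of_int k)"
 shows "periodic z = UNIV"
proof -
 obtain H where H: "0 \<le> H" "\<And>t t' s x. \<bar>z t s x - z t' s x\<bar> \<le> H * \<bar>t - t'\<bar>"
  using z unfolding nice_def by blast
 have uminus: "- a \<in> periodic z" if a: "a \<in> periodic z" for a
  unfolding periodic_def mem_Collect_eq
 proof (intro allI impI)
  fix e :: real assume "e > 0"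
  then obtain T where T: "\<And>t s x. t \<ge> T \<Longrightarrow> \<bar>z (t + a) s x - z t s x\<bar> \<le> e" using a unfolding periodic_def by blast
  have "\<bar>z (t + - a) s x - z t s x\<bar> \<le> e" if "t \<ge> T + a" for t s x
   using T[of "t - a" s x] that by auto
  then show "\<exists>T. \<forall>t\<ge>T. \<forall>s x. \<bar>z (t + - a) s x - z t s x\<bar> \<le> e" by blast
 qed
 have "periodic z = UNIV \<or> (\<exists>\<delta>>0. \<forall>a\<in>periodic z. \<exists>k::int. a = \<delta> * of_int k)"
 proof (rule real_subgroup_cases)
  show "0 \<in> periodic z" by (auto simp: periodic_def)
 next
  fix a b assume ab: "a \<in> periodic z" "b \<in> periodic z"
  show "a + b \<in> periodic z" unfolding periodic_def mem_Collect_eq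
  proof (intro allI impI)
   fix e :: real assume "e > 0"
   then have e2: "e / 2 > 0" by simp
   obtain T1 where T1: "\<And>t s x. t \<ge> T1 \<Longrightarrow> \<bar>z (t + a) s x - z t s x\<bar> \<le> e / 2"
    using ab(1) e2 unfolding periodic_def by blast
   obtain T2 where T2: "\<And>t s x. t \<ge> T2 \<Longrightarrow> \<bar>z (t + b) s x - z t s x\<bar> \<le> e / 2"
    using ab(2) e2 unfolding periodic_def by blast
   have "\<bar>z (t + (a + b)) s x - z t s x\<bar> \<le> e" if "t \<ge> max T2 (T1 - b)" for t s x
   proof -
    have "t + (a + b) = t + b + a" by simp
    then show ?thesis using T1[of "t + b" s x] T2[of t s x] that by (simp only:) linarith
   qed
   then show "\<exists>T. \<forall>t\<ge>T. \<forall>s x. \<bar>z (t + (a + b)) s x - z t s x\<bar> \<le> e" by blast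
  qed
 next
  fix a assume cl: "\<And>d. d > 0 \<Longrightarrow> \<exists>a'\<in>periodic z. \<bar>a - a'\<bar> < d"
  show "a \<in> periodic z" unfolding periodic_def mem_Collect_eq
  proof (intro allI impI)
   fix e :: real assume e: "e > 0"
   have "e / (2 * (H + 1)) > 0" using e H by simp
   then obtain a' where a': "a' \<in> periodic z" "\<bar>a - a'\<bar> < e / (2 * (H + 1))" using cl by blast
   have "H * \<bar>a - a'\<bar> \<le> (H + 1) * (e / (2 * (H + 1)))" using a' H by (intro mult_mono) auto
   also have "(H + 1) * (e / (2 * (H + 1))) = e / 2" using H by (simp add: divide_simps)
   finally have Ha: "H * \<bar>a - a'\<bar> \<le> e / 2" .
   have "e / 2 > 0" using e by simp
   then obtain T where T: "\<And>t s x. t \<ge> T \<Longrightarrow> \<bar>z (t + a') s x - z t s x\<bar> \<le> e / 2"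
    using a'(1) unfolding periodic_def by blast
   have "\<bar>z (t + a) s x - z t s x\<bar> \<le> e" if "t \<ge> T" for t s x
   proof -
    have "t + a - (t + a') = a - a'" by simp
    then show ?thesis using T[OF that, of s x] H(2)[of "t + a" s x "t + a'"] Ha by (simp only:)
   qed
   then show "\<exists>T. \<forall>t\<ge>T. \<forall>s x. \<bar>z (t + a) s x - z t s x\<bar> \<le> e" by blast
  qed
 qed (rule uminus)
 moreover have False if "\<delta> > 0" and \<delta>: "\<forall>a\<in>periodic z. \<exists>k::int. a = \<delta> * of_int k" for \<delta>
 proof -
  have per: "2 * ln \<bar>w\<bar> \<in> periodic z" if "near i w" for i w
  proof -
   have "- (2 * ln \<bar>w\<bar>) \<in> periodic z"
    using slow_variation_near[OF z that] unfolding periodic_def by (simp add: abs_minus_commute)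
   from uminus[OF this] show ?thesis by simp
  qed
  \<comment> \<open>The periods are twice the logarithms, so a lattice of mesh
    \<open>\<delta>\<close> for the former means mesh \<open>\<delta> / 2\<close> for the
    latter.\<close>
  have "AE m in \<zeta> j. \<exists>k::int. ln \<bar>m\<bar> = \<delta> / 2 * of_int k" for j
   using AE_near[of j]
  proof eventually_elim
   case (elim m)
   then obtain k :: int where "2 * ln \<bar>m\<bar> = \<delta> * of_int k" using per[OF elim] \<delta> by blast
   then show ?case by (intro exI[of _ k]) simp
  qed
  then show False using nonlattice[of "\<delta> / 2"] \<open>\<delta> > 0\<close> by auto
 qed
 ultimately show ?thesis by blast
qed

text \<open>Bounded shifts are rounded to a finite grid of periods; the Lipschitz bound covers the
  rounding error, and a maximum of finitely many thresholds gives uniformity.\<close>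

lemma slow_variation_uniform:
 assumes z: "nice \<rho> z" and per: "periodic z = UNIV" and e: "0 < e"
 shows "\<exists>T. \<forall>t\<ge>T. \<forall>a s x. \<bar>a\<bar> \<le> A \<longrightarrow> \<bar>z (t + a) s x - z t s x\<bar> \<le> e"
proof -
 obtain H where H: "0 \<le> H" "\<And>t t' s x. \<bar>z t s x - z t' s x\<bar> \<le> H * \<bar>t - t'\<bar>"
  using z unfolding nice_def by blast
 define d where "d = e / (2 * (H + 1))"
 have d: "0 < d" "H * d \<le> e / 2" using e H by (auto simp: d_def field_simps)
 define K where "K = {\<lfloor>- A / d\<rfloor>..\<lfloor>A / d\<rfloor>}"
 have "\<exists>T. \<forall>t\<ge>T. \<forall>s x. \<bar>z (t + of_int k * d) s x - z t s x\<bar> \<le> e / 2" for k :: int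
 proof -
  have "e / 2 > 0" "of_int k * d \<in> periodic z" using e per by auto
  then show ?thesis unfolding periodic_def by blast
 qed
 then obtain T where T: "\<And>k t s x. t \<ge> T k \<Longrightarrow> \<bar>z (t + of_int k * d) s x - z t s x\<bar> \<le> e / 2" for k :: int
  by metis
 have "\<bar>z (t + a) s x - z t s x\<bar> \<le> e" if t: "t \<ge> Max (insert 0 (T ` K))" and a: "\<bar>a\<bar> \<le> A" for t a s x
 proof -
  define k where "k = \<lfloor>a / d\<rfloor>"
  have "k \<in> K" unfolding K_def k_def using a d divide_right_mono[of "- A" a d]
   by (auto intro!: floor_mono divide_right_mono)
  then have "T k \<le> t" using t by (auto simp: K_def)
  then have 1: "\<bar>z (t + of_int k * d) s x - z t s x\<bar> \<le> e / 2" by (rule T)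
  have "\<bar>a - of_int k * d\<bar> \<le> d"
   using floor_divide_lower[OF d(1), of a] floor_divide_upper[OF d(1), of a] by (auto simp: k_def algebra_simps)
  then have "H * \<bar>a - of_int k * d\<bar> \<le> H * d" using H by (intro mult_left_mono)
  moreover have "t + a - (t + of_int k * d) = a - of_int k * d" by simp
  ultimately show ?thesis using 1 H(2)[of "t + a" s x "t + of_int k * d"] d(2) by (simp only:)
 qed
 then show ?thesis by blast
qed

section \<open>Vanishing oscillation over signs and sequences, and the limit theorem for the
  walk\<close>

lemma oscillation_step:
 assumes z: "nice \<rho> z" and per: "periodic z = UNIV" and near: "near i w"
  and UB: "\<And>e. e > 0 \<Longrightarrow> \<exists>T. \<forall>t\<ge>T. \<forall>s x s' y. z t s x - z t s' y \<le> D + e" and e: "0 < e"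
 shows "\<exists>d>0. \<exists>T. \<forall>t\<ge>T. \<forall>s x s' y. D - d \<le> z t s x - z t s' y \<longrightarrow>
  (\<forall>n\<le>N. D - e \<le> z t (sg w n s) (pre i n x) - z t s' y)"
 using e
proof (induction N arbitrary: e)
 case 0
 then show ?case by (intro exI[of _ e]) auto
next
 case (Suc N)
 obtain H where H: "0 \<le> H" "\<And>t t' s x. \<bar>z t s x - z t' s x\<bar> \<le> H * \<bar>t - t'\<bar>"
  using z unfolding nice_def by blast
 have adm: "adm z" and res: "\<And>e. e > 0 \<Longrightarrow> \<exists>T. \<forall>t\<ge>T. \<forall>s x. \<bar>z t s x - Pop z t s x\<bar> \<le> e"
  using z by (auto simp: nice_def)
 have e2: "0 < e / 2" using Suc.prems by simp
 obtain d0 where d0: "0 < d0"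
  "\<And>f S t s x. adm f \<Longrightarrow> (\<And>t t' s x. \<bar>f t s x - f t' s x\<bar> \<le> H * \<bar>t - t'\<bar>) \<Longrightarrow>
   (\<And>t' s' y. \<bar>t' - t\<bar> \<le> L \<Longrightarrow> f t' s' y \<le> S + d0) \<Longrightarrow> S - d0 \<le> Pop f t s x \<Longrightarrow>
   S - e / 2 \<le> f (t - ln \<bar>w\<bar>) (s = (0 < w)) (cons i x)"
  by (rule near_max_step[OF near H(1) e2]) auto
 have d2: "d0 / 2 > 0" using d0(1) by simp
 obtain T1 where T1: "\<And>t s x s' y. t \<ge> T1 \<Longrightarrow> z t s x - z t s' y \<le> D + d0 / 2" using UB[OF d2] by blast
 obtain T2 where T2: "\<And>t s x. t \<ge> T2 \<Longrightarrow> \<bar>z t s x - Pop z t s x\<bar> \<le> d0 / 2" using res[OF d2] by blast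
 obtain T3 where T3: "\<And>t a s x. t \<ge> T3 \<Longrightarrow> \<bar>a\<bar> \<le> L \<Longrightarrow> \<bar>z (t + a) s x - z t s x\<bar> \<le> d0 / 2"
  using slow_variation_uniform[OF z per d2] by blast
 obtain T4 where T4: "\<And>t a s x. t \<ge> T4 \<Longrightarrow> \<bar>a\<bar> \<le> \<bar>ln \<bar>w\<bar>\<bar> \<Longrightarrow> \<bar>z (t + a) s x - z t s x\<bar> \<le> e / 2"
  using slow_variation_uniform[OF z per e2] by blast
 have "0 < min e (d0 / 2)" using Suc.prems d2 by simp
 from Suc.IH[OF this] obtain d T where d: "d > 0"
  "\<And>t s x s' y n. t \<ge> T \<Longrightarrow> D - d \<le> z t s x - z t s' y \<Longrightarrow> n \<le> N \<Longrightarrow>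
   D - min e (d0 / 2) \<le> z t (sg w n s) (pre i n x) - z t s' y" by blast
 define T' where "T' = max T (max (T1 + L) (max T2 (max T3 T4)))"
 have "D - e \<le> z t (sg w n s) (pre i n x) - z t s' y"
  if t: "t \<ge> T'" and gt: "D - d \<le> z t s x - z t s' y" and n: "n \<le> Suc N" for t s x s' y n
 proof (cases "n \<le> N")
  case True
  then show ?thesis using d(2)[of t s x s' y n] t gt by (auto simp: T'_def)
 next
  case False
  then have n: "n = Suc N" using n by simp
  \<comment> \<open>The second point is frozen and enters as a constant, so the one-step maximum
    argument applies to the first. Its upper bound in the window and the final return from level
    \<open>t - ln \<bar>w\<bar>\<close> to \<open>t\<close> both use slow variation; thus the level
    stays at \<open>t\<close> throughout.\<close>
  define f where "f t' s x = z t' s x - z t s' y" for t' s x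
  have 1: "D - d0 / 2 \<le> z t (sg w N s) (pre i N x) - z t s' y"
   using d(2)[of t s x s' y N] t gt by (auto simp: T'_def)
  have 2: "\<bar>z t (sg w N s) (pre i N x) - Pop z t (sg w N s) (pre i N x)\<bar> \<le> d0 / 2"
   using t by (intro T2) (auto simp: T'_def)
  have Pf: "Pop f t s x = Pop z t s x - z t s' y" for s x
   unfolding f_def by (subst Pop_diff) (auto intro: adm)
  have "D - e / 2 \<le> f (t - ln \<bar>w\<bar>) (sg w N s = (0 < w)) (cons i (pre i N x))"
  proof (rule d0(2))
   show "adm f" unfolding f_def by (intro adm_diff adm adm_const)
   show "\<bar>f t s x - f t' s x\<bar> \<le> H * \<bar>t - t'\<bar>" for t t' s x using H(2) by (simp add: f_def)
   show "D - d0 \<le> Pop f t (sg w N s) (pre i N x)" unfolding Pf using 1 2 by linarith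
   fix t' s'' y'' assume t': "\<bar>t' - t\<bar> \<le> L"
   have "z t' s'' y'' - z t' s' y \<le> D + d0 / 2" using t t' by (intro T1) (auto simp: T'_def)
   moreover have "\<bar>z (t + (t' - t)) s' y - z t s' y\<bar> \<le> d0 / 2" using t t' by (intro T3) (auto simp: T'_def)
   ultimately show "f t' s'' y'' \<le> D + d0"
    unfolding f_def add_diff_cancel_left' add_diff_eq by (simp only: add_diff_cancel_left')
  qed
  moreover have "\<bar>z (t + - ln \<bar>w\<bar>) (sg w (Suc N) s) (pre i (Suc N) x) - z t (sg w (Suc N) s) (pre i (Suc N) x)\<bar> \<le> e / 2"
   using t by (intro T4) (auto simp: T'_def)
  ultimately show ?thesis unfolding f_def n sg_simps pre_simps add_uminus_conv_diff by linarith
 qed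
 then show ?case using d(1) by blast
qed

text \<open>Start from a pair almost realising the upper limit \<open>D\<close> of the oscillation.
  Prepending \<open>N\<close> copies of \<open>i\<close> to the first sequence, then as many to the
  second, keeps the pair almost extremal, yet both sequences now agree in \<open>N\<close> places.
  With equal signs the difference is at most \<open>H * \<rho> ^ N\<close>, so
  \<open>D \<le> 0\<close>.\<close>

lemma oscillation_vanishes:
 assumes z: "nice \<rho> z" and per: "periodic z = UNIV"
  and sgn: "(\<exists>i. 0 < measure (\<zeta> i) {m. m < 0}) \<or> (\<forall>t s s' x. z t s x = z t s' x)" and e: "0 < e"
 shows "\<exists>T. \<forall>t\<ge>T. \<forall>s x s' y. \<bar>z t s x - z t s' y\<bar> \<le> e"
proof -
 obtain B where B: "\<And>t s x. \<bar>z t s x\<bar> \<le> B" using z unfolding nice_def by blast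
 obtain H where H: "0 \<le> H" "\<And>t s x y n. (\<forall>k<n. x k = y k) \<Longrightarrow> \<bar>z t s x - z t s y\<bar> \<le> H * \<rho> ^ n"
  using z unfolding nice_def by blast
 have rho: "0 < \<rho>" "\<rho> < 1" using z by (auto simp: nice_def)
 obtain i w where near: "near i w" and w: "w < 0 \<or> (\<forall>t s s' x. z t s x = z t s' x)"
  using sgn near_exists near_neg_exists by blast
 define g where "g t u = z t (fst (fst u)) (snd (fst u)) - z t (fst (snd u)) (snd (snd u))" for t and u :: "(bool \<times> (nat \<Rightarrow> 'd)) \<times> (bool \<times> (nat \<Rightarrow> 'd))"
 have "\<bar>g t u\<bar> \<le> 2 * B" for t u
  using B[of t "fst (fst u)" "snd (fst u)"] B[of t "fst (snd u)" "snd (snd u)"] by (simp add: g_def)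
 from limsup_value[of g, OF this] obtain D where
  D: "\<And>e. e > 0 \<Longrightarrow> \<exists>T. \<forall>t\<ge>T. \<forall>s x s' y. z t s x - z t s' y \<le> D + e"
  "\<And>e T. e > 0 \<Longrightarrow> \<exists>t\<ge>T. \<exists>s x s' y. D - e \<le> z t s x - z t s' y"
  by (simp only: split_paired_All split_paired_Ex fst_conv snd_conv g_def) blast
 have "D \<le> e + H * \<rho> ^ N" if e: "0 < e" for e N
 proof -
  have UB': "\<exists>T. \<forall>t\<ge>T. \<forall>s x s' y. - z t s x - - z t s' y \<le> D + e" if e0: "e > 0" for e
  proof -
   obtain T where T: "\<And>t s x s' y. t \<ge> T \<Longrightarrow> z t s x - z t s' y \<le> D + e" using D(1)[OF e0] by blast
   have "- z t s x - - z t s' y \<le> D + e" if "t \<ge> T" for t s x s' y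
    using T[OF that, of s' y s x] by simp
   then show ?thesis by blast
  qed
  have per': "periodic (\<lambda>t s x. - z t s x) = UNIV"
  proof -
   have "\<bar>- z (t + a) s x - - z t s x\<bar> = \<bar>z (t + a) s x - z t s x\<bar>" for t a s x by simp
   then show ?thesis using per by (simp add: periodic_def)
  qed
  \<comment> \<open>The tolerances are fixed in reverse order: moving the second point, which uses
    \<open>- z\<close>, requires a pair within \<open>d1\<close> of \<open>D\<close>, and this is
    the precision demanded when the first point is moved.\<close>
  obtain d1 T1 where d1: "d1 > 0" "\<And>t s x s' y n. t \<ge> T1 \<Longrightarrow> D - d1 \<le> - z t s x - - z t s' y \<Longrightarrow> n \<le> Suc N \<Longrightarrow>
    D - e \<le> - z t (sg w n s) (pre i n x) - - z t s' y"
   using oscillation_step[OF nice_uminus[OF z] per' near UB' e, of "Suc N"] by blast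
  obtain d2 T2 where d2: "d2 > 0" "\<And>t s x s' y n. t \<ge> T2 \<Longrightarrow> D - d2 \<le> z t s x - z t s' y \<Longrightarrow> n \<le> N \<Longrightarrow>
    D - d1 \<le> z t (sg w n s) (pre i n x) - z t s' y"
   using oscillation_step[OF z per near D(1) d1(1), of N] by blast
  obtain t s x s' y where t: "t \<ge> max T1 T2" "D - d2 \<le> z t s x - z t s' y"
   using D(2)[OF d2(1)] by blast
  have 1: "D - d1 \<le> z t (sg w N s) (pre i N x) - z t s' y" using d2(2)[of t s x s' y N] t by auto
  have 2: "D - e \<le> z t (sg w N s) (pre i N x) - z t (sg w n s') (pre i n y)" if "n \<le> Suc N" for n
   using d1(2)[of t s' y "sg w N s" "pre i N x" n] 1 t that by auto
  \<comment> \<open>A negative \<open>w\<close> flips the sign at each step, so one additional step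
    repairs a mismatch; this is why the second point is allowed \<open>Suc N\<close> steps.
    Otherwise \<open>z\<close> does not depend on the sign.\<close>
  obtain n where n: "N \<le> n" "n \<le> Suc N" "z t (sg w N s) (pre i N x) = z t (sg w n s') (pre i N x)"
  proof (cases "w < 0 \<and> sg w N s \<noteq> sg w N s'")
   case True
   then show ?thesis by (intro that[of "Suc N"]) auto
  next
   case False
   then show ?thesis using w by (intro that[of N]) auto
  qed
  have "\<bar>z t (sg w n s') (pre i N x) - z t (sg w n s') (pre i n y)\<bar> \<le> H * \<rho> ^ N"
   using n by (intro H(2)) (auto simp: pre_nth)
  then show ?thesis using 2[OF n(2)] n(3) by linarith
 qed
 then have "D \<le> 0 + H * 0"
 proof -
  have "D \<le> e" if "e > 0" for e
  proof (rule tendsto_lowerbound[where F=sequentially and f="\<lambda>N. e + H * \<rho> ^ N"])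
   have "(\<lambda>N. e + H * \<rho> ^ N) \<longlonglongrightarrow> e + H * 0"
    using rho by (intro tendsto_intros LIMSEQ_power_zero) auto
   then show "(\<lambda>N. e + H * \<rho> ^ N) \<longlonglongrightarrow> e" by simp
  qed (use \<open>\<And>e N. 0 < e \<Longrightarrow> D \<le> e + H * \<rho> ^ N\<close> that in auto)
  then show ?thesis by (auto intro: field_le_epsilon)
 qed
 then have D0: "D \<le> 0" by simp
 obtain T where T: "\<And>t s x s' y. t \<ge> T \<Longrightarrow> z t s x - z t s' y \<le> D + e" using D(1)[OF e] by blast
 have "\<bar>z t s x - z t s' y\<bar> \<le> e" if "t \<ge> T" for t s x s' y
  using T[OF that, of s x s' y] T[OF that, of s' y s x] D0 by linarith
 then show ?thesis by blast
qed

text \<open>Slow variation and vanishing oscillation make \<open>z\<close> nearly constant on a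
  window as long as the largest step. The maximum principle carries the value of the window to all
  later levels, the Lyapunov function absorbing the residual. The residual rate is twice
  \<open>\<theta>\<close>: one factor matches the defect of \<open>G\<close>, the other makes its
  coefficient small for a late window.\<close>

theorem convergence:
 assumes z: "nice \<rho> z"
  and nonlattice: "\<And>\<delta>. \<delta> > 0 \<Longrightarrow> \<exists>j. \<not> (AE m in \<zeta> j. \<exists>k::int. ln \<bar>m\<bar> = \<delta> * of_int k)"
  and sgn: "(\<exists>i. 0 < measure (\<zeta> i) {m. m < 0}) \<or> (\<forall>t s s' x. z t s x = z t s' x)"
  and res: "\<And>t s x. t \<ge> 0 \<Longrightarrow> \<bar>z t s x - Pop z t s x\<bar> \<le> C * exp (- (2 * \<theta> * t))"
 shows "\<exists>c. \<forall>e>0. \<exists>T. \<forall>t\<ge>T. \<forall>s x. \<bar>z t s x - c\<bar> \<le> e"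
proof -
 have per: "periodic z = UNIV" by (rule slow_variation[OF z nonlattice])
 obtain B where B: "\<And>t s x. \<bar>z t s x\<bar> \<le> B" using z unfolding nice_def by blast
 have adm: "adm z" using z by (simp add: nice_def)
 have C: "0 \<le> C" using res[of 0 True undefined] by simp
 have key: "\<exists>c T. \<forall>t\<ge>T. \<forall>s x. \<bar>z t s x - c\<bar> \<le> e" if e: "0 < e" for e
 proof -
  have e4: "e / 4 > 0" using e by simp
  obtain T1 where T1: "\<And>t s x s' y. t \<ge> T1 \<Longrightarrow> \<bar>z t s x - z t s' y\<bar> \<le> e / 4"
   using oscillation_vanishes[OF z per sgn e4] by blast
  obtain T2 where T2: "\<And>t a s x. t \<ge> T2 \<Longrightarrow> \<bar>a\<bar> \<le> L \<Longrightarrow> \<bar>z (t + a) s x - z t s x\<bar> \<le> e / 4"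
   using slow_variation_uniform[OF z per e4] by blast
  have "((\<lambda>T. C / cG * exp (- (\<theta> * T))) \<longlongrightarrow> C / cG * 0) at_top"
   using theta_pos
   by (intro tendsto_intros filterlim_compose[OF exp_at_bot] filterlim_compose[OF filterlim_uminus_at_bot_at_top]
    filterlim_tendsto_pos_mult_at_top[OF tendsto_const _ filterlim_ident]) auto
  then have "eventually (\<lambda>T. C / cG * exp (- (\<theta> * T)) < e / 2) at_top"
   using e by (intro order_tendstoD) auto
  then obtain T3 where T3: "\<And>T. T \<ge> T3 \<Longrightarrow> C / cG * exp (- (\<theta> * T)) < e / 2"
   by (auto simp: eventually_at_top_linorder)
  define T where "T = max 0 (max T1 (max T2 T3))"
  define c where "c = z T True undefined"
  \<comment> \<open>With this weight the defect \<open>K * cG * exp (- \<theta> * t)\<close> of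
    \<open>K * G\<close> dominates \<open>C * exp (- (2 * \<theta> * t))\<close> for all
    \<open>t \<ge> T\<close>.\<close>
  define K where "K = C / cG * exp (- (\<theta> * T))"
  have "T3 \<le> T" by (simp add: T_def)
  from T3[OF this] have K: "0 \<le> K" "K \<le> e / 2" using C cG_pos by (simp_all add: K_def)
  have window: "\<bar>z t s x - c\<bar> \<le> e / 2" if "T \<le> t" "t \<le> T + L" for t s x
  proof -
   have "T1 \<le> T" "T2 \<le> T" "\<bar>t - T\<bar> \<le> L" "T + (t - T) = t" using that by (auto simp: T_def)
   then show ?thesis
    using T1[OF \<open>T1 \<le> T\<close>, of s x True undefined] T2[OF \<open>T2 \<le> T\<close> \<open>\<bar>t - T\<bar> \<le> L\<close>, of s x]
    unfolding c_def \<open>T + (t - T) = t\<close> by linarith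
  qed
  define W where "W t s x = \<bar>z t s x - c\<bar> - e / 2 - K * G t x" for t s x
  \<comment> \<open>The positive part is cut off before \<open>T\<close>. From levels beyond
    \<open>T + L\<close> a step cannot cross the cut, and on the window itself \<open>W\<close> is
    nonpositive, so the truncated function is still a subsolution; the cut also gives the growth
    bound of the maximum principle.\<close>
  define E where "E t s x = (if T \<le> t then max 0 (W t s x) else 0)" for t s x
  have admW: "adm W" unfolding W_def by (intro adm_diff adm_abs adm adm_const adm_cmult adm_G)
  have E0: "0 \<le> E t s x" for t s x by (simp add: E_def)
  have Eb: "E t s x \<le> (if T \<le> t then B + \<bar>c\<bar> else 0)" for t s x
  proof -
   have "W t s x \<le> B + \<bar>c\<bar>" "0 \<le> B + \<bar>c\<bar>"
    using B[of t s x] e mult_nonneg_nonneg[OF K(1) G_bounds(1)[of t x]] unfolding W_def by linarith+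
   then show ?thesis by (simp add: E_def)
  qed
  have admE: "adm E"
  proof (rule adm_bounded)
   show "\<bar>E t s x\<bar> \<le> B + \<bar>c\<bar>" for t s x
    using Eb[of t s x] E0[of t s x] B[of t s x] by (auto split: if_splits)
   have [measurable]: "(\<lambda>t. W t s x) \<in> borel_measurable borel" for s x by (rule admM[OF admW])
   show "(\<lambda>t. E t s x) \<in> borel_measurable borel" for s x unfolding E_def by measurable
  qed
  have E_le: "E t s x \<le> 0" for t s x
  proof (rule max_principle[OF admE])
   fix t s x
   have P0: "0 \<le> Pop E t s x" using Pop_mono[of "\<lambda>t s x. 0" E t s x] admE E0 by simp
   show "E t s x \<le> Pop E t s x"
   proof (cases "T + L \<le> t")
    case True
    then have tT: "T \<le> t" "0 \<le> t" using L_pos by (auto simp: T_def)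
    have "Pop W t s x = Pop (\<lambda>t s x. \<bar>z t s x - c\<bar>) t s x - e / 2 - K * Pop (\<lambda>t s x. G t x) t s x"
     unfolding W_def by (subst Pop_diff Pop_cmult; (intro adm_diff adm_abs adm adm_const adm_cmult adm_G)?)+ simp
    moreover have "\<bar>z t s x - c\<bar> \<le> Pop (\<lambda>t s x. \<bar>z t s x - c\<bar>) t s x + C * exp (- (2 * \<theta> * t))"
    proof -
     have "Pop (\<lambda>t s x. z t s x - c) t s x = Pop z t s x - c" by (subst Pop_diff) (auto intro: adm)
     then have "\<bar>Pop z t s x - c\<bar> \<le> Pop (\<lambda>t s x. \<bar>z t s x - c\<bar>) t s x"
      using Pop_abs[of "\<lambda>t s x. z t s x - c" t s x] adm by (simp add: adm_diff)
     then show ?thesis using res[OF tT(2), of s x] by linarith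
    qed
    moreover have "C * exp (- (2 * \<theta> * t)) + K * Pop (\<lambda>t s x. G t x) t s x \<le> K * G t x"
    proof -
     have "K * (Pop (\<lambda>t s x. G t x) t s x + cG * exp (- \<theta> * \<bar>t\<bar>)) \<le> K * G t x"
      by (intro mult_left_mono G_super K)
     moreover have "C * exp (- (2 * \<theta> * t)) \<le> K * (cG * exp (- \<theta> * \<bar>t\<bar>))"
     proof -
      have "C * exp (- (2 * \<theta> * t)) = C * (exp (- (\<theta> * t)) * exp (- (\<theta> * t)))"
       by (simp add: exp_add[symmetric])
      also have "\<dots> \<le> C * (exp (- (\<theta> * T)) * exp (- (\<theta> * t)))"
       using C tT theta_pos by (intro mult_left_mono mult_right_mono) auto
      also have "\<dots> = K * (cG * exp (- \<theta> * \<bar>t\<bar>))" using cG_pos tT by (simp add: K_def)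
      finally show ?thesis .
     qed
     ultimately show ?thesis by (simp add: algebra_simps)
    qed
    ultimately have WP: "W t s x \<le> Pop W t s x" unfolding W_def[of t s x] by linarith
    have "Pop W t s x \<le> Pop E t s x"
     using True L_pos by (intro Pop_mono admW admE) (auto simp: E_def)
    then show ?thesis using WP P0 by (simp add: E_def)
   next
    case False
    then have "E t s x = 0"
    proof (cases "T \<le> t")
     case True
     with False have "\<bar>z t s x - c\<bar> \<le> e / 2" by (intro window) auto
     then have "W t s x \<le> 0"
      using mult_nonneg_nonneg[OF K(1) G_bounds(1)[of t x]] unfolding W_def by linarith
     then show ?thesis by (simp add: E_def)
    qed (simp add: E_def)
    then show ?thesis using P0 by simp
   qed
   have B0: "0 \<le> B" using B[of t s x] by linarith
   have "E t s x \<le> (B + \<bar>c\<bar>) * (if T \<le> t then 1 else 0)"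
    using Eb[of t s x] by (cases "T \<le> t") simp_all
   also have "\<dots> \<le> (B + \<bar>c\<bar>) * exp (\<theta> * (t - T))"
    using B0 theta_pos by (intro mult_left_mono) auto
   also have "\<dots> = (B + \<bar>c\<bar>) * exp (- (\<theta> * T)) * exp (\<theta> * t)"
    by (simp add: exp_add[symmetric] algebra_simps)
   finally show "E t s x \<le> (B + \<bar>c\<bar>) * exp (- (\<theta> * T)) * exp (\<theta> * t)" .
  qed
  have W0: "W t s x \<le> 0" if "t \<ge> T" for t s x using that E_le[of t s x] by (simp add: E_def)
  have "\<bar>z t s x - c\<bar> \<le> e" if "t \<ge> T" for t s x
  proof -
   have "K * G t x \<le> e / 2" using K G_bounds[of t x] by (meson mult_left_le order_trans)
   then show ?thesis using W0[OF that, of s x] unfolding W_def by linarith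
  qed
  then show ?thesis by blast
 qed
 \<comment> \<open>The centre found above may change with the precision; the upper limit of
   \<open>z\<close> is common to all precisions and serves as the limit.\<close>
 obtain S where S: "\<And>e. e > 0 \<Longrightarrow> \<exists>T. \<forall>t\<ge>T. \<forall>u. z t (fst u) (snd u) \<le> S + e"
  "\<And>e T. e > 0 \<Longrightarrow> \<exists>t\<ge>T. \<exists>u. S - e \<le> z t (fst u) (snd u)"
  by (rule limsup_value[of "\<lambda>t u. z t (fst u) (snd u)", OF B]) blast
 have "\<exists>T. \<forall>t\<ge>T. \<forall>s x. \<bar>z t s x - S\<bar> \<le> e" if e: "0 < e" for e
 proof -
  have e3: "e / 3 > 0" using e by simp
  obtain c T where T: "\<And>t s x. t \<ge> T \<Longrightarrow> \<bar>z t s x - c\<bar> \<le> e / 3" using key[OF e3] by blast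
  obtain T' where T': "\<And>t u. t \<ge> T' \<Longrightarrow> z t (fst u) (snd u) \<le> S + e / 3" using S(1)[OF e3] by blast
  obtain t u where tu: "t \<ge> max T T'" "S - e / 3 \<le> z t (fst u) (snd u)" using S(2)[OF e3] by blast
  have "T \<le> t" "T' \<le> t" using tu(1) by auto
  then have "\<bar>c - S\<bar> \<le> 2 * e / 3" using T[OF \<open>T \<le> t\<close>, of "fst u" "snd u"] T'[OF \<open>T' \<le> t\<close>, of u] tu(2) by linarith
  then have "\<bar>z t s x - S\<bar> \<le> e" if "t \<ge> T" for t s x using T[OF that, of s x] by linarith
  then show ?thesis by blast
 qed
 then show ?thesis by blast
qed

end

section \<open>Affine kernels: transfer operator and its positive eigenfunction\<close>

locale affine_kernel =
 fixes g :: "'d::finite \<Rightarrow> (nat \<Rightarrow> 'd) \<Rightarrow> real" and lam :: "'d \<Rightarrow> (real \<times> real) measure"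
  and kap :: "(nat \<Rightarrow> 'd) \<Rightarrow> real measure" and q0 m0 \<alpha> B \<rho> :: real
 assumes prob_lam: "prob_space (lam j)" and sets_lam [simp]: "sets (lam j) = sets borel"
  and lam_bound: "AE u in lam j. \<bar>fst u\<bar> \<le> q0 \<and> 1 / m0 \<le> \<bar>snd u\<bar> \<and> \<bar>snd u\<bar> \<le> m0"
  and q0_pos: "0 < q0" and m0_pos: "0 < m0"
  and g_pos: "0 < g j x" and g_sum: "(\<Sum>j\<in>UNIV. g j x) = 1"
  and B_nonneg: "0 \<le> B" and rho_pos: "0 < \<rho>" and rho_less: "\<rho> < 1"
  and g_cmp: "(\<forall>k<n. x k = y k) \<Longrightarrow> g j x \<le> exp (B * \<rho> ^ n) * g j y"
  and prob_kap: "prob_space (kap x)" and sets_kap [measurable_cong, simp]: "sets (kap x) = sets borel"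
  and kap_cmp: "(\<forall>k<n. x k = y k) \<Longrightarrow> H \<in> borel_measurable borel \<Longrightarrow> (\<And>r. 0 \<le> H r \<and> H r \<le> 1) \<Longrightarrow>
   (\<integral>r. H r \<partial>kap x) \<le> exp (B * \<rho> ^ n) * (\<integral>r. H r \<partial>kap y)"
  and kap_rec: "continuous_on UNIV H \<Longrightarrow> (\<And>r. \<bar>H r\<bar> \<le> 1) \<Longrightarrow>
   (\<integral>r. H r \<partial>kap x) = (\<Sum>j\<in>UNIV. g j x * (\<integral>u. (\<integral>r. H (fst u + snd u * r) \<partial>kap (cons j x)) \<partial>lam j))"
begin

definition mom :: "real \<Rightarrow> 'd \<Rightarrow> real" where
 "mom \<beta> j = (\<integral>u. \<bar>snd u\<bar> powr \<beta> \<partial>lam j)"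

primrec vpow :: "real \<Rightarrow> nat \<Rightarrow> (nat \<Rightarrow> 'd) \<Rightarrow> real" where
 "vpow \<beta> 0 x = 1"
| "vpow \<beta> (Suc n) x = (\<Sum>j\<in>UNIV. g j x * mom \<beta> j * vpow \<beta> n (cons j x))"

lemma sets_lam' [measurable_cong]: "sets (lam j) = sets ((borel :: real measure) \<Otimes>\<^sub>M (borel :: real measure))"
 unfolding borel_prod by simp

lemma space_lam [simp]: "space (lam j) = UNIV"
 using sets_eq_imp_space_eq[OF sets_lam, of j] by simp

lemma space_kap [simp]: "space (kap x) = UNIV"
 using sets_eq_imp_space_eq[OF sets_kap, of x] by simp

lemma m0_ge: "1 \<le> m0"
proof -
 have "AE u in lam undefined. 1 / m0 \<le> m0"
  using lam_bound[of undefined] by eventually_elim linarith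
 have "1 / m0 \<le> m0"
 proof (rule ccontr)
  assume "\<not> 1 / m0 \<le> m0"
  with \<open>AE u in lam undefined. 1 / m0 \<le> m0\<close> have "AE u in lam undefined. False" by simp
  then show False using prob_space.AE_False[OF prob_lam] by blast
 qed
 then have "1 \<le> m0 * m0" using m0_pos by (simp add: field_simps)
 then show ?thesis using m0_pos by (smt (verit) mult_less_cancel_left2 mult_strict_mono)
qed

lemma lam_bound': "AE u in lam j. \<bar>fst u\<bar> \<le> q0 \<and> snd u \<noteq> 0 \<and> 1 / m0 \<le> \<bar>snd u\<bar> \<and> \<bar>snd u\<bar> \<le> m0 \<and> \<bar>ln \<bar>snd u\<bar>\<bar> \<le> ln m0"
 using lam_bound[of j]
proof eventually_elim
 case (elim u)
 have pos: "0 < \<bar>snd u\<bar>" using elim m0_pos by (meson divide_pos_pos less_le_trans zero_less_one)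
 have "ln (1 / m0) \<le> ln \<bar>snd u\<bar>" using elim m0_pos pos by (subst ln_le_cancel_iff) auto
 moreover have "ln \<bar>snd u\<bar> \<le> ln m0" using elim m0_pos pos by (subst ln_le_cancel_iff) auto
 ultimately show ?case using elim pos m0_pos by (auto simp: ln_div abs_le_iff)
qed

lemma powr_integrable: "integrable (lam j) (\<lambda>u. \<bar>snd u\<bar> powr \<beta>)"
proof -
 interpret prob_space "lam j" by (rule prob_lam)
 show ?thesis
 proof (rule integrable_const_bound[where B="m0 powr \<bar>\<beta>\<bar>"])
  show "AE u in lam j. norm (\<bar>snd u\<bar> powr \<beta>) \<le> m0 powr \<bar>\<beta>\<bar>"
   using lam_bound'[of j]
  proof eventually_elim
   case (elim u)
   have "\<beta> * ln \<bar>snd u\<bar> \<le> \<bar>\<beta>\<bar> * ln m0"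
    using elim by (metis abs_mult abs_ge_self abs_ge_zero mult_left_mono order_trans)
   then show ?case using elim m0_pos by (auto simp: powr_def)
  qed
 qed measurable
qed

lemma mom_pos: "0 < mom \<beta> j"
proof -
 interpret prob_space "lam j" by (rule prob_lam)
 have "0 \<le> mom \<beta> j" unfolding mom_def by (intro integral_nonneg_AE) auto
 moreover have "mom \<beta> j \<noteq> 0"
 proof
  assume "mom \<beta> j = 0"
  then have "AE u in lam j. \<bar>snd u\<bar> powr \<beta> = 0"
   unfolding mom_def by (subst (asm) integral_nonneg_eq_0_iff_AE) (auto intro: powr_integrable)
  with lam_bound'[of j] have "AE u in lam j. False" by eventually_elim auto
  then show False using AE_False by blast
 qed
 ultimately show ?thesis by simp
qed

text \<open>Functions whose logarithm depends geometrically little on remote coordinates. The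
  constant solves \<open>B + \<rho> * a = a\<close>: one application of the transfer operator adds
  \<open>B\<close> from the weights and shifts the coordinates by one, so the cone is
  invariant.\<close>

definition cone :: "((nat \<Rightarrow> 'd) \<Rightarrow> real) \<Rightarrow> bool" where
 "cone f \<longleftrightarrow> (\<forall>x y n. (\<forall>k<n. x k = y k) \<longrightarrow> f x \<le> exp (B / (1 - \<rho>) * \<rho> ^ n) * f y)"

definition V :: "real \<Rightarrow> ((nat \<Rightarrow> 'd) \<Rightarrow> real) \<Rightarrow> (nat \<Rightarrow> 'd) \<Rightarrow> real" where
 "V \<beta> f x = (\<Sum>j\<in>UNIV. g j x * mom \<beta> j * f (cons j x))"

lemma vpow_Suc_V: "vpow \<beta> (Suc n) = V \<beta> (vpow \<beta> n)"
 by (auto simp: V_def fun_eq_iff)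

lemma V_mono: "(\<And>x. f x \<le> f' x) \<Longrightarrow> V \<beta> f x \<le> V \<beta> f' x"
 unfolding V_def by (intro sum_mono mult_left_mono) (auto simp: g_pos mom_pos less_imp_le)

lemma V_cmult: "V \<beta> (\<lambda>x. c * f x) x = c * V \<beta> f x"
 by (simp add: V_def sum_distrib_left mult_ac)

lemma cone_V:
 assumes "cone f" "\<And>x. 0 \<le> f x" shows "cone (V \<beta> f)"
 unfolding cone_def
proof (intro allI impI)
 fix x y :: "nat \<Rightarrow> 'd" and n assume xy: "\<forall>k<n. x k = y k"
 have e: "exp (B * \<rho> ^ n) * exp (B / (1 - \<rho>) * \<rho> ^ Suc n) = exp (B / (1 - \<rho>) * \<rho> ^ n)"
  using rho_less by (simp add: exp_add[symmetric] field_simps)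
 have "V \<beta> f x \<le> (\<Sum>j\<in>UNIV. (exp (B * \<rho> ^ n) * g j y) * mom \<beta> j * (exp (B / (1 - \<rho>) * \<rho> ^ Suc n) * f (cons j y)))"
  unfolding V_def
 proof (intro sum_mono mult_mono mult_right_mono)
  fix j
  show "g j x \<le> exp (B * \<rho> ^ n) * g j y" by (rule g_cmp[OF xy])
  have "\<forall>k<Suc n. cons j x k = cons j y k" using xy by (auto split: nat.split)
  then show "f (cons j x) \<le> exp (B / (1 - \<rho>) * \<rho> ^ Suc n) * f (cons j y)"
   using assms(1) unfolding cone_def by blast
 qed (auto simp: g_pos mom_pos less_imp_le assms)
 also have "\<dots> = (exp (B * \<rho> ^ n) * exp (B / (1 - \<rho>) * \<rho> ^ Suc n)) * V \<beta> f y"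
  unfolding V_def sum_distrib_left by (simp add: mult_ac)
 finally show "V \<beta> f x \<le> exp (B / (1 - \<rho>) * \<rho> ^ n) * V \<beta> f y" unfolding e .
qed

lemma vpow_pos: "0 < vpow \<beta> n x"
 by (induction n arbitrary: x) (auto intro!: sum_pos mult_pos_pos g_pos mom_pos)

lemma cone_vpow: "cone (vpow \<beta> n)"
proof (induction n)
 case 0
 have "0 \<le> B / (1 - \<rho>) * \<rho> ^ n" for n using B_nonneg rho_less rho_pos by simp
 then show ?case unfolding cone_def by (simp del: times_divide_eq_left)
next
 case (Suc n)
 then show ?case unfolding vpow_Suc_V by (intro cone_V) (auto simp: vpow_pos less_imp_le)
qed

text \<open>The eigenfunction is reached by two monotone limits instead of compactness. The
  pointwise lower limit \<open>h0\<close> of the iterates of 1 satisfies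
  \<open>V h0 \<le> h0\<close>, and iterating \<open>V\<close> on \<open>h0\<close> then decreases
  to a fixed point. Pointwise limits pass through \<open>V\<close> because it is a finite
  sum.\<close>

lemma harmonic_exists:
 assumes c: "0 < c" and bd: "\<And>n x. c \<le> vpow \<beta> n x \<and> vpow \<beta> n x \<le> C"
 shows "\<exists>h. (\<forall>x. c * c \<le> h x \<and> h x \<le> C) \<and> (\<forall>x. V \<beta> h x = h x) \<and> cone h"
proof -
 define W where "W n x = (INF k. vpow \<beta> (n + k) x)" for n x
 have bddb: "bdd_below (range (\<lambda>k. vpow \<beta> (n + k) x))" for n x
  using bd by (intro bdd_belowI2[where m=c]) auto
 have W_le: "W n x \<le> vpow \<beta> (n + k) x" for n k x
  unfolding W_def by (rule cINF_lower[OF bddb]) simp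
 have W_ge: "c \<le> W n x" for n x unfolding W_def by (intro cINF_greatest) (auto simp: bd)
 have W_C: "W n x \<le> C" for n x using W_le[of n x 0] bd[of n x] by simp
 have W_mono: "W n x \<le> W (Suc n) x" for n x
  unfolding W_def[of "Suc n"] using W_le[of n x "Suc _"] by (intro cINF_greatest) auto
 have coneW: "W n x \<le> exp (B / (1 - \<rho>) * \<rho> ^ m) * W n y" if xy: "\<forall>k<m. x k = y k" for n m x y
 proof -
  have "W n x / exp (B / (1 - \<rho>) * \<rho> ^ m) \<le> W n y"
   unfolding W_def[of n y]
  proof (intro cINF_greatest)
   fix k
   have "W n x \<le> exp (B / (1 - \<rho>) * \<rho> ^ m) * vpow \<beta> (n + k) y"
    using W_le[of n x k] cone_vpow[of \<beta> "n + k"] xy unfolding cone_def by (meson order_trans)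
   then show "W n x / exp (B / (1 - \<rho>) * \<rho> ^ m) \<le> vpow \<beta> (n + k) y" by (simp add: divide_le_eq mult.commute)
  qed simp
  then show ?thesis by (simp add: divide_le_eq mult.commute)
 qed
 have "incseq (\<lambda>n. W n x)" for x using W_mono by (intro incseq_SucI)
 then have "\<exists>l. (\<lambda>n. W n x) \<longlonglongrightarrow> l" for x
  using W_C by (metis incseq_convergent)
 then obtain h0 where lim: "\<And>x. (\<lambda>n. W n x) \<longlonglongrightarrow> h0 x" by metis
 have h0: "c \<le> h0 x" "h0 x \<le> C" for x
  by (rule tendsto_lowerbound[OF lim] tendsto_upperbound[OF lim]; simp add: W_ge W_C)+
 have "cone h0" unfolding cone_def
 proof (intro allI impI)
  fix x y :: "nat \<Rightarrow> 'd" and n assume "\<forall>k<n. x k = y k"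
  then show "h0 x \<le> exp (B / (1 - \<rho>) * \<rho> ^ n) * h0 y"
   by (intro tendsto_le[OF _ tendsto_mult_left[OF lim] lim] always_eventually allI coneW) auto
 qed
 have VW: "V \<beta> (W n) x \<le> W (Suc n) x" for n x
  unfolding W_def[of "Suc n"]
 proof (intro cINF_greatest)
  fix k
  have "V \<beta> (W n) x \<le> V \<beta> (vpow \<beta> (n + k)) x" by (intro V_mono W_le)
  then show "V \<beta> (W n) x \<le> vpow \<beta> (Suc n + k) x" by (simp add: V_def)
 qed simp
 have limV: "(\<lambda>n. V \<beta> (f n) x) \<longlonglongrightarrow> V \<beta> f' x" if "\<And>x. (\<lambda>n. f n x) \<longlonglongrightarrow> f' x" for f f' x
  unfolding V_def by (intro tendsto_intros that)
 have Vh0: "V \<beta> h0 x \<le> h0 x" for x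
  by (rule tendsto_le[OF _ LIMSEQ_Suc[OF lim] limV[OF lim]]) (simp_all add: VW)
 \<comment> \<open>The decreasing iterates cannot collapse: \<open>h0 \<ge> c\<close> gives
   \<open>H n \<ge> c * vpow \<beta> n \<ge> c * c\<close>.\<close>
 define H where "H n = (V \<beta> ^^ n) h0" for n
 have HS: "H (Suc n) = V \<beta> (H n)" for n by (simp add: H_def)
 have Hdec: "H (Suc n) x \<le> H n x" for n x
 proof (induction n arbitrary: x)
  case 0 then show ?case using Vh0 by (simp add: H_def)
 next
  case (Suc n) then show ?case unfolding HS[of "Suc n"] HS[of n] by (metis HS V_mono)
 qed
 have Hge: "c * vpow \<beta> n x \<le> H n x" for n x
 proof (induction n arbitrary: x)
  case 0 then show ?case using h0 by (simp add: H_def)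
 next
  case (Suc n)
  have "c * vpow \<beta> (Suc n) x = V \<beta> (\<lambda>x. c * vpow \<beta> n x) x" by (simp add: V_cmult vpow_Suc_V)
  also have "\<dots> \<le> H (Suc n) x" unfolding HS by (intro V_mono Suc)
  finally show ?case .
 qed
 have Hge': "c * c \<le> H n x" for n x
  using mult_left_mono[of c "vpow \<beta> n x" c] bd[of n x] Hge[where n=n and x=x] c by linarith
 have Hle: "H n x \<le> C" for n x
 proof (induction n)
  case (Suc n) then show ?case using Hdec[of n x] by simp
 qed (simp add: H_def h0)
 have coneH: "cone (H n)" for n
 proof (induction n)
  case 0 then show ?case using \<open>cone h0\<close> by (simp add: H_def)
 next
  case (Suc n) then show ?case unfolding HS using Hge' c
   by (intro cone_V) (auto intro: order_trans[of _ "c * c"])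
 qed
 have "decseq (\<lambda>n. H n x)" for x using Hdec by (intro decseq_SucI)
 then have "\<exists>l. (\<lambda>n. H n x) \<longlonglongrightarrow> l" for x
  using Hge' by (metis decseq_convergent)
 then obtain h where h: "\<And>x. (\<lambda>n. H n x) \<longlonglongrightarrow> h x" by metis
 have "(\<lambda>n. H (Suc n) x) \<longlonglongrightarrow> V \<beta> h x" for x unfolding HS by (rule limV[OF h])
 then have "V \<beta> h x = h x" for x using LIMSEQ_Suc[OF h] LIMSEQ_unique by blast
 moreover have "cone h" unfolding cone_def
 proof (intro allI impI)
  fix x y :: "nat \<Rightarrow> 'd" and n assume "\<forall>k<n. x k = y k"
  then have "H m x \<le> exp (B / (1 - \<rho>) * \<rho> ^ n) * H m y" for m
   using coneH unfolding cone_def by blast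
  then show "h x \<le> exp (B / (1 - \<rho>) * \<rho> ^ n) * h y"
   by (intro tendsto_le[OF _ tendsto_mult_left[OF h] h] always_eventually allI) auto
 qed
 moreover have "c * c \<le> h x" "h x \<le> C" for x
  by (rule tendsto_lowerbound[OF h] tendsto_upperbound[OF h]; simp add: Hge' Hle)+
 ultimately show ?thesis by blast
qed

end

section \<open>Critical kernels: exponential tilting and the associated walk\<close>

definition esgn :: "bool \<Rightarrow> real" where "esgn s = (if s then 1 else - 1)"

lemma esgn_simps [simp]: "esgn True = 1" "esgn False = - 1" "\<bar>esgn s\<bar> = 1" "esgn s * esgn s = 1"
 by (auto simp: esgn_def)

text \<open>The Boolean state of the walk and the level together encode the signed multiplier: the
  new sign times the modulus equals the old sign times \<open>m\<close>.\<close>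

lemma esgn_step: "m \<noteq> 0 \<Longrightarrow> esgn (s = (0 < m)) * \<bar>m\<bar> = esgn s * m"
 by (auto simp: esgn_def)

locale critical_kernel = affine_kernel g lam kap q0 m0 \<alpha> B \<rho>
 for g :: "'d::finite \<Rightarrow> (nat \<Rightarrow> 'd) \<Rightarrow> real" and lam :: "'d \<Rightarrow> (real \<times> real) measure"
  and kap :: "(nat \<Rightarrow> 'd) \<Rightarrow> real measure" and q0 m0 \<alpha> B \<rho> :: real +
 assumes alpha_pos: "0 < \<alpha>"
  and critical: "\<exists>c C. 0 < c \<and> (\<forall>n x. c \<le> vpow \<alpha> n x \<and> vpow \<alpha> n x \<le> C)"
  and subcritical: "0 < \<beta> \<Longrightarrow> \<beta> < \<alpha> \<Longrightarrow> \<exists>C r. 0 < r \<and> r < 1 \<and> (\<forall>n x. vpow \<beta> n x \<le> C * r ^ n)"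
  and tail: "0 < \<beta> \<Longrightarrow> \<beta> < \<alpha> \<Longrightarrow> \<exists>C. \<forall>x t. 0 < t \<longrightarrow> measure (kap x) {r. \<bar>r\<bar> > t} \<le> C * t powr (- \<beta>)"
  and nonlattice: "\<delta> > 0 \<Longrightarrow> \<exists>j. \<not> (AE u in lam j. \<exists>k::int. ln \<bar>snd u\<bar> = \<delta> * of_int k)"
begin

definition h :: "(nat \<Rightarrow> 'd) \<Rightarrow> real" where
 "h = (SOME h. (\<exists>c>0. \<exists>C. \<forall>x. c \<le> h x \<and> h x \<le> C) \<and> (\<forall>x. V \<alpha> h x = h x) \<and> cone h)"

lemma h_props: "\<exists>c>0. \<exists>C. \<forall>x. c \<le> h x \<and> h x \<le> C" "V \<alpha> h x = h x" "cone h"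
proof -
 obtain c C where c: "0 < c" "\<And>n x. c \<le> vpow \<alpha> n x \<and> vpow \<alpha> n x \<le> C" using critical by blast
 obtain h' where h': "\<forall>x. c * c \<le> h' x \<and> h' x \<le> C" "\<forall>x. V \<alpha> h' x = h' x" "cone h'"
  using harmonic_exists[OF c] by blast
 have "0 < c * c" using c(1) by simp
 then have "\<exists>h. (\<exists>c>0. \<exists>C. \<forall>x. c \<le> h x \<and> h x \<le> C) \<and> (\<forall>x. V \<alpha> h x = h x) \<and> cone h"
  using h' by blast
 from someI_ex[OF this] show "\<exists>c>0. \<exists>C. \<forall>x. c \<le> h x \<and> h x \<le> C" "V \<alpha> h x = h x" "cone h"
  by (auto simp: h_def)
qed

definition hmin where "hmin = (SOME c. 0 < c \<and> (\<forall>x. c \<le> h x))"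
definition hmax where "hmax = (SOME C. \<forall>x. h x \<le> C)"

lemma h_bounds: "0 < hmin" "hmin \<le> h x" "h x \<le> hmax" "0 < h x" "0 < hmax"
proof -
 obtain c C where c: "0 < c" "\<forall>x. c \<le> h x" and C: "\<forall>x. h x \<le> C" using h_props(1) by blast
 have 1: "0 < hmin \<and> (\<forall>x. hmin \<le> h x)" unfolding hmin_def by (rule someI_ex) (use c in blast)
 have 2: "\<forall>x. h x \<le> hmax" unfolding hmax_def by (rule someI_ex) (use C in blast)
 show "0 < hmin" "hmin \<le> h x" "h x \<le> hmax" "0 < h x" using 1 2 by (auto intro: less_le_trans)
 then show "0 < hmax" by linarith
qed

text \<open>Doob transform of the backward chain by \<open>h\<close>; the rows sum to 1 because
  \<open>V \<alpha> h = h\<close>. The factor \<open>\<bar>m\<bar> powr \<alpha>\<close> of the tilt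
  is left to \<open>zeta\<close>, normalised by \<open>mom \<alpha> j\<close>, which reappears
  here.\<close>

definition pp :: "'d \<Rightarrow> (nat \<Rightarrow> 'd) \<Rightarrow> real" where
 "pp j x = g j x * mom \<alpha> j * h (cons j x) / h x"

definition zeta :: "'d \<Rightarrow> real measure" where
 "zeta j = distr (density (lam j) (\<lambda>u. ennreal (\<bar>snd u\<bar> powr \<alpha> / mom \<alpha> j))) borel snd"

lemma zeta_integral:
 assumes [measurable]: "f \<in> borel_measurable borel"
 shows "(\<integral>m. f m \<partial>zeta j) = (\<integral>u. \<bar>snd u\<bar> powr \<alpha> * f (snd u) \<partial>lam j) / mom \<alpha> j"
proof -
 have "(\<integral>m. f m \<partial>zeta j) = (\<integral>u. f (snd u) \<partial>density (lam j) (\<lambda>u. ennreal (\<bar>snd u\<bar> powr \<alpha> / mom \<alpha> j)))"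
  unfolding zeta_def by (subst integral_distr) auto
 also have "\<dots> = (\<integral>u. (\<bar>snd u\<bar> powr \<alpha> / mom \<alpha> j) *\<^sub>R f (snd u) \<partial>lam j)"
  using mom_pos[of \<alpha> j] by (subst integral_density) (auto simp: less_imp_le)
 finally show ?thesis by simp
qed

lemma AE_zeta:
 assumes [measurable]: "Measurable.pred borel Q"
 shows "(AE m in zeta j. Q m) \<longleftrightarrow> (AE u in lam j. Q (snd u))"
proof -
 have "(AE m in zeta j. Q m) \<longleftrightarrow> (AE u in lam j. 0 < ennreal (\<bar>snd u\<bar> powr \<alpha> / mom \<alpha> j) \<longrightarrow> Q (snd u))"
  unfolding zeta_def by (subst AE_distr_iff) (auto simp: AE_density)
 also have "\<dots> \<longleftrightarrow> (AE u in lam j. Q (snd u))"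
 proof
  assume "AE u in lam j. 0 < ennreal (\<bar>snd u\<bar> powr \<alpha> / mom \<alpha> j) \<longrightarrow> Q (snd u)"
  with lam_bound'[of j] show "AE u in lam j. Q (snd u)"
   by eventually_elim (use mom_pos[of \<alpha> j] in \<open>auto simp: ennreal_less_zero_iff\<close>)
 next
  assume "AE u in lam j. Q (snd u)"
  then show "AE u in lam j. 0 < ennreal (\<bar>snd u\<bar> powr \<alpha> / mom \<alpha> j) \<longrightarrow> Q (snd u)"
   by eventually_elim simp
 qed
 finally show ?thesis .
qed

lemma prob_zeta: "prob_space (zeta j)"
proof
 have "emeasure (zeta j) (space (zeta j)) = (\<integral>\<^sup>+u. ennreal (\<bar>snd u\<bar> powr \<alpha> / mom \<alpha> j) \<partial>lam j)"
  unfolding zeta_def by (subst emeasure_distr) (auto simp: emeasure_density)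
 also have "\<dots> = ennreal (\<integral>u. \<bar>snd u\<bar> powr \<alpha> / mom \<alpha> j \<partial>lam j)"
  using mom_pos[of \<alpha> j] by (intro nn_integral_eq_integral) (auto intro!: powr_integrable simp: less_imp_le)
 also have "\<dots> = 1" using mom_pos[of \<alpha> j] by (simp add: mom_def)
 finally show "emeasure (zeta j) (space (zeta j)) = 1" .
qed

text \<open>The two requirements are those of \<open>defect_bound\<close>:
  \<open>\<theta> \<le> 1 / 3\<close> gives \<open>\<theta> - 1 \<le> - 2 * \<theta>\<close> for
  large levels, and \<open>\<theta> \<le> \<alpha> / 2\<close> gives decay of
  \<open>exp (\<alpha> * t)\<close> at rate \<open>2 * \<theta>\<close> for negative levels.\<close>

definition \<theta> :: real where "\<theta> = min (1 / 3) (\<alpha> / 2)"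

lemma theta: "0 < \<theta>" "\<theta> < \<alpha>" "2 * \<theta> \<le> \<alpha>" "\<theta> - 1 \<le> - 2 * \<theta>"
 using alpha_pos by (auto simp: \<theta>_def min_def)

text \<open>The added 1 keeps the step bound positive when \<open>m0 = 1\<close>.\<close>

definition LL :: real where "LL = ln m0 + 1"

lemma g_lower: "\<exists>p0>0. \<forall>j x. p0 \<le> g j x"
proof -
 define x0 :: "nat \<Rightarrow> 'd" where "x0 = undefined"
 define p0 where "p0 = Min (range (\<lambda>j. g j x0)) / exp B"
 have "0 < Min (range (\<lambda>j. g j x0))" by (subst Min_gr_iff) (auto simp: g_pos)
 then have "0 < p0" by (simp add: p0_def)
 moreover have "p0 \<le> g j x" for j x
 proof -
  have "Min (range (\<lambda>j. g j x0)) \<le> g j x0" by (intro Min_le) auto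
  also have "\<dots> \<le> exp B * g j x" using g_cmp[of 0 x0 x j] by simp
  finally show ?thesis by (simp add: p0_def divide_le_eq mult.commute)
 qed
 ultimately show ?thesis by blast
qed

lemma mom_quot: "(\<integral>m. \<bar>m\<bar> powr (- \<theta>) \<partial>zeta j) = mom (\<alpha> - \<theta>) j / mom \<alpha> j"
proof -
 have "(\<integral>u. \<bar>snd u\<bar> powr \<alpha> * \<bar>snd u\<bar> powr (- \<theta>) \<partial>lam j) = mom (\<alpha> - \<theta>) j"
  unfolding mom_def by (intro Bochner_Integration.integral_cong refl) (simp add: powr_add[symmetric])
 then show ?thesis by (subst zeta_integral) auto
qed

text \<open>Under the tilt the moment of order \<open>- \<theta>\<close> becomes the original moment
  of order \<open>\<alpha> - \<theta>\<close>, which is subcritical. Its exponential decay under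
  iteration is converted into a one-step contraction by changing the weight function.\<close>

lemma markov_walk_exists: "\<exists>p0 \<kappa> bmax b. markov_walk pp zeta LL p0 \<theta> \<kappa> bmax b"
proof -
 obtain C r where Cr: "0 < r" "r < 1" "\<And>n x. vpow (\<alpha> - \<theta>) n x \<le> C * r ^ n"
  using subcritical[of "\<alpha> - \<theta>"] theta by auto
 obtain p1 where p1: "0 < p1" "\<And>j x. p1 \<le> g j x" using g_lower by blast
 define mm where "mm = Min (range (mom \<alpha>))"
 have mm: "0 < mm" "\<And>j. mm \<le> mom \<alpha> j"
  unfolding mm_def by (subst Min_gr_iff) (auto simp: mom_pos)
 define p0 where "p0 = p1 * mm * hmin / hmax"
 have "(\<lambda>n. C * r ^ n) \<longlonglongrightarrow> C * 0" using Cr by (intro tendsto_intros LIMSEQ_power_zero) auto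
 then have "eventually (\<lambda>n. C * r ^ n < 1 / 2) sequentially" by (intro order_tendstoD) auto
 then obtain N0 where N0: "\<And>n. n \<ge> N0 \<Longrightarrow> C * r ^ n < 1 / 2" by (auto simp: eventually_sequentially)
 define N where "N = Suc N0"
 have vN: "2 * vpow (\<alpha> - \<theta>) N x \<le> 1" for x
 proof -
  have "C * r ^ N < 1 / 2" by (rule N0) (simp add: N_def)
  then show ?thesis using Cr(3)[of N x] by linarith
 qed
 \<comment> \<open>Chosen so that \<open>\<kappa> ^ N = 2\<close> compensates exactly the bound
   \<open>1 / 2\<close> on the \<open>N\<close>-th iterate.\<close>
 define \<kappa> :: real where "\<kappa> = 2 powr (1 / real N)"
 have k1: "1 < \<kappa>" by (simp add: \<kappa>_def N_def)
 have kN: "\<kappa> ^ N = 2"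
 proof -
  have "\<kappa> ^ N = \<kappa> powr real N" by (simp add: \<kappa>_def powr_realpow)
  also have "\<dots> = 2 powr (1 / real N * real N)" unfolding \<kappa>_def by (rule powr_powr)
  also have "\<dots> = 2" by (simp add: N_def)
  finally show ?thesis .
 qed
 \<comment> \<open>The usual adapted weight: a discounted sum of iterates, contracted in one step
   although the operator is known to contract only after \<open>N\<close>. Division by
   \<open>h\<close> undoes the Doob transform, and \<open>hmax\<close> makes the weight at least
   1.\<close>
 define b where "b x = hmax / h x * (\<Sum>n<N. \<kappa> ^ n * vpow (\<alpha> - \<theta>) n x)" for x
 have C0: "0 \<le> C" using Cr(3)[of 0 undefined] by simp
 define bmax where "bmax = hmax / hmin * (\<Sum>n<N. \<kappa> ^ n * (C * r ^ n))"
 have sets: "sets (zeta j) = sets borel" for j by (simp add: zeta_def)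
 have "markov_walk pp zeta LL p0 \<theta> \<kappa> bmax b"
 proof (rule markov_walk.intro)
  fix j x
  show "prob_space (zeta j)" by (rule prob_zeta)
  show "sets (zeta j) = sets borel" by (rule sets)
  show "AE m in zeta j. m \<noteq> 0 \<and> \<bar>ln \<bar>m\<bar>\<bar> \<le> LL"
  proof (subst AE_zeta)
   show "AE u in lam j. snd u \<noteq> 0 \<and> \<bar>ln \<bar>snd u\<bar>\<bar> \<le> LL"
    using lam_bound'[of j] by eventually_elim (simp add: LL_def)
  qed measurable
  show "0 < LL" using m0_ge by (simp add: LL_def add_nonneg_pos)
  show "0 < p0" using p1 mm h_bounds by (simp add: p0_def)
  have "p1 * mm * hmin / hmax \<le> g j x * mom \<alpha> j * h (cons j x) / h x"
   using p1 mm h_bounds g_pos[of j x] mom_pos[of \<alpha> j] h_bounds(4)[of x] h_bounds(4)[of "cons j x"]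
   by (intro frac_le mult_mono mult_nonneg_nonneg) (auto simp: less_imp_le)
  then show "p0 \<le> pp j x" by (simp add: p0_def pp_def)
  have "(\<Sum>j\<in>UNIV. pp j x) = V \<alpha> h x / h x" by (simp add: pp_def V_def sum_divide_distrib)
  then show "(\<Sum>j\<in>UNIV. pp j x) = 1" using h_props(2)[of x] h_bounds(4)[of x] by simp
  show "0 < \<theta>" by (rule theta)
  show "1 < \<kappa>" by (rule k1)
  have "1 * 1 \<le> b x" unfolding b_def
  proof (rule mult_mono)
   show "1 \<le> hmax / h x" using h_bounds(3,4)[of x] by simp
   have "(\<Sum>n\<in>{0}. \<kappa> ^ n * vpow (\<alpha> - \<theta>) n x) \<le> (\<Sum>n<N. \<kappa> ^ n * vpow (\<alpha> - \<theta>) n x)"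
    using k1 by (intro sum_mono2) (auto simp: N_def intro!: mult_nonneg_nonneg less_imp_le[OF vpow_pos])
   then show "1 \<le> (\<Sum>n<N. \<kappa> ^ n * vpow (\<alpha> - \<theta>) n x)" by simp
  qed (use h_bounds(3,4)[of x] in \<open>auto intro!: divide_nonneg_pos\<close>)
  then show "1 \<le> b x" by simp
  show "b x \<le> bmax" unfolding b_def bmax_def
   using k1 Cr C0 h_bounds(1) h_bounds(2,4)[of x] h_bounds(5)
   by (intro mult_mono divide_left_mono sum_mono mult_left_mono sum_nonneg mult_nonneg_nonneg)
    (auto intro!: less_imp_le[OF vpow_pos] divide_nonneg_pos)
  have "(\<Sum>j\<in>UNIV. pp j x * (\<integral>m. \<bar>m\<bar> powr (- \<theta>) \<partial>zeta j) * b (cons j x)) =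
   (\<Sum>j\<in>UNIV. hmax / h x * (\<Sum>n<N. \<kappa> ^ n * (g j x * mom (\<alpha> - \<theta>) j * vpow (\<alpha> - \<theta>) n (cons j x))))"
  proof (intro sum.cong refl)
   fix j
   show "pp j x * (\<integral>m. \<bar>m\<bar> powr (- \<theta>) \<partial>zeta j) * b (cons j x) =
   hmax / h x * (\<Sum>n<N. \<kappa> ^ n * (g j x * mom (\<alpha> - \<theta>) j * vpow (\<alpha> - \<theta>) n (cons j x)))"
    using mom_pos[of \<alpha> j] h_bounds(4)[of "cons j x"]
    by (simp add: mom_quot pp_def b_def sum_distrib_left mult_ac)
  qed
  also have "\<dots> = hmax / h x * (\<Sum>n<N. \<kappa> ^ n * vpow (\<alpha> - \<theta>) (Suc n) x)"
   unfolding sum_distrib_left[symmetric] by (subst sum.swap) (simp add: sum_distrib_left)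
  also have "\<dots> \<le> hmax / h x * ((\<Sum>n<N. \<kappa> ^ n * vpow (\<alpha> - \<theta>) n x) / \<kappa>)"
  proof (rule mult_left_mono)
   have "\<kappa> * (\<Sum>n<N. \<kappa> ^ n * vpow (\<alpha> - \<theta>) (Suc n) x) = (\<Sum>n<N. \<kappa> ^ Suc n * vpow (\<alpha> - \<theta>) (Suc n) x)"
    by (simp add: sum_distrib_left mult_ac)
   \<comment> \<open>Shifting the index trades the term for 0, which equals 1, for the term for
     \<open>N\<close>, which is at most \<open>2 * (1 / 2)\<close>.\<close>
   also have "\<dots> = (\<Sum>n<N. \<kappa> ^ n * vpow (\<alpha> - \<theta>) n x) + \<kappa> ^ N * vpow (\<alpha> - \<theta>) N x - 1"
    using sum.lessThan_Suc_shift[of "\<lambda>n. \<kappa> ^ n * vpow (\<alpha> - \<theta>) n x" N]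
     sum.lessThan_Suc[of "\<lambda>n. \<kappa> ^ n * vpow (\<alpha> - \<theta>) n x" N]
    unfolding vpow.simps(1) power_0 by linarith
   also have "\<dots> \<le> (\<Sum>n<N. \<kappa> ^ n * vpow (\<alpha> - \<theta>) n x)" using vN[of x] by (simp add: kN)
   finally show "(\<Sum>n<N. \<kappa> ^ n * vpow (\<alpha> - \<theta>) (Suc n) x) \<le> (\<Sum>n<N. \<kappa> ^ n * vpow (\<alpha> - \<theta>) n x) / \<kappa>"
    using k1 by (simp add: field_simps)
  qed (use h_bounds(4)[of x] h_bounds(5) in auto)
  finally show "(\<Sum>j\<in>UNIV. pp j x * (\<integral>m. \<bar>m\<bar> powr (- \<theta>) \<partial>zeta j) * b (cons j x)) \<le> b x / \<kappa>"
   by (simp add: b_def)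
 qed
 then show ?thesis by blast
qed

text \<open>The four existential parameters are packed into one tuple, so that a single choice fixes
  them jointly and the sublocale has fixed arguments.\<close>

definition walk_params where
 "walk_params = (SOME u. markov_walk pp zeta LL (fst u) \<theta> (fst (snd u)) (fst (snd (snd u))) (snd (snd (snd u))))"

sublocale mw: markov_walk pp zeta LL "fst walk_params" \<theta> "fst (snd walk_params)"
 "fst (snd (snd walk_params))" "snd (snd (snd walk_params))"
proof -
 have "\<exists>u. markov_walk pp zeta LL (fst u) \<theta> (fst (snd u)) (fst (snd (snd u))) (snd (snd (snd u)))"
  using markov_walk_exists by simp
 from someI_ex[OF this]
 show "markov_walk pp zeta LL (fst walk_params) \<theta> (fst (snd walk_params))
  (fst (snd (snd walk_params))) (snd (snd (snd walk_params)))"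
  unfolding walk_params_def .
qed

lemma Pop_lam:
 assumes "mw.adm f"
 shows "mw.Pop f t s x = (\<Sum>j\<in>UNIV. g j x * (h (cons j x) *
  (\<integral>u. \<bar>snd u\<bar> powr \<alpha> * f (t - ln \<bar>snd u\<bar>) (s = (0 < snd u)) (cons j x) \<partial>lam j))) / h x"
proof -
 have "(\<lambda>m. f (t - ln \<bar>m\<bar>) (s = (0 < m)) y) \<in> borel_measurable borel" for y
  using mw.adm_measurable[OF assms, of t s y undefined] by (simp cong: measurable_cong_sets)
 then have "mw.Pop f t s x = (\<Sum>j\<in>UNIV. pp j x *
   ((\<integral>u. \<bar>snd u\<bar> powr \<alpha> * f (t - ln \<bar>snd u\<bar>) (s = (0 < snd u)) (cons j x) \<partial>lam j) / mom \<alpha> j))"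
  unfolding mw.Pop_def by (subst zeta_integral) auto
 also have "\<dots> = (\<Sum>j\<in>UNIV. g j x * (h (cons j x) *
  (\<integral>u. \<bar>snd u\<bar> powr \<alpha> * f (t - ln \<bar>snd u\<bar>) (s = (0 < snd u)) (cons j x) \<partial>lam j)) / h x)"
  using mom_pos[of \<alpha>] by (intro sum.cong refl) (simp add: pp_def less_imp_neq[THEN not_sym])
 finally show ?thesis by (simp add: sum_divide_distrib)
qed

section \<open>Smoothed rescaled tails as approximate solutions of the renewal equation\<close>

definition phi :: "real \<Rightarrow> real \<Rightarrow> real" where
 "phi d y = min 1 (max 0 ((y - 1) / d))"

lemma phi_bounds: "0 \<le> phi d y" "phi d y \<le> 1" by (auto simp: phi_def)

lemma phi_zero: "0 < d \<Longrightarrow> y \<le> 1 \<Longrightarrow> phi d y = 0"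
 using divide_nonpos_pos[of "y - 1" d] by (simp add: phi_def max_absorb1)

lemma phi_one: "0 < d \<Longrightarrow> 1 + d \<le> y \<Longrightarrow> phi d y = 1"
 by (auto simp: phi_def max_def min_def field_simps)

lemma phi_lipschitz: "0 < d \<Longrightarrow> \<bar>phi d y - phi d y'\<bar> \<le> \<bar>y - y'\<bar> / d"
proof -
 assume d: "0 < d"
 have "\<bar>phi d y - phi d y'\<bar> \<le> \<bar>(y - 1) / d - (y' - 1) / d\<bar>"
  unfolding phi_def by (auto simp: min_def max_def abs_if)
 also have "\<dots> = \<bar>y - y'\<bar> / d" using d by (simp add: diff_divide_distrib[symmetric])
 finally show ?thesis .
qed

lemma phi_continuous: "continuous_on A (phi d)"
 unfolding phi_def by (cases "d = 0") (auto intro!: continuous_intros)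

lemma phi_measurable [measurable]: "phi d \<in> borel_measurable borel"
 by (intro borel_measurable_continuous_onI phi_continuous)

lemma phi_le_indicator: "0 < d \<Longrightarrow> phi d (esgn s * exp (- t) * r) \<le> indicator {r. exp t < \<bar>r\<bar>} r"
proof (cases "exp t < \<bar>r\<bar>")
 case False
 assume d: "0 < d"
 have "esgn s * exp (- t) * r \<le> exp (- t) * \<bar>r\<bar>" by (cases s) (auto simp: abs_if)
 also have "\<dots> \<le> exp (- t) * exp t" using False by (intro mult_left_mono) auto
 finally have "esgn s * exp (- t) * r \<le> 1" by (simp add: exp_add[symmetric])
 then show ?thesis using phi_zero[OF d] by simp
qed (simp add: phi_bounds)

lemma integrable_kap_bounded:
 fixes f :: "real \<Rightarrow> real"
 assumes "f \<in> borel_measurable borel" "\<And>r. \<bar>f r\<bar> \<le> C"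
 shows "integrable (kap x) f"
proof -
 interpret prob_space "kap x" by (rule prob_kap)
 show ?thesis by (rule integrable_const_bound[where B=C]) (use assms in auto)
qed

lemma integrable_phi: "integrable (kap x) (\<lambda>r. phi d (a * r + a'))"
 by (rule integrable_kap_bounded[where C=1]) (auto simp: phi_bounds)

lemma integral_kap_01:
 fixes f :: "real \<Rightarrow> real"
 assumes "f \<in> borel_measurable borel" "\<And>r. 0 \<le> f r \<and> f r \<le> 1"
 shows "0 \<le> (\<integral>r. f r \<partial>kap x)" "(\<integral>r. f r \<partial>kap x) \<le> 1"
proof -
 interpret prob_space "kap x" by (rule prob_kap)
 show "0 \<le> (\<integral>r. f r \<partial>kap x)" by (intro Bochner_Integration.integral_nonneg) (use assms in auto)
 have "(\<integral>r. f r \<partial>kap x) \<le> (\<integral>r. 1 \<partial>kap x)"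
  using assms by (intro integral_mono integrable_kap_bounded[where C=1]) auto
 then show "(\<integral>r. f r \<partial>kap x) \<le> 1" by (simp add: prob_space[simplified])
qed

lemma affine_measurable:
 fixes H :: "real \<Rightarrow> real"
 assumes [measurable]: "H \<in> borel_measurable borel"
 shows "(\<lambda>u. \<integral>r. H (fst u + snd u * r) \<partial>kap x) \<in> borel_measurable (lam j)"
proof -
 interpret prob_space "kap x" by (rule prob_kap)
 show ?thesis
  by (rule borel_measurable_lebesgue_integral) measurable
qed

lemma affine_integrable:
 fixes H :: "real \<Rightarrow> real"
 assumes [measurable]: "H \<in> borel_measurable borel" and H: "\<And>r. 0 \<le> H r \<and> H r \<le> 1"
 shows "integrable (lam j) (\<lambda>u. \<integral>r. H (fst u + snd u * r) \<partial>kap x)"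
proof -
 interpret prob_space "lam j" by (rule prob_lam)
 have "0 \<le> (\<integral>r. H (fst u + snd u * r) \<partial>kap x) \<and> (\<integral>r. H (fst u + snd u * r) \<partial>kap x) \<le> 1" for u
  using integral_kap_01[of "\<lambda>r. H (fst u + snd u * r)"] H by auto
 then show ?thesis
  by (intro integrable_const_bound[where B=1] affine_measurable) (auto simp: abs_le_iff intro: assms order_trans[of _ 0])
qed

text \<open>The tail at scale \<open>exp t\<close> on the side \<open>s\<close>, multiplied by the
  inverse of its expected order and divided by \<open>h\<close>; this normalisation turns the affine
  recursion of \<open>kap\<close> into \<open>Pop\<close>, up to the translation by the first
  coefficient.\<close>

definition zz :: "real \<Rightarrow> real \<Rightarrow> bool \<Rightarrow> (nat \<Rightarrow> 'd) \<Rightarrow> real" where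
 "zz d t s x = exp (\<alpha> * t) * (\<integral>r. phi d (esgn s * exp (- t) * r) \<partial>kap x) / h x"

lemma zz_nonneg: "0 \<le> zz d t s x"
 unfolding zz_def using h_bounds(4)[of x] integral_kap_01[of "\<lambda>r. phi d (esgn s * exp (- t) * r)" x]
 by (auto simp: phi_bounds)

lemma measure_tail: "(\<integral>r. indicator {r. a < \<bar>r\<bar>} r \<partial>kap x) = measure (kap x) {r. a < \<bar>r\<bar>}" for a :: real
 by simp

lemma zz_le_tail:
 assumes d: "0 < d"
 shows "zz d t s x \<le> exp (\<alpha> * t) * measure (kap x) {r. exp t < \<bar>r\<bar>} / h x"
proof -
 have "(\<integral>r. phi d (esgn s * exp (- t) * r) \<partial>kap x) \<le> (\<integral>r. indicator {r. exp t < \<bar>r\<bar>} r \<partial>kap x)"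
  by (intro integral_mono phi_le_indicator[OF d] integrable_kap_bounded[where C=1]) (auto simp: phi_bounds)
 then show ?thesis unfolding zz_def measure_tail using h_bounds(4)[of x]
  by (intro divide_right_mono mult_left_mono) auto
qed

lemma tail_exp: "\<exists>C\<ge>0. \<forall>x t. measure (kap x) {r. exp t < \<bar>r\<bar>} \<le> C * exp (- ((\<alpha> - \<theta>) * t))"
proof -
 obtain C where C: "\<And>x t. 0 < t \<Longrightarrow> measure (kap x) {r. t < \<bar>r\<bar>} \<le> C * t powr (- (\<alpha> - \<theta>))"
  using tail[of "\<alpha> - \<theta>"] theta by auto
 have 1: "measure (kap x) {r. exp t < \<bar>r\<bar>} \<le> C * exp (- ((\<alpha> - \<theta>) * t))" for x t
  using C[of "exp t" x] by (simp add: powr_def algebra_simps)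
 moreover have "0 \<le> C" using order_trans[OF measure_nonneg C[of 1 undefined]] by simp
 ultimately show ?thesis by blast
qed

lemma zz_adm: "0 < d \<Longrightarrow> mw.adm (zz d)"
 unfolding mw.adm_def
proof (intro conjI allI)
 fix s x
 interpret prob_space "kap x" by (rule prob_kap)
 show "(\<lambda>t. zz d t s x) \<in> borel_measurable borel"
  unfolding zz_def by measurable
next
 fix A
 have "\<bar>zz d t s x\<bar> \<le> exp (\<alpha> * A) / hmin" if "\<bar>t\<bar> \<le> A" for t s x
 proof -
  have "zz d t s x \<le> exp (\<alpha> * A) * 1 / hmin"
   unfolding zz_def using that alpha_pos h_bounds(1) h_bounds(2)[of x]
    integral_kap_01[of "\<lambda>r. phi d (esgn s * exp (- t) * r)" x]
   by (intro frac_le mult_mono) (auto simp: phi_bounds)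
  then show ?thesis using zz_nonneg[of d t s x] by simp
 qed
 then show "\<exists>B. \<forall>t s x. \<bar>t\<bar> \<le> A \<longrightarrow> \<bar>zz d t s x\<bar> \<le> B" by blast
qed

lemma zz_rec:
 assumes d: "0 < d"
 shows "zz d t s x = exp (\<alpha> * t) * (\<Sum>j\<in>UNIV. g j x *
  (\<integral>u. (\<integral>r. phi d (esgn s * exp (- t) * (fst u + snd u * r)) \<partial>kap (cons j x)) \<partial>lam j)) / h x"
proof -
 have "continuous_on UNIV (\<lambda>r. phi d (esgn s * exp (- t) * r))"
  by (intro continuous_on_compose2[OF phi_continuous[of UNIV]] continuous_intros) auto
 then show ?thesis unfolding zz_def
  by (subst kap_rec) (auto simp: phi_bounds)
qed

text \<open>The result is the recursion of \<open>zz_rec\<close> with the translation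
  \<open>fst u\<close> deleted: the tilt restores \<open>exp (\<alpha> * t)\<close>, and the shifted
  level together with the new sign reassembles \<open>snd u\<close> inside the cutoff. The defect is
  therefore due to the translation alone.\<close>

lemma Pop_zz:
 assumes d: "0 < d"
 shows "mw.Pop (zz d) t s x = exp (\<alpha> * t) * (\<Sum>j\<in>UNIV. g j x *
  (\<integral>u. (\<integral>r. phi d (esgn s * exp (- t) * (snd u * r)) \<partial>kap (cons j x)) \<partial>lam j)) / h x"
proof -
 have "h y * (\<integral>u. \<bar>snd u\<bar> powr \<alpha> * zz d (t - ln \<bar>snd u\<bar>) (s = (0 < snd u)) y \<partial>lam j) =
  exp (\<alpha> * t) * (\<integral>u. (\<integral>r. phi d (esgn s * exp (- t) * (snd u * r)) \<partial>kap y) \<partial>lam j)" for j y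
 proof -
  interpret prob_space "kap y" by (rule prob_kap)
  have [measurable]: "(\<lambda>t. zz d t s y) \<in> borel_measurable borel" for s
   by (rule mw.admM[OF zz_adm[OF d]])
  have m: "(\<lambda>u. zz d (t - ln \<bar>snd u\<bar>) (s = (0 < snd u)) y) \<in> borel_measurable (lam j)"
  proof -
   have "(\<lambda>u. zz d (t - ln \<bar>snd u\<bar>) (s = (0 < snd u)) y) =
    (\<lambda>u. if 0 < snd u then zz d (t - ln \<bar>snd u\<bar>) s y else zz d (t - ln \<bar>snd u\<bar>) (\<not> s) y)"
    by (auto simp: fun_eq_iff)
   also have "\<dots> \<in> borel_measurable (lam j)" by measurable
   finally show ?thesis .
  qed
  have "(\<integral>u. \<bar>snd u\<bar> powr \<alpha> * zz d (t - ln \<bar>snd u\<bar>) (s = (0 < snd u)) y \<partial>lam j) =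
   (\<integral>u. exp (\<alpha> * t) / h y * (\<integral>r. phi d (esgn s * exp (- t) * (snd u * r)) \<partial>kap y) \<partial>lam j)"
  proof (rule integral_cong_AE)
   show "AE u in lam j. \<bar>snd u\<bar> powr \<alpha> * zz d (t - ln \<bar>snd u\<bar>) (s = (0 < snd u)) y =
    exp (\<alpha> * t) / h y * (\<integral>r. phi d (esgn s * exp (- t) * (snd u * r)) \<partial>kap y)"
    using lam_bound'[of j]
   proof eventually_elim
    case (elim u)
    then have m: "snd u \<noteq> 0" by simp
    have 1: "\<bar>snd u\<bar> powr \<alpha> * exp (\<alpha> * (t - ln \<bar>snd u\<bar>)) = exp (\<alpha> * t)"
     using m by (simp add: powr_def exp_add[symmetric] algebra_simps)
    have 2: "esgn (s = (0 < snd u)) * exp (- (t - ln \<bar>snd u\<bar>)) = esgn s * exp (- t) * snd u"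
    proof -
     have "exp (- (t - ln \<bar>snd u\<bar>)) = \<bar>snd u\<bar> * exp (- t)"
      using m by (simp add: exp_diff exp_minus divide_inverse)
     then show ?thesis using esgn_step[OF m, of s] by (simp add: mult_ac)
    qed
    show ?case unfolding zz_def 2 using 1 by (simp add: mult.assoc)
   qed
  qed (use m in measurable)
  then show ?thesis using h_bounds(4)[of y] by simp
 qed
 then show ?thesis
  by (simp add: Pop_lam[OF zz_adm[OF d]] sum_distrib_left mult_ac)
qed

lemma defect_le:
 assumes d: "0 < d" and D: "\<And>u y. \<bar>fst u\<bar> \<le> q0 \<Longrightarrow> \<bar>snd u\<bar> \<le> m0 \<Longrightarrow>
   (\<integral>r. \<bar>phi d (esgn s * exp (- t) * (fst u + snd u * r)) - phi d (esgn s * exp (- t) * (snd u * r))\<bar> \<partial>kap y) \<le> D"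
 shows "\<bar>zz d t s x - mw.Pop (zz d) t s x\<bar> \<le> exp (\<alpha> * t) * D / hmin"
proof -
 define a where "a = esgn s * exp (- t)"
 define F1 where "F1 j = (\<integral>u. (\<integral>r. phi d (a * (fst u + snd u * r)) \<partial>kap (cons j x)) \<partial>lam j)" for j
 define F2 where "F2 j = (\<integral>u. (\<integral>r. phi d (a * (snd u * r)) \<partial>kap (cons j x)) \<partial>lam j)" for j
 have F: "\<bar>F1 j - F2 j\<bar> \<le> D" for j
 proof -
  interpret prob_space "lam j" by (rule prob_lam)
  interpret k: prob_space "kap (cons j x)" by (rule prob_kap)
  have b1: "\<bar>\<integral>r. phi d (a * (fst u + snd u * r)) \<partial>kap (cons j x)\<bar> \<le> 1" for u
   using integral_kap_01[of "\<lambda>r. phi d (a * (fst u + snd u * r))" "cons j x"] by (simp add: phi_bounds)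
  have b2: "\<bar>\<integral>r. phi d (a * (snd u * r)) \<partial>kap (cons j x)\<bar> \<le> 1" for u :: "real \<times> real"
   using integral_kap_01[of "\<lambda>r. phi d (a * (snd u * r))" "cons j x"] by (simp add: phi_bounds)
  have i1: "integrable (lam j) (\<lambda>u. \<integral>r. phi d (a * (fst u + snd u * r)) \<partial>kap (cons j x))"
   by (intro integrable_const_bound[where B=1]) (use b1 in auto)
  have i2: "integrable (lam j) (\<lambda>u. \<integral>r. phi d (a * (snd u * r)) \<partial>kap (cons j x))"
   by (intro integrable_const_bound[where B=1]) (use b2 in auto)
  have "\<bar>F1 j - F2 j\<bar> = \<bar>\<integral>u. (\<integral>r. phi d (a * (fst u + snd u * r)) \<partial>kap (cons j x)) -
    (\<integral>r. phi d (a * (snd u * r)) \<partial>kap (cons j x)) \<partial>lam j\<bar>"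
   unfolding F1_def F2_def by (subst Bochner_Integration.integral_diff[OF i1 i2]) simp
  also have "\<dots> \<le> (\<integral>u. \<bar>(\<integral>r. phi d (a * (fst u + snd u * r)) \<partial>kap (cons j x)) -
    (\<integral>r. phi d (a * (snd u * r)) \<partial>kap (cons j x))\<bar> \<partial>lam j)"
   by (rule integral_abs_bound)
  also have "\<dots> \<le> (\<integral>u. D \<partial>lam j)"
  proof (rule integral_mono_AE)
   show "AE u in lam j. \<bar>(\<integral>r. phi d (a * (fst u + snd u * r)) \<partial>kap (cons j x)) -
    (\<integral>r. phi d (a * (snd u * r)) \<partial>kap (cons j x))\<bar> \<le> D"
    using lam_bound[of j]
   proof eventually_elim
    case (elim u)
    have "\<bar>(\<integral>r. phi d (a * (fst u + snd u * r)) \<partial>kap (cons j x)) - (\<integral>r. phi d (a * (snd u * r)) \<partial>kap (cons j x))\<bar>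
     = \<bar>\<integral>r. phi d (a * (fst u + snd u * r)) - phi d (a * (snd u * r)) \<partial>kap (cons j x)\<bar>"
     by (subst Bochner_Integration.integral_diff) (auto intro!: integrable_kap_bounded[where C=1] simp: phi_bounds)
    also have "\<dots> \<le> (\<integral>r. \<bar>phi d (a * (fst u + snd u * r)) - phi d (a * (snd u * r))\<bar> \<partial>kap (cons j x))"
     by (rule integral_abs_bound)
    also have "\<dots> \<le> D" using D[of u "cons j x"] elim by (simp add: a_def)
    finally show ?case .
   qed
  qed (auto intro!: integrable_abs Bochner_Integration.integrable_diff i1 i2)
  also have "\<dots> = D" using prob_space by simp
  finally show ?thesis .
 qed
 have D0: "0 \<le> D" using F[of undefined] by (meson abs_ge_zero order_trans)
 have "zz d t s x - mw.Pop (zz d) t s x = exp (\<alpha> * t) * (\<Sum>j\<in>UNIV. g j x * (F1 j - F2 j)) / h x"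
  unfolding zz_rec[OF d] Pop_zz[OF d] F1_def F2_def a_def
  by (simp add: diff_divide_distrib[symmetric] right_diff_distrib sum_subtractf)
 also have "\<bar>\<dots>\<bar> = exp (\<alpha> * t) * \<bar>\<Sum>j\<in>UNIV. g j x * (F1 j - F2 j)\<bar> / h x"
  using h_bounds(4)[of x] by (simp add: abs_mult)
 also have "\<dots> \<le> exp (\<alpha> * t) * D / hmin"
 proof (intro frac_le mult_left_mono)
  have "\<bar>\<Sum>j\<in>UNIV. g j x * (F1 j - F2 j)\<bar> \<le> (\<Sum>j\<in>UNIV. g j x * D)"
   by (rule order_trans[OF sum_abs]) (auto intro!: sum_mono mult_left_mono F simp: abs_mult g_pos less_imp_le)
  also have "\<dots> = D" by (simp add: sum_distrib_right[symmetric] g_sum)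
  finally show "\<bar>\<Sum>j\<in>UNIV. g j x * (F1 j - F2 j)\<bar> \<le> D" .
 qed (use h_bounds D0 in auto)
 finally show ?thesis .
qed

text \<open>For large \<open>t\<close> the translation changes the argument of the cutoff by at most
  \<open>q0 * exp (- t)\<close>, and only where \<open>\<bar>r\<bar>\<close> exceeds
  \<open>exp t / (2 * m0)\<close>. The a priori tail at exponent \<open>\<alpha> - \<theta>\<close>
  leaves \<open>exp ((\<theta> - 1) * t)\<close>. For other levels the trivial bound 1 on the
  difference suffices.\<close>

lemma defect_bound:
 assumes d: "0 < d"
 shows "\<exists>C. \<forall>t s x. \<bar>zz d t s x - mw.Pop (zz d) t s x\<bar> \<le> C * exp (- (2 * \<theta> * \<bar>t\<bar>))"
proof -
 obtain Ct where Ct: "0 \<le> Ct" "\<And>x t. measure (kap x) {r. exp t < \<bar>r\<bar>} \<le> Ct * exp (- ((\<alpha> - \<theta>) * t))"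
  using tail_exp by blast
 \<comment> \<open>Beyond \<open>t0\<close> the translation is at most half of \<open>exp t\<close>,
   so neither argument reaches the support of the cutoff unless the product \<open>snd u * r\<close>
   exceeds \<open>exp t / 2\<close> in modulus.\<close>
 define t0 where "t0 = max 0 (ln (2 * q0))"
 define K1 where "K1 = q0 / d * Ct * exp ((\<alpha> - \<theta>) * ln (2 * m0)) / hmin"
 \<comment> \<open>Covers the levels below \<open>t0\<close>: the exponent adds
   \<open>2 * \<theta>\<close> to \<open>\<alpha>\<close> to turn the growth of
   \<open>exp (\<alpha> * t)\<close> on \<open>[0, t0]\<close> into the required decaying
   form.\<close>
 define K2 where "K2 = exp ((\<alpha> + 2 * \<theta>) * t0) / hmin"
 have K1: "0 \<le> K1" using q0_pos d Ct h_bounds by (simp add: K1_def)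
 have K2: "0 \<le> K2" "1 / hmin \<le> K2"
  using h_bounds(1) alpha_pos theta by (auto simp: K2_def t0_def intro!: divide_right_mono mult_nonneg_nonneg add_nonneg_nonneg)
 have "\<bar>zz d t s x - mw.Pop (zz d) t s x\<bar> \<le> (K1 + K2) * exp (- (2 * \<theta> * \<bar>t\<bar>))" for t s x
 proof (cases "t0 \<le> t")
  case True
  then have t: "0 \<le> t" "2 * q0 \<le> exp t"
  proof -
   have "ln (2 * q0) \<le> t" using True by (simp add: t0_def)
   then have "exp (ln (2 * q0)) \<le> exp t" by simp
   then show "2 * q0 \<le> exp t" using q0_pos by simp
  qed (use True in \<open>simp add: t0_def\<close>)
  define A where "A = {r::real. exp (t - ln (2 * m0)) < \<bar>r\<bar>}"
  have eA: "exp (t - ln (2 * m0)) = exp t / (2 * m0)" using m0_pos by (simp add: exp_diff)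
  have "\<bar>zz d t s x - mw.Pop (zz d) t s x\<bar> \<le> exp (\<alpha> * t) * (q0 / d * exp (- t) * (Ct * exp (- ((\<alpha> - \<theta>) * (t - ln (2 * m0)))))) / hmin"
  proof (rule defect_le[OF d])
   fix u :: "real \<times> real" and y assume u: "\<bar>fst u\<bar> \<le> q0" "\<bar>snd u\<bar> \<le> m0"
   have "(\<integral>r. \<bar>phi d (esgn s * exp (- t) * (fst u + snd u * r)) - phi d (esgn s * exp (- t) * (snd u * r))\<bar> \<partial>kap y)
    \<le> (\<integral>r. q0 / d * exp (- t) * indicator A r \<partial>kap y)"
   proof (rule integral_mono)
    show "integrable (kap y) (\<lambda>r. \<bar>phi d (esgn s * exp (- t) * (fst u + snd u * r)) - phi d (esgn s * exp (- t) * (snd u * r))\<bar>)"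
     by (intro integrable_abs Bochner_Integration.integrable_diff integrable_kap_bounded[where C=1]) (auto simp: phi_bounds)
    show "integrable (kap y) (\<lambda>r. q0 / d * exp (- t) * indicator A r)"
     by (intro integrable_mult_right integrable_kap_bounded[where C=1]) (auto simp: A_def indicator_def)
    fix r
    show "\<bar>phi d (esgn s * exp (- t) * (fst u + snd u * r)) - phi d (esgn s * exp (- t) * (snd u * r))\<bar>
     \<le> q0 / d * exp (- t) * indicator A r"
    proof (cases "r \<in> A")
     case True
     have "\<bar>phi d (esgn s * exp (- t) * (fst u + snd u * r)) - phi d (esgn s * exp (- t) * (snd u * r))\<bar>
      \<le> \<bar>esgn s * exp (- t) * (fst u + snd u * r) - esgn s * exp (- t) * (snd u * r)\<bar> / d"
      by (rule phi_lipschitz[OF d])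
     also have "\<dots> = exp (- t) * \<bar>fst u\<bar> / d"
      by (simp add: right_diff_distrib[symmetric] abs_mult)
     also have "\<dots> \<le> exp (- t) * q0 / d" using u d by (intro divide_right_mono mult_left_mono) auto
     finally show ?thesis using True by (simp add: mult_ac)
    next
     case False
     then have "\<bar>r\<bar> \<le> exp t / (2 * m0)" by (simp add: A_def eA)
     then have "\<bar>snd u\<bar> * \<bar>r\<bar> \<le> m0 * (exp t / (2 * m0))" using u by (intro mult_mono) auto
     then have mr: "\<bar>snd u * r\<bar> \<le> exp t / 2" using m0_pos by (simp add: abs_mult)
     have z: "phi d (esgn s * exp (- t) * v) = 0" if "\<bar>v\<bar> \<le> exp t" for v
      using phi_le_indicator[OF d, of s t v] phi_bounds(1)[of d "esgn s * exp (- t) * v"] that by simp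
     have "\<bar>snd u * r\<bar> \<le> exp t" "\<bar>fst u + snd u * r\<bar> \<le> exp t"
      using mr u t(2) by (auto simp: abs_le_iff)
     then show ?thesis using False by (simp add: z)
    qed
   qed
   also have "\<dots> = q0 / d * exp (- t) * measure (kap y) A" by (simp add: A_def)
   also have "\<dots> \<le> q0 / d * exp (- t) * (Ct * exp (- ((\<alpha> - \<theta>) * (t - ln (2 * m0)))))"
    unfolding A_def using q0_pos d by (intro mult_left_mono Ct) auto
   finally show "(\<integral>r. \<bar>phi d (esgn s * exp (- t) * (fst u + snd u * r)) - phi d (esgn s * exp (- t) * (snd u * r))\<bar> \<partial>kap y)
    \<le> q0 / d * exp (- t) * (Ct * exp (- ((\<alpha> - \<theta>) * (t - ln (2 * m0)))))" .
  qed
  also have "\<dots> = K1 * exp (\<alpha> * t + - t + - ((\<alpha> - \<theta>) * t))"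
  proof -
   have "exp (- ((\<alpha> - \<theta>) * (t - ln (2 * m0)))) = exp ((\<alpha> - \<theta>) * ln (2 * m0)) * exp (- ((\<alpha> - \<theta>) * t))"
    by (simp add: exp_add[symmetric] algebra_simps)
   then show ?thesis by (simp only: K1_def exp_add) simp
  qed
  also have "\<dots> = K1 * exp ((\<theta> - 1) * t)" by (simp add: algebra_simps)
  also have "\<dots> \<le> K1 * exp (- (2 * \<theta> * \<bar>t\<bar>))"
   using K1 t(1) mult_right_mono[OF theta(4) t(1)] by (intro mult_left_mono) auto
  also have "\<dots> \<le> (K1 + K2) * exp (- (2 * \<theta> * \<bar>t\<bar>))" using K2 by (intro mult_right_mono) auto
  finally show ?thesis .
 next
  case False
  have "\<bar>zz d t s x - mw.Pop (zz d) t s x\<bar> \<le> exp (\<alpha> * t) * 1 / hmin"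
  proof (rule defect_le[OF d])
   fix u :: "real \<times> real" and y
   show "(\<integral>r. \<bar>phi d (esgn s * exp (- t) * (fst u + snd u * r)) - phi d (esgn s * exp (- t) * (snd u * r))\<bar> \<partial>kap y) \<le> 1"
   proof (rule integral_kap_01(2))
    fix r
    show "0 \<le> \<bar>phi d (esgn s * exp (- t) * (fst u + snd u * r)) - phi d (esgn s * exp (- t) * (snd u * r))\<bar> \<and>
     \<bar>phi d (esgn s * exp (- t) * (fst u + snd u * r)) - phi d (esgn s * exp (- t) * (snd u * r))\<bar> \<le> 1"
     using phi_bounds[of d "esgn s * exp (- t) * (fst u + snd u * r)"] phi_bounds[of d "esgn s * exp (- t) * (snd u * r)"]
     by auto
   qed measurable
  qed
  also have "\<dots> \<le> K2 * exp (- (2 * \<theta> * \<bar>t\<bar>))"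
  proof (cases "t \<le> 0")
   case True
   have "\<alpha> * t \<le> 2 * \<theta> * t" using theta True by (intro mult_right_mono_neg) auto
   then have "exp (\<alpha> * t) / hmin \<le> exp (- (2 * \<theta> * \<bar>t\<bar>)) / hmin"
    using True h_bounds(1) by (intro divide_right_mono) auto
   also have "\<dots> = 1 / hmin * exp (- (2 * \<theta> * \<bar>t\<bar>))" by simp
   also have "\<dots> \<le> K2 * exp (- (2 * \<theta> * \<bar>t\<bar>))" by (intro mult_right_mono K2) auto
   finally show ?thesis by simp
  next
   case tp: False
   have "(\<alpha> + 2 * \<theta>) * t \<le> (\<alpha> + 2 * \<theta>) * t0" using False alpha_pos theta by (intro mult_left_mono) auto
   then have "exp (\<alpha> * t) \<le> exp ((\<alpha> + 2 * \<theta>) * t0) * exp (- (2 * \<theta> * \<bar>t\<bar>))"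
    using tp by (simp add: exp_add[symmetric] algebra_simps)
   then show ?thesis using h_bounds(1) by (simp add: K2_def divide_right_mono)
  qed
  also have "\<dots> \<le> (K1 + K2) * exp (- (2 * \<theta> * \<bar>t\<bar>))" using K1 by (intro mult_right_mono) auto
  finally show ?thesis .
 qed
 then show ?thesis by blast
qed

text \<open>Bootstrap: the a priori tail allows growth \<open>exp (\<theta> * t)\<close>, just what
  the comparison with the Lyapunov function tolerates, and the comparison returns a uniform
  bound.\<close>

lemma zz_bounded:
 assumes d: "0 < d"
 shows "\<exists>C. \<forall>t s x. \<bar>zz d t s x\<bar> \<le> C"
proof -
 obtain C where C: "\<And>t s x. \<bar>zz d t s x - mw.Pop (zz d) t s x\<bar> \<le> C * exp (- (2 * \<theta> * \<bar>t\<bar>))"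
  using defect_bound[OF d] by blast
 obtain Ct where Ct: "0 \<le> Ct" "\<And>x t. measure (kap x) {r. exp t < \<bar>r\<bar>} \<le> Ct * exp (- ((\<alpha> - \<theta>) * t))"
  using tail_exp by blast
 have C0: "0 \<le> C" using C[of 0 True undefined] by simp
 have "\<bar>zz d t s x\<bar> \<le> C / mw.cG" for t s x
 proof (rule mw.bounded_of_small_defect[OF zz_adm[OF d], where B="Ct / hmin"])
  fix t s x
  have "zz d t s x \<le> exp (\<alpha> * t) * (Ct * exp (- ((\<alpha> - \<theta>) * t))) / hmin"
   using zz_le_tail[OF d, of t s x] Ct h_bounds(1) h_bounds(2)[of x]
   by (elim order_trans) (intro frac_le mult_left_mono mult_nonneg_nonneg, auto)
  also have "\<dots> = Ct / hmin * exp (\<alpha> * t + - ((\<alpha> - \<theta>) * t))" by (simp only: exp_add) simp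
  also have "\<alpha> * t + - ((\<alpha> - \<theta>) * t) = \<theta> * t" by (simp add: algebra_simps)
  finally show "\<bar>zz d t s x\<bar> \<le> Ct / hmin * exp (\<theta> * t)" using zz_nonneg[of d t s x] by simp
  have "C * exp (- (2 * \<theta> * \<bar>t\<bar>)) \<le> C * exp (- \<theta> * \<bar>t\<bar>)"
   using C0 theta by (intro mult_left_mono) auto
  then show "\<bar>zz d t s x - mw.Pop (zz d) t s x\<bar> \<le> C * exp (- \<theta> * \<bar>t\<bar>)"
   using C[of t s x] by linarith
 qed
 then show ?thesis by blast
qed

text \<open>Raises the exponent of the tail estimate from \<open>\<alpha> - \<theta>\<close> to
  \<open>\<alpha>\<close>. The cutoff of width 1 is full from 2 on, so lowering the level by
  \<open>ln 2\<close> makes the two one-sided cutoffs dominate the indicator.\<close>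

lemma tail_bound: "\<exists>C\<ge>0. \<forall>t x. exp (\<alpha> * t) * measure (kap x) {r. exp t < \<bar>r\<bar>} \<le> C"
proof -
 obtain C where C: "\<And>t s x. \<bar>zz 1 t s x\<bar> \<le> C" using zz_bounded[of 1] by auto
 have C0: "0 \<le> C" using C[of 0 True undefined] by simp
 have "exp (\<alpha> * t) * measure (kap x) {r. exp t < \<bar>r\<bar>} \<le> exp (\<alpha> * ln 2) * (hmax * (C + C))" for t x
 proof -
  define t' where "t' = t - ln 2"
  have et: "exp (- t') = 2 * exp (- t)" by (simp add: t'_def exp_diff exp_minus field_simps)
  have le: "indicator {r. exp t < \<bar>r\<bar>} r \<le> phi 1 (esgn True * exp (- t') * r) + phi 1 (esgn False * exp (- t') * r)" for r
  proof (cases "exp t < \<bar>r\<bar>")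
   case True
   have "exp (- t) * exp t \<le> exp (- t) * \<bar>r\<bar>" using True by (intro mult_left_mono) auto
   then have 1: "1 \<le> exp (- t) * \<bar>r\<bar>" by (simp add: exp_add[symmetric])
   have "phi 1 (esgn (0 < r) * exp (- t') * r) = 1"
   proof (rule phi_one)
    have "esgn (0 < r) * exp (- t') * r = 2 * (exp (- t) * \<bar>r\<bar>)"
     using True by (auto simp: et esgn_def abs_if)
    then show "1 + 1 \<le> esgn (0 < r) * exp (- t') * r" using 1 by linarith
   qed simp
   then show ?thesis using phi_bounds[of 1 "esgn True * exp (- t') * r"] phi_bounds[of 1 "esgn False * exp (- t') * r"] True
    by (cases "0 < r") auto
  qed (simp add: phi_bounds add_nonneg_nonneg)
  have "measure (kap x) {r. exp t < \<bar>r\<bar>} = (\<integral>r. indicator {r. exp t < \<bar>r\<bar>} r \<partial>kap x)" by simp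
  also have "\<dots> \<le> (\<integral>r. phi 1 (esgn True * exp (- t') * r) + phi 1 (esgn False * exp (- t') * r) \<partial>kap x)"
   by (intro integral_mono le Bochner_Integration.integrable_add integrable_kap_bounded[where C=1]) (auto simp: phi_bounds indicator_def)
  also have "\<dots> = (\<integral>r. phi 1 (esgn True * exp (- t') * r) \<partial>kap x) + (\<integral>r. phi 1 (esgn False * exp (- t') * r) \<partial>kap x)"
   by (intro Bochner_Integration.integral_add integrable_kap_bounded[where C=1]) (auto simp: phi_bounds)
  finally have "exp (\<alpha> * t) * measure (kap x) {r. exp t < \<bar>r\<bar>} \<le>
    exp (\<alpha> * t) * ((\<integral>r. phi 1 (esgn True * exp (- t') * r) \<partial>kap x) + (\<integral>r. phi 1 (esgn False * exp (- t') * r) \<partial>kap x))"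
   by (intro mult_left_mono) auto
  also have "\<dots> = exp (\<alpha> * ln 2) * (h x * (zz 1 t' True x + zz 1 t' False x))"
  proof -
   have "exp (\<alpha> * t) = exp (\<alpha> * ln 2) * exp (\<alpha> * t')" by (simp add: t'_def exp_add[symmetric] algebra_simps)
   then show ?thesis using h_bounds(4)[of x] by (simp add: zz_def field_simps)
  qed
  also have "\<dots> \<le> exp (\<alpha> * ln 2) * (hmax * (C + C))"
   using C[of t' True x] C[of t' False x] h_bounds(3,4)[of x] zz_nonneg[of 1 t' True x] zz_nonneg[of 1 t' False x]
   by (intro mult_left_mono mult_mono add_mono) auto
  finally show ?thesis .
 qed
 moreover have "0 \<le> exp (\<alpha> * ln 2) * (hmax * (C + C))" using C0 h_bounds(5) by simp
 ultimately show ?thesis by blast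
qed

text \<open>The estimate is local in \<open>r\<close>: the factor \<open>exp (\<alpha> * t)\<close>
  is harmless only because it meets the probability of \<open>\<bar>r\<bar> > exp t'\<close>, which
  is of the inverse order.\<close>

lemma phi_exp_lipschitz:
 assumes d: "0 < d" and t: "t' \<le> t"
 shows "\<bar>exp (\<alpha> * t) * phi d (esgn s * exp (- t) * r) - exp (\<alpha> * t') * phi d (esgn s * exp (- t') * r)\<bar>
  \<le> (\<alpha> + (1 + d) / d) * exp (\<alpha> * t) * (t - t') * indicator {r. exp t' < \<bar>r\<bar>} r"
proof (cases "exp t' < \<bar>r\<bar>")
 case False
 have z: "phi d (esgn s * exp (- u) * r) = 0" if "t' \<le> u" for u
 proof -
  have "\<not> exp u < \<bar>r\<bar>" using False that by (meson exp_le_cancel_iff le_less_trans not_le)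
  then show ?thesis using phi_le_indicator[OF d, of s u r] phi_bounds(1)[of d "esgn s * exp (- u) * r"] by simp
 qed
 then show ?thesis using z[of t] z[of t'] t False by simp
next
 case True
 define y y' where "y = esgn s * exp (- t) * r" and "y' = esgn s * exp (- t') * r"
 have yy': "y = y' * exp (- (t - t'))" by (simp add: y_def y'_def exp_add[symmetric])
 have 1: "\<bar>phi d y - phi d y'\<bar> \<le> (1 + d) / d * (t - t')"
 proof (cases "0 < y'")
  case False
  then have "y' \<le> 1" "y \<le> 1" unfolding yy' by (auto intro: order_trans[OF mult_nonpos_nonneg])
  then show ?thesis using d t by (simp add: phi_zero)
 next
  case y'p: True
  \<comment> \<open>The argument \<open>y'\<close> is unbounded, and so is its variation in
    \<open>t\<close>. The cutoff is constant above \<open>1 + d\<close>, so truncating there costs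
    nothing and yields the factor \<open>(1 + d) / d\<close>.\<close>
  define w where "w = min y' (1 + d)"
  have phiw: "phi d w = phi d y'" unfolding w_def using phi_one[OF d, of y'] phi_one[OF d, of "1 + d"] by (auto simp: min_def)
  have yp: "0 < y" "y \<le> y'" using y'p t by (auto simp: yy')
  show ?thesis
  proof (cases "1 + d \<le> y")
   case True
   then show ?thesis using yp d t by (simp add: phi_one)
  next
   case False
   have yw: "y \<le> w" using False yp by (simp add: w_def)
   have "1 - (t - t') \<le> exp (- (t - t'))" using exp_ge_add_one_self[of "- (t - t')"] by linarith
   then have "w * (1 - (t - t')) \<le> w * exp (- (t - t'))" using y'p d by (intro mult_left_mono) (auto simp: w_def)
   also have "\<dots> \<le> y" unfolding yy' by (intro mult_right_mono) (auto simp: w_def)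
   finally have "w - y \<le> w * (t - t')" by (simp add: algebra_simps)
   also have "\<dots> \<le> (1 + d) * (t - t')" using t by (intro mult_right_mono) (auto simp: w_def)
   finally have "\<bar>y - w\<bar> \<le> (1 + d) * (t - t')" using yw by simp
   then have "\<bar>y - w\<bar> / d \<le> (1 + d) * (t - t') / d" using d by (intro divide_right_mono) auto
   then show ?thesis using phi_lipschitz[OF d, of y w] by (simp add: phiw)
  qed
 qed
 have 2: "\<bar>exp (\<alpha> * t) - exp (\<alpha> * t')\<bar> \<le> \<alpha> * exp (\<alpha> * t) * (t - t')"
 proof -
  have "exp (\<alpha> * t) * (1 - \<alpha> * (t - t')) \<le> exp (\<alpha> * t) * exp (- (\<alpha> * (t - t')))"
   using exp_ge_add_one_self[of "- (\<alpha> * (t - t'))"] by (intro mult_left_mono) auto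
  also have "\<dots> = exp (\<alpha> * t')" by (simp add: exp_add[symmetric] algebra_simps)
  finally show ?thesis using alpha_pos t by (simp add: algebra_simps)
 qed
 have "\<bar>exp (\<alpha> * t) * phi d y - exp (\<alpha> * t') * phi d y'\<bar> = \<bar>exp (\<alpha> * t) * (phi d y - phi d y') + (exp (\<alpha> * t) - exp (\<alpha> * t')) * phi d y'\<bar>"
  by (simp add: algebra_simps)
 also have "\<dots> \<le> exp (\<alpha> * t) * \<bar>phi d y - phi d y'\<bar> + \<bar>exp (\<alpha> * t) - exp (\<alpha> * t')\<bar> * \<bar>phi d y'\<bar>"
  by (rule order_trans[OF abs_triangle_ineq]) (simp add: abs_mult)
 also have "\<dots> \<le> exp (\<alpha> * t) * ((1 + d) / d * (t - t')) + (\<alpha> * exp (\<alpha> * t) * (t - t')) * 1"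
  using 1 2 phi_bounds[of d y'] alpha_pos t by (intro add_mono mult_mono mult_left_mono) auto
 also have "\<dots> = (\<alpha> + (1 + d) / d) * exp (\<alpha> * t) * (t - t') * indicator {r. exp t' < \<bar>r\<bar>} r"
  using True by (simp add: algebra_simps)
 finally show ?thesis unfolding y_def y'_def .
qed

text \<open>For level differences above 1 boundedness suffices. Otherwise the local estimate is
  integrated against the sharp tail bound at the lower level, and \<open>exp (\<alpha> * t)\<close>
  exceeds \<open>exp (\<alpha> * t')\<close> by at most \<open>exp \<alpha>\<close>.\<close>

lemma zz_lipschitz:
 assumes d: "0 < d"
 shows "\<exists>H\<ge>0. \<forall>t t' s x. \<bar>zz d t s x - zz d t' s x\<bar> \<le> H * \<bar>t - t'\<bar>"
proof -
 obtain C where C: "\<And>t s x. \<bar>zz d t s x\<bar> \<le> C" using zz_bounded[OF d] by auto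
 have C0: "0 \<le> C" using C[of 0 True undefined] by simp
 obtain Ct where Ct: "0 \<le> Ct" "\<And>t x. exp (\<alpha> * t) * measure (kap x) {r. exp t < \<bar>r\<bar>} \<le> Ct" using tail_bound by blast
 define A where "A = \<alpha> + (1 + d) / d"
 have A: "0 \<le> A" using alpha_pos d by (simp add: A_def)
 define H where "H = 2 * C + A * exp \<alpha> * Ct / hmin"
 have "0 \<le> A * exp \<alpha> * Ct / hmin" using A Ct(1) h_bounds(1) by simp
 then have H: "2 * C \<le> H" "A * exp \<alpha> * Ct / hmin \<le> H" "0 \<le> H"
  using C0 unfolding H_def by linarith+
 have main: "\<bar>zz d t s x - zz d t' s x\<bar> \<le> H * (t - t')" if t: "t' \<le> t" for t t' s x
 proof (cases "t - t' \<le> 1")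
  case False
  have "\<bar>zz d t s x - zz d t' s x\<bar> \<le> 2 * C" using C[of t s x] C[of t' s x] by linarith
  also have "\<dots> \<le> H * (t - t')" using H False mult_left_mono[of 1 "t - t'" H] by linarith
  finally show ?thesis .
 next
  case True
  have int: "integrable (kap x) (\<lambda>r. exp (\<alpha> * t) * phi d (esgn s * exp (- t) * r))" for t
   by (intro integrable_mult_right integrable_kap_bounded[where C=1]) (auto simp: phi_bounds)
  have eq: "zz d t s x - zz d t' s x = (\<integral>r. exp (\<alpha> * t) * phi d (esgn s * exp (- t) * r) - exp (\<alpha> * t') * phi d (esgn s * exp (- t') * r) \<partial>kap x) / h x"
   by (subst Bochner_Integration.integral_diff[OF int int]) (simp add: zz_def diff_divide_distrib)
  have "\<bar>zz d t s x - zz d t' s x\<bar> = \<bar>\<integral>r. exp (\<alpha> * t) * phi d (esgn s * exp (- t) * r) - exp (\<alpha> * t') * phi d (esgn s * exp (- t') * r) \<partial>kap x\<bar> / h x"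
   unfolding eq using h_bounds(4)[of x] by (simp only: abs_divide abs_of_pos)
  also have "\<dots> \<le> (\<integral>r. A * exp (\<alpha> * t) * (t - t') * indicator {r. exp t' < \<bar>r\<bar>} r \<partial>kap x) / h x"
  proof (rule divide_right_mono[OF order_trans[OF integral_abs_bound integral_mono]])
   show "integrable (kap x) (\<lambda>r. \<bar>exp (\<alpha> * t) * phi d (esgn s * exp (- t) * r) - exp (\<alpha> * t') * phi d (esgn s * exp (- t') * r)\<bar>)"
    by (intro integrable_abs Bochner_Integration.integrable_diff int)
   show "integrable (kap x) (\<lambda>r. A * exp (\<alpha> * t) * (t - t') * indicator {r. exp t' < \<bar>r\<bar>} r)"
    by (intro integrable_mult_right integrable_kap_bounded[where C=1]) (auto simp: indicator_def)
   show "\<bar>exp (\<alpha> * t) * phi d (esgn s * exp (- t) * r) - exp (\<alpha> * t') * phi d (esgn s * exp (- t') * r)\<bar>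
    \<le> A * exp (\<alpha> * t) * (t - t') * indicator {r. exp t' < \<bar>r\<bar>} r" for r
    unfolding A_def by (rule phi_exp_lipschitz[OF d t])
   show "0 \<le> h x" using h_bounds(4)[of x] by (rule less_imp_le)
  qed
  also have "\<dots> = A * (t - t') * (exp (\<alpha> * t) * measure (kap x) {r. exp t' < \<bar>r\<bar>}) / h x"
   by (subst integral_mult_right_zero) (simp add: mult_ac)
  also have "\<dots> \<le> A * (t - t') * (exp \<alpha> * Ct) / hmin"
  proof (intro frac_le mult_left_mono)
   have "exp (\<alpha> * t) \<le> exp \<alpha> * exp (\<alpha> * t')"
    using True alpha_pos mult_left_mono[of "t - t'" 1 \<alpha>] by (simp add: exp_add[symmetric] algebra_simps)
   then have "exp (\<alpha> * t) * measure (kap x) {r. exp t' < \<bar>r\<bar>} \<le> exp \<alpha> * exp (\<alpha> * t') * measure (kap x) {r. exp t' < \<bar>r\<bar>}"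
    by (intro mult_right_mono) auto
   also have "\<dots> \<le> exp \<alpha> * Ct" using Ct(2)[of t' x] by (simp add: mult.assoc)
   finally show "exp (\<alpha> * t) * measure (kap x) {r. exp t' < \<bar>r\<bar>} \<le> exp \<alpha> * Ct" .
   show "0 \<le> A * (t - t')" "0 \<le> A * (t - t') * (exp \<alpha> * Ct)" using A t Ct(1) by simp_all
  qed (rule h_bounds)+
  also have "\<dots> = A * exp \<alpha> * Ct / hmin * (t - t')" by (simp add: mult_ac)
  also have "\<dots> \<le> H * (t - t')" using H t by (intro mult_right_mono) auto
  finally show ?thesis .
 qed
 have "\<bar>zz d t s x - zz d t' s x\<bar> \<le> H * \<bar>t - t'\<bar>" for t t' s x
  using main[of t' t s x] main[of t t' s x] by (cases "t' \<le> t") (auto simp: abs_minus_commute)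
 then show ?thesis using H(3) by blast
qed

lemma zz_hoelder:
 assumes d: "0 < d"
 shows "\<exists>H\<ge>0. \<forall>t s x y n. (\<forall>k<n. x k = y k) \<longrightarrow> \<bar>zz d t s x - zz d t s y\<bar> \<le> H * \<rho> ^ n"
proof -
 obtain C where C: "\<And>t s x. \<bar>zz d t s x\<bar> \<le> C" using zz_bounded[OF d] by auto
 have C0: "0 \<le> C" using C[of 0 True undefined] by simp
 \<comment> \<open>The first summand comes from the comparison of \<open>kap x\<close> with
   \<open>kap y\<close>, the second from \<open>h\<close> lying in the cone.\<close>
 define B2 where "B2 = B + B / (1 - \<rho>)"
 have B2: "0 \<le> B2" using B_nonneg rho_less by (simp add: B2_def)
 have main: "zz d t s x - zz d t s y \<le> B2 * exp B2 * C * \<rho> ^ n" if xy: "\<forall>k<n. x k = y k" for t s x y n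
 proof -
  have r1: "0 \<le> \<rho> ^ n" "\<rho> ^ n \<le> 1" using rho_pos rho_less by (auto intro: power_le_one)
  have 1: "(\<integral>r. phi d (esgn s * exp (- t) * r) \<partial>kap x) \<le> exp (B * \<rho> ^ n) * (\<integral>r. phi d (esgn s * exp (- t) * r) \<partial>kap y)"
   by (rule kap_cmp[OF xy]) (auto simp: phi_bounds)
  have 2: "h y \<le> exp (B / (1 - \<rho>) * \<rho> ^ n) * h x" using h_props(3) xy unfolding cone_def by simp
  have 3: "0 \<le> (\<integral>r. phi d (esgn s * exp (- t) * r) \<partial>kap y)" by (rule integral_kap_01) (auto simp: phi_bounds)
  have "zz d t s x \<le> exp (\<alpha> * t) * (exp (B * \<rho> ^ n) * (\<integral>r. phi d (esgn s * exp (- t) * r) \<partial>kap y)) / (h y / exp (B / (1 - \<rho>) * \<rho> ^ n))"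
   unfolding zz_def using 1 2 3 h_bounds(4)[of y]
   by (intro frac_le mult_left_mono) (auto simp: divide_le_eq mult.commute)
  also have "\<dots> = exp (B2 * \<rho> ^ n) * zz d t s y"
   by (simp add: zz_def B2_def distrib_right exp_add del: times_divide_eq_left)
  finally have "zz d t s x - zz d t s y \<le> (exp (B2 * \<rho> ^ n) - 1) * zz d t s y" by (simp add: algebra_simps)
  also have "\<dots> \<le> (B2 * \<rho> ^ n * exp B2) * C"
  proof (intro mult_mono)
   have u: "0 \<le> B2 * \<rho> ^ n" "B2 * \<rho> ^ n \<le> B2" using B2 r1 by (auto intro: mult_left_le)
   have "exp (B2 * \<rho> ^ n) * (1 - B2 * \<rho> ^ n) \<le> exp (B2 * \<rho> ^ n) * exp (- (B2 * \<rho> ^ n))"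
    using exp_ge_add_one_self[of "- (B2 * \<rho> ^ n)"] by (intro mult_left_mono) auto
   then have "exp (B2 * \<rho> ^ n) - 1 \<le> B2 * \<rho> ^ n * exp (B2 * \<rho> ^ n)" by (simp add: exp_add[symmetric] algebra_simps)
   also have "\<dots> \<le> B2 * \<rho> ^ n * exp B2" using u by (intro mult_left_mono) auto
   finally show "exp (B2 * \<rho> ^ n) - 1 \<le> B2 * \<rho> ^ n * exp B2" .
   show "zz d t s y \<le> C" using C[of t s y] by simp
  qed (use B2 r1 zz_nonneg in auto)
  finally show ?thesis by (simp add: mult_ac)
 qed
 have "\<bar>zz d t s x - zz d t s y\<bar> \<le> B2 * exp B2 * C * \<rho> ^ n" if xy: "\<forall>k<n. x k = y k" for t s x y n
  using main[OF xy, of t s] main[of n y x t s] xy by (simp add: abs_le_iff)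
 moreover have "0 \<le> B2 * exp B2 * C" using B2 C0 by simp
 ultimately show ?thesis by blast
qed

lemma zz_nice:
 assumes d: "0 < d"
 shows "mw.nice \<rho> (zz d)"
proof -
 obtain C where C: "\<And>t s x. \<bar>zz d t s x - mw.Pop (zz d) t s x\<bar> \<le> C * exp (- (2 * \<theta> * \<bar>t\<bar>))"
  using defect_bound[OF d] by blast
 have res: "\<exists>T. \<forall>t\<ge>T. \<forall>s x. \<bar>zz d t s x - mw.Pop (zz d) t s x\<bar> \<le> e" if e: "e > 0" for e
 proof -
  have "((\<lambda>t. C * exp (- (2 * \<theta> * t))) \<longlongrightarrow> C * 0) at_top"
   using theta by (intro tendsto_intros filterlim_compose[OF exp_at_bot] filterlim_compose[OF filterlim_uminus_at_bot_at_top]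
    filterlim_tendsto_pos_mult_at_top[OF tendsto_const _ filterlim_ident]) auto
  then have "eventually (\<lambda>t. C * exp (- (2 * \<theta> * t)) < e) at_top" using e by (intro order_tendstoD) auto
  then obtain T where T: "\<And>t. t \<ge> T \<Longrightarrow> C * exp (- (2 * \<theta> * t)) < e" by (auto simp: eventually_at_top_linorder)
  have "\<bar>zz d t s x - mw.Pop (zz d) t s x\<bar> \<le> e" if "t \<ge> max T 0" for t s x
   using T[of t] C[of t s x] that by auto
  then show ?thesis by blast
 qed
 obtain H1 where H1: "0 \<le> H1" "\<And>t t' s x. \<bar>zz d t s x - zz d t' s x\<bar> \<le> H1 * \<bar>t - t'\<bar>" using zz_lipschitz[OF d] by blast
 obtain H2 where H2: "0 \<le> H2" "\<And>t s x y n. (\<forall>k<n. x k = y k) \<Longrightarrow> \<bar>zz d t s x - zz d t s y\<bar> \<le> H2 * \<rho> ^ n" using zz_hoelder[OF d] by blast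
 have "\<bar>zz d t s x - zz d t' s x\<bar> \<le> (H1 + H2) * \<bar>t - t'\<bar>" for t t' s x
  using H1(2)[of t s x t'] H2(1) by (simp add: distrib_right add_increasing2)
 moreover have "\<bar>zz d t s x - zz d t s y\<bar> \<le> (H1 + H2) * \<rho> ^ n" if "\<forall>k<n. x k = y k" for t s x y n
  using H2(2)[OF that, of t s] H1(1) rho_pos by (simp add: distrib_right add_increasing)
 moreover have "0 \<le> H1 + H2" using H1 H2 by simp
 ultimately show ?thesis
  unfolding mw.nice_def using rho_pos rho_less zz_adm[OF d] zz_bounded[OF d] res by blast
qed

definition neg :: bool where "neg \<longleftrightarrow> (\<exists>j. \<not> (AE u in lam j. 0 < snd u))"

text \<open>With negative multipliers the walk mixes the two signs, and one constant serves both.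
  Without them the sign never changes, and each side is a solution on its own.\<close>

lemma zz_limit:
 assumes d: "0 < d"
 shows "\<exists>c. (neg \<longrightarrow> c True = c False) \<and> (\<forall>s. \<forall>e>0. \<exists>T. \<forall>t\<ge>T. \<forall>x. \<bar>zz d t s x - c s\<bar> \<le> e)"
proof -
 obtain C where C: "\<And>t s x. \<bar>zz d t s x - mw.Pop (zz d) t s x\<bar> \<le> C * exp (- (2 * \<theta> * \<bar>t\<bar>))"
  using defect_bound[OF d] by blast
 have C': "\<bar>zz d t s x - mw.Pop (zz d) t s x\<bar> \<le> C * exp (- (2 * \<theta> * t))" if "t \<ge> 0" for t s x
  using C[of t s x] that by simp
 have nonlat: "\<exists>j. \<not> (AE m in zeta j. \<exists>k::int. ln \<bar>m\<bar> = \<delta> * of_int k)" if \<delta>: "\<delta> > 0" for \<delta>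
 proof -
  have [measurable]: "Measurable.pred borel (\<lambda>m::real. \<exists>k::int. ln \<bar>m\<bar> = \<delta> * of_int k)" by measurable
  show ?thesis using nonlattice[OF \<delta>] by (simp add: AE_zeta)
 qed
 show ?thesis
 proof (cases neg)
  case True
  then obtain j where j: "\<not> (AE u in lam j. 0 < snd u)" by (auto simp: neg_def)
  have "measure (zeta j) {m. m < 0} \<noteq> 0"
  proof
   interpret zp: prob_space "zeta j" by (rule prob_zeta)
   assume "measure (zeta j) {m. m < 0} = 0"
   then have "AE m in zeta j. m \<notin> {m. m < 0}"
    by (intro AE_not_in) (auto simp: null_sets_def zp.emeasure_eq_measure)
   then have "AE m in zeta j. \<not> m < 0" by simp
   then have "AE u in lam j. \<not> snd u < 0" by (subst (asm) AE_zeta) auto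
   with lam_bound'[of j] have "AE u in lam j. 0 < snd u" by eventually_elim auto
   then show False using j by simp
  qed
  then have "0 < measure (zeta j) {m. m < 0}" using measure_nonneg[of "zeta j" "{m. m < 0}"] by linarith
  then have "\<exists>c. \<forall>e>0. \<exists>T. \<forall>t\<ge>T. \<forall>s x. \<bar>zz d t s x - c\<bar> \<le> e"
   using mw.convergence[OF zz_nice[OF d] nonlat _ C'] by blast
  then obtain c where c: "\<forall>e>0. \<exists>T. \<forall>t\<ge>T. \<forall>s x. \<bar>zz d t s x - c\<bar> \<le> e" by blast
  then have "\<forall>e>0. \<exists>T. \<forall>t\<ge>T. \<forall>x. \<bar>zz d t s x - c\<bar> \<le> e" for s by blast
  then show ?thesis by (intro exI[of _ "\<lambda>_. c"]) simp
 next
  case False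
  then have pos: "AE m in zeta j. 0 < m" for j by (subst AE_zeta) (auto simp: neg_def)
  have "\<exists>c. \<forall>e>0. \<exists>T. \<forall>t\<ge>T. \<forall>x. \<bar>zz d t s x - c\<bar> \<le> e" for s
  proof -
   \<comment> \<open>The fixed side \<open>s\<close> is presented as a function that ignores its
     sign argument; as multipliers are positive, its average equals that of \<open>zz d\<close> on
     side \<open>s\<close>, and the limit theorem applies in its sign-free case.\<close>
   define w where "w t s' x = zz d t s x" for t and s' :: bool and x
   have admw: "mw.adm w" using zz_adm[OF d] unfolding w_def mw.adm_def by blast
   have Pw: "mw.Pop w t s' x = mw.Pop (zz d) t s x" for t s' x
    unfolding mw.Pop_def
   proof (intro sum.cong refl arg_cong2[where f="(*)"] integral_cong_AE)
    fix j
    show "AE m in zeta j. w (t - ln \<bar>m\<bar>) (s' = (0 < m)) (cons j x) = zz d (t - ln \<bar>m\<bar>) (s = (0 < m)) (cons j x)"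
     using pos[of j] by eventually_elim (simp add: w_def)
   qed (auto intro: mw.adm_measurable zz_adm[OF d] admw)
   have "mw.nice \<rho> w"
   proof -
    obtain Bz where Bz: "\<And>t s x. \<bar>zz d t s x\<bar> \<le> Bz" using zz_bounded[OF d] by blast
    obtain H where H: "0 \<le> H" "\<And>t t' s x. \<bar>zz d t s x - zz d t' s x\<bar> \<le> H * \<bar>t - t'\<bar>"
     "\<And>t s x y n. (\<forall>k<n. x k = y k) \<Longrightarrow> \<bar>zz d t s x - zz d t s y\<bar> \<le> H * \<rho> ^ n"
     using zz_nice[OF d] unfolding mw.nice_def by blast
    have "\<exists>T. \<forall>t\<ge>T. \<forall>s' x. \<bar>w t s' x - mw.Pop w t s' x\<bar> \<le> e" if "e > 0" for e
     using zz_nice[OF d] that unfolding mw.nice_def Pw w_def by meson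
    moreover have "\<exists>B. \<forall>t s' x. \<bar>w t s' x\<bar> \<le> B" unfolding w_def using Bz by blast
    moreover have "\<exists>H\<ge>0. (\<forall>t t' s' x. \<bar>w t s' x - w t' s' x\<bar> \<le> H * \<bar>t - t'\<bar>) \<and>
      (\<forall>t s' x y n. (\<forall>k<n. x k = y k) \<longrightarrow> \<bar>w t s' x - w t s' y\<bar> \<le> H * \<rho> ^ n)"
     unfolding w_def using H by (intro exI[of _ H]) simp
    ultimately show ?thesis unfolding mw.nice_def using rho_pos rho_less admw by blast
   qed
   then have "\<exists>c. \<forall>e>0. \<exists>T. \<forall>t\<ge>T. \<forall>s' x. \<bar>w t s' x - c\<bar> \<le> e"
    by (rule mw.convergence[OF _ nonlat _ _, where C=C]) (use C' in \<open>auto simp: Pw w_def\<close>)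
   then show ?thesis unfolding w_def by blast
  qed
  then have "\<exists>c. \<forall>s. \<forall>e>0. \<exists>T. \<forall>t\<ge>T. \<forall>x. \<bar>zz d t s x - c s\<bar> \<le> e" by metis
  then show ?thesis using False by blast
 qed
qed

section \<open>From smoothed to actual tails\<close>

definition tl :: "bool \<Rightarrow> real \<Rightarrow> (nat \<Rightarrow> 'd) \<Rightarrow> real" where
 "tl s t x = exp (\<alpha> * t) * measure (kap x) {r. exp t < esgn s * r} / h x"

lemma esgn_measurable [measurable]: "{r. a < esgn s * r} \<in> sets borel"
 by (cases s) auto

lemma zz_le_tl:
 assumes d: "0 < d" shows "zz d t s x \<le> tl s t x"
proof -
 have le: "phi d (esgn s * exp (- t) * r) \<le> indicator {r. exp t < esgn s * r} r" for r
 proof (cases "exp t < esgn s * r")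
  case False
  have "esgn s * exp (- t) * r = exp (- t) * (esgn s * r)" by simp
  also have "\<dots> \<le> exp (- t) * exp t" using False by (intro mult_left_mono) auto
  finally have "esgn s * exp (- t) * r \<le> 1" by (simp add: exp_add[symmetric])
  then show ?thesis using phi_zero[OF d] by simp
 qed (simp add: phi_bounds)
 have "(\<integral>r. phi d (esgn s * exp (- t) * r) \<partial>kap x) \<le> (\<integral>r. indicator {r. exp t < esgn s * r} r \<partial>kap x)"
  by (intro integral_mono le integrable_kap_bounded[where C=1]) (auto simp: phi_bounds indicator_def)
 then show ?thesis unfolding zz_def tl_def using h_bounds(4)[of x]
  by (intro divide_right_mono mult_left_mono) auto
qed

lemma tl_le_zz:
 assumes d: "0 < d" shows "tl s t x \<le> (1 + d) powr \<alpha> * zz d (t - ln (1 + d)) s x"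
proof -
 define t' where "t' = t - ln (1 + d)"
 have et: "exp (- t') = (1 + d) * exp (- t)" using d by (simp add: t'_def exp_diff exp_minus field_simps)
 have ea: "exp (\<alpha> * t) = (1 + d) powr \<alpha> * exp (\<alpha> * t')"
  using d by (simp add: t'_def powr_def exp_add[symmetric] algebra_simps)
 have le: "indicator {r. exp t < esgn s * r} r \<le> phi d (esgn s * exp (- t') * r)" for r
 proof (cases "exp t < esgn s * r")
  case True
  have "1 = exp (- t) * exp t" by (simp add: exp_add[symmetric])
  also have "\<dots> \<le> exp (- t) * (esgn s * r)" using True by (intro mult_left_mono) auto
  finally have "(1 + d) * 1 \<le> (1 + d) * (exp (- t) * (esgn s * r))" using d by (intro mult_left_mono) auto
  then have "1 + d \<le> esgn s * exp (- t') * r" by (simp add: et mult_ac)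
  then show ?thesis using phi_one[OF d] by simp
 qed (simp add: phi_bounds)
 have "(\<integral>r. indicator {r. exp t < esgn s * r} r \<partial>kap x) \<le> (\<integral>r. phi d (esgn s * exp (- t') * r) \<partial>kap x)"
  by (intro integral_mono le integrable_kap_bounded[where C=1]) (auto simp: phi_bounds indicator_def)
 then have "exp (\<alpha> * t) * measure (kap x) {r. exp t < esgn s * r} / h x \<le>
   exp (\<alpha> * t) * (\<integral>r. phi d (esgn s * exp (- t') * r) \<partial>kap x) / h x"
  using h_bounds(4)[of x] by (intro divide_right_mono mult_left_mono) auto
 then show ?thesis unfolding tl_def ea zz_def t'_def by simp
qed

lemma uniform_limit_at:
 fixes f :: "real \<Rightarrow> real"
 assumes "\<And>e. e > 0 \<Longrightarrow> \<exists>T. \<forall>t\<ge>T. \<bar>f t - c\<bar> \<le> e"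
 shows "(f \<longlongrightarrow> c) at_top"
proof (rule tendstoI)
 fix e :: real assume "0 < e"
 then obtain T where "\<And>t. t \<ge> T \<Longrightarrow> \<bar>f t - c\<bar> \<le> e / 2" using assms[of "e / 2"] by auto
 then show "\<forall>\<^sub>F t in at_top. dist (f t) c < e"
  unfolding eventually_at_top_linorder dist_real_def using \<open>0 < e\<close> by (intro exI[of _ T]) force
qed

text \<open>The tail lies between the smoothed tail at the same level and
  \<open>(1 + d) powr \<alpha>\<close> times the one at level \<open>t - ln (1 + d)\<close>. The
  smoothed limits \<open>cd d\<close> are hence within that factor of one another; their supremum is
  the limit, as the factor tends to 1 when \<open>d\<close> does to 0.\<close>

lemma tail_limit:
 "\<exists>c. (\<forall>s. 0 \<le> c s) \<and> (neg \<longrightarrow> c True = c False) \<and>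
  (\<forall>s. \<forall>e>0. \<exists>T. \<forall>t\<ge>T. \<forall>x. \<bar>tl s t x - c s\<bar> \<le> e)"
proof -
 have "\<forall>d. \<exists>c. 0 < d \<longrightarrow> ((neg \<longrightarrow> c True = c False) \<and> (\<forall>s. \<forall>e>0. \<exists>T. \<forall>t\<ge>T. \<forall>x. \<bar>zz d t s x - c s\<bar> \<le> e))"
  using zz_limit by blast
 then obtain cd where cd: "\<And>d. 0 < d \<Longrightarrow> neg \<Longrightarrow> cd d True = cd d False"
  "\<And>d s e. 0 < d \<Longrightarrow> e > 0 \<Longrightarrow> \<exists>T. \<forall>t\<ge>T. \<forall>x. \<bar>zz d t s x - cd d s\<bar> \<le> e" by metis
 have lim: "((\<lambda>t. zz d t s x) \<longlongrightarrow> cd d s) at_top" if "0 < d" for d s x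
  by (rule uniform_limit_at) (use cd(2)[OF that] in blast)
 have cd0: "0 \<le> cd d s" if "0 < d" for d s
  by (rule tendsto_lowerbound[OF lim[OF that, of s undefined]]) (auto simp: zz_nonneg)
 have cmp: "cd d s \<le> (1 + d') powr \<alpha> * cd d' s" if "0 < d" "0 < d'" for d d' s
 proof (rule tendsto_le[OF _ _ lim[OF that(1), of s undefined]])
  have "filterlim (\<lambda>t. t - ln (1 + d')) at_top at_top"
   using filterlim_tendsto_add_at_top[OF tendsto_const[of "- ln (1 + d')"] filterlim_ident] by simp
  from filterlim_compose[OF lim[OF that(2)] this]
  show "((\<lambda>t. (1 + d') powr \<alpha> * zz d' (t - ln (1 + d')) s undefined) \<longlongrightarrow> (1 + d') powr \<alpha> * cd d' s) at_top"
   by (rule tendsto_mult_left)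
  show "\<forall>\<^sub>F t in at_top. zz d t s undefined \<le> (1 + d') powr \<alpha> * zz d' (t - ln (1 + d')) s undefined"
   using order_trans[OF zz_le_tl[OF that(1)] tl_le_zz[OF that(2)]] by simp
 qed simp
 \<comment> \<open>Any two widths are comparable, which bounds the supremum and gives
   \<open>cd d s \<le> c s \<le> (1 + d) powr \<alpha> * cd d s\<close>.\<close>
 define c where "c s = (SUP d\<in>{0<..}. cd d s)" for s
 have bdd: "bdd_above ((\<lambda>d. cd d s) ` {0<..})" for s
  using cmp[of _ 1 s] by (intro bdd_aboveI2[where M="(1 + 1) powr \<alpha> * cd 1 s"]) auto
 have c1: "cd d s \<le> c s" if "0 < d" for d s unfolding c_def by (rule cSUP_upper[OF _ bdd]) (use that in auto)
 have c2: "c s \<le> (1 + d) powr \<alpha> * cd d s" if "0 < d" for d s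
  unfolding c_def using cmp[OF _ that, of _ s] by (intro cSUP_least) auto
 have c0: "0 \<le> c s" for s using cd0[of 1 s] c1[of 1 s] by simp
 have main: "\<exists>T. \<forall>t\<ge>T. \<forall>x. \<bar>tl s t x - c s\<bar> \<le> e" if e: "0 < e" for s e
 proof -
  have A: "((\<lambda>d. (1 + d) powr \<alpha>) \<longlongrightarrow> (1 + 0) powr \<alpha>) (at_right 0)"
   by (intro tendsto_intros) auto
  then have A: "((\<lambda>d. (1 + d) powr \<alpha>) \<longlongrightarrow> 1) (at_right (0::real))" by simp
  have "((\<lambda>d. c s / (1 + d) powr \<alpha>) \<longlongrightarrow> c s / 1) (at_right (0::real))"
   by (intro tendsto_divide tendsto_const A) simp
  then have e1: "\<forall>\<^sub>F d in at_right (0::real). c s - e / 2 < c s / (1 + d) powr \<alpha>"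
   using e by (intro order_tendstoD) auto
  have "((\<lambda>d. (1 + d) powr \<alpha> * (c s + e / 2)) \<longlongrightarrow> 1 * (c s + e / 2)) (at_right (0::real))"
   by (intro tendsto_mult A tendsto_const)
  then have e2: "\<forall>\<^sub>F d in at_right (0::real). (1 + d) powr \<alpha> * (c s + e / 2) < c s + e"
   using e by (intro order_tendstoD) auto
  obtain d :: real where d: "0 < d" "c s - e / 2 < c s / (1 + d) powr \<alpha>" "(1 + d) powr \<alpha> * (c s + e / 2) < c s + e"
   using eventually_happens'[OF _ eventually_conj[OF eventually_at_right_less[of 0] eventually_conj[OF e1 e2]]] by auto
  have Apos: "0 < (1 + d) powr \<alpha>" using d by simp
  have "e / 2 > 0" using e by simp
  from cd(2)[OF d(1) this] obtain T where T: "\<And>t x. t \<ge> T \<Longrightarrow> \<bar>zz d t s x - cd d s\<bar> \<le> e / 2" by blast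
  have "\<bar>tl s t x - c s\<bar> \<le> e" if t: "t \<ge> max T (T + ln (1 + d))" for t x
  proof -
   have "c s / (1 + d) powr \<alpha> \<le> cd d s" using c2[OF d(1), of s] Apos by (simp add: divide_le_eq mult.commute)
   moreover have "cd d s - e / 2 \<le> tl s t x"
   proof -
    have "T \<le> t" using t by simp
    from T[OF this, of x] zz_le_tl[OF d(1), of t s x] show ?thesis by linarith
   qed
   moreover have "tl s t x \<le> (1 + d) powr \<alpha> * (c s + e / 2)"
   proof -
    have "tl s t x \<le> (1 + d) powr \<alpha> * zz d (t - ln (1 + d)) s x" by (rule tl_le_zz[OF d(1)])
    also have "\<dots> \<le> (1 + d) powr \<alpha> * (c s + e / 2)"
    proof (rule mult_left_mono)
     have "\<bar>zz d (t - ln (1 + d)) s x - cd d s\<bar> \<le> e / 2" by (rule T) (use t in auto)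
     then show "zz d (t - ln (1 + d)) s x \<le> c s + e / 2" using c1[OF d(1), of s] by linarith
    qed simp
    finally show ?thesis .
   qed
   ultimately show ?thesis using d(2,3) by linarith
  qed
  then show ?thesis by blast
 qed
 have "c True = c False" if neg unfolding c_def using cd(1)[OF _ that] by (intro SUP_cong) auto
 then show ?thesis using c0 main by blast
qed

section \<open>Lower bound for the tail of non-degenerate kernels\<close>

definition psi :: "real \<Rightarrow> real" where "psi y = min 1 (max 0 (\<bar>y\<bar> - 1))"

lemma psi_facts: "0 \<le> psi y" "psi y \<le> 1" "2 \<le> \<bar>y\<bar> \<Longrightarrow> psi y = 1" "\<bar>y\<bar> \<le> 1 \<Longrightarrow> psi y = 0"
 "continuous_on A psi" "psi \<bar>y\<bar> = psi y"
 unfolding psi_def by (auto intro!: continuous_intros)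

lemma psi_measurable [measurable]: "psi \<in> borel_measurable borel"
 by (intro borel_measurable_continuous_onI psi_facts)

text \<open>Spread around an arbitrary centre is used instead of size: an affine map carries the
  event of being far from \<open>a\<close> to the same kind of event with another centre, so the
  recursion is exact and free of a defect. A subsolution then transports the non-degeneracy at
  levels in \<open>[- LL, 0]\<close> to all higher levels.\<close>

lemma concentration_lower:
 assumes "0 < \<delta>" "0 < k" and nondeg: "\<And>x a. k \<le> measure (kap x) {r. \<delta> < \<bar>r - a\<bar>}"
 shows "\<exists>c>0. \<forall>t\<ge>0. \<forall>x. c \<le> exp (\<alpha> * t) * measure (kap x) {r. \<delta> / 2 * exp t < \<bar>r\<bar>}"
proof -
 define bb where "bb = snd (snd (snd walk_params))"
 define \<kappa> where "\<kappa> = fst (snd walk_params)"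
 have bb1: "1 \<le> bb x" for x unfolding bb_def by (rule mw.b_ge)
 have k1: "1 < \<kappa>" unfolding \<kappa>_def by (rule mw.kappa_gt)
 have LL: "0 < LL" by (rule mw.L_pos)
 define d where "d = \<delta> / 2"
 have d: "0 < d" using assms by (simp add: d_def)
 define N where "N t a x = (\<integral>r. psi ((r - a) / (d * exp t)) \<partial>kap x)" for t a x
 \<comment> \<open>Normalised for the initial window, where \<open>exp (\<alpha> * t)\<close> is at
   least \<open>exp (- (\<alpha> * LL))\<close> and \<open>h\<close> at most
   \<open>hmax\<close>.\<close>
 define c where "c = exp (- (\<alpha> * LL)) * k / hmax"
 have c: "0 < c" using assms h_bounds(5) by (simp add: c_def)
 have int: "integrable (kap x) (\<lambda>r. psi ((r - a) / v))" for x a v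
  by (rule integrable_kap_bounded[where C=1]) (auto simp: psi_facts)
 have base: "c * h x \<le> exp (\<alpha> * t) * N t a x" if "- LL \<le> t" "t \<le> 0" for t a x
 proof -
  have "k \<le> (\<integral>r. indicator {r. \<delta> < \<bar>r - a\<bar>} r \<partial>kap x)" using nondeg[of x a] by simp
  also have "\<dots> \<le> N t a x" unfolding N_def
  proof (intro integral_mono int)
   show "indicator {r. \<delta> < \<bar>r - a\<bar>} r \<le> psi ((r - a) / (d * exp t))" for r
   proof (cases "\<delta> < \<bar>r - a\<bar>")
    case True
    have "d * exp t \<le> d * 1" using that d by (intro mult_left_mono) auto
    then have "2 * (d * exp t) \<le> \<bar>r - a\<bar>" using True by (simp add: d_def)
    then have "2 \<le> \<bar>(r - a) / (d * exp t)\<bar>" using d by (simp add: abs_mult le_divide_eq)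
    then show ?thesis by (simp add: psi_facts)
   qed (simp add: psi_facts)
   show "integrable (kap x) (indicat_real {r. \<delta> < \<bar>r - a\<bar>})"
    by (rule integrable_kap_bounded[where C=1]) (auto simp: indicator_def)
  qed
  finally have kN: "k \<le> N t a x" .
  have "c * h x \<le> c * hmax" using c h_bounds(3)[of x] by (intro mult_left_mono) auto
  also have "\<dots> = exp (- (\<alpha> * LL)) * k" using h_bounds(5) by (simp add: c_def)
  also have "\<dots> \<le> exp (\<alpha> * t) * N t a x"
  proof (intro mult_mono)
   show "exp (- (\<alpha> * LL)) \<le> exp (\<alpha> * t)" using that alpha_pos mult_left_mono[of "- LL" t \<alpha>] by simp
  qed (use kN assms in auto)
  finally show ?thesis .
 qed
 \<comment> \<open>Subsolutions increasing to the constant \<open>c\<close>: the subtracted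
   supersolution loses a factor \<open>\<kappa>\<close> per step, and its initial coefficient makes
   \<open>f 0\<close> nonpositive from level \<open>- LL\<close> on. The convergence is pointwise,
   which is enough as \<open>t\<close> is kept fixed.\<close>
 define f where "f n t s x = c - c * inverse \<kappa> ^ n * exp (\<theta> * LL) * (exp (\<theta> * t) * bb x)" for n and t and s :: bool and x
 have admf: "mw.adm (f n)" for n unfolding f_def bb_def
  by (intro mw.adm_diff mw.adm_const mw.adm_cmult mw.adm_exp_b)
 have Popf: "f (Suc n) t s x \<le> mw.Pop (f n) t s x" for n t s x
 proof -
  have "mw.Pop (f n) t s x = c - c * inverse \<kappa> ^ n * exp (\<theta> * LL) * mw.Pop (\<lambda>t s x. exp (\<theta> * t) * bb x) t s x"
   unfolding f_def bb_def by (subst mw.Pop_diff) (auto simp only: mw.Pop_const mw.Pop_cmult intro!: mw.adm_const mw.adm_cmult mw.adm_exp_b)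
  also have "\<dots> \<ge> c - c * inverse \<kappa> ^ n * exp (\<theta> * LL) * (exp (\<theta> * t) * bb x / \<kappa>)"
   using mw.Pop_exp_b[of t s x] c k1 unfolding bb_def \<kappa>_def
   by (intro diff_left_mono mult_left_mono) auto
  finally show ?thesis by (simp add: f_def field_simps)
 qed
 have main: "h x * f n t s x \<le> exp (\<alpha> * t) * N t a x" if "- LL \<le> t" for n t a x s
  using that
 proof (induction n arbitrary: t a x s)
  case 0
  have "1 * 1 \<le> exp (\<theta> * (t + LL)) * bb x" using 0 theta bb1[of x] by (intro mult_mono) auto
  then have "c * 1 \<le> c * (exp (\<theta> * (t + LL)) * bb x)" using c by (intro mult_left_mono) auto
  then have "f 0 t s x \<le> 0" by (simp add: f_def distrib_left exp_add mult_ac)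
  then have "h x * f 0 t s x \<le> 0" using h_bounds(4)[of x] by (simp add: mult_nonneg_nonpos)
  also have "0 \<le> exp (\<alpha> * t) * N t a x" unfolding N_def
   by (intro mult_nonneg_nonneg integral_kap_01) (auto simp: psi_facts)
  finally show ?case .
 next
  case (Suc n)
  show ?case
  proof (cases "t \<le> 0")
   case True
   have "f (Suc n) t s x \<le> c" using c k1 bb1[of x] unfolding f_def by simp
   then have "h x * f (Suc n) t s x \<le> c * h x" using h_bounds(4)[of x] by (simp add: mult.commute)
   then show ?thesis using base[of t x a] Suc.prems True by linarith
  next
   case False
   \<comment> \<open>For positive levels every successor has level at least \<open>- LL\<close>, so
     the induction hypothesis applies to it with whatever centre arises.\<close>
   have "h x * f (Suc n) t s x \<le> h x * mw.Pop (f n) t s x" using Popf h_bounds(4)[of x] by (intro mult_left_mono) auto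
   also have "\<dots> = (\<Sum>j\<in>UNIV. g j x * (h (cons j x) *
     (\<integral>u. \<bar>snd u\<bar> powr \<alpha> * f n (t - ln \<bar>snd u\<bar>) (s = (0 < snd u)) (cons j x) \<partial>lam j)))"
    unfolding Pop_lam[OF admf] using h_bounds(4)[of x] by simp
   also have "\<dots> \<le> (\<Sum>j\<in>UNIV. g j x * (exp (\<alpha> * t) * (\<integral>u. (\<integral>r. psi ((fst u + snd u * r - a) / (d * exp t)) \<partial>kap (cons j x)) \<partial>lam j)))"
   proof (intro sum_mono mult_left_mono)
    fix j
    define y where "y = cons j x"
    have i2: "integrable (lam j) (\<lambda>u. \<integral>r. psi ((fst u + snd u * r - a) / (d * exp t)) \<partial>kap y)"
     using affine_integrable[of "\<lambda>r. psi ((r - a) / (d * exp t))" j y] by (auto simp: psi_facts)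
    have [measurable]: "(\<lambda>t. f n t s y) \<in> borel_measurable borel" for s by (rule mw.admM[OF admf])
    have meas: "(\<lambda>u. f n (t - ln \<bar>snd u\<bar>) (s = (0 < snd u)) y) \<in> borel_measurable (lam j)"
     unfolding f_def by measurable
    have i1: "integrable (lam j) (\<lambda>u. \<bar>snd u\<bar> powr \<alpha> * f n (t - ln \<bar>snd u\<bar>) (s = (0 < snd u)) y)"
    proof -
     obtain A where A: "\<And>t' s x. \<bar>t'\<bar> \<le> \<bar>t\<bar> + ln m0 \<Longrightarrow> \<bar>f n t' s x\<bar> \<le> A"
      using admf[of n] unfolding mw.adm_def by meson
     interpret prob_space "lam j" by (rule prob_lam)
     show ?thesis
     proof (rule Bochner_Integration.integrable_bound[OF integrable_mult_left[OF powr_integrable[of j \<alpha>], of A]])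
      show "AE u in lam j. norm (\<bar>snd u\<bar> powr \<alpha> * f n (t - ln \<bar>snd u\<bar>) (s = (0 < snd u)) y) \<le> norm (\<bar>snd u\<bar> powr \<alpha> * A)"
       using lam_bound'[of j]
      proof eventually_elim
       case (elim u)
       have "\<bar>f n (t - ln \<bar>snd u\<bar>) (s = (0 < snd u)) y\<bar> \<le> A" by (rule A) (use elim in auto)
       then show ?case by (simp add: abs_mult mult_left_mono)
      qed
     qed (use meas in measurable)
    qed
    have "h y * (\<integral>u. \<bar>snd u\<bar> powr \<alpha> * f n (t - ln \<bar>snd u\<bar>) (s = (0 < snd u)) y \<partial>lam j)
     = (\<integral>u. h y * (\<bar>snd u\<bar> powr \<alpha> * f n (t - ln \<bar>snd u\<bar>) (s = (0 < snd u)) y) \<partial>lam j)" by simp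
    also have "\<dots> \<le> (\<integral>u. exp (\<alpha> * t) * (\<integral>r. psi ((fst u + snd u * r - a) / (d * exp t)) \<partial>kap y) \<partial>lam j)"
    proof (intro integral_mono_AE integrable_mult_right i1 i2)
     show "AE u in lam j. h y * (\<bar>snd u\<bar> powr \<alpha> * f n (t - ln \<bar>snd u\<bar>) (s = (0 < snd u)) y)
      \<le> exp (\<alpha> * t) * (\<integral>r. psi ((fst u + snd u * r - a) / (d * exp t)) \<partial>kap y)"
      using lam_bound'[of j]
     proof eventually_elim
      case (elim u)
      define t' where "t' = t - ln \<bar>snd u\<bar>"
      \<comment> \<open>The preimage of the centre under the affine map; with it the scaled distance
        of \<open>r\<close> from \<open>a'\<close> equals that of the image from
        \<open>a\<close>.\<close>
      define a' where "a' = (a - fst u) / snd u"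
      have m: "snd u \<noteq> 0" using elim by simp
      have et: "exp t' = exp t / \<bar>snd u\<bar>" using m by (simp add: t'_def exp_diff)
      have ea: "\<bar>snd u\<bar> powr \<alpha> * exp (\<alpha> * t') = exp (\<alpha> * t)"
       using m by (simp add: t'_def powr_def exp_add[symmetric] algebra_simps)
      have "- LL \<le> t'" using elim False by (auto simp: t'_def LL_def)
      then have "h y * f n t' (s = (0 < snd u)) y \<le> exp (\<alpha> * t') * N t' a' y" by (rule Suc.IH)
      then have "\<bar>snd u\<bar> powr \<alpha> * (h y * f n t' (s = (0 < snd u)) y) \<le> \<bar>snd u\<bar> powr \<alpha> * (exp (\<alpha> * t') * N t' a' y)"
       by (intro mult_left_mono) auto
      also have "\<dots> = exp (\<alpha> * t) * N t' a' y" using ea by (simp add: mult.assoc[symmetric])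
      also have "N t' a' y = (\<integral>r. psi ((fst u + snd u * r - a) / (d * exp t)) \<partial>kap y)"
      proof -
       have "psi ((r - a') / (d * exp t')) = psi ((fst u + snd u * r - a) / (d * exp t))" for r
       proof -
        have "\<bar>(r - a') / (d * exp t')\<bar> = \<bar>(fst u + snd u * r - a) / (d * exp t)\<bar>"
        proof -
         have "snd u * (r - a') = fst u + snd u * r - a" using m by (simp add: a'_def field_simps)
         then have "\<bar>fst u + snd u * r - a\<bar> = \<bar>snd u\<bar> * \<bar>r - a'\<bar>" by (simp add: abs_mult[symmetric])
         then show ?thesis using m d by (simp add: et abs_mult)
        qed
        then show ?thesis by (metis psi_facts(6))
       qed
       then show ?thesis by (simp add: N_def)
      qed
      finally show ?case by (simp add: t'_def mult_ac)
     qed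
    qed
    also have "\<dots> = exp (\<alpha> * t) * (\<integral>u. (\<integral>r. psi ((fst u + snd u * r - a) / (d * exp t)) \<partial>kap y) \<partial>lam j)" by simp
    finally show "h (cons j x) * (\<integral>u. \<bar>snd u\<bar> powr \<alpha> * f n (t - ln \<bar>snd u\<bar>) (s = (0 < snd u)) (cons j x) \<partial>lam j) \<le>
     exp (\<alpha> * t) * (\<integral>u. (\<integral>r. psi ((fst u + snd u * r - a) / (d * exp t)) \<partial>kap (cons j x)) \<partial>lam j)"
     by (simp add: y_def)
   qed (simp add: g_pos less_imp_le)
   also have "\<dots> = exp (\<alpha> * t) * N t a x"
   proof -
    have "N t a x = (\<Sum>j\<in>UNIV. g j x * (\<integral>u. (\<integral>r. psi ((fst u + snd u * r - a) / (d * exp t)) \<partial>kap (cons j x)) \<partial>lam j))"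
     unfolding N_def
    proof (rule kap_rec)
     show "continuous_on UNIV (\<lambda>r. psi ((r - a) / (d * exp t)))"
      using d by (intro continuous_on_compose2[OF psi_facts(5)[of UNIV]] continuous_intros) auto
    qed (simp add: psi_facts)
    then show ?thesis by (simp add: sum_distrib_left mult_ac)
   qed
   finally show ?thesis .
  qed
 qed
 have "c * hmin \<le> exp (\<alpha> * t) * measure (kap x) {r. \<delta> / 2 * exp t < \<bar>r\<bar>}" if "0 \<le> t" for t x
 proof -
  have "(\<lambda>n. h x * f n t True x) \<longlonglongrightarrow> h x * (c - c * 0 * exp (\<theta> * LL) * (exp (\<theta> * t) * bb x))"
   unfolding f_def using k1 by (intro tendsto_intros LIMSEQ_power_zero) (auto simp: field_simps)
  then have "h x * (c - c * 0 * exp (\<theta> * LL) * (exp (\<theta> * t) * bb x)) \<le> exp (\<alpha> * t) * N t 0 x"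
   by (rule tendsto_upperbound) (use main[of t x _ True 0] that LL in auto)
  then have "h x * c \<le> exp (\<alpha> * t) * N t 0 x" by simp
  moreover have "c * hmin \<le> h x * c" using c h_bounds(2)[of x] by (simp add: mult.commute)
  moreover have "N t 0 x \<le> measure (kap x) {r. \<delta> / 2 * exp t < \<bar>r\<bar>}"
  proof -
   have "N t 0 x \<le> (\<integral>r. indicator {r. \<delta> / 2 * exp t < \<bar>r\<bar>} r \<partial>kap x)" unfolding N_def
   proof (intro integral_mono int)
    show "psi ((r - 0) / (d * exp t)) \<le> indicator {r. \<delta> / 2 * exp t < \<bar>r\<bar>} r" for r
    proof (cases "\<delta> / 2 * exp t < \<bar>r\<bar>")
     case False
     then have "\<bar>r / (d * exp t)\<bar> \<le> 1" using d by (simp add: d_def abs_mult)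
     then show ?thesis by (simp add: psi_facts)
    qed (simp add: psi_facts)
    show "integrable (kap x) (indicat_real {r. \<delta> / 2 * exp t < \<bar>r\<bar>})"
     by (rule integrable_kap_bounded[where C=1]) (auto simp: indicator_def)
   qed
   then show ?thesis by simp
  qed
  then have "exp (\<alpha> * t) * N t 0 x \<le> exp (\<alpha> * t) * measure (kap x) {r. \<delta> / 2 * exp t < \<bar>r\<bar>}"
   by (intro mult_left_mono) auto
  ultimately show ?thesis by linarith
 qed
 moreover have "0 < c * hmin" using c h_bounds(1) by simp
 ultimately show ?thesis by blast
qed

section \<open>Tails after one further affine step\<close>

lemma ratio_powr_limit:
 assumes q: "0 < q" and e: "0 < (e::real)"
 shows "\<exists>T>q. \<forall>t\<ge>T. \<forall>v. \<bar>v\<bar> \<le> q \<longrightarrow> \<bar>(t / (t - v)) powr \<alpha> - 1\<bar> \<le> e"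
proof -
 have lim: "((\<lambda>t. (1 / (1 - a / t)) powr \<alpha>) \<longlongrightarrow> (1 / (1 - 0)) powr \<alpha>) at_top" for a :: real
  by (intro tendsto_intros tendsto_divide_0[OF tendsto_const] filterlim_at_top_imp_at_infinity filterlim_ident) auto
 have e1: "\<forall>\<^sub>F t in at_top. (1 / (1 - q / t)) powr \<alpha> < 1 + e" by (rule order_tendstoD(2)[OF lim]) (use e in simp)
 have e2: "\<forall>\<^sub>F t in at_top. 1 - e < (1 / (1 - (- q) / t)) powr \<alpha>" by (rule order_tendstoD(1)[OF lim]) (use e in simp)
 obtain T where T: "\<And>t. t \<ge> T \<Longrightarrow> (1 / (1 - q / t)) powr \<alpha> < 1 + e \<and> 1 - e < (1 / (1 - (- q) / t)) powr \<alpha>"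
  using eventually_conj[OF e1 e2] by (auto simp: eventually_at_top_linorder)
 have "\<bar>(t / (t - v)) powr \<alpha> - 1\<bar> \<le> e" if t: "t \<ge> max T (q + 1)" and v: "\<bar>v\<bar> \<le> q" for t v
 proof -
  have tq: "q < t" "0 < t" using t q by auto
  have 1: "t / (t - v) = 1 / (1 - v / t)" using tq by (simp add: field_simps)
  have pos: "0 < 1 - q / t" using tq by simp
  have le: "1 - q / t \<le> 1 - v / t" "1 - v / t \<le> 1 - (- q) / t"
   using v tq divide_right_mono[of v q t] divide_right_mono[of "- q" v t] by (simp_all add: abs_le_iff)
  have mono: "(1 / c) powr \<alpha> \<le> (1 / b) powr \<alpha>" if "0 < b" "b \<le> c" for b c :: real
   using that alpha_pos by (intro powr_mono2 frac_le) auto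
  have "(1 / (1 - v / t)) powr \<alpha> \<le> (1 / (1 - q / t)) powr \<alpha>" "(1 / (1 - (- q) / t)) powr \<alpha> \<le> (1 / (1 - v / t)) powr \<alpha>"
   using mono[OF pos le(1)] mono[OF less_le_trans[OF pos le(1)] le(2)] .
  then show ?thesis unfolding 1 using T[of t] t by auto
 qed
 then show ?thesis by (intro exI[of _ "max T (q + 1)"]) auto
qed

text \<open>\<open>kap x\<close> describes the perpetuity started just before the coordinate
  \<open>x 0\<close>; applying the affine map of the symbol \<open>x 0\<close> once more gives the
  law that belongs to the perpetuity of the theorem.\<close>

definition Fm :: "bool \<Rightarrow> real \<Rightarrow> (nat \<Rightarrow> 'd) \<Rightarrow> real" where
 "Fm s t x = (\<integral>u. measure (kap x) {r. t < esgn s * (fst u + snd u * r)} \<partial>lam (x 0))"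

text \<open>The event is a tail event for \<open>kap x\<close> at
  \<open>v = (t - q) / \<bar>m\<bar>\<close> on the side given by the product of signs. Scaling
  produces \<open>\<bar>m\<bar> powr \<alpha>\<close>, whose mean is the moment in the limit, and
  replacing \<open>t - q\<close> by \<open>t\<close> is uniform since \<open>q\<close> is
  bounded.\<close>

lemma Fm_limit:
 assumes c0: "\<And>s. 0 \<le> c s" and neg: "neg \<longrightarrow> c True = c False"
  and lim: "\<And>s e. e > 0 \<Longrightarrow> \<exists>T. \<forall>t\<ge>T. \<forall>x. \<bar>tl s t x - c s\<bar> \<le> e" and e: "0 < e"
 shows "\<exists>T. \<forall>t\<ge>T. \<forall>x. \<bar>t powr \<alpha> * Fm s t x - h x * c s * mom \<alpha> (x 0)\<bar> \<le> e"
proof -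
 define cm where "cm = c True + c False"
 have cm: "c s \<le> cm" for s using c0[of True] c0[of False] by (cases s) (auto simp: cm_def)
 have cm0: "0 \<le> cm" using c0 cm order_trans by blast
 define A where "A = m0 powr \<alpha> * hmax"
 have A: "0 < A" using m0_pos h_bounds(5) by (simp add: A_def)
 \<comment> \<open>The tolerance \<open>e1\<close> is for the convergence of the tail and
   \<open>e2\<close> below for the ratio of \<open>t\<close> to \<open>t - q\<close>; each uses half
   of \<open>e\<close>, and \<open>A\<close> bounds the common factor.\<close>
 define e1 where "e1 = min 1 (e / (2 * A))"
 have e1: "0 < e1" "e1 \<le> 1" "A * e1 \<le> e / 2"
  using e A by (auto simp: e1_def min_def field_simps)
 define e2 where "e2 = e / (2 * A * (cm + 1))"
 have e2: "0 < e2" "A * (e2 * (cm + 1)) \<le> e / 2"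
 proof -
  show "0 < e2" using e A cm0 by (simp add: e2_def)
  define b where "b = A * (cm + 1)"
  have "0 < b" using A cm0 by (simp add: b_def)
  have "e2 = e / (2 * b)" by (simp add: e2_def b_def mult_ac)
  then have "e2 * b = e / 2" using \<open>0 < b\<close> by simp
  then show "A * (e2 * (cm + 1)) \<le> e / 2" by (simp add: b_def mult_ac)
 qed
 obtain T0 where T0: "\<And>s t x. t \<ge> T0 s \<Longrightarrow> \<bar>tl s t x - c s\<bar> \<le> e1"
  using lim[OF e1(1)] by metis
 define T1 where "T1 = max (T0 True) (T0 False)"
 have T1: "\<bar>tl s t x - c s\<bar> \<le> e1" if "t \<ge> T1" for s t x
  using T0[of s t x] that by (cases s) (auto simp: T1_def)
 obtain T2 where T2: "q0 < T2" "\<And>t v. t \<ge> T2 \<Longrightarrow> \<bar>v\<bar> \<le> q0 \<Longrightarrow> \<bar>(t / (t - v)) powr \<alpha> - 1\<bar> \<le> e2"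
  using ratio_powr_limit[OF q0_pos e2(1)] by blast
 define T where "T = max T2 (q0 + m0 * exp T1)"
 have "\<bar>t powr \<alpha> * Fm s t x - h x * c s * mom \<alpha> (x 0)\<bar> \<le> e" if t: "t \<ge> T" for t x
 proof -
  interpret prob_space "lam (x 0)" by (rule prob_lam)
  interpret k: prob_space "kap x" by (rule prob_kap)
  define f where "f u = measure (kap x) {r. t < esgn s * (fst u + snd u * r)}" for u :: "real \<times> real"
  have [measurable]: "f \<in> borel_measurable (lam (x 0))"
  proof -
   have "f = (\<lambda>u. \<integral>r. indicator {v. t < esgn s * v} (fst u + snd u * r) \<partial>kap x)"
   proof
    fix u
    have "(\<integral>r. indicat_real {v. t < esgn s * v} (fst u + snd u * r) \<partial>kap x) = (\<integral>r. indicat_real {r. t < esgn s * (fst u + snd u * r)} r \<partial>kap x)"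
     by (intro Bochner_Integration.integral_cong) (auto simp: indicator_def)
    then show "f u = (\<integral>r. indicator {v. t < esgn s * v} (fst u + snd u * r) \<partial>kap x)" by (simp add: f_def)
   qed
   then show ?thesis using affine_measurable[of "indicator {v. t < esgn s * v}" x "x 0"] by simp
  qed
  have f1: "\<bar>f u\<bar> \<le> 1" for u by (simp add: f_def)
  have fi: "integrable (lam (x 0)) f" by (rule integrable_const_bound[where B=1]) (use f1 in auto)
  \<comment> \<open>Either all multipliers are positive and the side does not change, or the two
    constants agree.\<close>
  have sgn: "AE u in lam (x 0). c (s = (0 < snd u)) = c s"
  proof (cases neg)
   case True
   then have "c s' = c s" for s' using neg by (cases s'; cases s) auto
   then show ?thesis by simp
  next
   case False
   then have "AE u in lam (x 0). 0 < snd u" by (auto simp: neg_def)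
   then show ?thesis by eventually_elim simp
  qed
  have "t powr \<alpha> * Fm s t x - h x * c s * mom \<alpha> (x 0) = (\<integral>u. t powr \<alpha> * f u - h x * c s * \<bar>snd u\<bar> powr \<alpha> \<partial>lam (x 0))"
   by (subst Bochner_Integration.integral_diff)
    (auto simp: Fm_def f_def[symmetric] mom_def intro!: integrable_mult_right fi powr_integrable)
  also have "\<bar>\<integral>u. t powr \<alpha> * f u - h x * c s * \<bar>snd u\<bar> powr \<alpha> \<partial>lam (x 0)\<bar> \<le> (\<integral>u. e \<partial>lam (x 0))"
  proof (rule order_trans[OF integral_abs_bound integral_mono_AE])
   show "AE u in lam (x 0). \<bar>t powr \<alpha> * f u - h x * c s * \<bar>snd u\<bar> powr \<alpha>\<bar> \<le> e"
    using lam_bound'[of "x 0"] sgn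
   proof eventually_elim
    case (elim u)
    define s' where "s' = (s = (0 < snd u))"
    define v where "v = (t - esgn s * fst u) / \<bar>snd u\<bar>"
    have m: "snd u \<noteq> 0" "0 < \<bar>snd u\<bar>" using elim by auto
    have eq: "\<bar>esgn s * fst u\<bar> \<le> q0" using elim by (simp add: abs_mult)
    have tq: "q0 + m0 * exp T1 \<le> t" "T2 \<le> t" using t by (auto simp: T_def)
    have "m0 * exp T1 \<le> t - esgn s * fst u" using eq tq by (auto simp: abs_le_iff)
    moreover have "\<bar>snd u\<bar> * exp T1 \<le> m0 * exp T1" using elim by (intro mult_right_mono) auto
    ultimately have "\<bar>snd u\<bar> * exp T1 \<le> t - esgn s * fst u" by linarith
    then have "exp T1 \<le> v" using m by (simp add: v_def le_divide_eq mult.commute)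
    then have v: "0 < v" "T1 \<le> ln v" using less_le_trans[OF exp_gt_zero] by (auto simp: ln_ge_iff)
    have tpos: "0 < t" "0 < t - esgn s * fst u" using tq T2(1) q0_pos eq by (auto simp: abs_le_iff)
    have set: "{r. t < esgn s * (fst u + snd u * r)} = {r. v < esgn s' * r}"
    proof -
     have es: "esgn s' * \<bar>snd u\<bar> = esgn s * snd u"
      using esgn_step[OF m(1), of s] by (simp add: s'_def)
     have "t < esgn s * (fst u + snd u * r) \<longleftrightarrow> v < esgn s' * r" for r
     proof -
      have "esgn s * (fst u + snd u * r) = esgn s * fst u + esgn s' * \<bar>snd u\<bar> * r"
       unfolding es by (simp add: algebra_simps)
      moreover have "v < esgn s' * r \<longleftrightarrow> t - esgn s * fst u < esgn s' * r * \<bar>snd u\<bar>"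
       unfolding v_def using m by (simp add: divide_less_eq)
      ultimately show ?thesis by (auto simp: mult_ac)
     qed
     then show ?thesis by simp
    qed
    have "v powr \<alpha> * f u = h x * tl s' (ln v) x"
     using v h_bounds(4)[of x] by (simp add: tl_def f_def set powr_def)
    moreover have "t powr \<alpha> = (t / (t - esgn s * fst u)) powr \<alpha> * \<bar>snd u\<bar> powr \<alpha> * v powr \<alpha>"
    proof -
     have "t = (t / (t - esgn s * fst u)) * \<bar>snd u\<bar> * v" using m tpos by (simp add: v_def)
     then have "t powr \<alpha> = ((t / (t - esgn s * fst u)) * \<bar>snd u\<bar> * v) powr \<alpha>" by simp
     also have "\<dots> = (t / (t - esgn s * fst u)) powr \<alpha> * \<bar>snd u\<bar> powr \<alpha> * v powr \<alpha>"
     proof -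
      have "0 \<le> t / (t - esgn s * fst u)" "0 \<le> \<bar>snd u\<bar>" "0 \<le> v" "0 \<le> t / (t - esgn s * fst u) * \<bar>snd u\<bar>"
       using tpos v by auto
      then show ?thesis by (simp only: powr_mult)
     qed
     finally show ?thesis .
    qed
    ultimately have tf: "t powr \<alpha> * f u = (t / (t - esgn s * fst u)) powr \<alpha> * \<bar>snd u\<bar> powr \<alpha> * (h x * tl s' (ln v) x)"
     by simp
    define a where "a = (t / (t - esgn s * fst u)) powr \<alpha>"
    have a: "\<bar>a - 1\<bar> \<le> e2" unfolding a_def by (rule T2(2)) (use tq eq in auto)
    have cs: "c s' = c s" using elim(2) by (simp add: s'_def)
    have tlc: "\<bar>tl s' (ln v) x - c s\<bar> \<le> e1" using T1[OF v(2), of s' x] cs by simp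
    have tl0: "0 \<le> tl s' (ln v) x" using h_bounds(4)[of x] by (simp add: tl_def)
    have tlm: "tl s' (ln v) x \<le> cm + 1" using tlc cm[of s] e1(2) by linarith
    have "t powr \<alpha> * f u - h x * c s * \<bar>snd u\<bar> powr \<alpha> = (\<bar>snd u\<bar> powr \<alpha> * h x) * ((a - 1) * tl s' (ln v) x + (tl s' (ln v) x - c s))"
     unfolding tf a_def[symmetric] by (simp add: algebra_simps)
    then have "\<bar>t powr \<alpha> * f u - h x * c s * \<bar>snd u\<bar> powr \<alpha>\<bar> = (\<bar>snd u\<bar> powr \<alpha> * h x) * \<bar>(a - 1) * tl s' (ln v) x + (tl s' (ln v) x - c s)\<bar>"
     using h_bounds(4)[of x] by (simp add: abs_mult)
    also have "\<dots> \<le> A * (e2 * (cm + 1) + e1)"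
    proof (intro mult_mono)
     show "\<bar>snd u\<bar> powr \<alpha> * h x \<le> A" unfolding A_def
      using elim alpha_pos h_bounds(3,4)[of x] by (intro mult_mono powr_mono2) auto
     have "\<bar>(a - 1) * tl s' (ln v) x\<bar> \<le> e2 * (cm + 1)"
      unfolding abs_mult using a tl0 tlm e2(1) by (intro mult_mono) auto
     then show "\<bar>(a - 1) * tl s' (ln v) x + (tl s' (ln v) x - c s)\<bar> \<le> e2 * (cm + 1) + e1"
      using tlc by (intro order_trans[OF abs_triangle_ineq] add_mono)
    qed (use A in auto)
    also have "\<dots> \<le> e" using e1(3) e2(2) by (simp only: distrib_left)
    finally show ?case .
   qed
   show "integrable (lam (x 0)) (\<lambda>u. \<bar>t powr \<alpha> * f u - h x * c s * \<bar>snd u\<bar> powr \<alpha>\<bar>)"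
    by (intro integrable_abs Bochner_Integration.integrable_diff integrable_mult_right fi powr_integrable)
  qed simp
  also have "\<dots> = e" using prob_space by simp
  finally show ?thesis .
 qed
 then show ?thesis by blast
qed

text \<open>Since \<open>h\<close> and the moments are strictly positive, the limit vanishes at one
  sequence exactly when its constant \<open>c s\<close> vanishes. If both constants were zero, the
  lower bound for non-degenerate kernels would be violated at large levels.\<close>

theorem kernel_limits:
 "\<exists>K :: bool \<Rightarrow> (nat \<Rightarrow> 'd) \<Rightarrow> real.
  (\<forall>s. bounded (range (K s)) \<and> (\<forall>x. 0 \<le> K s x) \<and> ((\<forall>x. K s x = 0) \<or> (\<forall>x. 0 < K s x)) \<and>
    (\<forall>e>0. \<exists>T. \<forall>t\<ge>T. \<forall>x. \<bar>t powr \<alpha> * Fm s t x - K s x\<bar> \<le> e)) \<and>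
  (neg \<longrightarrow> K True = K False) \<and>
  ((\<exists>\<delta>>0. \<exists>k>0. \<forall>x a. k \<le> measure (kap x) {r. \<delta> < \<bar>r - a\<bar>}) \<longrightarrow> (\<exists>s. \<forall>x. 0 < K s x))"
proof -
 obtain c where c: "\<And>s. 0 \<le> c s" "neg \<longrightarrow> c True = c False"
  "\<And>s e. e > 0 \<Longrightarrow> \<exists>T. \<forall>t\<ge>T. \<forall>x. \<bar>tl s t x - c s\<bar> \<le> e"
  using tail_limit by blast
 define K where "K s x = h x * c s * mom \<alpha> (x 0)" for s x
 have K0: "0 \<le> K s x" for s x using c(1)[of s] h_bounds(4)[of x] mom_pos[of \<alpha> "x 0"] by (simp add: K_def)
 define mx where "mx = Max (range (mom \<alpha>))"
 have mx: "mom \<alpha> j \<le> mx" for j unfolding mx_def by (intro Max_ge) auto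
 have "K s x \<le> hmax * c s * mx" for s x unfolding K_def
  using c(1)[of s] h_bounds(3,4)[of x] mom_pos[of \<alpha> "x 0"] mx[of "x 0"] h_bounds(5) by (intro mult_mono) auto
 then have bd: "bounded (range (K s))" for s
  using K0 by (intro boundedI[where B="hmax * c s * mx"]) auto
 have dich: "(\<forall>x. K s x = 0) \<or> (\<forall>x. 0 < K s x)" for s
 proof (cases "c s = 0")
  case False
  then have "0 < c s" using c(1)[of s] by simp
  then show ?thesis using h_bounds(4) mom_pos by (simp add: K_def)
 qed (simp add: K_def)
 have lim: "\<exists>T. \<forall>t\<ge>T. \<forall>x. \<bar>t powr \<alpha> * Fm s t x - K s x\<bar> \<le> e" if "0 < e" for s e
  unfolding K_def by (rule Fm_limit[OF c that])
 have nd: "\<exists>s. \<forall>x. 0 < K s x" if \<delta>: "0 < \<delta>" "0 < k" "\<And>x a. k \<le> measure (kap x) {r. \<delta> < \<bar>r - a\<bar>}" for \<delta> k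
 proof (rule ccontr)
  assume no: "\<not> ?thesis"
  have "c s = 0" for s
  proof (rule ccontr)
   assume "c s \<noteq> 0"
   then have "0 < c s" using c(1)[of s] by simp
   then have "\<forall>x. 0 < K s x" using h_bounds(4) mom_pos by (simp add: K_def)
   then show False using no by blast
  qed
  obtain c' where c': "0 < c'" "\<And>t x. 0 \<le> t \<Longrightarrow> c' \<le> exp (\<alpha> * t) * measure (kap x) {r. \<delta> / 2 * exp t < \<bar>r\<bar>}"
   using concentration_lower[OF \<delta>] by blast
  \<comment> \<open>The lower bound concerns the threshold \<open>\<delta> / 2 * exp t\<close>,
    which is \<open>exp (t + l)\<close> in terms of the rescaled tails.\<close>
  define l where "l = ln (\<delta> / 2)"
  define e where "e = c' * exp (\<alpha> * l) / (4 * hmax)"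
  have e: "0 < e" using c' h_bounds(5) by (simp add: e_def)
  obtain T0 where T0: "\<And>s t x. t \<ge> T0 s \<Longrightarrow> \<bar>tl s t x - c s\<bar> \<le> e" using c(3)[OF e] by metis
  define t where "t = max 0 (max (T0 True) (T0 False) - l)"
  define x where "x = (undefined :: nat \<Rightarrow> 'd)"
  interpret k: prob_space "kap x" by (rule prob_kap)
  have tls: "tl s (t + l) x \<le> e" for s
  proof -
   have "T0 s \<le> t + l" by (cases s) (auto simp: t_def)
   then have "\<bar>tl s (t + l) x - c s\<bar> \<le> e" by (rule T0)
   then show ?thesis using \<open>\<And>s. c s = 0\<close>[of s] by simp
  qed
  have "measure (kap x) {r. \<delta> / 2 * exp t < \<bar>r\<bar>} \<le> measure (kap x) {r. exp (t + l) < esgn True * r} + measure (kap x) {r. exp (t + l) < esgn False * r}"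
  proof -
   have "{r. \<delta> / 2 * exp t < \<bar>r\<bar>} \<subseteq> {r. exp (t + l) < esgn True * r} \<union> {r. exp (t + l) < esgn False * r}"
    using \<delta>(1) by (auto simp: l_def exp_add abs_if mult.commute split: if_splits)
   then have "measure (kap x) {r. \<delta> / 2 * exp t < \<bar>r\<bar>} \<le> measure (kap x) ({r. exp (t + l) < esgn True * r} \<union> {r. exp (t + l) < esgn False * r})"
    by (intro k.finite_measure_mono) (auto intro: esgn_measurable simp del: esgn_simps)
   also have "\<dots> \<le> measure (kap x) {r. exp (t + l) < esgn True * r} + measure (kap x) {r. exp (t + l) < esgn False * r}"
    by (intro measure_subadditive) (auto simp: esgn_measurable simp del: esgn_simps)
   finally show ?thesis .
  qed
  then have "exp (\<alpha> * (t + l)) * measure (kap x) {r. \<delta> / 2 * exp t < \<bar>r\<bar>} \<le> h x * (tl True (t + l) x + tl False (t + l) x)"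
  proof -
   have "h x * (tl True (t + l) x + tl False (t + l) x) = exp (\<alpha> * (t + l)) *
    (measure (kap x) {r. exp (t + l) < esgn True * r} + measure (kap x) {r. exp (t + l) < esgn False * r})"
    using h_bounds(4)[of x] by (simp add: tl_def distrib_left del: esgn_simps)
   then show ?thesis using \<open>measure (kap x) {r. \<delta> / 2 * exp t < \<bar>r\<bar>} \<le> _\<close> by (simp only:) (intro mult_left_mono, auto)
  qed
  also have "\<dots> \<le> hmax * (e + e)"
  proof (intro mult_mono add_mono tls)
   show "0 \<le> tl True (t + l) x + tl False (t + l) x" using h_bounds(4)[of x] by (simp add: tl_def)
  qed (use h_bounds(3)[of x] h_bounds(5) in auto)
  also have "\<dots> = exp (\<alpha> * l) * (c' / 2)" using h_bounds(5) by (simp add: e_def)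
  finally have "exp (\<alpha> * l) * (exp (\<alpha> * t) * measure (kap x) {r. \<delta> / 2 * exp t < \<bar>r\<bar>}) \<le> exp (\<alpha> * l) * (c' / 2)"
   by (simp add: distrib_left exp_add mult_ac)
  then have "exp (\<alpha> * t) * measure (kap x) {r. \<delta> / 2 * exp t < \<bar>r\<bar>} \<le> c' / 2" by simp
  then show False using c'(2)[of t x] c'(1) by (simp add: t_def)
 qed
 have "K True = K False" if neg using c(2) that by (auto simp: K_def fun_eq_iff)
 then show ?thesis using bd K0 dich lim nd by (intro exI[of _ K]) blast
qed

end

section \<open>Geometric bounds and multiplicative Cauchy sequences\<close>

lemma eln_limsup_decay:
 assumes fin: "\<And>n. gam n < \<infinity>" and nonneg: "\<And>n. 0 \<le> gam n"
  and lim: "limsup (\<lambda>n. eln (gam n) / ereal (real n)) < 0"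
 shows "\<exists>C \<rho>. 0 \<le> C \<and> 0 < \<rho> \<and> \<rho> < 1 \<and> (\<forall>n. gam n \<le> ereal (C * \<rho> ^ n))"
proof -
 obtain r where r: "limsup (\<lambda>n. eln (gam n) / ereal (real n)) < ereal r" "r < 0"
  using ereal_dense2[OF lim] by auto
 obtain G where G: "\<And>n. gam n = ereal (G n)"
 proof -
  have "\<bar>gam n\<bar> \<noteq> \<infinity>" for n using fin[of n] nonneg[of n] by (cases "gam n") auto
  then have "gam n = ereal (real_of_ereal (gam n))" for n by (simp add: ereal_real)
  then show ?thesis by (rule that)
 qed
 have G0: "0 \<le> G n" for n using nonneg[of n] by (simp add: G)
 define \<rho> where "\<rho> = exp r"
 have rho: "0 < \<rho>" "\<rho> < 1" using r by (auto simp: \<rho>_def)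
 have "\<forall>\<^sub>F n in sequentially. eln (gam n) / ereal (real n) < ereal r"
  using r(1) Limsup_lessD by blast
 then obtain n0 where n0: "\<And>n. n \<ge> n0 \<Longrightarrow> eln (gam n) / ereal (real n) < ereal r" by (auto simp: eventually_sequentially)
 have le: "G n \<le> \<rho> ^ n" if n: "n \<ge> Suc n0" for n
 proof (cases "G n = 0")
  case False
  then have "eln (gam n) = ereal (ln (G n))" by (simp add: eln_def G)
  then have "ereal (ln (G n)) / ereal (real n) < ereal r" using n0[of n] n by simp
  then have "ln (G n) / real n < r" using n by simp
  then have "ln (G n) < r * real n" using n by (simp add: divide_less_eq)
  then have "exp (ln (G n)) < exp (r * real n)" by simp
  then show ?thesis using False G0[of n] by (simp add: \<rho>_def exp_of_nat_mult[symmetric] mult.commute)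
 qed (use rho in simp)
 \<comment> \<open>The rate is available from \<open>n0\<close> on only; the finitely many earlier
   terms are finite and are absorbed into the constant.\<close>
 define C where "C = Max (insert 1 ((\<lambda>n. G n / \<rho> ^ n) ` {..n0}))"
 have C1: "1 \<le> C" unfolding C_def by (intro Max_ge) auto
 have "G n \<le> C * \<rho> ^ n" for n
 proof (cases "n \<le> n0")
  case True
  have "G n / \<rho> ^ n \<le> C" unfolding C_def using True by (intro Max_ge) auto
  then show ?thesis using rho by (simp add: divide_le_eq)
 next
  case False
  then have "G n \<le> 1 * \<rho> ^ n" using le[of n] by simp
  also have "\<dots> \<le> C * \<rho> ^ n" using C1 rho by (intro mult_right_mono) auto
  finally show ?thesis .
 qed
 then show ?thesis using C1 rho by (intro exI[of _ C] exI[of _ \<rho>]) (auto simp: G)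
qed

text \<open>The logarithms are Cauchy. Working multiplicatively keeps the limit positive and
  preserves the explicit relative error at each index, which later gives regularity in the
  sequence.\<close>

lemma ratio_cauchy:
 fixes a :: "nat \<Rightarrow> real"
 assumes pos: "\<And>n. 0 < a n" and rho: "0 < \<rho>" "\<rho> < 1" and B: "0 \<le> B"
  and cmp: "\<And>n k. a (n + k) \<le> exp (B * \<rho> ^ n) * a n \<and> a n \<le> exp (B * \<rho> ^ n) * a (n + k)"
 shows "\<exists>l. a \<longlonglongrightarrow> l \<and> 0 < l \<and> (\<forall>n. l \<le> exp (B * \<rho> ^ n) * a n \<and> a n \<le> exp (B * \<rho> ^ n) * l)"
proof -
 have le: "\<bar>ln (a (n + k)) - ln (a n)\<bar> \<le> B * \<rho> ^ n" for n k
 proof -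
  have "ln (a (n + k)) \<le> ln (exp (B * \<rho> ^ n) * a n)" "ln (a n) \<le> ln (exp (B * \<rho> ^ n) * a (n + k))"
   using cmp[of n k] pos by (auto simp: ln_le_cancel_iff)
  then show ?thesis using pos[of n] pos[of "n + k"] by (simp add: ln_mult abs_le_iff)
 qed
 have "Cauchy (\<lambda>n. ln (a n))"
 proof (rule metric_CauchyI)
  fix e :: real assume e: "0 < e"
  have "(\<lambda>n. B * \<rho> ^ n) \<longlonglongrightarrow> B * 0" using rho by (intro tendsto_intros LIMSEQ_power_zero) auto
  then have "\<forall>\<^sub>F n in sequentially. B * \<rho> ^ n < e / 2" using e by (intro order_tendstoD) auto
  then obtain M where M: "B * \<rho> ^ M < e / 2" by (auto simp: eventually_sequentially)
  have "dist (ln (a m)) (ln (a n)) < e" if "m \<ge> M" "n \<ge> M" for m n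
   using le[of M "m - M"] le[of M "n - M"] M that by (simp add: dist_real_def)
  then show "\<exists>M. \<forall>m\<ge>M. \<forall>n\<ge>M. dist (ln (a m)) (ln (a n)) < e" by blast
 qed
 then obtain l where l: "(\<lambda>n. ln (a n)) \<longlonglongrightarrow> l" using Cauchy_convergent convergent_def by blast
 then have "(\<lambda>n. exp (ln (a n))) \<longlonglongrightarrow> exp l" by (rule tendsto_exp)
 then have lim: "a \<longlonglongrightarrow> exp l" using pos by simp
 have lk: "(\<lambda>k. a (n + k)) \<longlonglongrightarrow> exp l" for n using LIMSEQ_ignore_initial_segment[OF lim, of n] by (simp add: add.commute)
 have "exp l \<le> exp (B * \<rho> ^ n) * a n" for n
  by (rule tendsto_upperbound[OF lk[of n]]) (use cmp in auto)
 moreover have "a n \<le> exp (B * \<rho> ^ n) * exp l" for n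
  by (rule tendsto_lowerbound[OF tendsto_mult_left[OF lk[of n]]]) (use cmp in auto)
 ultimately show ?thesis using lim by (intro exI[of _ "exp l"]) auto
qed

section \<open>Cylinder probabilities of the chain and near independence across a block\<close>

locale c_chain = prob_space P for P :: "'a measure" +
 fixes X :: "int \<Rightarrow> 'a \<Rightarrow> 'd::finite"
 assumes C_chain: "C_chain P X"
begin

lemma X_measurable [measurable]: "X n \<in> measurable P (count_space UNIV)"
 using C_chain by (simp add: C_chain_def)

definition cyl :: "int \<Rightarrow> 'd list \<Rightarrow> 'a set" where
 "cyl k w = {\<omega>\<in>space P. \<forall>j<length w. X (k + int j) \<omega> = w ! j}"

definition pl :: "'d list \<Rightarrow> real" where "pl w = prob (cyl 0 w)"

lemma cyl_sets [measurable, simp]: "cyl k w \<in> events"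
 unfolding cyl_def by measurable

lemma prob_cyl: "prob (cyl k w) = pl w"
proof -
 have st: "stationary_chain P X" using C_chain by (simp add: C_chain_def)
 show ?thesis unfolding cyl_def pl_def
  using spec[OF spec[OF spec[OF st[unfolded stationary_chain_def], of k], of "length w"], of "\<lambda>j. w ! j"] by simp
qed

lemma pl_pos: "0 < pl w"
proof -
 have "\<forall>(m::nat) (f::nat \<Rightarrow> 'd). prob {\<omega>\<in>space P. \<forall>j<m. X (int j + 1) \<omega> = f j} > 0"
  using C_chain unfolding C_chain_def by (elim conjE)
 from spec[OF spec[OF this, of "length w"], of "\<lambda>j. w ! j"]
 have "0 < prob {\<omega>\<in>space P. \<forall>j<length w. X (int j + 1) \<omega> = w ! j}" .
 also have "{\<omega>\<in>space P. \<forall>j<length w. X (int j + 1) \<omega> = w ! j} = cyl 1 w"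
  by (auto simp: cyl_def add.commute)
 finally show ?thesis by (simp add: prob_cyl)
qed

lemma cylD: "\<omega> \<in> cyl k w \<Longrightarrow> j < length w \<Longrightarrow> X (k + int j) \<omega> = w ! j"
 unfolding cyl_def by blast

lemma cyl_space: "\<omega> \<in> cyl k w \<Longrightarrow> \<omega> \<in> space P"
 unfolding cyl_def by blast

lemma cylI: "\<omega> \<in> space P \<Longrightarrow> (\<And>j. j < length w \<Longrightarrow> X (k + int j) \<omega> = w ! j) \<Longrightarrow> \<omega> \<in> cyl k w"
 unfolding cyl_def by blast

lemma cyl_append: "cyl k (u @ w) = cyl k u \<inter> cyl (k + int (length u)) w"
proof (intro set_eqI iffI IntI)
 fix \<omega> assume a: "\<omega> \<in> cyl k (u @ w)"
 show "\<omega> \<in> cyl k u"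
 proof (rule cylI[OF cyl_space[OF a]])
  fix j assume "j < length u"
  then show "X (k + int j) \<omega> = u ! j" using cylD[OF a, of j] by (simp add: nth_append)
 qed
 show "\<omega> \<in> cyl (k + int (length u)) w"
 proof (rule cylI[OF cyl_space[OF a]])
  fix j assume "j < length w"
  then show "X (k + int (length u) + int j) \<omega> = w ! j"
   using cylD[OF a, of "length u + j"] by (simp add: nth_append add.assoc)
 qed
next
 fix \<omega> assume "\<omega> \<in> cyl k u \<inter> cyl (k + int (length u)) w"
 then have a: "\<omega> \<in> cyl k u" and b: "\<omega> \<in> cyl (k + int (length u)) w" by auto
 show "\<omega> \<in> cyl k (u @ w)"
 proof (rule cylI[OF cyl_space[OF a]])
  fix j assume j: "j < length (u @ w)"
  show "X (k + int j) \<omega> = (u @ w) ! j"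
  proof (cases "j < length u")
   case True
   show ?thesis unfolding cylD[OF a True] using True by (simp add: nth_append)
  next
   case False
   have e: "k + int j = k + int (length u) + int (j - length u)" using False by simp
   have l: "j - length u < length w" using j False by simp
   show ?thesis unfolding e cylD[OF b l] using False by (simp add: nth_append)
  qed
 qed
qed

definition wds :: "nat \<Rightarrow> 'd list set" where "wds n = {w. length w = n}"

lemma finite_wds [simp]: "finite (wds n)"
 using finite_lists_length_eq[of "UNIV :: 'd set" n] by (simp add: wds_def)

lemma wds_length: "w \<in> wds n \<Longrightarrow> length w = n" by (simp add: wds_def)

lemma wds_0 [simp]: "wds 0 = {[]}" by (auto simp: wds_def)

lemma cyl_disjoint: "length w = length w' \<Longrightarrow> w \<noteq> w' \<Longrightarrow> cyl k w \<inter> cyl k w' = {}"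
 by (auto simp: cyl_def list_eq_iff_nth_eq)

definition wd :: "int \<Rightarrow> nat \<Rightarrow> 'a \<Rightarrow> 'd list" where
 "wd k n \<omega> = map (\<lambda>j. X (k + int j) \<omega>) [0..<n]"

lemma in_cyl_iff: "\<omega> \<in> space P \<Longrightarrow> length w = n \<Longrightarrow> \<omega> \<in> cyl k w \<longleftrightarrow> wd k n \<omega> = w"
 by (auto simp: cyl_def wd_def list_eq_iff_nth_eq)

lemma cyl_integrable: "integrable P (indicator (cyl k w) :: 'a \<Rightarrow> real)"
 by (intro integrable_real_indicator) (simp_all add: emeasure_eq_measure)

lemma in_cyl_wds: "\<omega> \<in> space P \<Longrightarrow> w \<in> wds n \<Longrightarrow> \<omega> \<in> cyl k w \<longleftrightarrow> w = wd k n \<omega>"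
 using in_cyl_iff[of \<omega> w n k] by (auto simp: wds_def)

lemma wd_wds [simp]: "wd k n \<omega> \<in> wds n" by (simp add: wd_def wds_def)

lemma indicator_partition:
 assumes "\<omega> \<in> space P"
 shows "f \<omega> = (\<Sum>w\<in>wds n. indicator (cyl k w) \<omega> * (f \<omega> :: real))"
proof -
 have "(\<Sum>w\<in>wds n. indicator (cyl k w) \<omega> * f \<omega>) = (\<Sum>w\<in>{wd k n \<omega>}. indicator (cyl k w) \<omega> * f \<omega>)"
  by (rule sum.mono_neutral_right) (auto simp: in_cyl_wds[OF assms] indicator_def)
 then show ?thesis by (simp add: in_cyl_wds[OF assms wd_wds])
qed

lemma integral_partition:
 fixes f :: "'a \<Rightarrow> real"
 assumes "integrable P f"
 shows "(\<integral>\<omega>. f \<omega> \<partial>P) = (\<Sum>w\<in>wds n. \<integral>\<omega>. indicator (cyl k w) \<omega> * f \<omega> \<partial>P)"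
proof -
 have int: "integrable P (\<lambda>\<omega>. indicator (cyl k w) \<omega> * f \<omega>)" for w
  using integrable_mult_indicator[OF cyl_sets assms, of k w] by simp
 have "(\<integral>\<omega>. f \<omega> \<partial>P) = (\<integral>\<omega>. (\<Sum>w\<in>wds n. indicator (cyl k w) \<omega> * f \<omega>) \<partial>P)"
  by (intro Bochner_Integration.integral_cong refl indicator_partition)
 also have "\<dots> = (\<Sum>w\<in>wds n. \<integral>\<omega>. indicator (cyl k w) \<omega> * f \<omega> \<partial>P)"
  by (rule Bochner_Integration.integral_sum) (rule int)
 finally show ?thesis .
qed

lemma sum_pl_prefix: "(\<Sum>u\<in>wds n. pl (u @ w)) = pl w"
proof -
 have "pl w = (\<integral>\<omega>. indicator (cyl (int n) w) \<omega> \<partial>P)" by (simp add: prob_cyl)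
 also have "\<dots> = (\<Sum>u\<in>wds n. \<integral>\<omega>. indicator (cyl 0 u) \<omega> * indicator (cyl (int n) w) \<omega> \<partial>P)"
  by (rule integral_partition[OF cyl_integrable])
 also have "\<dots> = (\<Sum>u\<in>wds n. pl (u @ w))"
 proof (intro sum.cong refl)
  fix u assume u: "u \<in> wds n"
  have "(\<integral>\<omega>. indicat_real (cyl 0 u) \<omega> * indicator (cyl (int n) w) \<omega> \<partial>P) = (\<integral>\<omega>. indicat_real (cyl 0 (u @ w)) \<omega> \<partial>P)"
   using wds_length[OF u] by (intro Bochner_Integration.integral_cong) (auto simp: cyl_append indicator_def)
  then show "(\<integral>\<omega>. indicat_real (cyl 0 u) \<omega> * indicator (cyl (int n) w) \<omega> \<partial>P) = pl (u @ w)"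
   by (simp add: prob_cyl)
 qed
 finally show ?thesis by simp
qed

lemma sum_pl_suffix: "(\<Sum>u\<in>wds n. pl (w @ u)) = pl w"
proof -
 have "pl w = (\<integral>\<omega>. indicator (cyl 0 w) \<omega> \<partial>P)" by (simp add: prob_cyl)
 also have "\<dots> = (\<Sum>u\<in>wds n. \<integral>\<omega>. indicator (cyl (int (length w)) u) \<omega> * indicator (cyl 0 w) \<omega> \<partial>P)"
  by (rule integral_partition[OF cyl_integrable])
 also have "\<dots> = (\<Sum>u\<in>wds n. pl (w @ u))"
 proof (intro sum.cong refl)
  fix u assume u: "u \<in> wds n"
  have "(\<integral>\<omega>. indicat_real (cyl (int (length w)) u) \<omega> * indicator (cyl 0 w) \<omega> \<partial>P) = (\<integral>\<omega>. indicat_real (cyl 0 (w @ u)) \<omega> \<partial>P)"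
   by (intro Bochner_Integration.integral_cong) (auto simp: cyl_append indicator_def)
  then show "(\<integral>\<omega>. indicat_real (cyl (int (length w)) u) \<omega> * indicator (cyl 0 w) \<omega> \<partial>P) = pl (w @ u)"
   by (simp add: prob_cyl)
 qed
 finally show ?thesis by simp
qed

lemma pl_Nil: "pl [] = 1" by (simp add: pl_def cyl_def prob_space)

lemma cond0_nonneg: "0 \<le> cond0 P X i w"
proof -
 have "convergent (cp_ratio P X i w)" using C_chain by (simp add: C_chain_def)
 then have "cp_ratio P X i w \<longlonglongrightarrow> cond0 P X i w" by (simp add: convergent_LIMSEQ_iff cond0_def)
 then show ?thesis by (rule tendsto_lowerbound) (auto simp: cp_ratio_def)
qed

lemma cond0_version: "cond_prob_version P (past X) seqM (\<lambda>\<omega>. X 0 \<omega> = i) (cond0 P X i)"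
 using C_chain by (simp add: C_chain_def)

lemma cond0_integrable: "integrable P (\<lambda>\<omega>. cond0 P X i (past X \<omega>))"
 using cond0_version by (simp add: cond_prob_version_def)

text \<open>Turns the conditional probability, given only as a version, into cylinder probabilities.
  Words are written in chronological order whereas the past is indexed backwards, hence the
  reversal.\<close>

lemma cond0_word: "pl (v @ [i]) = (\<integral>\<omega>. indicator (cyl (- int (length v)) v) \<omega> * cond0 P X i (past X \<omega>) \<partial>P)"
proof -
 define B where "B = {w :: nat \<Rightarrow> 'd. \<forall>k<length v. w k = rev v ! k}"
 have "B = {w \<in> space (PiM UNIV (\<lambda>_::nat. count_space (UNIV::'d set))). \<forall>k<length v. w k = rev v ! k}"
  by (auto simp: B_def space_PiM)
 also have "\<dots> \<in> sets (PiM UNIV (\<lambda>_::nat. count_space (UNIV::'d set)))"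
  by measurable
 finally have B: "B \<in> sets seqM" by (simp add: seqM_def)
 have pB: "past X \<omega> \<in> B \<longleftrightarrow> \<omega> \<in> cyl (- int (length v)) v" if "\<omega> \<in> space P" for \<omega>
 proof -
  have "past X \<omega> \<in> B \<longleftrightarrow> (\<forall>k<length v. X (- int k - 1) \<omega> = v ! (length v - Suc k))"
   by (auto simp: B_def past_def rev_nth)
  also have "\<dots> \<longleftrightarrow> (\<forall>j<length v. X (- int (length v) + int j) \<omega> = v ! j)"
  proof (intro iffI allI impI)
   fix j assume a: "\<forall>k<length v. X (- int k - 1) \<omega> = v ! (length v - Suc k)" and j: "j < length v"
   have "- int (length v - Suc j) - 1 = - int (length v) + int j" using j by (simp add: of_nat_diff)
   moreover have "length v - Suc (length v - Suc j) = j" using j by simp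
   ultimately show "X (- int (length v) + int j) \<omega> = v ! j" using a[rule_format, of "length v - Suc j"] j by simp
  next
   fix j assume a: "\<forall>k<length v. X (- int (length v) + int k) \<omega> = v ! k" and j: "j < length v"
   have "- int (length v) + int (length v - Suc j) = - int j - 1" using j by (simp add: of_nat_diff)
   moreover have "length v - Suc j < length v" using j by simp
   ultimately show "X (- int j - 1) \<omega> = v ! (length v - Suc j)" using a by metis
  qed
  finally show ?thesis using that by (simp add: cyl_def)
 qed
 have "(\<integral>\<omega>. indicator {\<omega>\<in>space P. past X \<omega> \<in> B} \<omega> * cond0 P X i (past X \<omega>) \<partial>P)
   = prob {\<omega>\<in>space P. X 0 \<omega> = i \<and> past X \<omega> \<in> B}"
  using cond0_version[of i] B by (simp add: cond_prob_version_def)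
 moreover have "{\<omega>\<in>space P. past X \<omega> \<in> B} = cyl (- int (length v)) v"
  using pB by (auto simp: cyl_def)
 moreover have "{\<omega>\<in>space P. X 0 \<omega> = i \<and> past X \<omega> \<in> B} = cyl (- int (length v)) (v @ [i])"
  unfolding cyl_append using pB by (auto simp: cyl_def)
 ultimately show ?thesis by (simp add: prob_cyl)
qed

text \<open>If the conditional probability vanished at one past but not at another, their
  extended-real quotient would be infinite and so would \<open>gamma P X 0\<close>. It cannot vanish
  at all pasts, as each symbol has positive probability.\<close>

lemma cond0_pos: "0 < cond0 P X i w"
proof (rule ccontr)
 assume "\<not> ?thesis"
 then have w: "cond0 P X i w = 0" using cond0_nonneg[of i w] by simp
 have "\<exists>v. cond0 P X i v \<noteq> 0"
 proof (rule ccontr)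
  assume "\<not> ?thesis"
  then have "pl [i] = 0" using cond0_word[of "[]" i] by simp
  then show False using pl_pos[of "[i]"] by simp
 qed
 then obtain v where v: "0 < cond0 P X i v" using cond0_nonneg[of i] less_le by metis
 have "\<bar>ereal (cond0 P X i v) / ereal (cond0 P X i w) - 1\<bar> \<le> gamma P X 0"
  unfolding gamma_def by (intro Sup_upper) blast
 moreover have "\<bar>ereal (cond0 P X i v) / ereal (cond0 P X i w) - 1\<bar> = \<infinity>" using v w by (simp add: divide_ereal_def)
 moreover have "gamma P X 0 < \<infinity>" using C_chain by (simp add: C_chain_def)
 ultimately show False by simp
qed

lemma cond0_ratio: "\<exists>C \<rho>. 0 \<le> C \<and> 0 < \<rho> \<and> \<rho> < 1 \<and>
 (\<forall>n i w v. (\<forall>k<n. w k = v k) \<longrightarrow> cond0 P X i w \<le> exp (C * \<rho> ^ n) * cond0 P X i v)"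
proof -
 have el: "\<bar>ereal (cond0 P X i w) / ereal (cond0 P X i v) - 1\<bar> \<le> gamma P X n" if "\<forall>k<n. w k = v k" for n i w v
  unfolding gamma_def by (intro Sup_upper) (use that in blast)
 have "0 \<le> gamma P X n" for n
  by (rule order_trans[OF abs_ereal_pos el[of n undefined undefined]]) simp
 then obtain C \<rho> where C: "0 \<le> C" "0 < \<rho>" "\<rho> < 1" "\<And>n. gamma P X n \<le> ereal (C * \<rho> ^ n)"
  using eln_limsup_decay[of "gamma P X"] C_chain by (auto simp: C_chain_def)
 have "cond0 P X i w \<le> exp (C * \<rho> ^ n) * cond0 P X i v" if wv: "\<forall>k<n. w k = v k" for n i w v
 proof -
  have "ereal \<bar>cond0 P X i w / cond0 P X i v - 1\<bar> = \<bar>ereal (cond0 P X i w) / ereal (cond0 P X i v) - 1\<bar>"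
   using cond0_pos[of i v] by (simp add: one_ereal_def)
  also have "\<dots> \<le> ereal (C * \<rho> ^ n)" using el[OF wv] C(4) order_trans by blast
  finally have "cond0 P X i w / cond0 P X i v - 1 \<le> C * \<rho> ^ n" by simp
  then have "cond0 P X i w / cond0 P X i v \<le> exp (C * \<rho> ^ n)"
   using exp_ge_add_one_self[of "C * \<rho> ^ n"] by linarith
  then show ?thesis using cond0_pos[of i v] by (simp add: divide_le_eq)
 qed
 then show ?thesis using C by blast
qed

definition CC where "CC = (SOME C. 0 \<le> C \<and> (\<exists>\<rho>. 0 < \<rho> \<and> \<rho> < 1 \<and>
 (\<forall>n i w v. (\<forall>k<n. w k = v k) \<longrightarrow> cond0 P X i w \<le> exp (C * \<rho> ^ n) * cond0 P X i v)))"
definition \<rho> where "\<rho> = (SOME \<rho>. 0 < \<rho> \<and> \<rho> < 1 \<and>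
 (\<forall>n i w v. (\<forall>k<n. w k = v k) \<longrightarrow> cond0 P X i w \<le> exp (CC * \<rho> ^ n) * cond0 P X i v))"

lemma CC_rho: "0 \<le> CC" "0 < \<rho>" "\<rho> < 1"
 "(\<forall>k<n. w k = v k) \<Longrightarrow> cond0 P X i w \<le> exp (CC * \<rho> ^ n) * cond0 P X i v"
proof -
 have 1: "0 \<le> CC \<and> (\<exists>\<rho>. 0 < \<rho> \<and> \<rho> < 1 \<and>
 (\<forall>n i w v. (\<forall>k<n. w k = v k) \<longrightarrow> cond0 P X i w \<le> exp (CC * \<rho> ^ n) * cond0 P X i v))"
  unfolding CC_def by (rule someI_ex) (use cond0_ratio in blast)
 then show "0 \<le> CC" by blast
 have 2: "0 < \<rho> \<and> \<rho> < 1 \<and>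
 (\<forall>n i w v. (\<forall>k<n. w k = v k) \<longrightarrow> cond0 P X i w \<le> exp (CC * \<rho> ^ n) * cond0 P X i v)"
  unfolding \<rho>_def by (rule someI_ex) (use 1 in blast)
 then show "0 < \<rho>" "\<rho> < 1"
  "(\<forall>k<n. w k = v k) \<Longrightarrow> cond0 P X i w \<le> exp (CC * \<rho> ^ n) * cond0 P X i v" by blast+
qed

text \<open>The probability of the next symbol varies by at most the stated factor over all pasts
  ending in \<open>v\<close>; averaging this pointwise comparison over the two cylinders gives the
  inequality. The cross-multiplied form is what composes when further symbols are appended.\<close>

lemma pl_step: "pl (u @ v @ [i]) * pl (u' @ v) \<le> exp (CC * \<rho> ^ length v) * (pl (u' @ v @ [i]) * pl (u @ v))"
proof -
 define n where "n = length v"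
 define F where "F = (\<lambda>\<omega>. cond0 P X i (past X \<omega>))"
 define c1 c2 where "c1 = cyl (- int (length (u @ v))) (u @ v)" and "c2 = cyl (- int (length (u' @ v))) (u' @ v)"
 have intF: "integrable P F" unfolding F_def by (rule cond0_integrable)
 have intF': "integrable P (\<lambda>\<omega>. indicator (cyl k w) \<omega> * F \<omega>)" for k w
  using integrable_mult_indicator[OF cyl_sets intF, of k w] by simp
 have in_v: "\<omega> \<in> cyl (- int (length v)) v" if "\<omega> \<in> cyl (- int (length (a @ v))) (a @ v)" for a \<omega>
  using that by (simp add: cyl_append)
 have past_v: "past X \<omega> k = rev v ! k" if "\<omega> \<in> cyl (- int (length v)) v" "k < n" for \<omega> k
 proof -
  have "X (- int (length v) + int (length v - Suc k)) \<omega> = v ! (length v - Suc k)"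
   using that by (intro cylD) (auto simp: n_def)
  moreover have "- int (length v) + int (length v - Suc k) = - int k - 1" using that(2) by (simp add: of_nat_diff n_def)
  ultimately have "X (- int k - 1) \<omega> = v ! (length v - Suc k)" by (simp only:)
  then show ?thesis using that(2) unfolding past_def by (simp add: rev_nth n_def)
 qed
 have cmp: "F \<omega> \<le> exp (CC * \<rho> ^ n) * F \<omega>'" if "\<omega> \<in> c1" "\<omega>' \<in> c2" for \<omega> \<omega>'
  unfolding F_def using past_v[OF in_v] that by (intro CC_rho(4)) (simp add: c1_def c2_def)
 have 1: "pl (u @ v @ [i]) \<le> exp (CC * \<rho> ^ n) * F \<omega>' * pl (u @ v)" if "\<omega>' \<in> c2" for \<omega>'
 proof -
  have "pl (u @ v @ [i]) = (\<integral>\<omega>. indicator c1 \<omega> * F \<omega> \<partial>P)"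
   using cond0_word[of "u @ v" i] by (simp add: c1_def F_def)
  also have "\<dots> \<le> (\<integral>\<omega>. indicator c1 \<omega> * (exp (CC * \<rho> ^ n) * F \<omega>') \<partial>P)"
   using cmp[OF _ that] unfolding c1_def
   by (intro integral_mono intF' integrable_mult_left cyl_integrable) (auto simp: indicator_def)
  also have "\<dots> = exp (CC * \<rho> ^ n) * F \<omega>' * pl (u @ v)" by (simp add: c1_def prob_cyl)
  finally show ?thesis .
 qed
 have "pl (u @ v @ [i]) * pl (u' @ v) = (\<integral>\<omega>. indicator c2 \<omega> * pl (u @ v @ [i]) \<partial>P)" by (simp add: c2_def prob_cyl)
 also have "\<dots> \<le> (\<integral>\<omega>. exp (CC * \<rho> ^ n) * pl (u @ v) * (indicator c2 \<omega> * F \<omega>) \<partial>P)"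
  using 1 unfolding c2_def
  by (intro integral_mono integrable_mult_right intF' integrable_mult_left cyl_integrable) (auto simp: indicator_def mult_ac)
 also have "\<dots> = exp (CC * \<rho> ^ n) * pl (u @ v) * pl (u' @ v @ [i])"
  using cond0_word[of "u' @ v" i] by (simp add: c2_def F_def)
 finally show ?thesis by (simp add: n_def mult_ac)
qed

definition BB where "BB = CC / (1 - \<rho>)"

lemma BB_nonneg: "0 \<le> BB" using CC_rho by (simp add: BB_def)

text \<open>Appending a symbol after a common block of length \<open>n\<close> costs
  \<open>CC * \<rho> ^ n = BB * (\<rho> ^ n - \<rho> ^ Suc n)\<close>, so the exponents telescope
  along \<open>w\<close>.\<close>

lemma pl_cross: "pl (u @ v @ w) * pl (u' @ v) \<le> exp (BB * (\<rho> ^ length v - \<rho> ^ (length v + length w))) * (pl (u' @ v @ w) * pl (u @ v))"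
proof (induction w rule: rev_induct)
 case Nil then show ?case by (simp add: mult.commute)
next
 case (snoc i w)
 define n where "n = length v + length w"
 have BC: "BB * (\<rho> ^ length v - \<rho> ^ n) + CC * \<rho> ^ n = BB * (\<rho> ^ length v - \<rho> ^ Suc n)"
 proof -
  have "CC = BB * (1 - \<rho>)" using CC_rho by (simp add: BB_def)
  then have "BB * (\<rho> ^ length v - \<rho> ^ n) + CC * \<rho> ^ n = BB * (\<rho> ^ length v - \<rho> ^ n) + BB * (1 - \<rho>) * \<rho> ^ n" by simp
  then show ?thesis by (simp add: algebra_simps)
 qed
 have "pl (u @ v @ w @ [i]) * pl (u' @ v) * pl (u' @ v @ w) \<le> exp (CC * \<rho> ^ n) * (pl (u' @ v @ w @ [i]) * pl (u @ v @ w)) * pl (u' @ v)"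
  using pl_step[of u "v @ w" i u'] pl_pos[of "u' @ v"] by (simp add: n_def mult_ac mult_left_mono)
 also have "\<dots> = exp (CC * \<rho> ^ n) * pl (u' @ v @ w @ [i]) * (pl (u @ v @ w) * pl (u' @ v))" by simp
 also have "\<dots> \<le> exp (CC * \<rho> ^ n) * pl (u' @ v @ w @ [i]) * (exp (BB * (\<rho> ^ length v - \<rho> ^ n)) * (pl (u' @ v @ w) * pl (u @ v)))"
  using snoc.IH pl_pos[of "u' @ v @ w @ [i]"] by (intro mult_left_mono) (auto simp: n_def)
 also have "\<dots> = exp (BB * (\<rho> ^ length v - \<rho> ^ n) + CC * \<rho> ^ n) * (pl (u' @ v @ w @ [i]) * pl (u @ v)) * pl (u' @ v @ w)"
  by (simp add: exp_add mult_ac)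
 finally show ?case unfolding BC using pl_pos[of "u' @ v @ w"] by (simp add: n_def)
qed

text \<open>Given the block \<open>v\<close>, the words on its two sides are independent up to a
  factor tending to 1 geometrically. The statement is symmetric in time, although the hypothesis
  concerns only the influence of the past on the present; this permits conditioning on the
  future.\<close>

lemma pl_split:
 "pl (u @ v @ w) * pl v \<le> exp (BB * \<rho> ^ length v) * (pl (v @ w) * pl (u @ v))"
 "pl (v @ w) * pl (u @ v) \<le> exp (BB * \<rho> ^ length v) * (pl (u @ v @ w) * pl v)"
proof -
 have e: "exp (BB * (\<rho> ^ length v - \<rho> ^ (length v + length w))) \<le> exp (BB * \<rho> ^ length v)"
  using BB_nonneg CC_rho by (auto intro!: mult_left_mono)
 show "pl (u @ v @ w) * pl v \<le> exp (BB * \<rho> ^ length v) * (pl (v @ w) * pl (u @ v))"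
  by (rule order_trans[OF pl_cross[of u v w "[]", unfolded append_Nil] mult_right_mono[OF e]]) (simp add: pl_pos less_imp_le)
 show "pl (v @ w) * pl (u @ v) \<le> exp (BB * \<rho> ^ length v) * (pl (u @ v @ w) * pl v)"
  by (rule order_trans[OF pl_cross[of "[]" v w u, unfolded append_Nil] mult_right_mono[OF e]]) (simp add: pl_pos less_imp_le)
qed

section \<open>The conditional law of the past given the future\<close>

definition pre :: "nat \<Rightarrow> (nat \<Rightarrow> 'd) \<Rightarrow> 'd list" where "pre n x = map x [0..<n]"

lemma pre_length [simp]: "length (pre n x) = n" by (simp add: pre_def)

lemma pre_0 [simp]: "pre 0 x = []" by (simp add: pre_def)

lemma pre_add: "pre (n + k) x = pre n x @ pre k (\<lambda>j. x (n + j))"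
 by (induction k) (simp_all add: pre_def)

lemma pre_cons: "pre (Suc n) (cons j x) = j # pre n x"
 by (induction n) (simp_all add: pre_def)

lemma pre_cong: "(\<forall>k<n. x k = y k) \<Longrightarrow> pre n x = pre n y"
 by (auto simp: pre_def)

text \<open>The word \<open>u\<close> is listed backwards in time, its head being the symbol at time
  -1, so that prepending symbols to the future corresponds to reading \<open>u\<close> from the
  left.\<close>

definition Pcn :: "'d list \<Rightarrow> (nat \<Rightarrow> 'd) \<Rightarrow> nat \<Rightarrow> real" where
 "Pcn u x n = pl (rev u @ pre n x) / pl (pre n x)"

definition Pc :: "'d list \<Rightarrow> (nat \<Rightarrow> 'd) \<Rightarrow> real" where "Pc u x = lim (Pcn u x)"

lemma Pcn_pos: "0 < Pcn u x n" by (simp add: Pcn_def pl_pos)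

lemma frac_cross_le: "0 < b \<Longrightarrow> 0 < d \<Longrightarrow> a * d \<le> e * (b * c) \<Longrightarrow> a / b \<le> e * (c / d)" for a b c d e :: real
 by (simp add: divide_le_eq le_divide_eq mult_ac)

lemma Pcn_cmp: "Pcn u x (n + k) \<le> exp (BB * \<rho> ^ n) * Pcn u x n \<and> Pcn u x n \<le> exp (BB * \<rho> ^ n) * Pcn u x (n + k)"
proof -
 define w where "w = pre k (\<lambda>j. x (n + j))"
 define v where "v = pre n x"
 have l: "length v = n" by (simp add: v_def)
 have e1: "Pcn u x (n + k) = pl (rev u @ v @ w) / pl (v @ w)"
  unfolding Pcn_def pre_add v_def w_def ..
 have e2: "Pcn u x n = pl (rev u @ v) / pl v" unfolding Pcn_def v_def ..
 have "pl (rev u @ v @ w) / pl (v @ w) \<le> exp (BB * \<rho> ^ n) * (pl (rev u @ v) / pl v)"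
  by (rule frac_cross_le[OF pl_pos pl_pos]) (use pl_split(1)[of "rev u" v w] in \<open>simp only: l\<close>)
 moreover have "pl (rev u @ v) / pl v \<le> exp (BB * \<rho> ^ n) * (pl (rev u @ v @ w) / pl (v @ w))"
  by (rule frac_cross_le[OF pl_pos pl_pos]) (use pl_split(2)[of v w "rev u"] in \<open>simp only: l mult.commute\<close>)
 ultimately show ?thesis unfolding e1 e2 by blast
qed

lemma Pc_lim: "Pcn u x \<longlonglongrightarrow> Pc u x" and Pc_pos: "0 < Pc u x"
 and Pc_cmp: "Pc u x \<le> exp (BB * \<rho> ^ n) * Pcn u x n" "Pcn u x n \<le> exp (BB * \<rho> ^ n) * Pc u x"
proof -
 have "\<exists>l. Pcn u x \<longlonglongrightarrow> l \<and> 0 < l \<and> (\<forall>n. l \<le> exp (BB * \<rho> ^ n) * Pcn u x n \<and> Pcn u x n \<le> exp (BB * \<rho> ^ n) * l)"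
  by (rule ratio_cauchy[OF Pcn_pos CC_rho(2,3) BB_nonneg Pcn_cmp])
 then obtain l where l: "Pcn u x \<longlonglongrightarrow> l" "0 < l" "\<And>n. l \<le> exp (BB * \<rho> ^ n) * Pcn u x n \<and> Pcn u x n \<le> exp (BB * \<rho> ^ n) * l"
  by blast
 have eq: "Pc u x = l" unfolding Pc_def by (rule limI[OF l(1)])
 show "Pcn u x \<longlonglongrightarrow> Pc u x" "0 < Pc u x" "Pc u x \<le> exp (BB * \<rho> ^ n) * Pcn u x n" "Pcn u x n \<le> exp (BB * \<rho> ^ n) * Pc u x"
  unfolding eq using l(1,2) l(3)[of n] by blast+
qed

lemma Pc_Nil [simp]: "Pc [] x = 1"
proof -
 have "Pcn [] x n = 1" for n using pl_pos[of "pre n x"] by (simp add: Pcn_def)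
 then have "Pcn [] x = (\<lambda>n. 1)" by (rule ext)
 then show ?thesis using Pc_lim[of "[]" x] by (simp add: LIMSEQ_const_iff)
qed

lemma Pc_le: "Pc u x \<le> exp BB * pl (rev u)" "pl (rev u) \<le> exp BB * Pc u x"
 using Pc_cmp[of u x 0] by (simp_all add: Pcn_def pl_Nil)

lemma Pc_ratio:
 assumes xy: "\<forall>k<n. x k = y k"
 shows "Pc u x \<le> exp (2 * BB * \<rho> ^ n) * Pc u y"
proof -
 have eq: "Pcn u x n = Pcn u y n" using pre_cong[OF xy] by (simp add: Pcn_def)
 have "Pc u x \<le> exp (BB * \<rho> ^ n) * Pcn u y n" using Pc_cmp(1)[of u x n] unfolding eq .
 also have "\<dots> \<le> exp (BB * \<rho> ^ n) * (exp (BB * \<rho> ^ n) * Pc u y)"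
  by (intro mult_left_mono Pc_cmp) simp
 also have "\<dots> = exp (2 * BB * \<rho> ^ n) * Pc u y"
  by (simp add: mult_exp_exp mult.assoc[symmetric])
 finally show ?thesis .
qed

text \<open>The chain rule for the backward chain, inherited from an exact identity at finite
  length: one conditioning coordinate more is available after the first symbol has joined the
  future.\<close>

lemma Pc_Cons: "Pc (j # u) x = Pc [j] x * Pc u (cons j x)"
proof -
 have "Pcn (j # u) x n = Pcn [j] x n * Pcn u (cons j x) (Suc n)" for n
  using pl_pos[of "j # pre n x"] by (simp add: Pcn_def pre_cons)
 then have "(\<lambda>n. Pcn (j # u) x n) \<longlonglongrightarrow> Pc [j] x * Pc u (cons j x)"
  by (simp only:) (intro tendsto_mult Pc_lim LIMSEQ_Suc[OF Pc_lim])
 then show ?thesis using Pc_lim LIMSEQ_unique by blast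
qed

lemma sum_wds_Suc: "(\<Sum>u\<in>wds (Suc n). f u) = (\<Sum>j\<in>UNIV. \<Sum>u\<in>wds n. f (j # u))"
proof -
 have "(\<Sum>u\<in>wds (Suc n). f u) = (\<Sum>(j, u)\<in>UNIV \<times> wds n. f (j # u))"
  by (rule sum.reindex_bij_witness[where i="\<lambda>(j, u). j # u" and j="\<lambda>w. (hd w, tl w)"]) (auto simp: wds_def length_Suc_conv)
 then show ?thesis by (simp add: sum.cartesian_product)
qed

lemma wds_rev: "rev ` wds n = wds n"
proof -
 have "w \<in> rev ` wds n" if "w \<in> wds n" for w using that by (intro image_eqI[of _ _ "rev w"]) (auto simp: wds_def)
 then show ?thesis by (auto simp: wds_def)
qed

lemma sum_wds_rev: "(\<Sum>u\<in>wds n. f (rev u)) = (\<Sum>u\<in>wds n. f u)"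
 using sum.reindex[of rev "wds n" f] by (simp add: wds_rev)

lemma Pc_sum: "(\<Sum>u\<in>wds n. Pc u x) = 1"
proof -
 have "(\<Sum>u\<in>wds n. Pcn u x k) = 1" for k
 proof -
  have "(\<Sum>u\<in>wds n. Pcn u x k) = (\<Sum>u\<in>wds n. pl (rev u @ pre k x)) / pl (pre k x)" by (simp add: Pcn_def sum_divide_distrib)
  also have "\<dots> = 1" using sum_wds_rev[of "\<lambda>u. pl (u @ pre k x)" n] sum_pl_prefix pl_pos[of "pre k x"] by simp
  finally show ?thesis .
 qed
 moreover have "(\<lambda>k. \<Sum>u\<in>wds n. Pcn u x k) \<longlonglongrightarrow> (\<Sum>u\<in>wds n. Pc u x)" by (intro tendsto_intros Pc_lim)
 ultimately show ?thesis by (simp add: LIMSEQ_const_iff)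
qed

lemma Pc_sum1: "(\<Sum>j\<in>UNIV. Pc [j] x) = 1"
 using Pc_sum[where n="Suc 0" and x=x] by (simp add: sum_wds_Suc[of _ 0, simplified])

text \<open>The density of the joint law of \<open>n\<close> past and \<open>n\<close> future
  symbols with respect to the product of the marginals; its limit \<open>Psi\<close> makes sense for
  every pair of sequences.\<close>

definition Psin :: "(nat \<Rightarrow> 'd) \<Rightarrow> (nat \<Rightarrow> 'd) \<Rightarrow> nat \<Rightarrow> real" where
 "Psin y x n = pl (rev (pre n y) @ pre n x) / (pl (rev (pre n y)) * pl (pre n x))"

definition Psi :: "(nat \<Rightarrow> 'd) \<Rightarrow> (nat \<Rightarrow> 'd) \<Rightarrow> real" where "Psi y x = lim (Psin y x)"

lemma Psin_pos: "0 < Psin y x n" by (simp add: Psin_def pl_pos)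

text \<open>Both sides are lengthened at once, so near independence is used three times: across the
  whole middle block, across its past half and across its future half. This is the origin of the
  factor 3.\<close>

lemma Psin_cmp: "Psin y x (n + k) \<le> exp (3 * BB * \<rho> ^ n) * Psin y x n \<and> Psin y x n \<le> exp (3 * BB * \<rho> ^ n) * Psin y x (n + k)"
proof -
 define e where "e = exp (BB * \<rho> ^ n)"
 have e: "0 < e" "exp (3 * BB * \<rho> ^ n) = e * e * e" by (auto simp: e_def exp_add[symmetric])
 have en: "exp (BB * \<rho> ^ length (rev (pre n y))) = e" "exp (BB * \<rho> ^ length (pre n x)) = e" by (simp_all add: e_def)
 define u where "u = rev (pre k (\<lambda>j. y (n + j)))"
 define w where "w = pre k (\<lambda>j. x (n + j))"
 define v1 where "v1 = rev (pre n y)"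
 define v2 where "v2 = pre n x"
 have e2: "exp (BB * \<rho> ^ length (v1 @ v2)) \<le> e"
 proof -
  have "\<rho> ^ (n + n) \<le> \<rho> ^ n" using CC_rho by (intro power_decreasing) auto
  then show ?thesis using BB_nonneg by (auto simp: e_def v1_def v2_def intro!: mult_left_mono)
 qed
 have pos: "0 < pl w" for w by (rule pl_pos)
 define A where "A = pl (u @ v1 @ v2 @ w)"
 define a where "a = pl (v1 @ v2)"
 define b1 where "b1 = pl (u @ v1)"
 define b2 where "b2 = pl v1"
 define c1 where "c1 = pl (v2 @ w)"
 define c2 where "c2 = pl v2"
 define p1 where "p1 = pl (u @ v1 @ v2)"
 define p2 where "p2 = pl (v1 @ v2 @ w)"
 have P: "0 < A" "0 < a" "0 < b1" "0 < b2" "0 < c1" "0 < c2" "0 < p1" "0 < p2"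
  by (simp_all add: A_def a_def b1_def b2_def c1_def c2_def p1_def p2_def pos)
 \<comment> \<open>The middle block here has length \<open>2 * n\<close>, so its error is even
   smaller; it is weakened to \<open>e\<close> for uniformity with the other two.\<close>
 have s1: "A * a \<le> e * (p2 * p1)" "p2 * p1 \<le> e * (A * a)"
 proof -
  have "A * a \<le> exp (BB * \<rho> ^ length (v1 @ v2)) * (p2 * p1)"
   using pl_split(1)[of u "v1 @ v2" w] by (simp add: A_def a_def p1_def p2_def)
  also have "\<dots> \<le> e * (p2 * p1)" using P by (intro mult_right_mono e2) auto
  finally show "A * a \<le> e * (p2 * p1)" .
  have "p2 * p1 \<le> exp (BB * \<rho> ^ length (v1 @ v2)) * (A * a)"
   using pl_split(2)[of "v1 @ v2" w u] by (simp add: A_def a_def p1_def p2_def)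
  also have "\<dots> \<le> e * (A * a)" using P by (intro mult_right_mono e2) auto
  finally show "p2 * p1 \<le> e * (A * a)" .
 qed
 have s2: "p1 * b2 \<le> e * (a * b1)" "a * b1 \<le> e * (p1 * b2)"
  using pl_split(1)[of u v1 v2] pl_split(2)[of v1 v2 u] en unfolding p1_def b2_def a_def b1_def by (simp_all add: v1_def)
 have s3: "p2 * c2 \<le> e * (c1 * a)" "c1 * a \<le> e * (p2 * c2)"
  using pl_split(1)[of v1 v2 w] pl_split(2)[of v2 w v1] en unfolding p2_def c2_def a_def c1_def by (simp_all add: v2_def)
 have "A / (b1 * c1) \<le> e * e * e * (a / (b2 * c2))"
 proof -
  have "(A * a) * (b2 * c2) \<le> e * (p2 * p1) * (b2 * c2)" using s1 P by (intro mult_right_mono) auto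
  also have "\<dots> = e * (p1 * b2) * (p2 * c2)" by simp
  also have "\<dots> \<le> e * (e * (a * b1)) * (e * (c1 * a))"
   by (rule mult_mono[OF mult_left_mono[OF s2(1)] s3(1)]) (use P e in auto)
  finally have "a * (A * (b2 * c2)) \<le> a * (e * e * e * a * (b1 * c1))" by (simp add: mult_ac)
  then have "A * (b2 * c2) \<le> e * e * e * a * (b1 * c1)" using P by simp
  then have "A * (b2 * c2) \<le> e * e * e * ((b1 * c1) * a)" by (simp only: mult_ac)
  then show ?thesis using P by (intro frac_cross_le) auto
 qed
 moreover have "a / (b2 * c2) \<le> e * e * e * (A / (b1 * c1))"
 proof -
  have "(a * b1) * (c1 * a) \<le> (e * (p1 * b2)) * (e * (p2 * c2))"
   by (rule mult_mono[OF s2(2) s3(2)]) (use P e in auto)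
  also have "\<dots> = e * e * (b2 * c2) * (p2 * p1)" by simp
  also have "\<dots> \<le> e * e * (b2 * c2) * (e * (A * a))" using s1 P e by (intro mult_left_mono) auto
  finally have "a * (a * (b1 * c1)) \<le> a * (e * e * e * A * (b2 * c2))" by (simp add: mult_ac)
  then have "a * (b1 * c1) \<le> e * e * e * A * (b2 * c2)" using P by simp
  then have "a * (b1 * c1) \<le> e * e * e * ((b2 * c2) * A)" by (simp only: mult_ac)
  then show ?thesis using P by (intro frac_cross_le) auto
 qed
 moreover have "Psin y x (n + k) = A / (b1 * c1)" "Psin y x n = a / (b2 * c2)"
  unfolding Psin_def pre_add A_def a_def b1_def b2_def c1_def c2_def u_def v1_def v2_def w_def by simp_all
 ultimately show ?thesis unfolding e(2) by simp
qed

lemma Psi_lim: "Psin y x \<longlonglongrightarrow> Psi y x" and Psi_pos: "0 < Psi y x"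
 and Psi_cmp: "Psi y x \<le> exp (3 * BB * \<rho> ^ n) * Psin y x n" "Psin y x n \<le> exp (3 * BB * \<rho> ^ n) * Psi y x"
proof -
 have "\<exists>l. Psin y x \<longlonglongrightarrow> l \<and> 0 < l \<and> (\<forall>n. l \<le> exp (3 * BB * \<rho> ^ n) * Psin y x n \<and> Psin y x n \<le> exp (3 * BB * \<rho> ^ n) * l)"
  by (rule ratio_cauchy[OF Psin_pos CC_rho(2,3) _ Psin_cmp]) (simp add: BB_nonneg)
 then obtain l where l: "Psin y x \<longlonglongrightarrow> l" "0 < l" "\<And>n. l \<le> exp (3 * BB * \<rho> ^ n) * Psin y x n \<and> Psin y x n \<le> exp (3 * BB * \<rho> ^ n) * l"
  by blast
 have eq: "Psi y x = l" unfolding Psi_def by (rule limI[OF l(1)])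
 show "Psin y x \<longlonglongrightarrow> Psi y x" "0 < Psi y x" "Psi y x \<le> exp (3 * BB * \<rho> ^ n) * Psin y x n" "Psin y x n \<le> exp (3 * BB * \<rho> ^ n) * Psi y x"
  unfolding eq using l(1,2) l(3)[of n] by blast+
qed

lemma Psi_bounds: "exp (- (3 * BB)) \<le> Psi y x" "Psi y x \<le> exp (3 * BB)"
 using Psi_cmp[of y x 0] by (simp_all add: Psin_def pl_Nil exp_minus inverse_eq_divide divide_le_eq mult.commute)

lemma Psin_bounds: "Psin y x n \<le> exp (6 * BB)"
proof -
 have "\<rho> ^ n \<le> 1" using CC_rho by (intro power_le_one) auto
 then have "3 * BB * \<rho> ^ n \<le> 3 * BB" using BB_nonneg by (intro mult_left_le) auto
 then have "exp (3 * BB * \<rho> ^ n) \<le> exp (3 * BB)" by simp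
 then have "exp (3 * BB * \<rho> ^ n) * Psi y x \<le> exp (3 * BB) * exp (3 * BB)" using Psi_bounds Psi_pos[of y x] by (intro mult_mono) auto
 then show ?thesis using Psi_cmp(2)[of y x n] by (simp add: exp_add[symmetric])
qed

lemma Psi_ratio:
 assumes xy: "\<forall>k<n. x k = x' k"
 shows "Psi y x \<le> exp (6 * BB * \<rho> ^ n) * Psi y x'"
proof -
 have eq: "Psin y x n = Psin y x' n" using pre_cong[OF xy] by (simp add: Psin_def)
 have "Psi y x \<le> exp (3 * BB * \<rho> ^ n) * Psin y x' n" using Psi_cmp(1)[of y x n] unfolding eq .
 also have "\<dots> \<le> exp (3 * BB * \<rho> ^ n) * (exp (3 * BB * \<rho> ^ n) * Psi y x')"
  by (intro mult_left_mono Psi_cmp) simp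
 also have "\<dots> = exp (6 * BB * \<rho> ^ n) * Psi y x'"
  by (simp add: mult_exp_exp mult.assoc[symmetric])
 finally show ?thesis .
qed

lemma pre_past: "rev (pre n (past X \<omega>)) = wd (- int n) n \<omega>"
 unfolding pre_def past_def wd_def
 by (rule nth_equalityI) (auto simp: rev_nth of_nat_diff intro!: arg_cong[where f="\<lambda>k. X k \<omega>"])

lemma wd_cyl: "\<omega> \<in> cyl k w \<Longrightarrow> wd k (length w) \<omega> = w"
 using in_cyl_iff[of \<omega> w "length w" k] cyl_space by blast

lemma wd_cyl_wds: "w \<in> wds n \<Longrightarrow> \<omega> \<in> cyl k w \<Longrightarrow> wd k n \<omega> = w"
 using wd_cyl[of \<omega> k w] by (simp add: wds_def)

lemma Psin_word: "Psin (past X \<omega>) x n = (\<Sum>w\<in>wds n. indicator (cyl (- int n) w) \<omega> * (pl (w @ pre n x) / (pl w * pl (pre n x))))"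
 if "\<omega> \<in> space P"
proof -
 have "Psin (past X \<omega>) x n = (\<Sum>w\<in>wds n. indicator (cyl (- int n) w) \<omega> * Psin (past X \<omega>) x n)"
  using that by (rule indicator_partition)
 also have "\<dots> = (\<Sum>w\<in>wds n. indicator (cyl (- int n) w) \<omega> * (pl (w @ pre n x) / (pl w * pl (pre n x))))"
  by (intro sum.cong refl) (auto simp: Psin_def pre_past wd_cyl_wds indicator_def)
 finally show ?thesis .
qed

lemma Psin_measurable: "(\<lambda>\<omega>. Psin (past X \<omega>) x n) \<in> borel_measurable P"
 by (subst measurable_cong[OF Psin_word]) measurable

lemma Psi_measurable [measurable]: "(\<lambda>\<omega>. Psi (past X \<omega>) x) \<in> borel_measurable P"
 by (rule borel_measurable_LIMSEQ_real[OF Psi_lim Psin_measurable])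

text \<open>\<open>Psi\<close> in its first argument is the density, with respect to the law of the
  past, of the conditional law given the future \<open>x\<close>. At finite length the identity is
  exact, because summing over the more remote symbols removes them; dominated convergence does the
  rest.\<close>

lemma cyl_Psi: "(\<integral>\<omega>. indicator (cyl (- int (length u)) (rev u)) \<omega> * Psi (past X \<omega>) x \<partial>P) = Pc u x"
proof -
 define N where "N = length u"
 have fin: "(\<integral>\<omega>. indicator (cyl (- int N) (rev u)) \<omega> * Psin (past X \<omega>) x (N + k) \<partial>P) = Pcn u x (N + k)" for k
 proof -
  define n where "n = N + k"
  have int: "integrable P (\<lambda>\<omega>. indicator (cyl (- int N) (rev u)) \<omega> * Psin (past X \<omega>) x n)"
   using Psin_measurable[of x n] Psin_bounds[of _ x n] Psin_pos[of _ x n]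
   by (intro integrable_const_bound[where B="exp (6 * BB)"]) (auto simp: indicator_def less_imp_le)
  have "(\<integral>\<omega>. indicator (cyl (- int N) (rev u)) \<omega> * Psin (past X \<omega>) x n \<partial>P)
   = (\<Sum>v\<in>wds k. \<integral>\<omega>. indicator (cyl (- int n) v) \<omega> * (indicator (cyl (- int N) (rev u)) \<omega> * Psin (past X \<omega>) x n) \<partial>P)"
   by (rule integral_partition[OF int])
  also have "\<dots> = (\<Sum>v\<in>wds k. pl (v @ rev u @ pre n x) / pl (pre n x))"
  proof (intro sum.cong refl)
   fix v assume v: "v \<in> wds k"
   have c: "cyl (- int n) (v @ rev u) = cyl (- int n) v \<inter> cyl (- int N) (rev u)"
    using wds_length[OF v] by (simp add: cyl_append n_def)
   have "(\<integral>\<omega>. indicator (cyl (- int n) v) \<omega> * (indicator (cyl (- int N) (rev u)) \<omega> * Psin (past X \<omega>) x n) \<partial>P)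
    = (\<integral>\<omega>. indicator (cyl (- int n) (v @ rev u)) \<omega> * (pl (v @ rev u @ pre n x) / (pl (v @ rev u) * pl (pre n x))) \<partial>P)"
   proof (intro Bochner_Integration.integral_cong refl)
    fix \<omega>
    have "wd (- int n) n \<omega> = v @ rev u" if "\<omega> \<in> cyl (- int n) (v @ rev u)"
     using wd_cyl[OF that] wds_length[OF v] by (simp add: n_def N_def add.commute)
    then show "indicator (cyl (- int n) v) \<omega> * (indicator (cyl (- int N) (rev u)) \<omega> * Psin (past X \<omega>) x n) =
     indicator (cyl (- int n) (v @ rev u)) \<omega> * (pl (v @ rev u @ pre n x) / (pl (v @ rev u) * pl (pre n x)))"
     unfolding c by (auto simp: indicator_def Psin_def pre_past)
   qed
   also have "\<dots> = pl (v @ rev u @ pre n x) / pl (pre n x)"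
    using pl_pos[of "v @ rev u"] by (simp add: prob_cyl)
   finally show "(\<integral>\<omega>. indicator (cyl (- int n) v) \<omega> * (indicator (cyl (- int N) (rev u)) \<omega> * Psin (past X \<omega>) x n) \<partial>P)
    = pl (v @ rev u @ pre n x) / pl (pre n x)" .
  qed
  also have "\<dots> = Pcn u x n" by (simp add: sum_divide_distrib[symmetric] sum_pl_prefix Pcn_def)
  finally show ?thesis by (simp add: n_def)
 qed
 have L: "(\<lambda>k. \<integral>\<omega>. indicator (cyl (- int N) (rev u)) \<omega> * Psin (past X \<omega>) x (N + k) \<partial>P)
  \<longlonglongrightarrow> (\<integral>\<omega>. indicator (cyl (- int N) (rev u)) \<omega> * Psi (past X \<omega>) x \<partial>P)"
 proof (rule integral_dominated_convergence[where w="\<lambda>_. exp (6 * BB)"])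
  show "AE \<omega> in P. (\<lambda>k. indicator (cyl (- int N) (rev u)) \<omega> * Psin (past X \<omega>) x (N + k)) \<longlonglongrightarrow> indicator (cyl (- int N) (rev u)) \<omega> * Psi (past X \<omega>) x"
   using LIMSEQ_ignore_initial_segment[OF Psi_lim, of _ x N] by (intro AE_I2 tendsto_mult_left) (simp add: add.commute)
  show "AE \<omega> in P. norm (indicator (cyl (- int N) (rev u)) \<omega> * Psin (past X \<omega>) x (N + k)) \<le> exp (6 * BB)" for k
   using Psin_bounds[of _ x "N + k"] Psin_pos[of _ x "N + k"] by (intro AE_I2) (auto simp: indicator_def less_imp_le)
 qed (use Psin_measurable in \<open>auto intro!: borel_measurable_times\<close>)
 have "(\<lambda>k. Pcn u x (N + k)) \<longlonglongrightarrow> Pc u x"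
  using LIMSEQ_ignore_initial_segment[OF Pc_lim, of u x N] by (simp add: add.commute)
 from LIMSEQ_unique[OF L[unfolded fin] this] show ?thesis by (simp add: N_def)
qed

definition Xf :: "'a \<Rightarrow> nat \<Rightarrow> 'd" where "Xf \<omega> = (\<lambda>k. X (int k) \<omega>)"

lemma pre_Xf: "pre n (Xf \<omega>) = wd 0 n \<omega>"
 by (simp add: pre_def Xf_def wd_def)

lemma Pcn_Xf_word: "Pcn u (Xf \<omega>) n = (\<Sum>w\<in>wds n. indicator (cyl 0 w) \<omega> * (pl (rev u @ w) / pl w))"
 if "\<omega> \<in> space P"
proof -
 have "Pcn u (Xf \<omega>) n = (\<Sum>w\<in>wds n. indicator (cyl 0 w) \<omega> * Pcn u (Xf \<omega>) n)"
  using that by (rule indicator_partition)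
 also have "\<dots> = (\<Sum>w\<in>wds n. indicator (cyl 0 w) \<omega> * (pl (rev u @ w) / pl w))"
  by (intro sum.cong refl) (auto simp: Pcn_def pre_Xf wd_cyl_wds indicator_def)
 finally show ?thesis .
qed

lemma Pcn_Xf_measurable: "(\<lambda>\<omega>. Pcn u (Xf \<omega>) n) \<in> borel_measurable P"
 by (subst measurable_cong[OF Pcn_Xf_word]) measurable

lemma Pcn_bound: "Pcn u x n \<le> exp (2 * BB)"
proof -
 have "Pcn u x n \<le> exp (BB * \<rho> ^ 0) * Pcn u x 0" using Pcn_cmp[of u x 0 n] by simp
 also have "\<dots> \<le> exp (2 * BB) * 1"
 proof (intro mult_mono)
  show "Pcn u x 0 \<le> 1" unfolding Pcn_def pre_0 pl_Nil by (simp add: pl_def)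
 qed (use BB_nonneg Pcn_pos[of u x 0] in auto)
 finally show ?thesis by simp
qed

lemma Pc_Xf_measurable [measurable]: "(\<lambda>\<omega>. Pc u (Xf \<omega>)) \<in> borel_measurable P"
 by (rule borel_measurable_LIMSEQ_real[OF Pc_lim Pcn_Xf_measurable])

text \<open>The pointwise limit is a version of the conditional probability of a past word given the
  future. The integrals at finite length do not depend on the length, so the limit is
  immediate.\<close>

lemma cyl_Pc_Xf: "(\<integral>\<omega>. indicator (cyl 0 w) \<omega> * Pc u (Xf \<omega>) \<partial>P) = pl (rev u @ w)"
proof -
 define n where "n = length w"
 have fin: "(\<integral>\<omega>. indicator (cyl 0 w) \<omega> * Pcn u (Xf \<omega>) (n + k) \<partial>P) = pl (rev u @ w)" for k
 proof -
  have int: "integrable P (\<lambda>\<omega>. indicator (cyl 0 w) \<omega> * Pcn u (Xf \<omega>) (n + k))"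
   using Pcn_Xf_measurable[of u "n + k"] Pcn_bound[of u _ "n + k"] Pcn_pos[of u _ "n + k"]
   by (intro integrable_const_bound[where B="exp (2 * BB)"]) (auto simp: indicator_def less_imp_le)
  have "(\<integral>\<omega>. indicator (cyl 0 w) \<omega> * Pcn u (Xf \<omega>) (n + k) \<partial>P)
   = (\<Sum>v\<in>wds k. \<integral>\<omega>. indicator (cyl (int n) v) \<omega> * (indicator (cyl 0 w) \<omega> * Pcn u (Xf \<omega>) (n + k)) \<partial>P)"
   by (rule integral_partition[OF int])
  also have "\<dots> = (\<Sum>v\<in>wds k. pl ((rev u @ w) @ v))"
  proof (intro sum.cong refl)
   fix v assume v: "v \<in> wds k"
   have c: "cyl 0 (w @ v) = cyl 0 w \<inter> cyl (int n) v" by (simp add: cyl_append n_def)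
   have "(\<integral>\<omega>. indicator (cyl (int n) v) \<omega> * (indicator (cyl 0 w) \<omega> * Pcn u (Xf \<omega>) (n + k)) \<partial>P)
    = (\<integral>\<omega>. indicator (cyl 0 (w @ v)) \<omega> * (pl (rev u @ w @ v) / pl (w @ v)) \<partial>P)"
   proof (intro Bochner_Integration.integral_cong refl)
    fix \<omega>
    have "wd 0 (n + k) \<omega> = w @ v" if "\<omega> \<in> cyl 0 (w @ v)"
     using wd_cyl[OF that] wds_length[OF v] by (simp add: n_def)
    then show "indicator (cyl (int n) v) \<omega> * (indicator (cyl 0 w) \<omega> * Pcn u (Xf \<omega>) (n + k)) =
     indicator (cyl 0 (w @ v)) \<omega> * (pl (rev u @ w @ v) / pl (w @ v))"
     unfolding c by (auto simp: indicator_def Pcn_def pre_Xf)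
   qed
   also have "\<dots> = pl ((rev u @ w) @ v)" using pl_pos[of "w @ v"] by (simp add: prob_cyl)
   finally show "(\<integral>\<omega>. indicator (cyl (int n) v) \<omega> * (indicator (cyl 0 w) \<omega> * Pcn u (Xf \<omega>) (n + k)) \<partial>P) = pl ((rev u @ w) @ v)" .
  qed
  also have "\<dots> = pl (rev u @ w)" by (rule sum_pl_suffix)
  finally show ?thesis .
 qed
 have "(\<lambda>k. \<integral>\<omega>. indicator (cyl 0 w) \<omega> * Pcn u (Xf \<omega>) (n + k) \<partial>P) \<longlonglongrightarrow> (\<integral>\<omega>. indicator (cyl 0 w) \<omega> * Pc u (Xf \<omega>) \<partial>P)"
 proof (rule integral_dominated_convergence[where w="\<lambda>_. exp (2 * BB)"])
  show "AE \<omega> in P. (\<lambda>k. indicator (cyl 0 w) \<omega> * Pcn u (Xf \<omega>) (n + k)) \<longlonglongrightarrow> indicator (cyl 0 w) \<omega> * Pc u (Xf \<omega>)"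
   using LIMSEQ_ignore_initial_segment[OF Pc_lim, of u _ n] by (intro AE_I2 tendsto_mult_left) (simp add: add.commute)
  show "AE \<omega> in P. norm (indicator (cyl 0 w) \<omega> * Pcn u (Xf \<omega>) (n + k)) \<le> exp (2 * BB)" for k
   using Pcn_bound[of u _ "n + k"] Pcn_pos[of u _ "n + k"] by (intro AE_I2) (auto simp: indicator_def less_imp_le)
 qed (use Pcn_Xf_measurable in \<open>auto intro!: borel_measurable_times\<close>)
 then show ?thesis unfolding fin by (simp add: LIMSEQ_const_iff)
qed

end

section \<open>Measurability of the limits in the sequence variables\<close>

context c_chain
begin

lemma fin_dep_measurable:
 fixes f :: "'s \<Rightarrow> nat \<Rightarrow> 'd" and F :: "'d list \<Rightarrow> real"
 assumes f: "\<And>j. (\<lambda>x. f x j) \<in> measurable M (count_space UNIV)"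
 shows "(\<lambda>x. F (pre n (f x))) \<in> borel_measurable M"
proof -
 have [measurable]: "Measurable.pred M (\<lambda>x. f x j = a)" for j a
  using f[of j] by measurable
 have eq: "pre n (f x) = w \<longleftrightarrow> (\<forall>j<n. f x j = w ! j)" if "w \<in> wds n" for w x
  using that by (auto simp: pre_def wds_def list_eq_iff_nth_eq)
 have "F (pre n (f x)) = (\<Sum>w\<in>wds n. (if \<forall>j<n. f x j = w ! j then F w else 0))" for x
 proof -
  have "(\<Sum>w\<in>wds n. (if \<forall>j<n. f x j = w ! j then F w else 0)) = (\<Sum>w\<in>wds n. (if w = pre n (f x) then F w else 0))"
   using eq[of _ x] by (intro sum.cong refl if_cong) auto
  moreover have "pre n (f x) \<in> wds n" by (simp add: wds_def)
  ultimately show ?thesis by (simp add: sum.delta[OF finite_wds])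
 qed
 moreover have "(\<lambda>x. \<Sum>w\<in>wds n. (if \<forall>j<n. f x j = w ! j then F w else 0)) \<in> borel_measurable M"
  by measurable
 ultimately show ?thesis by simp
qed

lemma Psi_gen_measurable:
 assumes "\<And>j. (\<lambda>z. f z j) \<in> measurable M (count_space UNIV)"
 shows "(\<lambda>z. Psi (f z) x) \<in> borel_measurable M"
 by (rule borel_measurable_LIMSEQ_real[OF Psi_lim])
  (unfold Psin_def, rule fin_dep_measurable[OF assms])

lemma Pc_gen_measurable:
 assumes "\<And>j. (\<lambda>z. f z j) \<in> measurable M (count_space UNIV)"
 shows "(\<lambda>z. Pc u (f z)) \<in> borel_measurable M"
 by (rule borel_measurable_LIMSEQ_real[OF Pc_lim])
  (unfold Pcn_def, rule fin_dep_measurable[OF assms])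

end

section \<open>Random coefficients and truncated perpetuities\<close>

locale coeffs_chain = c_chain P X for P :: "'a measure" and X :: "int \<Rightarrow> 'a \<Rightarrow> 'd::finite" +
 fixes Qc Mc :: "int \<Rightarrow> 'd \<Rightarrow> 'a \<Rightarrow> real" and q0 m0 :: real
 assumes induced: "induced_coeffs P X Qc Mc"
  and q0_pos: "0 < q0" and m0_pos: "0 < m0"
  and bound0: "AE \<omega> in P. \<bar>Qc 0 (X 0 \<omega>) \<omega>\<bar> < q0 \<and> 1 / m0 < \<bar>Mc 0 (X 0 \<omega>) \<omega>\<bar> \<and> \<bar>Mc 0 (X 0 \<omega>) \<omega>\<bar> < m0"
begin

definition cf :: "'a \<Rightarrow> int \<times> 'd \<Rightarrow> real \<times> real" where
 "cf \<omega> = (\<lambda>p. (Qc (fst p) (snd p) \<omega>, Mc (fst p) (snd p) \<omega>))"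

definition Xs :: "'a \<Rightarrow> int \<Rightarrow> 'd" where "Xs \<omega> = (\<lambda>n. X n \<omega>)"

abbreviation N1 :: "(int \<Rightarrow> 'd) measure" where "N1 \<equiv> PiM UNIV (\<lambda>_::int. count_space UNIV)"
abbreviation N2 :: "(int \<times> 'd \<Rightarrow> real \<times> real) measure" where "N2 \<equiv> PiM UNIV (\<lambda>_::int \<times> 'd. borel :: (real \<times> real) measure)"

definition lam :: "'d \<Rightarrow> (real \<times> real) measure" where
 "lam j = distr P borel (\<lambda>\<omega>. (Qc 0 j \<omega>, Mc 0 j \<omega>))"

lemma cf_indep: "indep_vars (\<lambda>_. borel) (\<lambda>p \<omega>. cf \<omega> p) UNIV"
 using induced by (simp add: induced_coeffs_def cf_def)

lemma cf_component [measurable]: "(\<lambda>\<omega>. cf \<omega> p) \<in> borel_measurable P"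
 using cf_indep unfolding indep_vars_def by blast

lemma Qc_measurable [measurable]: "Qc n i \<in> borel_measurable P"
proof -
 have "(\<lambda>\<omega>. fst (cf \<omega> (n, i))) \<in> borel_measurable P"
  by (rule borel_measurable_continuous_on[OF continuous_on_fst[OF continuous_on_id] cf_component])
 then show ?thesis by (simp add: cf_def)
qed

lemma Mc_measurable [measurable]: "Mc n i \<in> borel_measurable P"
proof -
 have "(\<lambda>\<omega>. snd (cf \<omega> (n, i))) \<in> borel_measurable P"
  by (rule borel_measurable_continuous_on[OF continuous_on_snd[OF continuous_on_id] cf_component])
 then show ?thesis by (simp add: cf_def)
qed

lemma Xs_measurable [measurable]: "Xs \<in> measurable P N1"
 unfolding Xs_def by (intro measurable_PiM_single') (auto simp: X_measurable)

lemma cf_measurable [measurable]: "cf \<in> measurable P N2"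
proof (intro measurable_PiM_single')
 fix p show "(\<lambda>\<omega>. cf \<omega> p) \<in> borel_measurable P" by (rule cf_component)
qed (auto simp: space_PiM)

lemma indep_XC: "indep_set (sets (vimage_algebra (space P) Xs N1)) (sets (vimage_algebra (space P) cf N2))"
 using induced unfolding induced_coeffs_def cf_def[abs_def] Xs_def[abs_def] by blast

lemma indep_XC_real:
 fixes G :: "(int \<Rightarrow> 'd) \<Rightarrow> real" and F :: "(int \<times> 'd \<Rightarrow> real \<times> real) \<Rightarrow> real"
 assumes [measurable]: "G \<in> borel_measurable N1" "F \<in> borel_measurable N2"
 shows "indep_var borel (\<lambda>\<omega>. G (Xs \<omega>)) borel (\<lambda>\<omega>. F (cf \<omega>))"
proof -
 have sub: "sigma_sets (space P) {(\<lambda>\<omega>. g (f \<omega>)) -` A \<inter> space P |A. A \<in> sets borel} \<subseteq> sets (vimage_algebra (space P) f N)"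
  if "g \<in> borel_measurable N" "f \<in> measurable P N" for f :: "'a \<Rightarrow> 's" and g :: "'s \<Rightarrow> real" and N
 proof -
  have f: "f \<in> measurable (vimage_algebra (space P) f N) N"
   using measurable_space[OF that(2)] by (intro measurable_vimage_algebra1) auto
  have "(\<lambda>\<omega>. g (f \<omega>)) \<in> borel_measurable (vimage_algebra (space P) f N)" by (rule measurable_compose[OF f that(1)])
  from measurable_sets[OF this]
  have "{(\<lambda>\<omega>. g (f \<omega>)) -` A \<inter> space P |A. A \<in> sets borel} \<subseteq> sets (vimage_algebra (space P) f N)" by auto
  then show ?thesis using sets.sigma_sets_subset[of _ "vimage_algebra (space P) f N"] by simp
 qed
 show ?thesis unfolding indep_var_eq
 proof (intro conjI)
  show "indep_set (sigma_sets (space P) {(\<lambda>\<omega>. G (Xs \<omega>)) -` A \<inter> space P |A. A \<in> sets borel})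
   (sigma_sets (space P) {(\<lambda>\<omega>. F (cf \<omega>)) -` A \<inter> space P |A. A \<in> sets borel})"
   unfolding indep_set_def
  proof (rule indep_sets_mono_sets[OF indep_XC[unfolded indep_set_def]])
   fix b :: bool
   show "(case b of True \<Rightarrow> sigma_sets (space P) {(\<lambda>\<omega>. G (Xs \<omega>)) -` A \<inter> space P |A. A \<in> sets borel}
     | False \<Rightarrow> sigma_sets (space P) {(\<lambda>\<omega>. F (cf \<omega>)) -` A \<inter> space P |A. A \<in> sets borel})
    \<subseteq> (case b of True \<Rightarrow> sets (vimage_algebra (space P) Xs N1) | False \<Rightarrow> sets (vimage_algebra (space P) cf N2))"
    by (cases b) (simp_all add: sub[OF assms(1) Xs_measurable] sub[OF assms(2) cf_measurable])
  qed
 qed measurable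
qed

lemma indep_integral:
 fixes G :: "(int \<Rightarrow> 'd) \<Rightarrow> real" and F :: "(int \<times> 'd \<Rightarrow> real \<times> real) \<Rightarrow> real"
 assumes G: "G \<in> borel_measurable N1" "integrable P (\<lambda>\<omega>. G (Xs \<omega>))" and F: "F \<in> borel_measurable N2" "integrable P (\<lambda>\<omega>. F (cf \<omega>))"
 shows "(\<integral>\<omega>. G (Xs \<omega>) * F (cf \<omega>) \<partial>P) = (\<integral>\<omega>. G (Xs \<omega>) \<partial>P) * (\<integral>\<omega>. F (cf \<omega>) \<partial>P)"
  "integrable P (\<lambda>\<omega>. G (Xs \<omega>) * F (cf \<omega>))"
 by (rule indep_var_lebesgue_integral[OF indep_XC_real[OF G(1) F(1)] G(2) F(2)])
  (rule indep_var_integrable[OF indep_XC_real[OF G(1) F(1)] G(2) F(2)])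

lemma lam_eq: "distr P borel (\<lambda>\<omega>. (Qc n j \<omega>, Mc n j \<omega>)) = lam j"
 using induced unfolding induced_coeffs_def lam_def by blast

lemma lam_eq': "distr P borel (\<lambda>\<omega>. cf \<omega> (n, j)) = lam j"
 using lam_eq by (simp add: cf_def)

lemma prob_lam: "prob_space (lam j)"
 unfolding lam_eq'[of 0, symmetric] by (rule prob_space_distr) (rule cf_component)

lemma sets_lam [simp]: "sets (lam j) = sets borel" by (simp add: lam_def)

lemma space_lam [simp]: "space (lam j) = UNIV" by (simp add: lam_def)

text \<open>The perpetuity along a prescribed word, as a function of the coefficient array alone;
  once the word is fixed, independence from the chain and between coefficients can be used.\<close>

primrec rrf :: "'d list \<Rightarrow> int \<Rightarrow> (int \<times> 'd \<Rightarrow> real \<times> real) \<Rightarrow> real" where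
 "rrf [] k c = 0"
| "rrf (j # u) k c = fst (c (k, j)) + snd (c (k, j)) * rrf u (k - 1) c"

definition rr :: "'d list \<Rightarrow> int \<Rightarrow> 'a \<Rightarrow> real" where "rr u k \<omega> = rrf u k (cf \<omega>)"

lemma comp_measurable2: "p \<in> A \<Longrightarrow> (\<lambda>c. c p) \<in> borel_measurable (PiM A (\<lambda>_::int \<times> 'd. borel :: (real \<times> real) measure))"
 by measurable

lemma fst_snd_measurable [measurable]:
 "fst \<in> borel_measurable (borel :: (real \<times> real) measure)" "snd \<in> borel_measurable (borel :: (real \<times> real) measure)"
 by (intro borel_measurable_continuous_onI continuous_intros)+

lemma rrf_measurable_on:
 assumes "\<And>l j. l \<le> k \<Longrightarrow> (l, j) \<in> A"
 shows "rrf u k \<in> borel_measurable (PiM A (\<lambda>_. borel))"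
 using assms
proof (induction u arbitrary: k)
 case Nil then show ?case by (simp add: rrf.simps[abs_def])
next
 case (Cons j u)
 have [measurable]: "rrf u (k - 1) \<in> borel_measurable (PiM A (\<lambda>_. borel))" by (rule Cons.IH) (use Cons.prems in auto)
 have c: "(\<lambda>c. c (k, j)) \<in> borel_measurable (PiM A (\<lambda>_::int \<times> 'd. borel :: (real \<times> real) measure))"
  by (rule comp_measurable2) (use Cons.prems in auto)
 have [measurable]: "(\<lambda>c. fst (c (k, j))) \<in> borel_measurable (PiM A (\<lambda>_::int \<times> 'd. borel :: (real \<times> real) measure))"
  "(\<lambda>c. snd (c (k, j))) \<in> borel_measurable (PiM A (\<lambda>_::int \<times> 'd. borel :: (real \<times> real) measure))"
  by (rule measurable_compose[OF c fst_snd_measurable(1)] measurable_compose[OF c fst_snd_measurable(2)])+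
 show ?case unfolding rrf.simps by measurable
qed

lemma rrf_measurable [measurable]: "rrf u k \<in> borel_measurable N2"
 by (rule rrf_measurable_on) simp

lemma rr_measurable [measurable]: "rr u k \<in> borel_measurable P"
 unfolding rr_def[abs_def] by measurable

lemma rrf_restrict: "(\<And>l j. l \<le> k \<Longrightarrow> (l, j) \<in> A) \<Longrightarrow> rrf u k (restrict c A) = rrf u k c"
 by (induction u arbitrary: k) auto

definition LJ :: "'d list \<Rightarrow> real measure" where "LJ u = distr P borel (rr u 0)"

lemma sets_LJ [simp, measurable_cong]: "sets (LJ u) = sets borel" by (simp add: LJ_def)
lemma space_LJ [simp]: "space (LJ u) = UNIV" by (simp add: LJ_def)
lemma prob_LJ: "prob_space (LJ u)" unfolding LJ_def by (rule prob_space_distr) measurable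

definition emb :: "real \<Rightarrow> real \<times> real" where "emb r = (r, 0)"

lemma emb_measurable [measurable]: "emb \<in> borel_measurable borel"
 unfolding emb_def[abs_def] by (intro borel_measurable_continuous_onI continuous_intros)

text \<open>Independence of two random variables is only available for a common range type; the
 embedding \<open>r \<mapsto> (r, 0)\<close> puts the truncated perpetuity into the range of the coefficients.\<close>

lemma rr_pair_law: "distr P (borel \<Otimes>\<^sub>M borel) (\<lambda>\<omega>. (cf \<omega> (k, j), emb (rr u (k - 1) \<omega>))) = lam j \<Otimes>\<^sub>M distr (distr P borel (rr u (k - 1))) borel emb"
proof -
 define A where "A = {(k, j)}"
 define B where "B = {p :: int \<times> 'd. fst p < k}"
 have "indep_var (PiM A (\<lambda>_. borel)) (\<lambda>\<omega>. restrict (\<lambda>i. cf \<omega> i) A) (PiM B (\<lambda>_. borel)) (\<lambda>\<omega>. restrict (\<lambda>i. cf \<omega> i) B)"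
  by (rule indep_var_restrict[OF cf_indep]) (auto simp: A_def B_def)
 moreover have "(\<lambda>c. c (k, j)) \<in> borel_measurable (PiM A (\<lambda>_. borel :: (real \<times> real) measure))"
  by (rule comp_measurable2) (simp add: A_def)
 moreover have "(\<lambda>c. emb (rrf u (k - 1) c)) \<in> borel_measurable (PiM B (\<lambda>_. borel))"
  by (rule measurable_compose[OF rrf_measurable_on emb_measurable]) (simp add: B_def)
 ultimately have "indep_var borel ((\<lambda>c. c (k, j)) \<circ> (\<lambda>\<omega>. restrict (\<lambda>i. cf \<omega> i) A)) borel ((\<lambda>c. emb (rrf u (k - 1) c)) \<circ> (\<lambda>\<omega>. restrict (\<lambda>i. cf \<omega> i) B))"
  by (rule indep_var_compose)
 moreover have "(\<lambda>c. c (k, j)) \<circ> (\<lambda>\<omega>. restrict (\<lambda>i. cf \<omega> i) A) = (\<lambda>\<omega>. cf \<omega> (k, j))" by (auto simp: A_def)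
 moreover have "(\<lambda>c. emb (rrf u (k - 1) c)) \<circ> (\<lambda>\<omega>. restrict (\<lambda>i. cf \<omega> i) B) = (\<lambda>\<omega>. emb (rr u (k - 1) \<omega>))"
 proof
  fix \<omega>
  have "rrf u (k - 1) (restrict (cf \<omega>) B) = rrf u (k - 1) (cf \<omega>)" by (rule rrf_restrict) (auto simp: B_def)
  then show "((\<lambda>c. emb (rrf u (k - 1) c)) \<circ> (\<lambda>\<omega>. restrict (\<lambda>i. cf \<omega> i) B)) \<omega> = emb (rr u (k - 1) \<omega>)" by (simp add: rr_def)
 qed
 ultimately have iv: "indep_var borel (\<lambda>\<omega>. cf \<omega> (k, j)) borel (\<lambda>\<omega>. emb (rr u (k - 1) \<omega>))" by simp
 have "distr (distr P borel (rr u (k - 1))) borel emb = distr P borel (\<lambda>\<omega>. emb (rr u (k - 1) \<omega>))"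
  by (subst distr_distr) (auto simp: comp_def)
 then show ?thesis using iv unfolding indep_var_distribution_eq lam_eq' by simp
qed

definition aff :: "(real \<times> real) \<times> (real \<times> real) \<Rightarrow> real" where
 "aff z = fst (fst z) + snd (fst z) * fst (snd z)"

lemma aff_measurable [measurable]: "aff \<in> borel_measurable ((borel :: (real \<times> real) measure) \<Otimes>\<^sub>M (borel :: (real \<times> real) measure))"
 unfolding borel_prod aff_def[abs_def] by (intro borel_measurable_continuous_onI continuous_intros)

lemma rr_Cons_law: "distr P borel (rr (j # u) k) = distr (lam j \<Otimes>\<^sub>M distr (distr P borel (rr u (k - 1))) borel emb) borel aff"
proof -
 have m: "(\<lambda>\<omega>. (cf \<omega> (k, j), emb (rr u (k - 1) \<omega>))) \<in> measurable P (borel \<Otimes>\<^sub>M borel)"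
  by (intro measurable_Pair cf_component measurable_compose[OF rr_measurable emb_measurable])
 have "distr (distr P (borel \<Otimes>\<^sub>M borel) (\<lambda>\<omega>. (cf \<omega> (k, j), emb (rr u (k - 1) \<omega>)))) borel aff
  = distr P borel (rr (j # u) k)"
  by (subst distr_distr[OF aff_measurable m]) (auto simp: comp_def rr_def aff_def emb_def intro!: distr_cong)
 then show ?thesis unfolding rr_pair_law by simp
qed

text \<open>The law does not depend on the starting time, since the head coefficient is independent
  of the earlier ones at any time and its law depends on the symbol only.\<close>

lemma rr_law: "distr P borel (rr u k) = LJ u"
proof (induction u arbitrary: k)
 case Nil then show ?case by (simp add: LJ_def rr_def[abs_def])
next
 case (Cons j u)
 show ?case unfolding LJ_def[of "j # u"] rr_Cons_law Cons.IH ..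
qed

lemma LJ_Cons: "LJ (j # u) = distr (lam j \<Otimes>\<^sub>M distr (LJ u) borel emb) borel aff"
 using rr_Cons_law[of j u 0] unfolding rr_law .

lemma LJ_integral_Cons:
 fixes H :: "real \<Rightarrow> real"
 assumes Hm [measurable]: "H \<in> borel_measurable borel" and H: "\<And>r. \<bar>H r\<bar> \<le> B"
 shows "(\<integral>r. H r \<partial>LJ (j # u)) = (\<integral>v. (\<integral>r. H (fst v + snd v * r) \<partial>LJ u) \<partial>lam j)"
proof -
 have em: "emb \<in> measurable (LJ u) borel" by measurable
 interpret l: prob_space "lam j" by (rule prob_lam)
 interpret m: prob_space "distr (LJ u) borel emb" by (rule prob_space.prob_space_distr[OF prob_LJ em])
 interpret pair_prob_space "lam j" "distr (LJ u) borel emb" ..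
 have st: "sets (lam j \<Otimes>\<^sub>M distr (LJ u) borel emb) = sets ((borel :: (real \<times> real) measure) \<Otimes>\<^sub>M (borel :: (real \<times> real) measure))"
  by (intro sets_pair_measure_cong) auto
 have mm: "aff \<in> borel_measurable (lam j \<Otimes>\<^sub>M distr (LJ u) borel emb)"
  using aff_measurable measurable_cong_sets[OF st refl] by blast
 have "(\<integral>r. H r \<partial>LJ (j # u)) = (\<integral>z. H (aff z) \<partial>(lam j \<Otimes>\<^sub>M distr (LJ u) borel emb))"
  unfolding LJ_Cons by (rule integral_distr[OF mm Hm])
 also have "\<dots> = (\<integral>v. (\<integral>y. H (aff (v, y)) \<partial>distr (LJ u) borel emb) \<partial>lam j)"
 proof -
  have "integrable (lam j \<Otimes>\<^sub>M distr (LJ u) borel emb) (\<lambda>z. H (aff z))"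
   by (rule P.integrable_const_bound[where B=B]) (use H measurable_compose[OF mm Hm] in auto)
  from integral_fst'[OF this] show ?thesis by simp
 qed
 also have "\<dots> = (\<integral>v. (\<integral>r. H (fst v + snd v * r) \<partial>LJ u) \<partial>lam j)"
 proof (intro Bochner_Integration.integral_cong refl)
  fix v :: "real \<times> real"
  have "(\<lambda>y. aff (v, y)) \<in> borel_measurable borel"
   unfolding aff_def by (intro borel_measurable_continuous_onI continuous_intros)
  then have "(\<lambda>y. H (aff (v, y))) \<in> borel_measurable borel" by (rule measurable_compose[OF _ Hm])
  from integral_distr[OF em this] show "(\<integral>y. H (aff (v, y)) \<partial>distr (LJ u) borel emb) = (\<integral>r. H (fst v + snd v * r) \<partial>LJ u)"
   by (simp add: aff_def emb_def)
 qed
 finally show ?thesis .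
qed

lemma rr_integral: "H \<in> borel_measurable borel \<Longrightarrow> (\<integral>\<omega>. H (rr u k \<omega>) \<partial>P) = (\<integral>r. H r \<partial>LJ u)" for H :: "real \<Rightarrow> real"
 unfolding rr_law[of u k, symmetric] by (rule integral_distr[symmetric]) measurable

primrec Rt :: "nat \<Rightarrow> int \<Rightarrow> 'a \<Rightarrow> real" where
 "Rt 0 k \<omega> = 0"
| "Rt (Suc N) k \<omega> = Qc k (X k \<omega>) \<omega> + Mc k (X k \<omega>) \<omega> * Rt N (k - 1) \<omega>"

lemma X_comp_measurable:
 assumes "\<And>i. f i \<in> borel_measurable P" shows "(\<lambda>\<omega>. f (X k \<omega>) \<omega> :: real) \<in> borel_measurable P"
 by (rule measurable_compose_countable[where f=f and g="X k"]) (rule assms X_measurable)+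

lemma Q_measurable [measurable]: "(\<lambda>\<omega>. Qc n (X k \<omega>) \<omega>) \<in> borel_measurable P"
 by (rule X_comp_measurable) measurable

lemma M_measurable [measurable]: "(\<lambda>\<omega>. Mc n (X k \<omega>) \<omega>) \<in> borel_measurable P"
 by (rule X_comp_measurable) measurable

lemma Rt_measurable [measurable]: "Rt N k \<in> borel_measurable P"
proof (induction N arbitrary: k)
 case 0 then show ?case by (simp add: Rt.simps[abs_def])
next
 case (Suc N)
 have [measurable]: "Rt N (k - 1) \<in> borel_measurable P" by (rule Suc)
 show ?case unfolding Rt.simps by measurable
qed

lemma Rt_rr: "(\<And>i. i < length u \<Longrightarrow> X (k - int i) \<omega> = u ! i) \<Longrightarrow> Rt (length u) k \<omega> = rr u k \<omega>"
proof (induction u arbitrary: k)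
 case Nil then show ?case by (simp add: rr_def)
next
 case (Cons j u)
 have "X k \<omega> = j" using Cons.prems[of 0] by simp
 moreover have "Rt (length u) (k - 1) \<omega> = rr u (k - 1) \<omega>"
 proof (rule Cons.IH)
  fix i assume "i < length u"
  then show "X (k - 1 - int i) \<omega> = u ! i" using Cons.prems[of "Suc i"] by (simp add: algebra_simps)
 qed
 ultimately show ?case by (simp add: rr_def cf_def)
qed

lemma Rt_cyl: "length u = N \<Longrightarrow> \<omega> \<in> cyl (k + 1 - int N) (rev u) \<Longrightarrow> Rt N k \<omega> = rr u k \<omega>"
proof -
 assume N: "length u = N" and \<omega>: "\<omega> \<in> cyl (k + 1 - int N) (rev u)"
 have "X (k - int i) \<omega> = u ! i" if "i < length u" for i
 proof -
  have l: "N - Suc i < length (rev u)" using that N by simp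
  have e: "k + 1 - int N + int (N - Suc i) = k - int i" using that N by (simp add: of_nat_diff)
  show ?thesis using cylD[OF \<omega> l] that N unfolding e by (simp add: rev_nth)
 qed
 from Rt_rr[OF this] show ?thesis using N by simp
qed

lemma cyl_N1: "\<exists>G \<in> borel_measurable N1. \<forall>\<omega>\<in>space P. indicat_real (cyl k w) \<omega> = G (Xs \<omega>) \<and> (\<forall>x. \<bar>G x\<bar> \<le> 1)"
proof -
 define G where "G x = (if \<forall>j<length w. x (k + int j) = w ! j then 1 else 0 :: real)" for x :: "int \<Rightarrow> 'd"
 have "G \<in> borel_measurable N1" unfolding G_def by measurable
 moreover have "indicat_real (cyl k w) \<omega> = G (Xs \<omega>)" if "\<omega> \<in> space P" for \<omega>
  using that by (simp add: G_def cyl_def Xs_def indicator_def)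
 moreover have "\<bar>G x\<bar> \<le> 1" for x by (simp add: G_def)
 ultimately show ?thesis by blast
qed

lemma word_integral:
 fixes H :: "real \<Rightarrow> real"
 assumes G: "G \<in> borel_measurable N1" "\<And>x. \<bar>G x\<bar> \<le> B1" and H: "H \<in> borel_measurable borel" "\<And>r. \<bar>H r\<bar> \<le> B2" and u: "length u = N"
 shows "(\<integral>\<omega>. indicator (cyl (k + 1 - int N) (rev u)) \<omega> * (G (Xs \<omega>) * H (Rt N k \<omega>)) \<partial>P)
  = (\<integral>\<omega>. indicator (cyl (k + 1 - int N) (rev u)) \<omega> * G (Xs \<omega>) \<partial>P) * (\<integral>r. H r \<partial>LJ u)"
proof -
 obtain G' where G': "G' \<in> borel_measurable N1" "\<And>\<omega>. \<omega> \<in> space P \<Longrightarrow> indicat_real (cyl (k + 1 - int N) (rev u)) \<omega> = G' (Xs \<omega>)" "\<And>\<omega> x. \<omega> \<in> space P \<Longrightarrow> \<bar>G' x\<bar> \<le> 1"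
  using cyl_N1 by blast
 obtain \<omega>0 where "\<omega>0 \<in> space P" using not_empty by blast
 then have G'1: "\<bar>G' x\<bar> \<le> 1" for x using G'(3) by blast
 have B1: "0 \<le> B1" using G(2) abs_ge_zero order_trans by blast
 have "(\<integral>\<omega>. indicator (cyl (k + 1 - int N) (rev u)) \<omega> * (G (Xs \<omega>) * H (Rt N k \<omega>)) \<partial>P)
  = (\<integral>\<omega>. (G' (Xs \<omega>) * G (Xs \<omega>)) * H (rrf u k (cf \<omega>)) \<partial>P)"
 proof (intro Bochner_Integration.integral_cong refl)
  fix \<omega> assume \<omega>: "\<omega> \<in> space P"
  show "indicator (cyl (k + 1 - int N) (rev u)) \<omega> * (G (Xs \<omega>) * H (Rt N k \<omega>)) = (G' (Xs \<omega>) * G (Xs \<omega>)) * H (rrf u k (cf \<omega>))"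
   using Rt_cyl[OF u, of \<omega> k] G'(2)[OF \<omega>] by (cases "\<omega> \<in> cyl (k + 1 - int N) (rev u)") (auto simp: rr_def)
 qed
 also have "\<dots> = (\<integral>\<omega>. G' (Xs \<omega>) * G (Xs \<omega>) \<partial>P) * (\<integral>\<omega>. H (rrf u k (cf \<omega>)) \<partial>P)"
 proof (rule indep_integral(1)[where G="\<lambda>x. G' x * G x" and F="\<lambda>c. H (rrf u k c)"])
  show m1: "(\<lambda>x. G' x * G x) \<in> borel_measurable N1" by (intro borel_measurable_times G' G)
  have b: "\<bar>G' x * G x\<bar> \<le> 1 * B1" for x unfolding abs_mult by (intro mult_mono G'1 G) auto
  show "integrable P (\<lambda>\<omega>. G' (Xs \<omega>) * G (Xs \<omega>))"
   by (rule integrable_const_bound[where B="1 * B1"]) (use b measurable_compose[OF Xs_measurable m1] in auto)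
  show m2: "(\<lambda>c. H (rrf u k c)) \<in> borel_measurable N2" by (rule measurable_compose[OF rrf_measurable H(1)])
  show "integrable P (\<lambda>\<omega>. H (rrf u k (cf \<omega>)))"
   by (rule integrable_const_bound[where B=B2]) (use H(2) measurable_compose[OF cf_measurable m2] in auto)
 qed
 also have "(\<integral>\<omega>. H (rrf u k (cf \<omega>)) \<partial>P) = (\<integral>r. H r \<partial>LJ u)" using rr_integral[OF H(1), of u k] by (simp add: rr_def)
 also have "(\<integral>\<omega>. G' (Xs \<omega>) * G (Xs \<omega>) \<partial>P) = (\<integral>\<omega>. indicator (cyl (k + 1 - int N) (rev u)) \<omega> * G (Xs \<omega>) \<partial>P)"
  by (intro Bochner_Integration.integral_cong refl) (simp add: G'(2))
 finally show ?thesis .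
qed

text \<open>Partitioning by the word read by the chain freezes the symbols that select the
  coefficients; on each piece the truncated perpetuity is a function of the array and factors
  off.\<close>

lemma word_sum:
 fixes H :: "real \<Rightarrow> real"
 assumes G: "G \<in> borel_measurable N1" "\<And>x. \<bar>G x\<bar> \<le> B1" and H: "H \<in> borel_measurable borel" "\<And>r. \<bar>H r\<bar> \<le> B2"
 shows "(\<integral>\<omega>. G (Xs \<omega>) * H (Rt N k \<omega>) \<partial>P)
  = (\<Sum>u\<in>wds N. (\<integral>\<omega>. indicator (cyl (k + 1 - int N) (rev u)) \<omega> * G (Xs \<omega>) \<partial>P) * (\<integral>r. H r \<partial>LJ u))"
proof -
 have [measurable]: "G \<in> borel_measurable N1" "H \<in> borel_measurable borel" by (rule G H)+
 have "\<bar>G x * H r\<bar> \<le> B1 * B2" for x r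
  unfolding abs_mult using G(2)[of x] H(2)[of r] by (intro mult_mono) (auto intro: order_trans[OF abs_ge_zero])
 then have "integrable P (\<lambda>\<omega>. G (Xs \<omega>) * H (Rt N k \<omega>))" by (intro integrable_const_bound[where B="B1 * B2"]) auto
 from integral_partition[OF this, where n=N and k="k + 1 - int N"]
 have "(\<integral>\<omega>. G (Xs \<omega>) * H (Rt N k \<omega>) \<partial>P)
  = (\<Sum>u\<in>wds N. (\<integral>\<omega>. indicator (cyl (k + 1 - int N) (rev u)) \<omega> * (G (Xs \<omega>) * H (Rt N k \<omega>)) \<partial>P))"
  by (simp add: sum_wds_rev[of "\<lambda>w. \<integral>\<omega>. indicator (cyl (k + 1 - int N) w) \<omega> * (G (Xs \<omega>) * H (Rt N k \<omega>)) \<partial>P"])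
 also have "\<dots> = (\<Sum>u\<in>wds N. (\<integral>\<omega>. indicator (cyl (k + 1 - int N) (rev u)) \<omega> * G (Xs \<omega>) \<partial>P) * (\<integral>r. H r \<partial>LJ u))"
  by (intro sum.cong refl word_integral[OF G H] wds_length)
 finally show ?thesis .
qed

lemma Psi_Xs: "(\<lambda>z. Psi (\<lambda>k. z (- int k - 1)) x) \<in> borel_measurable N1" "Psi (past X \<omega>) x = Psi (\<lambda>k. Xs \<omega> (- int k - 1)) x"
 by (rule Psi_gen_measurable) (auto simp: past_def Xs_def)

text \<open>Reweighting by \<open>Psi\<close> gives the truncated perpetuity its law under the
  backward chain with future \<open>x\<close>, namely a mixture of the word laws \<open>LJ u\<close>
  with weights \<open>Pc u x\<close>.\<close>

lemma Rt_Psi: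
 fixes H :: "real \<Rightarrow> real"
 assumes H: "H \<in> borel_measurable borel" "\<And>r. \<bar>H r\<bar> \<le> B2"
 shows "(\<integral>\<omega>. H (Rt N (-1) \<omega>) * Psi (past X \<omega>) x \<partial>P) = (\<Sum>u\<in>wds N. Pc u x * (\<integral>r. H r \<partial>LJ u))"
proof -
 have b: "\<bar>Psi y x\<bar> \<le> exp (3 * BB)" for y using Psi_bounds[of y x] Psi_pos[of y x] by simp
 have "(\<integral>\<omega>. H (Rt N (-1) \<omega>) * Psi (past X \<omega>) x \<partial>P) = (\<integral>\<omega>. Psi (\<lambda>k. Xs \<omega> (- int k - 1)) x * H (Rt N (-1) \<omega>) \<partial>P)"
  by (simp add: Psi_Xs(2) mult.commute)
 also have "\<dots> = (\<Sum>u\<in>wds N. (\<integral>\<omega>. indicator (cyl (-1 + 1 - int N) (rev u)) \<omega> * Psi (\<lambda>k. Xs \<omega> (- int k - 1)) x \<partial>P) * (\<integral>r. H r \<partial>LJ u))"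
  by (rule word_sum[OF Psi_Xs(1) b H])
 also have "\<dots> = (\<Sum>u\<in>wds N. Pc u x * (\<integral>r. H r \<partial>LJ u))"
  using cyl_Psi by (intro sum.cong refl) (auto simp: Psi_Xs(2)[symmetric] wds_def)
 finally show ?thesis .
qed

lemma Rt_word:
 fixes H :: "real \<Rightarrow> real"
 assumes H: "H \<in> borel_measurable borel" "\<And>r. \<bar>H r\<bar> \<le> B2"
 shows "(\<integral>\<omega>. indicator (cyl 0 (i # w)) \<omega> * H (Rt (Suc N) 0 \<omega>) \<partial>P) = (\<Sum>u\<in>wds N. pl (rev u @ i # w) * (\<integral>r. H r \<partial>LJ (i # u)))"
proof -
 obtain G where G: "G \<in> borel_measurable N1" "\<And>\<omega>. \<omega> \<in> space P \<Longrightarrow> indicat_real (cyl 0 (i # w)) \<omega> = G (Xs \<omega>)" "\<And>\<omega> x. \<omega> \<in> space P \<Longrightarrow> \<bar>G x\<bar> \<le> 1"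
  using cyl_N1 by blast
 obtain \<omega>0 where "\<omega>0 \<in> space P" using not_empty by blast
 then have G1: "\<bar>G x\<bar> \<le> 1" for x using G(3) by blast
 have "(\<integral>\<omega>. indicator (cyl 0 (i # w)) \<omega> * H (Rt (Suc N) 0 \<omega>) \<partial>P) = (\<integral>\<omega>. G (Xs \<omega>) * H (Rt (Suc N) 0 \<omega>) \<partial>P)"
  by (intro Bochner_Integration.integral_cong refl) (simp add: G(2))
 also have "\<dots> = (\<Sum>u\<in>wds (Suc N). (\<integral>\<omega>. indicator (cyl (0 + 1 - int (Suc N)) (rev u)) \<omega> * G (Xs \<omega>) \<partial>P) * (\<integral>r. H r \<partial>LJ u))"
  by (rule word_sum[OF G(1) G1 H])
 also have "\<dots> = (\<Sum>j\<in>UNIV. \<Sum>u\<in>wds N. (\<integral>\<omega>. indicator (cyl (- int N) (rev u @ [j])) \<omega> * G (Xs \<omega>) \<partial>P) * (\<integral>r. H r \<partial>LJ (j # u)))"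
  by (simp add: sum_wds_Suc)
 \<comment> \<open>The perpetuity started at time 0 also uses the symbol at time 0, which the
   cylinder already prescribes; all other choices of \<open>j\<close> contribute nothing.\<close>
 also have "\<dots> = (\<Sum>j\<in>UNIV. \<Sum>u\<in>wds N. (if j = i then pl (rev u @ i # w) else 0) * (\<integral>r. H r \<partial>LJ (j # u)))"
 proof (intro sum.cong refl arg_cong2[where f="(*)"])
  fix j u assume u: "u \<in> wds N"
  have l: "length u = N" using u by (rule wds_length)
  have "(\<integral>\<omega>. indicator (cyl (- int N) (rev u @ [j])) \<omega> * G (Xs \<omega>) \<partial>P) = (\<integral>\<omega>. (if j = i then indicat_real (cyl (- int N) (rev u @ i # w)) \<omega> else 0) \<partial>P)"
  proof (intro Bochner_Integration.integral_cong refl)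
   fix \<omega> assume \<omega>: "\<omega> \<in> space P"
   have c1: "cyl (- int N) (rev u @ v) = cyl (- int N) (rev u) \<inter> cyl 0 v" for v using l by (simp add: cyl_append)
   have c2: "cyl 0 (i # w) = cyl 0 [i] \<inter> cyl 1 w" using cyl_append[of 0 "[i]" w] by simp
   have c3: "cyl 0 [j] \<inter> cyl 0 [i] = (if j = i then cyl 0 [i] else {})" using cyl_disjoint[of "[j]" "[i]" 0] by auto
   show "indicator (cyl (- int N) (rev u @ [j])) \<omega> * G (Xs \<omega>) = (if j = i then indicat_real (cyl (- int N) (rev u @ i # w)) \<omega> else 0)"
    unfolding G(2)[OF \<omega>, symmetric] c1 c2 using c3 by (auto simp: indicator_def split: if_splits)
  qed
  then show "(\<integral>\<omega>. indicator (cyl (- int N) (rev u @ [j])) \<omega> * G (Xs \<omega>) \<partial>P) = (if j = i then pl (rev u @ i # w) else 0)"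
   by (cases "j = i") (simp_all add: prob_cyl)
 qed
 also have "\<dots> = (\<Sum>j\<in>UNIV. if j = i then \<Sum>u\<in>wds N. pl (rev u @ i # w) * (\<integral>r. H r \<partial>LJ (i # u)) else 0)"
  by (intro sum.cong refl) auto
 finally show ?thesis by simp
qed

end

section \<open>Moments of products: growth rate, convexity, critical exponent\<close>

lemma quasi_additive_limit:
 fixes a :: "nat \<Rightarrow> real"
 assumes qa: "\<And>n m. \<bar>a (n + m) - a n - a m\<bar> \<le> B" and a0: "a 0 = 0"
 shows "\<exists>l. (\<lambda>n. a n / real n) \<longlonglongrightarrow> l \<and> (\<forall>n. \<bar>a n - real n * l\<bar> \<le> B)"
proof -
 have B: "0 \<le> B" using qa[of 0 0] by linarith
 have mult: "\<bar>a (m * n) - real m * a n\<bar> \<le> real m * B" for m n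
 proof (induction m)
  case (Suc m)
  have "real (Suc m) * a n = real m * a n + a n" "real (Suc m) * B = real m * B + B" by (simp_all add: algebra_simps)
  then show ?case using Suc qa[of n "m * n"] unfolding mult_Suc by linarith
 qed (simp add: a0)
 \<comment> \<open>Both \<open>a n / n\<close> and \<open>a m / m\<close> are compared with
   \<open>a (m * n) / (m * n)\<close>. The resulting Cauchy estimate has a rate, and letting
   \<open>m\<close> grow in it yields the bound on \<open>a n - n * l\<close> that is uniform in
   \<open>n\<close>.\<close>
 have half: "\<bar>a (m * n) / real (m * n) - a n / real n\<bar> \<le> B / real n" if "0 < m" "0 < n" for m n
 proof -
  have "a (m * n) / real (m * n) - a n / real n = (a (m * n) - real m * a n) / real (m * n)"
   using that by (simp add: field_simps)
  then have "\<bar>a (m * n) / real (m * n) - a n / real n\<bar> = \<bar>a (m * n) - real m * a n\<bar> / real (m * n)" by simp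
  also have "\<dots> \<le> real m * B / real (m * n)" by (intro divide_right_mono mult) simp
  also have "\<dots> = B / real n" using that by simp
  finally show ?thesis .
 qed
 have dist: "\<bar>a n / real n - a m / real m\<bar> \<le> B / real n + B / real m" if "0 < m" "0 < n" for m n
  using half[OF that] half[OF that(2,1)] by (simp add: mult.commute)
 have Bn: "(\<lambda>n. B / real n) \<longlonglongrightarrow> 0" by (rule lim_const_over_n)
 have "Cauchy (\<lambda>n. a n / real n)"
 proof (rule metric_CauchyI)
  fix e :: real assume e: "0 < e"
  have "\<forall>\<^sub>F n in sequentially. B / real n < e / 2" using e by (intro order_tendstoD(2)[OF Bn]) simp
  then obtain M where M: "\<And>n. n \<ge> M \<Longrightarrow> B / real n < e / 2" by (auto simp: eventually_sequentially)
  have "dist (a m / real m) (a n / real n) < e" if "m \<ge> Suc M" "n \<ge> Suc M" for m n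
  proof -
   have "B / real n < e / 2" "B / real m < e / 2" using M[of m] M[of n] that by auto
   moreover have "0 < n" "0 < m" using that by auto
   ultimately show ?thesis using dist[of m n] unfolding dist_real_def by linarith
  qed
  then show "\<exists>M. \<forall>m\<ge>M. \<forall>n\<ge>M. dist (a m / real m) (a n / real n) < e" by blast
 qed
 then obtain l where l: "(\<lambda>n. a n / real n) \<longlonglongrightarrow> l" using Cauchy_convergent convergent_def by blast
 have "\<bar>a n - real n * l\<bar> \<le> B" for n
 proof (cases "n = 0")
  case False
  have "(\<lambda>m. \<bar>a n / real n - a m / real m\<bar>) \<longlonglongrightarrow> \<bar>a n / real n - l\<bar>" by (intro tendsto_intros l)
  moreover have "(\<lambda>m. B / real n + B / real m) \<longlonglongrightarrow> B / real n + 0" by (intro tendsto_add tendsto_const Bn)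
  moreover have "\<forall>\<^sub>F m in sequentially. \<bar>a n / real n - a m / real m\<bar> \<le> B / real n + B / real m"
   using eventually_gt_at_top[of 0] by eventually_elim (use dist False in auto)
  ultimately have "\<bar>a n / real n - l\<bar> \<le> B / real n + 0" by (intro tendsto_le[OF trivial_limit_sequentially])
  then have "real n * \<bar>a n / real n - l\<bar> \<le> real n * (B / real n)" by (intro mult_left_mono) auto
  moreover have "real n * \<bar>a n / real n - l\<bar> = \<bar>real n * (a n / real n - l)\<bar>" by (simp add: abs_mult)
  ultimately show ?thesis using False by (simp add: right_diff_distrib)
 qed (use B a0 in simp)
 then show ?thesis using l by blast
qed

context coeffs_chain
begin

lemma AE_coef:
 assumes Q [measurable]: "Measurable.pred borel Q" and lam: "\<And>i. AE u in lam i. Q u"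
 shows "AE \<omega> in P. \<forall>n i. Q (cf \<omega> (n, i))"
proof -
 have "AE \<omega> in P. Q (cf \<omega> (n, i))" for n i
  using lam[of i] unfolding lam_eq'[of n i, symmetric] by (subst (asm) AE_distr_iff) auto
 then show ?thesis by (simp add: AE_all_countable)
qed

text \<open>Every pair of symbols occurs at times 0 and 1 with positive probability and
  independently of the coefficients, so an almost sure property of the selected pair holds under
  each law \<open>lam i\<close>, whatever the next symbol is.\<close>

lemma AE_lam_of_AE:
 assumes Q [measurable]: "\<And>i j. Measurable.pred borel (Q i j)" and AE: "AE \<omega> in P. Q (X 0 \<omega>) (X 1 \<omega>) (cf \<omega> (0, X 0 \<omega>))"
 shows "AE u in lam i. Q i j u"
proof -
 obtain G where G: "G \<in> borel_measurable N1" "\<And>\<omega>. \<omega> \<in> space P \<Longrightarrow> indicat_real (cyl 0 [i, j]) \<omega> = G (Xs \<omega>)"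
  using cyl_N1 by blast
 define A where "A = {u. \<not> Q i j u}"
 have A: "A \<in> sets borel" unfolding A_def by measurable
 define F where "F c = indicat_real A (c (0::int, i))" for c :: "int \<times> 'd \<Rightarrow> real \<times> real"
 have Fm: "F \<in> borel_measurable N2"
  unfolding F_def[abs_def] by (rule measurable_compose[OF comp_measurable2]) (use A in auto)
 have iG: "integrable P (\<lambda>\<omega>. G (Xs \<omega>))"
  using cyl_integrable[of 0 "[i, j]"] G(2) by (subst Bochner_Integration.integrable_cong[OF refl]) auto
 have iF: "integrable P (\<lambda>\<omega>. F (cf \<omega>))"
  by (rule integrable_const_bound[where B=1]) (use measurable_compose[OF cf_measurable Fm] in \<open>auto simp: F_def indicator_def\<close>)
 have G1: "(\<integral>\<omega>. G (Xs \<omega>) \<partial>P) = pl [i, j]"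
 proof -
  have "(\<integral>\<omega>. G (Xs \<omega>) \<partial>P) = (\<integral>\<omega>. indicat_real (cyl 0 [i, j]) \<omega> \<partial>P)"
   by (intro Bochner_Integration.integral_cong) (simp_all add: G(2))
  then show ?thesis by (simp add: prob_cyl)
 qed
 have F1: "(\<integral>\<omega>. F (cf \<omega>) \<partial>P) = measure (lam i) A"
 proof -
  have "(\<integral>\<omega>. F (cf \<omega>) \<partial>P) = (\<integral>\<omega>. indicat_real A (cf \<omega> (0, i)) \<partial>P)" by (simp add: F_def)
  also have "\<dots> = (\<integral>u. indicat_real A u \<partial>distr P borel (\<lambda>\<omega>. cf \<omega> (0, i)))"
   by (rule integral_distr[symmetric]) (use A in auto)
  also have "\<dots> = measure (lam i) A" unfolding lam_eq' using A by simp
  finally show ?thesis .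
 qed
 have "(\<integral>\<omega>. G (Xs \<omega>) * F (cf \<omega>) \<partial>P) = (\<integral>\<omega>. 0 \<partial>P)"
 proof (rule integral_cong_AE)
  show "AE \<omega> in P. G (Xs \<omega>) * F (cf \<omega>) = 0"
   using AE
  proof (rule AE_mp, intro AE_I2 impI)
   fix \<omega> assume \<omega>: "\<omega> \<in> space P" and q: "Q (X 0 \<omega>) (X 1 \<omega>) (cf \<omega> (0, X 0 \<omega>))"
   show "G (Xs \<omega>) * F (cf \<omega>) = 0"
   proof (cases "\<omega> \<in> cyl 0 [i, j]")
    case True
    have "X 0 \<omega> = i" "X 1 \<omega> = j" using cylD[OF True, of 0] cylD[OF True, of 1] by auto
    then show ?thesis using q by (simp add: F_def A_def)
   next
    case False
    then show ?thesis using G(2)[OF \<omega>] by simp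
   qed
  qed
 qed (use measurable_compose[OF cf_measurable Fm] measurable_compose[OF Xs_measurable G(1)] in auto)
 then have "pl [i, j] * measure (lam i) A = 0"
  using indep_integral(1)[OF G(1) iG Fm iF] G1 F1 by simp
 then have "measure (lam i) A = 0" using pl_pos[of "[i, j]"] by simp
 moreover interpret l: prob_space "lam i" by (rule prob_lam)
 have "A \<in> sets (lam i)" using A by simp
 ultimately have "AE u in lam i. u \<notin> A" by (intro AE_not_in) (auto simp: null_sets_def l.emeasure_eq_measure)
 then show ?thesis by (simp add: A_def)
qed

lemma lam_bound: "AE u in lam j. \<bar>fst u\<bar> \<le> q0 \<and> 1 / m0 \<le> \<bar>snd u\<bar> \<and> \<bar>snd u\<bar> \<le> m0"
proof (rule AE_lam_of_AE[where Q="\<lambda>_ _ u. \<bar>fst u\<bar> \<le> q0 \<and> 1 / m0 \<le> \<bar>snd u\<bar> \<and> \<bar>snd u\<bar> \<le> m0"])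
 show "AE \<omega> in P. \<bar>fst (cf \<omega> (0, X 0 \<omega>))\<bar> \<le> q0 \<and> 1 / m0 \<le> \<bar>snd (cf \<omega> (0, X 0 \<omega>))\<bar> \<and> \<bar>snd (cf \<omega> (0, X 0 \<omega>))\<bar> \<le> m0"
  using bound0 by eventually_elim (auto simp: cf_def)
qed measurable

text \<open>The bounds are imposed on all coefficients at once, also on those the chain does not
  select, so that later estimates hold pathwise.\<close>

definition good :: "'a \<Rightarrow> bool" where
 "good \<omega> \<longleftrightarrow> (\<forall>n i. \<bar>Qc n i \<omega>\<bar> \<le> q0 \<and> 1 / m0 \<le> \<bar>Mc n i \<omega>\<bar> \<and> \<bar>Mc n i \<omega>\<bar> \<le> m0)"

lemma AE_good: "AE \<omega> in P. good \<omega>"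
 using AE_coef[OF _ lam_bound] unfolding good_def cf_def by simp

lemma good_M_pos: "good \<omega> \<Longrightarrow> 0 < \<bar>Mc n i \<omega>\<bar>"
 unfolding good_def using m0_pos by (meson divide_pos_pos less_le_trans zero_less_one)

definition momc :: "real \<Rightarrow> 'd \<Rightarrow> real" where "momc \<beta> j = (\<integral>u. \<bar>snd u\<bar> powr \<beta> \<partial>lam j)"

definition mp :: "real \<Rightarrow> 'd list \<Rightarrow> real" where "mp \<beta> u = (\<Prod>i<length u. momc \<beta> (u ! i))"

lemma mp_simps [simp]: "mp \<beta> [] = 1" "mp \<beta> (j # u) = momc \<beta> j * mp \<beta> u"
 unfolding mp_def by (simp_all add: prod.lessThan_Suc_shift del: prod.lessThan_Suc)

lemma mp_append: "mp \<beta> (u @ v) = mp \<beta> u * mp \<beta> v"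
 by (induction u) (simp_all add: mult.assoc)

lemma powr_integrable: "integrable P (\<lambda>\<omega>. \<bar>Mc n i \<omega>\<bar> powr \<beta>)"
proof (rule integrable_const_bound[where B="m0 powr \<bar>\<beta>\<bar> + (1 / m0) powr (- \<bar>\<beta>\<bar>)"])
 show "AE \<omega> in P. norm (\<bar>Mc n i \<omega>\<bar> powr \<beta>) \<le> m0 powr \<bar>\<beta>\<bar> + (1 / m0) powr (- \<bar>\<beta>\<bar>)"
  using AE_good
 proof eventually_elim
  case (elim \<omega>)
  have b: "1 / m0 \<le> \<bar>Mc n i \<omega>\<bar>" "\<bar>Mc n i \<omega>\<bar> \<le> m0" using elim by (auto simp: good_def)
  have p: "0 < \<bar>Mc n i \<omega>\<bar>" by (rule good_M_pos[OF elim])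
  have p1: "0 \<le> m0 powr \<bar>\<beta>\<bar>" "0 \<le> (1 / m0) powr (- \<bar>\<beta>\<bar>)" by simp_all
  show ?case
  proof (cases "0 \<le> \<beta>")
   case True
   then have "\<bar>Mc n i \<omega>\<bar> powr \<beta> \<le> m0 powr \<bar>\<beta>\<bar>" using b p by (simp add: powr_mono2)
   then show ?thesis using p1 unfolding real_norm_def abs_of_nonneg[OF powr_ge_zero] by linarith
  next
   case False
   then have "\<bar>Mc n i \<omega>\<bar> powr \<beta> \<le> (1 / m0) powr (- \<bar>\<beta>\<bar>)" using b m0_pos powr_mono2'[of \<beta> "1 / m0" "\<bar>Mc n i \<omega>\<bar>"] by simp
   then show ?thesis using p1 unfolding real_norm_def abs_of_nonneg[OF powr_ge_zero] by linarith
  qed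
 qed
qed measurable

lemma momc_eq: "(\<integral>\<omega>. \<bar>Mc n i \<omega>\<bar> powr \<beta> \<partial>P) = momc \<beta> i"
proof -
 have "(\<integral>u. \<bar>snd u\<bar> powr \<beta> \<partial>distr P borel (\<lambda>\<omega>. cf \<omega> (n, i))) = (\<integral>\<omega>. \<bar>snd (cf \<omega> (n, i))\<bar> powr \<beta> \<partial>P)"
  by (rule integral_distr) measurable
 then show ?thesis unfolding lam_eq' momc_def by (simp add: cf_def)
qed

lemma momc_pos: "0 < momc \<beta> i"
proof -
 have "0 \<le> momc \<beta> i" unfolding momc_def by (intro integral_nonneg_AE) auto
 moreover have "momc \<beta> i \<noteq> 0"
 proof
  assume "momc \<beta> i = 0"
  then have "(\<integral>\<omega>. \<bar>Mc 0 i \<omega>\<bar> powr \<beta> \<partial>P) = 0" by (simp add: momc_eq)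
  then have "AE \<omega> in P. \<bar>Mc 0 i \<omega>\<bar> powr \<beta> = 0" by (subst (asm) integral_nonneg_eq_0_iff_AE) (auto intro: powr_integrable)
  with AE_good have "AE \<omega> in P. False"
   by eventually_elim (use good_M_pos[of _ 0 i] in force)
  then show False by simp
 qed
 ultimately show ?thesis by simp
qed

lemma mp_pos: "0 < mp \<beta> u" by (induction u) (auto simp: momc_pos)

definition Pw :: "int \<Rightarrow> nat \<Rightarrow> 'a \<Rightarrow> real" where
 "Pw k n \<omega> = (\<Prod>i<n. \<bar>Mc (k - int i) (X (k - int i) \<omega>) \<omega>\<bar>)"

lemma Pw_measurable [measurable]: "Pw k n \<in> borel_measurable P"
 unfolding Pw_def[abs_def] by measurable

text \<open>The moment of a product of \<open>n\<close> selected multipliers, written as a sum over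
  words; in this form near independence of words applies directly.\<close>

definition An :: "real \<Rightarrow> nat \<Rightarrow> real" where
 "An \<beta> n = (\<Sum>u\<in>wds n. pl (rev u) * mp \<beta> u)"

lemma An_pos: "0 < An \<beta> n"
proof -
 have "replicate n undefined \<in> wds n" by (simp add: wds_def)
 then have "wds n \<noteq> {}" by blast
 then show ?thesis unfolding An_def by (intro sum_pos) (auto simp: pl_pos mp_pos)
qed

lemma prod_word: "integrable P (\<lambda>\<omega>. \<Prod>i<length u. \<bar>Mc (k - int i) (u ! i) \<omega>\<bar> powr \<beta>)"
 "(\<integral>\<omega>. (\<Prod>i<length u. \<bar>Mc (k - int i) (u ! i) \<omega>\<bar> powr \<beta>) \<partial>P) = mp \<beta> u"
proof -
 define f where "f p \<omega> = \<bar>snd (cf \<omega> p)\<bar> powr \<beta>" for p \<omega>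
 define I where "I = (\<lambda>i. (k - int i, u ! i)) ` {..<length u}"
 have inj: "inj_on (\<lambda>i. (k - int i, u ! i)) {..<length u}" by (auto simp: inj_on_def)
 have m: "(\<lambda>u. \<bar>snd u\<bar> powr \<beta>) \<in> borel_measurable (borel :: (real \<times> real) measure)" by measurable
 have "indep_vars (\<lambda>_. borel) f UNIV"
  unfolding f_def by (rule indep_vars_compose2[OF cf_indep, where Y="\<lambda>_ u. \<bar>snd u\<bar> powr \<beta>"]) (rule m)
 then have ind: "indep_vars (\<lambda>_. borel) f I" by (rule indep_vars_subset) simp
 have int: "integrable P (f p)" for p using powr_integrable[of "fst p" "snd p" \<beta>] by (simp add: f_def[abs_def] cf_def)
 have fin: "finite I" by (simp add: I_def)
 have eq: "(\<Prod>p\<in>I. f p \<omega>) = (\<Prod>i<length u. \<bar>Mc (k - int i) (u ! i) \<omega>\<bar> powr \<beta>)" for \<omega>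
  unfolding I_def by (subst prod.reindex[OF inj]) (simp add: f_def cf_def)
 show "integrable P (\<lambda>\<omega>. \<Prod>i<length u. \<bar>Mc (k - int i) (u ! i) \<omega>\<bar> powr \<beta>)"
  using indep_vars_integrable[OF fin ind int] by (simp add: eq)
 have "(\<integral>\<omega>. (\<Prod>p\<in>I. f p \<omega>) \<partial>P) = (\<Prod>p\<in>I. \<integral>\<omega>. f p \<omega> \<partial>P)"
  by (rule indep_vars_lebesgue_integral[OF fin ind int])
 also have "\<dots> = (\<Prod>i<length u. \<integral>\<omega>. f (k - int i, u ! i) \<omega> \<partial>P)"
  unfolding I_def by (subst prod.reindex[OF inj]) simp
 also have "\<dots> = mp \<beta> u" unfolding mp_def by (intro prod.cong refl) (simp add: f_def cf_def momc_eq)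
 finally show "(\<integral>\<omega>. (\<Prod>i<length u. \<bar>Mc (k - int i) (u ! i) \<omega>\<bar> powr \<beta>) \<partial>P) = mp \<beta> u" by (simp add: eq)
qed

lemma Pw_powr: "Pw k n \<omega> powr \<beta> = (\<Prod>i<n. \<bar>Mc (k - int i) (X (k - int i) \<omega>) \<omega>\<bar> powr \<beta>)"
 unfolding Pw_def by (induction n) (simp_all add: powr_mult)

lemma Pw_word: "\<omega> \<in> space P \<Longrightarrow> Pw k n \<omega> powr \<beta> =
 (\<Sum>u\<in>wds n. indicator (cyl (k + 1 - int n) (rev u)) \<omega> * (\<Prod>i<length u. \<bar>Mc (k - int i) (u ! i) \<omega>\<bar> powr \<beta>))"
proof -
 assume \<omega>: "\<omega> \<in> space P"
 have "Pw k n \<omega> powr \<beta> = (\<Sum>u\<in>wds n. indicator (cyl (k + 1 - int n) (rev u)) \<omega> * Pw k n \<omega> powr \<beta>)"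
  using indicator_partition[OF \<omega>, where f="\<lambda>\<omega>. Pw k n \<omega> powr \<beta>" and n=n and k="k + 1 - int n"]
  by (simp add: sum_wds_rev[of "\<lambda>w. indicator (cyl (k + 1 - int n) w) \<omega> * Pw k n \<omega> powr \<beta>"])
 also have "\<dots> = (\<Sum>u\<in>wds n. indicator (cyl (k + 1 - int n) (rev u)) \<omega> * (\<Prod>i<length u. \<bar>Mc (k - int i) (u ! i) \<omega>\<bar> powr \<beta>))"
 proof (intro sum.cong refl)
  fix u assume u: "u \<in> wds n"
  have l: "length u = n" by (rule wds_length[OF u])
  show "indicator (cyl (k + 1 - int n) (rev u)) \<omega> * Pw k n \<omega> powr \<beta> =
   indicator (cyl (k + 1 - int n) (rev u)) \<omega> * (\<Prod>i<length u. \<bar>Mc (k - int i) (u ! i) \<omega>\<bar> powr \<beta>)"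
  proof (cases "\<omega> \<in> cyl (k + 1 - int n) (rev u)")
   case True
   have "X (k - int i) \<omega> = u ! i" if "i < n" for i
   proof -
    have ll: "n - Suc i < length (rev u)" using that l by simp
    have e: "k + 1 - int n + int (n - Suc i) = k - int i" using that by (simp add: of_nat_diff)
    show ?thesis using cylD[OF True ll] that l unfolding e by (simp add: rev_nth)
   qed
   then show ?thesis unfolding Pw_powr l by simp
  qed simp
 qed
 finally show ?thesis .
qed

lemma Pw_expectation: "integrable P (\<lambda>\<omega>. Pw k n \<omega> powr \<beta>)" "(\<integral>\<omega>. Pw k n \<omega> powr \<beta> \<partial>P) = An \<beta> n"
proof -
 define F where "F u c = (\<Prod>i<length u. \<bar>snd (c (k - int i, u ! i))\<bar> powr \<beta>)" for u and c :: "int \<times> 'd \<Rightarrow> real \<times> real"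
 have Fm: "F u \<in> borel_measurable N2" for u
 proof -
  have "(\<lambda>c. \<bar>snd (c p)\<bar> powr \<beta>) \<in> borel_measurable N2" for p
  proof -
   have "(\<lambda>u. \<bar>snd u\<bar> powr \<beta>) \<in> borel_measurable (borel :: (real \<times> real) measure)" by measurable
   then show ?thesis using measurable_compose[OF comp_measurable2[of p]] by blast
  qed
  then show ?thesis unfolding F_def[abs_def] by (intro borel_measurable_prod)
 qed
 have Fe: "F u (cf \<omega>) = (\<Prod>i<length u. \<bar>Mc (k - int i) (u ! i) \<omega>\<bar> powr \<beta>)" for u \<omega> by (simp add: F_def cf_def)
 have iF: "integrable P (\<lambda>\<omega>. F u (cf \<omega>))" "(\<integral>\<omega>. F u (cf \<omega>) \<partial>P) = mp \<beta> u" for u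
  using prod_word[of k u \<beta>] by (simp_all add: Fe)
 have trm: "integrable P (\<lambda>\<omega>. indicator (cyl l w) \<omega> * F u (cf \<omega>)) \<and> (\<integral>\<omega>. indicator (cyl l w) \<omega> * F u (cf \<omega>) \<partial>P) = pl w * mp \<beta> u" for l w u
 proof -
  obtain G where G: "G \<in> borel_measurable N1" "\<And>\<omega>. \<omega> \<in> space P \<Longrightarrow> indicat_real (cyl l w) \<omega> = G (Xs \<omega>)"
   using cyl_N1 by blast
  have iG: "integrable P (\<lambda>\<omega>. G (Xs \<omega>))"
   using cyl_integrable[of l w] G(2) by (subst Bochner_Integration.integrable_cong[OF refl]) auto
  have eG: "(\<integral>\<omega>. G (Xs \<omega>) \<partial>P) = pl w"
  proof -
   have "(\<integral>\<omega>. G (Xs \<omega>) \<partial>P) = (\<integral>\<omega>. indicat_real (cyl l w) \<omega> \<partial>P)"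
    by (intro Bochner_Integration.integral_cong) (simp_all add: G(2))
   then show ?thesis by (simp add: prob_cyl)
  qed
  have "integrable P (\<lambda>\<omega>. indicator (cyl l w) \<omega> * F u (cf \<omega>)) \<longleftrightarrow> integrable P (\<lambda>\<omega>. G (Xs \<omega>) * F u (cf \<omega>))"
   by (intro Bochner_Integration.integrable_cong) (simp_all add: G(2))
  moreover have "(\<integral>\<omega>. indicator (cyl l w) \<omega> * F u (cf \<omega>) \<partial>P) = (\<integral>\<omega>. G (Xs \<omega>) * F u (cf \<omega>) \<partial>P)"
   by (intro Bochner_Integration.integral_cong) (simp_all add: G(2))
  ultimately show ?thesis using indep_integral[OF G(1) iG Fm iF(1)] iF(2) eG by simp
 qed
 have eq: "Pw k n \<omega> powr \<beta> = (\<Sum>u\<in>wds n. indicator (cyl (k + 1 - int n) (rev u)) \<omega> * F u (cf \<omega>))" if "\<omega> \<in> space P" for \<omega>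
  using Pw_word[OF that] by (simp add: Fe)
 show "integrable P (\<lambda>\<omega>. Pw k n \<omega> powr \<beta>)"
  by (subst Bochner_Integration.integrable_cong[OF refl eq], assumption, rule Bochner_Integration.integrable_sum) (use trm in blast)
 have "(\<integral>\<omega>. Pw k n \<omega> powr \<beta> \<partial>P) = (\<integral>\<omega>. (\<Sum>u\<in>wds n. indicator (cyl (k + 1 - int n) (rev u)) \<omega> * F u (cf \<omega>)) \<partial>P)"
  by (intro Bochner_Integration.integral_cong refl eq)
 also have "\<dots> = (\<Sum>u\<in>wds n. \<integral>\<omega>. indicator (cyl (k + 1 - int n) (rev u)) \<omega> * F u (cf \<omega>) \<partial>P)"
  by (rule Bochner_Integration.integral_sum) (use trm in blast)
 also have "\<dots> = An \<beta> n" using trm by (simp add: An_def)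
 finally show "(\<integral>\<omega>. Pw k n \<omega> powr \<beta> \<partial>P) = An \<beta> n" .
qed

lemma sum_wds_add: "(\<Sum>w\<in>wds (n + m). f w) = (\<Sum>u\<in>wds n. \<Sum>v\<in>wds m. f (u @ v))"
proof (induction n arbitrary: f)
 case 0 then show ?case by simp
next
 case (Suc n)
 have "(\<Sum>w\<in>wds (Suc n + m). f w) = (\<Sum>j\<in>UNIV. \<Sum>w\<in>wds (n + m). f (j # w))" by (simp add: sum_wds_Suc)
 also have "\<dots> = (\<Sum>j\<in>UNIV. \<Sum>u\<in>wds n. \<Sum>v\<in>wds m. f ((j # u) @ v))" unfolding Suc.IH by simp
 also have "\<dots> = (\<Sum>u\<in>wds (Suc n). \<Sum>v\<in>wds m. f (u @ v))" unfolding sum_wds_Suc ..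
 finally show ?case .
qed

text \<open>Near independence with an empty separating block makes word probabilities multiplicative
  up to \<open>exp BB\<close>, and the word moments are exactly multiplicative. The two-sided
  estimate is what keeps the moments bounded at the critical exponent.\<close>

lemma An_quasi: "An \<beta> (n + m) \<le> exp BB * (An \<beta> n * An \<beta> m)" "An \<beta> n * An \<beta> m \<le> exp BB * An \<beta> (n + m)"
proof -
 have s: "pl (v @ u) \<le> exp BB * (pl u * pl v)" "pl u * pl v \<le> exp BB * pl (v @ u)" for u v
  using pl_split(1)[of v "[]" u] pl_split(2)[of "[]" u v] by (simp_all add: pl_Nil)
 have A: "An \<beta> n * An \<beta> m = (\<Sum>u\<in>wds n. \<Sum>v\<in>wds m. (pl (rev u) * pl (rev v)) * (mp \<beta> u * mp \<beta> v))"
  unfolding An_def sum_product by (simp add: mult_ac)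
 have B: "An \<beta> (n + m) = (\<Sum>u\<in>wds n. \<Sum>v\<in>wds m. pl (rev v @ rev u) * (mp \<beta> u * mp \<beta> v))"
  unfolding An_def sum_wds_add by (simp add: mp_append)
 have pos: "0 \<le> mp \<beta> u * mp \<beta> v" for u v using mp_pos[of \<beta> u] mp_pos[of \<beta> v] by simp
 have "An \<beta> (n + m) \<le> (\<Sum>u\<in>wds n. \<Sum>v\<in>wds m. (exp BB * (pl (rev u) * pl (rev v))) * (mp \<beta> u * mp \<beta> v))"
  unfolding B by (intro sum_mono mult_right_mono s pos)
 then show "An \<beta> (n + m) \<le> exp BB * (An \<beta> n * An \<beta> m)" unfolding A by (simp add: sum_distrib_left mult.assoc)
 have "An \<beta> n * An \<beta> m \<le> (\<Sum>u\<in>wds n. \<Sum>v\<in>wds m. (exp BB * pl (rev v @ rev u)) * (mp \<beta> u * mp \<beta> v))"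
  unfolding A by (intro sum_mono mult_right_mono s pos)
 then show "An \<beta> n * An \<beta> m \<le> exp BB * An \<beta> (n + m)" unfolding B by (simp add: sum_distrib_left mult.assoc)
qed

lemma An_0 [simp]: "An \<beta> 0 = 1" by (simp add: An_def pl_Nil)

definition Lam :: "real \<Rightarrow> real" where "Lam \<beta> = lim (\<lambda>n. ln (An \<beta> n) / real n)"

lemma Lam_lim: "(\<lambda>n. ln (An \<beta> n) / real n) \<longlonglongrightarrow> Lam \<beta>"
 and Lam_bound: "\<bar>ln (An \<beta> n) - real n * Lam \<beta>\<bar> \<le> BB"
proof -
 have "\<bar>ln (An \<beta> (n + m)) - ln (An \<beta> n) - ln (An \<beta> m)\<bar> \<le> BB" for n m
 proof -
  have "ln (An \<beta> (n + m)) \<le> ln (exp BB * (An \<beta> n * An \<beta> m))" "ln (An \<beta> n * An \<beta> m) \<le> ln (exp BB * An \<beta> (n + m))"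
   using An_quasi An_pos by (auto simp: ln_le_cancel_iff)
  then show ?thesis using An_pos[of \<beta> n] An_pos[of \<beta> m] An_pos[of \<beta> "n + m"] by (simp add: ln_mult abs_le_iff)
 qed
 from quasi_additive_limit[of "\<lambda>n. ln (An \<beta> n)", OF this]
 have ex: "\<exists>l. (\<lambda>n. ln (An \<beta> n) / real n) \<longlonglongrightarrow> l \<and> (\<forall>n. \<bar>ln (An \<beta> n) - real n * l\<bar> \<le> BB)" by simp
 then obtain l where l: "(\<lambda>n. ln (An \<beta> n) / real n) \<longlonglongrightarrow> l" "\<And>n. \<bar>ln (An \<beta> n) - real n * l\<bar> \<le> BB" by blast
 have eq: "Lam \<beta> = l" unfolding Lam_def by (rule limI[OF l(1)])
 show "(\<lambda>n. ln (An \<beta> n) / real n) \<longlonglongrightarrow> Lam \<beta>" "\<bar>ln (An \<beta> n) - real n * Lam \<beta>\<bar> \<le> BB"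
  unfolding eq by (rule l(1), rule l(2))
qed

lemma An_bounds: "An \<beta> n \<le> exp (BB + real n * Lam \<beta>)" "exp (real n * Lam \<beta> - BB) \<le> An \<beta> n"
proof -
 have "ln (An \<beta> n) \<le> BB + real n * Lam \<beta>" "real n * Lam \<beta> - BB \<le> ln (An \<beta> n)"
  using Lam_bound[of \<beta> n] by linarith+
 then have "exp (ln (An \<beta> n)) \<le> exp (BB + real n * Lam \<beta>)" "exp (real n * Lam \<beta> - BB) \<le> exp (ln (An \<beta> n))" by simp_all
 then show "An \<beta> n \<le> exp (BB + real n * Lam \<beta>)" "exp (real n * Lam \<beta> - BB) \<le> An \<beta> n" using An_pos[of \<beta> n] by simp_all
qed

text \<open>The product over times \<open>0\<close> to \<open>n - 1\<close> is the backward product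
  started at time \<open>n - 1\<close>, and the moments of backward products do not depend on the
  starting time.\<close>

lemma Lambda_seq_eq: "Lambda_seq P X Mc \<beta> n = ln (An \<beta> n) / real n"
proof -
 have "(\<Prod>i<n. \<bar>Mc (int i) (X (int i) \<omega>) \<omega>\<bar> powr \<beta>) = Pw (int n - 1) n \<omega> powr \<beta>" for \<omega>
 proof -
  have "(\<Prod>i<n. \<bar>Mc (int i) (X (int i) \<omega>) \<omega>\<bar> powr \<beta>) = (\<Prod>i<n. \<bar>Mc (int (n - Suc i)) (X (int (n - Suc i)) \<omega>) \<omega>\<bar> powr \<beta>)"
   by (rule prod.nat_diff_reindex[symmetric])
  also have "\<dots> = Pw (int n - 1) n \<omega> powr \<beta>"
  proof -
   have e: "int (n - Suc i) = int n - 1 - int i" if "i < n" for i using that by (simp add: of_nat_diff)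
   show ?thesis unfolding Pw_powr by (intro prod.cong refl) (simp only: lessThan_iff e)
  qed
  finally show ?thesis .
 qed
 then show ?thesis unfolding Lambda_seq_def by (simp add: Pw_expectation(2))
qed

lemma Lambda_eq: "Lambda P X Mc \<beta> = ereal (Lam \<beta>)"
 unfolding Lambda_def Lambda_seq_eq using Lam_lim[of \<beta>] by (intro lim_imp_Limsup) auto

lemma Lambda_seq_lim: "(\<lambda>n. ereal (Lambda_seq P X Mc \<beta> n)) \<longlonglongrightarrow> Lambda P X Mc \<beta>"
 unfolding Lambda_eq Lambda_seq_eq using Lam_lim[of \<beta>] by simp

lemma Pw_pos: "good \<omega> \<Longrightarrow> 0 < Pw k n \<omega>"
 unfolding Pw_def by (intro prod_pos ballI) (rule good_M_pos)

text \<open>The inequality of Hoelder, derived from the pointwise inequality of Young after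
  normalising both powers by their expectations.\<close>

lemma An_log_convex:
 assumes t: "0 < t" "t < 1"
 shows "An ((1 - t) * x + t * y) n \<le> An x n powr (1 - t) * An y n powr t"
proof -
 define a b where "a = An x n" and "b = An y n"
 have ab: "0 < a" "0 < b" by (simp_all add: a_def b_def An_pos)
 have i: "integrable P (\<lambda>\<omega>. a powr (1 - t) * b powr t * ((1 - t) / a * Pw 0 n \<omega> powr x + t / b * Pw 0 n \<omega> powr y))"
  by (intro integrable_mult_right Bochner_Integration.integrable_add Pw_expectation)
 have "An ((1 - t) * x + t * y) n = (\<integral>\<omega>. Pw 0 n \<omega> powr ((1 - t) * x + t * y) \<partial>P)" by (simp add: Pw_expectation)
 also have "\<dots> \<le> (\<integral>\<omega>. a powr (1 - t) * b powr t * ((1 - t) / a * Pw 0 n \<omega> powr x + t / b * Pw 0 n \<omega> powr y) \<partial>P)"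
 proof (rule integral_mono_AE[OF Pw_expectation(1) i])
  show "AE \<omega> in P. Pw 0 n \<omega> powr ((1 - t) * x + t * y) \<le> a powr (1 - t) * b powr t * ((1 - t) / a * Pw 0 n \<omega> powr x + t / b * Pw 0 n \<omega> powr y)"
   using AE_good
  proof eventually_elim
   case (elim \<omega>)
   define p where "p = Pw 0 n \<omega>"
   have p: "0 < p" using Pw_pos[OF elim] by (simp add: p_def)
   have "(p powr x / a) powr (1 - t) * (p powr y / b) powr t \<le> (1 - t) * (p powr x / a) + t * (p powr y / b)"
    by (rule Youngs_inequality_0) (use t p ab in auto)
   then have "a powr (1 - t) * b powr t * ((p powr x / a) powr (1 - t) * (p powr y / b) powr t) \<le> a powr (1 - t) * b powr t * ((1 - t) / a * p powr x + t / b * p powr y)"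
    by (intro mult_left_mono) auto
   moreover have "a powr (1 - t) * b powr t * ((p powr x / a) powr (1 - t) * (p powr y / b) powr t) = p powr ((1 - t) * x + t * y)"
    using ab p by (simp add: powr_divide powr_powr powr_add mult_ac)
   ultimately show ?case by (simp add: p_def)
  qed
 qed
 also have "\<dots> = a powr (1 - t) * b powr t * ((1 - t) / a * a + t / b * b)"
  by (subst integral_mult_right_zero, subst Bochner_Integration.integral_add)
   (simp_all add: Pw_expectation a_def b_def)
 also have "\<dots> = a powr (1 - t) * b powr t" using ab by simp
 finally show ?thesis by (simp add: a_def b_def)
qed

lemma Lam_convex: "convex_on UNIV Lam"
proof (rule convex_onI)
 fix t x y :: real assume t: "0 < t" "t < 1"
 have le: "ln (An ((1 - t) * x + t * y) n) \<le> (1 - t) * ln (An x n) + t * ln (An y n)" for n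
 proof -
  have "ln (An ((1 - t) * x + t * y) n) \<le> ln (An x n powr (1 - t) * An y n powr t)"
  proof (subst ln_le_cancel_iff)
   show "0 < An x n powr (1 - t) * An y n powr t"
    using An_pos[of x n] An_pos[of y n] by (intro mult_pos_pos) simp_all
  qed (rule An_pos, rule An_log_convex[OF t])
  also have "\<dots> = (1 - t) * ln (An x n) + t * ln (An y n)" using An_pos[of x n] An_pos[of y n] by (simp add: ln_mult ln_powr)
  finally show ?thesis .
 qed
 have "Lam ((1 - t) * x + t * y) \<le> (1 - t) * Lam x + t * Lam y"
 proof (rule tendsto_le[OF trivial_limit_sequentially _ Lam_lim])
  show "(\<lambda>n. (1 - t) * (ln (An x n) / real n) + t * (ln (An y n) / real n)) \<longlonglongrightarrow> (1 - t) * Lam x + t * Lam y"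
   by (intro tendsto_intros Lam_lim)
  have "ln (An ((1 - t) * x + t * y) n) / real n \<le> (1 - t) * (ln (An x n) / real n) + t * (ln (An y n) / real n)" for n
   using divide_right_mono[OF le[of n], of "real n"] by (simp add: add_divide_distrib)
  then show "\<forall>\<^sub>F n in sequentially. ln (An ((1 - t) * x + t * y) n) / real n \<le> (1 - t) * (ln (An x n) / real n) + t * (ln (An y n) / real n)" by simp
 qed
 then show "Lam ((1 - t) *\<^sub>R x + t *\<^sub>R y) \<le> (1 - t) * Lam x + t * Lam y" by simp
qed simp

lemma Lam_0: "Lam 0 = 0"
proof -
 have "momc 0 i = 1" for i
 proof -
  have "momc 0 i = (\<integral>\<omega>. \<bar>Mc 0 i \<omega>\<bar> powr 0 \<partial>P)" by (rule momc_eq[symmetric])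
  also have "(\<integral>\<omega>. \<bar>Mc 0 i \<omega>\<bar> powr 0 \<partial>P) = (\<integral>\<omega>. 1 \<partial>P)"
  proof (rule integral_cong_AE)
   show "AE \<omega> in P. \<bar>Mc 0 i \<omega>\<bar> powr 0 = 1" using AE_good by eventually_elim (use good_M_pos[of _ 0 i] in force)
  qed auto
  finally show ?thesis by (simp add: prob_space)
 qed
 then have "mp 0 u = 1" for u by (induction u) auto
 then have "An 0 n = 1" for n using sum_pl_suffix[of "[]" n] by (simp add: An_def sum_wds_rev[of pl] pl_Nil)
 then show ?thesis using Lam_lim[of 0] by (simp add: LIMSEQ_const_iff)
qed

lemma Lam_conv: "0 \<le> t \<Longrightarrow> t \<le> 1 \<Longrightarrow> Lam ((1 - t) * x + t * y) \<le> (1 - t) * Lam x + t * Lam y"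
 using convex_onD[OF Lam_convex, of t x y] by simp

lemma Lam_between:
 assumes "x < y" "y < z" "Lam x \<le> 0" "Lam z \<le> 0" "Lam x < 0 \<or> Lam z < 0"
 shows "Lam y < 0"
proof -
 define t where "t = (y - x) / (z - x)"
 have t: "0 < t" "t < 1" using assms by (auto simp: t_def)
 have "(1 - t) * x + t * z = x + t * (z - x)" by (simp add: algebra_simps)
 also have "\<dots> = y" using assms by (simp add: t_def)
 finally have "Lam y \<le> (1 - t) * Lam x + t * Lam z" using Lam_conv[of t x z] t by simp
 moreover have "(1 - t) * Lam x + t * Lam z < 0"
  using assms t mult_nonneg_nonpos[of "1 - t" "Lam x"] mult_nonneg_nonpos[of t "Lam z"]
   mult_pos_neg[of "1 - t" "Lam x"] mult_pos_neg[of t "Lam z"] by (auto simp: add_nonpos_neg add_neg_nonpos)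
 ultimately show ?thesis by linarith
qed

text \<open>A convex function that vanishes at 0 and is negative at \<open>b1\<close> can return to
  0 only once, beyond \<open>b1\<close>, and is negative before. Convexity also gives
  \<open>b1 < b2\<close>, so the intermediate value theorem provides the zero.\<close>

lemma critical_exponent:
 assumes b: "0 < b1" "0 < b2" "Lam b1 < 0" "Lam b2 > 0"
 shows "\<exists>\<alpha>>0. Lam \<alpha> = 0 \<and> (\<forall>a. a > 0 \<and> Lam a = 0 \<longrightarrow> a = \<alpha>) \<and> (\<forall>\<beta>. 0 < \<beta> \<and> \<beta> < \<alpha> \<longrightarrow> Lam \<beta> < 0)"
proof -
 have cont: "continuous_on UNIV Lam" by (rule convex_on_continuous[OF open_UNIV Lam_convex])
 have "b1 < b2"
 proof (rule ccontr)
  assume "\<not> b1 < b2"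
  then have "b2 < b1" using b by (cases "b1 = b2") auto
  then have "Lam b2 < 0" using Lam_between[of 0 b2 b1] b Lam_0 by simp
  then show False using b by simp
 qed
 then obtain \<alpha> where \<alpha>: "b1 \<le> \<alpha>" "\<alpha> \<le> b2" "Lam \<alpha> = 0"
  using IVT'[of Lam b1 0 b2] b continuous_on_subset[OF cont] by auto
 have a1: "b1 < \<alpha>" using \<alpha> b by (cases "b1 = \<alpha>") auto
 have key: "Lam \<beta> < 0" if "0 < \<beta>" "\<beta> < a" "Lam a = 0" "b1 < a" for \<beta> a
 proof (cases "\<beta>" b1 rule: linorder_cases)
  case less then show ?thesis using Lam_between[of 0 \<beta> b1] that b Lam_0 by simp
 next
  case equal then show ?thesis using b by simp
 next
  case greater then show ?thesis using Lam_between[of b1 \<beta> a] that b by simp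
 qed
 have uniq: "a = \<alpha>" if "a > 0" "Lam a = 0" for a
 proof (rule ccontr)
  assume "a \<noteq> \<alpha>"
  have ab: "b1 < a"
  proof (rule ccontr)
   assume "\<not> b1 < a"
   then have "a < b1" using that b by (cases "a = b1") auto
   then show False using Lam_between[of 0 a b1] that b Lam_0 by simp
  qed
  show False
  proof (cases "a < \<alpha>")
   case True then show False using key[of a \<alpha>] that \<alpha> a1 by simp
  next
   case False then show False using key[of \<alpha> a] that \<alpha> a1 ab b \<open>a \<noteq> \<alpha>\<close> by simp
  qed
 qed
 show ?thesis using \<alpha> b a1 uniq key[OF _ _ \<alpha>(3) a1] by (intro exI[of _ \<alpha>]) auto
qed

end

section \<open>Almost sure convergence of the perpetuity and its a priori tail\<close>

context coeffs_chain
begin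

abbreviation Qx :: "int \<Rightarrow> 'a \<Rightarrow> real" where "Qx k \<omega> \<equiv> Qc k (X k \<omega>) \<omega>"
abbreviation Mx :: "int \<Rightarrow> 'a \<Rightarrow> real" where "Mx k \<omega> \<equiv> Mc k (X k \<omega>) \<omega>"

lemma Rt_diff: "Rt (Suc N) k \<omega> - Rt N k \<omega> = Qx (k - int N) \<omega> * (\<Prod>i<N. Mx (k - int i) \<omega>)"
proof (induction N arbitrary: k)
 case (Suc N)
 have "Rt (Suc (Suc N)) k \<omega> - Rt (Suc N) k \<omega> = Mx k \<omega> * (Rt (Suc N) (k - 1) \<omega> - Rt N (k - 1) \<omega>)"
  unfolding Rt.simps(2)[of "Suc N" k] Rt.simps(2)[of N k] by (simp only: algebra_simps)
 also have "\<dots> = Mx k \<omega> * (Qx (k - 1 - int N) \<omega> * (\<Prod>i<N. Mx (k - 1 - int i) \<omega>))" unfolding Suc.IH ..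
 also have "\<dots> = Qx (k - int (Suc N)) \<omega> * (\<Prod>i<Suc N. Mx (k - int i) \<omega>)"
  unfolding prod.lessThan_Suc_shift by (simp add: diff_diff_eq mult_ac)
 finally show ?case .
qed simp

lemma Rt_diff_le: "good \<omega> \<Longrightarrow> \<bar>Rt (Suc N) k \<omega> - Rt N k \<omega>\<bar> \<le> q0 * Pw k N \<omega>"
 unfolding Rt_diff abs_mult abs_prod Pw_def good_def by (intro mult_right_mono prod_nonneg) auto

lemma Pw_tail:
 assumes \<beta>: "0 < \<beta>" and s: "0 < s"
 shows "prob {\<omega>\<in>space P. s < Pw k n \<omega>} \<le> An \<beta> n * s powr (- \<beta>)"
proof -
 have "prob {\<omega>\<in>space P. s < Pw k n \<omega>} \<le> prob {\<omega>\<in>space P. s powr \<beta> \<le> Pw k n \<omega> powr \<beta>}"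
  using \<beta> s by (intro finite_measure_mono) (auto intro!: powr_mono2)
 also have "\<dots> \<le> (\<integral>\<omega>. Pw k n \<omega> powr \<beta> \<partial>P) / s powr \<beta>"
  by (rule integral_Markov_inequality_measure[where A="{}"]) (use s Pw_expectation in auto)
 finally show ?thesis by (simp add: Pw_expectation powr_minus divide_inverse)
qed

text \<open>The threshold \<open>t\<close> is distributed over the terms of the series with
  geometric weights of total 1, and each term is estimated by the moment inequality of Markov at
  exponent \<open>\<beta>\<close>.\<close>

lemma tail_core:
 assumes \<beta>: "0 < \<beta>" "Lam \<beta> < 0"
 shows "\<exists>r C. 0 < r \<and> r < 1 \<and> 0 \<le> C \<and> (\<forall>t>0. prob {\<omega>\<in>space P. \<exists>n. (1 - r) * r ^ n * t < q0 * Pw k n \<omega>} \<le> C * t powr (- \<beta>))"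
proof -
 \<comment> \<open>With this ratio the weights cost \<open>exp (- n * Lam \<beta> / 2)\<close>, half
   of the decay of the moments; the other half, \<open>z ^ n\<close>, sums the series.\<close>
 define r where "r = exp (Lam \<beta> / (2 * \<beta>))"
 define z where "z = exp (Lam \<beta> / 2)"
 define D where "D = exp BB * ((1 - r) / q0) powr (- \<beta>)"
 have r: "0 < r" "r < 1" using \<beta> by (auto simp: r_def divide_neg_pos)
 have z: "0 < z" "z < 1" using \<beta> by (auto simp: z_def)
 have D: "0 \<le> D" by (simp add: D_def)
 define E where "E t n = {\<omega>\<in>space P. (1 - r) * r ^ n * t / q0 < Pw k n \<omega>}" for t n
 have E: "range (E t) \<subseteq> events" for t unfolding E_def by auto
 have p: "prob (E t n) \<le> D * t powr (- \<beta>) * z ^ n" if t: "0 < t" for t n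
 proof -
  have s: "0 < (1 - r) * r ^ n * t / q0" using r t q0_pos by simp
  have "prob (E t n) \<le> An \<beta> n * ((1 - r) * r ^ n * t / q0) powr (- \<beta>)"
   unfolding E_def by (rule Pw_tail[OF \<beta>(1) s])
  also have "\<dots> \<le> exp (BB + real n * Lam \<beta>) * ((1 - r) * r ^ n * t / q0) powr (- \<beta>)"
   by (intro mult_right_mono An_bounds) auto
  also have "((1 - r) * r ^ n * t / q0) powr (- \<beta>) = ((1 - r) / q0) powr (- \<beta>) * (r ^ n) powr (- \<beta>) * t powr (- \<beta>)"
  proof -
   have "(1 - r) * r ^ n * t / q0 = (1 - r) / q0 * r ^ n * t" by simp
   then show ?thesis using r t q0_pos by (simp only: powr_mult)
  qed
  also have "(r ^ n) powr (- \<beta>) = exp (- (real n * Lam \<beta> / 2))"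
   using \<beta> by (simp add: r_def powr_def exp_of_nat_mult[symmetric] ln_exp)
  also have "exp (BB + real n * Lam \<beta>) * (((1 - r) / q0) powr (- \<beta>) * exp (- (real n * Lam \<beta> / 2)) * t powr (- \<beta>))
   = D * t powr (- \<beta>) * (exp (real n * Lam \<beta>) * exp (- (real n * Lam \<beta> / 2)))"
   by (simp add: D_def exp_add mult_ac)
  also have "exp (real n * Lam \<beta>) * exp (- (real n * Lam \<beta> / 2)) = z ^ n"
   by (simp add: z_def exp_of_nat_mult[symmetric] exp_add[symmetric])
  finally show ?thesis .
 qed
 have sz: "(\<lambda>n. D * t powr (- \<beta>) * z ^ n) sums (D * t powr (- \<beta>) * (1 / (1 - z)))" for t
  by (intro sums_mult geometric_sums) (use z in simp)
 have "prob {\<omega>\<in>space P. \<exists>n. (1 - r) * r ^ n * t < q0 * Pw k n \<omega>} \<le> (D / (1 - z)) * t powr (- \<beta>)" if t: "0 < t" for t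
 proof -
  have su: "summable (\<lambda>n. prob (E t n))"
   by (rule summable_comparison_test'[OF sums_summable[OF sz[of t]], of 0]) (use p[OF t] in simp)
  have "{\<omega>\<in>space P. \<exists>n. (1 - r) * r ^ n * t < q0 * Pw k n \<omega>} = (\<Union>n. E t n)"
   using q0_pos by (auto simp: E_def divide_less_eq mult_ac)
  then have "prob {\<omega>\<in>space P. \<exists>n. (1 - r) * r ^ n * t < q0 * Pw k n \<omega>} = prob (\<Union>n. E t n)" by simp
  also have "\<dots> \<le> (\<Sum>n. prob (E t n))" by (rule finite_measure_subadditive_countably[OF E su])
  also have "\<dots> \<le> (\<Sum>n. D * t powr (- \<beta>) * z ^ n)" by (intro suminf_le p t su sums_summable[OF sz])
  also have "\<dots> = (D / (1 - z)) * t powr (- \<beta>)" using sums_unique[OF sz[of t]] by simp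
  finally show ?thesis .
 qed
 moreover have "0 \<le> D / (1 - z)" using D z by simp
 ultimately show ?thesis using r by blast
qed

text \<open>On the complementary event the increments are dominated by a geometric series with sum
  \<open>t\<close>, which gives the bound, convergence, and decay of the products together.\<close>

lemma Rt_le_of_Pw:
 assumes g: "good \<omega>" and r: "0 < r" "r < 1" and b: "\<And>n. q0 * Pw k n \<omega> \<le> (1 - r) * r ^ n * t"
 shows "\<bar>Rt N k \<omega>\<bar> \<le> t" "convergent (\<lambda>N. Rt N k \<omega>)" "(\<lambda>n. Pw k n \<omega>) \<longlonglongrightarrow> 0"
proof -
 have d: "\<bar>Rt (Suc N) k \<omega> - Rt N k \<omega>\<bar> \<le> (1 - r) * r ^ N * t" for N
  using Rt_diff_le[OF g, of N k] b[of N] by linarith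
 have t: "0 \<le> t"
 proof -
  have "0 \<le> (1 - r) * t" using b[of 0] q0_pos by (simp add: Pw_def)
  then show ?thesis using r by (simp add: zero_le_mult_iff)
 qed
 have R: "\<bar>Rt N k \<omega>\<bar> \<le> (1 - r ^ N) * t" for N
 proof (induction N)
  case (Suc N)
  have "(1 - r ^ Suc N) * t = (1 - r ^ N) * t + (1 - r) * r ^ N * t" by (simp add: algebra_simps)
  then show ?case using Suc d[of N] by linarith
 qed simp
 have "(1 - r ^ N) * t \<le> t" using mult_right_mono[of "1 - r ^ N" 1 t] r t by simp
 then show "\<bar>Rt N k \<omega>\<bar> \<le> t" using R[of N] by linarith
 have "summable (\<lambda>N. (1 - r) * r ^ N * t)" using r by (intro summable_mult summable_mult2 summable_geometric) auto
 moreover have "norm (Rt (Suc N) k \<omega> - Rt N k \<omega>) \<le> (1 - r) * r ^ N * t" for N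
  using d[of N] unfolding real_norm_def .
 ultimately have "summable (\<lambda>N. Rt (Suc N) k \<omega> - Rt N k \<omega>)"
  by (rule summable_comparison_test'[where N=0])
 then have c: "convergent (\<lambda>n. \<Sum>N<n. Rt (Suc N) k \<omega> - Rt N k \<omega>)" unfolding summable_iff_convergent .
 have e: "(\<lambda>n. \<Sum>N<n. Rt (Suc N) k \<omega> - Rt N k \<omega>) = (\<lambda>n. Rt n k \<omega>)"
 proof
  fix n show "(\<Sum>N<n. Rt (Suc N) k \<omega> - Rt N k \<omega>) = Rt n k \<omega>"
   by (induction n) (simp_all del: Rt.simps(2))
 qed
 show "convergent (\<lambda>N. Rt N k \<omega>)" using c unfolding e .
 have "(\<lambda>n. (1 - r) * r ^ n * t / q0) \<longlonglongrightarrow> (1 - r) * 0 * t / q0"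
  using r q0_pos by (intro tendsto_intros LIMSEQ_realpow_zero) auto
 then have A: "(\<lambda>n. (1 - r) * r ^ n * t / q0) \<longlonglongrightarrow> 0" by simp
 have "Pw k n \<omega> \<le> (1 - r) * r ^ n * t / q0" for n using b[of n] unfolding pos_le_divide_eq[OF q0_pos] mult.commute[of "Pw k n \<omega>"] .
 then have B: "\<forall>\<^sub>F n in sequentially. Pw k n \<omega> \<le> (1 - r) * r ^ n * t / q0" by (intro always_eventually allI)
 have C: "\<forall>\<^sub>F n in sequentially. 0 \<le> Pw k n \<omega>"
  by (intro always_eventually allI less_imp_le Pw_pos g)
 show "(\<lambda>n. Pw k n \<omega>) \<longlonglongrightarrow> 0" by (rule tendsto_sandwich[OF C B tendsto_const A])
qed

definition R1 :: "'a \<Rightarrow> real" where "R1 \<omega> = lim (\<lambda>N. Rt N (-1) \<omega>)"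

lemma R1_measurable [measurable]: "R1 \<in> borel_measurable P"
 unfolding R1_def[abs_def] by (rule borel_measurable_lim_metric) measurable

lemma R1_tail:
 assumes \<beta>: "0 < \<beta>" "Lam \<beta> < 0"
 shows "AE \<omega> in P. (\<lambda>N. Rt N (-1) \<omega>) \<longlonglongrightarrow> R1 \<omega> \<and> (\<lambda>n. Pw (-1) n \<omega>) \<longlonglongrightarrow> 0"
  and "\<exists>C\<ge>0. \<forall>t>0. prob {\<omega>\<in>space P. t < \<bar>R1 \<omega>\<bar>} \<le> C * t powr (- \<beta>)"
proof -
 obtain r C where r: "0 < r" "r < 1" and C: "0 \<le> C"
  and p: "\<And>t. t > 0 \<Longrightarrow> prob {\<omega>\<in>space P. \<exists>n. (1 - r) * r ^ n * t < q0 * Pw (-1) n \<omega>} \<le> C * t powr (- \<beta>)"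
  using tail_core[OF \<beta>, of "-1"] by blast
 \<comment> \<open>Paths for which no integer threshold works; the bound at threshold
   \<open>Suc m\<close> tends to zero, so they form a null set.\<close>
 define Ns where "Ns = {\<omega>\<in>space P. \<forall>m::nat. \<exists>n. (1 - r) * r ^ n * real (Suc m) < q0 * Pw (-1) n \<omega>}"
 have Ns [measurable]: "Ns \<in> events" unfolding Ns_def by measurable
 have "prob Ns \<le> 0"
 proof (rule tendsto_lowerbound)
  have "(\<lambda>m. real (Suc m) powr (- \<beta>)) \<longlonglongrightarrow> 0"
   using \<beta> by (intro tendsto_neg_powr filterlim_compose[OF filterlim_real_sequentially filterlim_Suc]) auto
  then show "(\<lambda>m. C * real (Suc m) powr (- \<beta>)) \<longlonglongrightarrow> 0" using tendsto_mult_right_zero by blast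
  have "prob Ns \<le> C * real (Suc m) powr (- \<beta>)" for m
  proof -
   have "prob Ns \<le> prob {\<omega>\<in>space P. \<exists>n. (1 - r) * r ^ n * real (Suc m) < q0 * Pw (-1) n \<omega>}"
    by (intro finite_measure_mono) (auto simp: Ns_def)
   also have "\<dots> \<le> C * real (Suc m) powr (- \<beta>)" by (rule p) simp
   finally show ?thesis .
  qed
  then show "\<forall>\<^sub>F m in sequentially. prob Ns \<le> C * real (Suc m) powr (- \<beta>)" by simp
 qed simp
 then have "prob Ns = 0" by (simp add: measure_le_0_iff)
 then have "AE \<omega> in P. \<omega> \<notin> Ns" using Ns by (simp add: prob_eq_0)
 then have ae: "AE \<omega> in P. good \<omega> \<and> (\<exists>t. \<forall>n. q0 * Pw (-1) n \<omega> \<le> (1 - r) * r ^ n * t)"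
  using AE_good AE_space
 proof eventually_elim
  case (elim \<omega>)
  then obtain m :: nat where "\<forall>n. \<not> (1 - r) * r ^ n * real (Suc m) < q0 * Pw (-1) n \<omega>" unfolding Ns_def by blast
  then show ?case using elim(2) by (meson not_less)
 qed
 show conv: "AE \<omega> in P. (\<lambda>N. Rt N (-1) \<omega>) \<longlonglongrightarrow> R1 \<omega> \<and> (\<lambda>n. Pw (-1) n \<omega>) \<longlonglongrightarrow> 0"
  using ae
 proof eventually_elim
  case (elim \<omega>)
  then obtain t where b: "\<And>n. q0 * Pw (-1) n \<omega> \<le> (1 - r) * r ^ n * t" by blast
  have g: "good \<omega>" using elim by simp
  show ?case
   using Rt_le_of_Pw(2,3)[OF g r b] unfolding R1_def by (simp add: convergent_LIMSEQ_iff)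
 qed
 have "prob {\<omega>\<in>space P. t < \<bar>R1 \<omega>\<bar>} \<le> C * t powr (- \<beta>)" if t: "0 < t" for t
 proof -
  have "prob {\<omega>\<in>space P. t < \<bar>R1 \<omega>\<bar>} \<le> prob {\<omega>\<in>space P. \<exists>n. (1 - r) * r ^ n * t < q0 * Pw (-1) n \<omega>}"
  proof (rule finite_measure_mono_AE)
   show "AE \<omega> in P. \<omega> \<in> {\<omega>\<in>space P. t < \<bar>R1 \<omega>\<bar>} \<longrightarrow> \<omega> \<in> {\<omega>\<in>space P. \<exists>n. (1 - r) * r ^ n * t < q0 * Pw (-1) n \<omega>}"
    using conv AE_good
   proof eventually_elim
    case (elim \<omega>)
    have "\<bar>R1 \<omega>\<bar> \<le> t" if b: "\<And>n. q0 * Pw (-1) n \<omega> \<le> (1 - r) * r ^ n * t"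
    proof (rule tendsto_upperbound)
     show "(\<lambda>N. \<bar>Rt N (-1) \<omega>\<bar>) \<longlonglongrightarrow> \<bar>R1 \<omega>\<bar>" using elim(1) by (intro tendsto_rabs) blast
     show "\<forall>\<^sub>F N in sequentially. \<bar>Rt N (-1) \<omega>\<bar> \<le> t" using Rt_le_of_Pw(1)[OF elim(2) r b] by simp
    qed simp
    then show ?case by (auto simp: not_le[symmetric])
   qed
  qed measurable
  also have "\<dots> \<le> C * t powr (- \<beta>)" by (rule p[OF t])
  finally show ?thesis .
 qed
 then show "\<exists>C\<ge>0. \<forall>t>0. prob {\<omega>\<in>space P. t < \<bar>R1 \<omega>\<bar>} \<le> C * t powr (- \<beta>)" using C by blast
qed

text \<open>Every term of the series contains the multiplier at time 0; taking it out leaves the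
  increments of the perpetuity started at time -1.\<close>

lemma R_series:
 assumes "(\<lambda>N. Rt N (-1) \<omega>) \<longlonglongrightarrow> R1 \<omega>"
 shows "(\<Sum>n. Qx (- int n - 1) \<omega> * (\<Prod>i<Suc n. Mx (- int i) \<omega>)) = Mx 0 \<omega> * R1 \<omega>"
proof -
 have "(\<Sum>n<N. Qx (- int n - 1) \<omega> * (\<Prod>i<Suc n. Mx (- int i) \<omega>)) = Mx 0 \<omega> * Rt N (-1) \<omega>" for N
 proof (induction N)
  case (Suc N)
  have e: "- int N - 1 = - 1 - int N" "\<And>i. - int (Suc i) = - 1 - int i" by simp_all
  have "Qx (- int N - 1) \<omega> * (\<Prod>i<Suc N. Mx (- int i) \<omega>) = Mx 0 \<omega> * (Qx (- 1 - int N) \<omega> * (\<Prod>i<N. Mx (- 1 - int i) \<omega>))"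
   unfolding prod.lessThan_Suc_shift e by (simp add: mult_ac)
  also have "\<dots> = Mx 0 \<omega> * (Rt (Suc N) (-1) \<omega> - Rt N (-1) \<omega>)" unfolding Rt_diff ..
  finally show ?case using Suc unfolding sum.lessThan_Suc by (simp only: right_diff_distrib)
 qed simp
 then have "(\<lambda>n. Qx (- int n - 1) \<omega> * (\<Prod>i<Suc n. Mx (- int i) \<omega>)) sums (Mx 0 \<omega> * R1 \<omega>)"
  unfolding sums_def using tendsto_mult_left[OF assms, of "Mx 0 \<omega>"] by simp
 then show ?thesis by (rule sums_unique[symmetric])
qed

section \<open>The conditional law of the perpetuity at every future sequence\<close>

definition kap :: "(nat \<Rightarrow> 'd) \<Rightarrow> real measure" where
 "kap x = distr (density P (\<lambda>\<omega>. ennreal (Psi (past X \<omega>) x))) borel R1"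

lemma sets_kap [measurable_cong, simp]: "sets (kap x) = sets borel" by (simp add: kap_def)
lemma space_kap [simp]: "space (kap x) = UNIV" by (simp add: kap_def)

lemma Psi_integrable: "H \<in> borel_measurable P \<Longrightarrow> (\<And>\<omega>. \<bar>H \<omega>\<bar> \<le> C) \<Longrightarrow> integrable P (\<lambda>\<omega>. Psi (past X \<omega>) x * H \<omega>)" for H :: "'a \<Rightarrow> real"
proof -
 assume H: "H \<in> borel_measurable P" "\<And>\<omega>. \<bar>H \<omega>\<bar> \<le> C"
 have "\<bar>Psi (past X \<omega>) x * H \<omega>\<bar> \<le> exp (3 * BB) * C" for \<omega>
  unfolding abs_mult using Psi_bounds(2)[of "past X \<omega>" x] Psi_pos[of "past X \<omega>" x] H(2)[of \<omega>] by (intro mult_mono) auto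
 then show ?thesis using H(1) by (intro integrable_const_bound[where B="exp (3 * BB) * C"]) auto
qed

lemma kap_integral: "H \<in> borel_measurable borel \<Longrightarrow> (\<integral>r. H r \<partial>kap x) = (\<integral>\<omega>. Psi (past X \<omega>) x * H (R1 \<omega>) \<partial>P)" for H :: "real \<Rightarrow> real"
proof -
 assume H [measurable]: "H \<in> borel_measurable borel"
 have "(\<integral>r. H r \<partial>kap x) = (\<integral>\<omega>. H (R1 \<omega>) \<partial>density P (\<lambda>\<omega>. ennreal (Psi (past X \<omega>) x)))"
  unfolding kap_def by (rule integral_distr) measurable
 also have "\<dots> = (\<integral>\<omega>. Psi (past X \<omega>) x *\<^sub>R H (R1 \<omega>) \<partial>P)"
  by (rule integral_density) (auto simp: less_imp_le[OF Psi_pos])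
 finally show ?thesis by simp
qed

lemma Psi_integral: "(\<integral>\<omega>. Psi (past X \<omega>) x \<partial>P) = 1"
proof -
 interpret L: prob_space "LJ []" by (rule prob_LJ)
 show ?thesis using Rt_Psi[of "\<lambda>_. 1" 1 0 x] by (simp add: L.prob_space[simplified])
qed

lemma prob_kap: "prob_space (kap x)"
proof -
 have "prob_space (density P (\<lambda>\<omega>. ennreal (Psi (past X \<omega>) x)))"
 proof (rule prob_spaceI)
  have "emeasure (density P (\<lambda>\<omega>. ennreal (Psi (past X \<omega>) x))) (space P) = (\<integral>\<^sup>+\<omega>. ennreal (Psi (past X \<omega>) x) \<partial>P)"
   by (subst emeasure_density) (auto intro!: nn_integral_cong)
  also have "\<dots> = ennreal (\<integral>\<omega>. Psi (past X \<omega>) x \<partial>P)"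
   using Psi_integrable[of "\<lambda>_. 1" 1 x] by (intro nn_integral_eq_integral) (auto simp: less_imp_le[OF Psi_pos])
  finally show "emeasure (density P (\<lambda>\<omega>. ennreal (Psi (past X \<omega>) x))) (space (density P (\<lambda>\<omega>. ennreal (Psi (past X \<omega>) x)))) = 1"
   by (simp add: Psi_integral)
 qed
 then show ?thesis unfolding kap_def by (rule prob_space.prob_space_distr) measurable
qed

text \<open>All three comparisons follow from those of the density \<open>Psi\<close>: its relative
  regularity in the future, and its bounds from above and below.\<close>

lemma kap_mono:
 fixes H :: "real \<Rightarrow> real"
 assumes H [measurable]: "H \<in> borel_measurable borel" "\<And>r. 0 \<le> H r \<and> H r \<le> 1"
 shows "(\<forall>k<n. x k = y k) \<Longrightarrow> (\<integral>r. H r \<partial>kap x) \<le> exp (6 * BB * \<rho> ^ n) * (\<integral>r. H r \<partial>kap y)"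
  and "(\<integral>r. H r \<partial>kap x) \<le> exp (3 * BB) * (\<integral>\<omega>. H (R1 \<omega>) \<partial>P)"
  and "(\<integral>\<omega>. H (R1 \<omega>) \<partial>P) \<le> exp (3 * BB) * (\<integral>r. H r \<partial>kap x)"
proof -
 have b: "\<bar>H r\<bar> \<le> 1" for r using H(2)[of r] by simp
 have i: "integrable P (\<lambda>\<omega>. Psi (past X \<omega>) x * H (R1 \<omega>))" for x by (rule Psi_integrable[where C=1]) (use b in auto)
 have i1: "integrable P (\<lambda>\<omega>. H (R1 \<omega>))" by (rule integrable_const_bound[where B=1]) (use b in auto)
 have "(\<integral>\<omega>. Psi (past X \<omega>) x * H (R1 \<omega>) \<partial>P) \<le> (\<integral>\<omega>. exp (6 * BB * \<rho> ^ n) * (Psi (past X \<omega>) y * H (R1 \<omega>)) \<partial>P)" if "\<forall>k<n. x k = y k"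
 proof (intro integral_mono integrable_mult_right i)
  fix \<omega> show "Psi (past X \<omega>) x * H (R1 \<omega>) \<le> exp (6 * BB * \<rho> ^ n) * (Psi (past X \<omega>) y * H (R1 \<omega>))"
   using mult_right_mono[OF Psi_ratio[OF that, of "past X \<omega>"], of "H (R1 \<omega>)"] H(2) by (simp add: mult.assoc)
 qed
 then show "(\<forall>k<n. x k = y k) \<Longrightarrow> (\<integral>r. H r \<partial>kap x) \<le> exp (6 * BB * \<rho> ^ n) * (\<integral>r. H r \<partial>kap y)"
  unfolding kap_integral[OF H(1)] by simp
 have "(\<integral>\<omega>. Psi (past X \<omega>) x * H (R1 \<omega>) \<partial>P) \<le> (\<integral>\<omega>. exp (3 * BB) * H (R1 \<omega>) \<partial>P)"
  by (intro integral_mono integrable_mult_right i i1 mult_right_mono Psi_bounds) (use H(2) in auto)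
 then show "(\<integral>r. H r \<partial>kap x) \<le> exp (3 * BB) * (\<integral>\<omega>. H (R1 \<omega>) \<partial>P)" unfolding kap_integral[OF H(1)] by simp
 have "(\<integral>\<omega>. H (R1 \<omega>) \<partial>P) \<le> (\<integral>\<omega>. exp (3 * BB) * (Psi (past X \<omega>) x * H (R1 \<omega>)) \<partial>P)"
 proof (intro integral_mono integrable_mult_right i i1)
  fix \<omega>
  have "exp (3 * BB) * exp (- (3 * BB)) \<le> exp (3 * BB) * Psi (past X \<omega>) x" by (intro mult_left_mono Psi_bounds) simp
  then have "1 \<le> exp (3 * BB) * Psi (past X \<omega>) x" by (simp add: exp_add[symmetric])
  from mult_right_mono[OF this, of "H (R1 \<omega>)"]
  show "H (R1 \<omega>) \<le> exp (3 * BB) * (Psi (past X \<omega>) x * H (R1 \<omega>))" using H(2) by (simp add: mult.assoc)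
 qed
 then show "(\<integral>\<omega>. H (R1 \<omega>) \<partial>P) \<le> exp (3 * BB) * (\<integral>r. H r \<partial>kap x)" unfolding kap_integral[OF H(1)] by simp
qed

lemma kap_measure: "A \<in> sets borel \<Longrightarrow> measure (kap x) A = (\<integral>r. indicat_real A r \<partial>kap x)"
 by simp

lemma kap_measure_bounds:
 assumes A [measurable]: "A \<in> sets borel"
 shows "measure (kap x) A \<le> exp (3 * BB) * prob {\<omega>\<in>space P. R1 \<omega> \<in> A}" "prob {\<omega>\<in>space P. R1 \<omega> \<in> A} \<le> exp (3 * BB) * measure (kap x) A"
proof -
 have e: "(\<integral>\<omega>. indicat_real A (R1 \<omega>) \<partial>P) = prob {\<omega>\<in>space P. R1 \<omega> \<in> A}"
 proof -
  have "(\<integral>\<omega>. indicat_real A (R1 \<omega>) \<partial>P) = (\<integral>\<omega>. indicat_real {\<omega>\<in>space P. R1 \<omega> \<in> A} \<omega> \<partial>P)"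
   by (intro Bochner_Integration.integral_cong) (auto simp: indicator_def)
  moreover have "{\<omega>\<in>space P. R1 \<omega> \<in> A} \<inter> space P = {\<omega>\<in>space P. R1 \<omega> \<in> A}" by blast
  ultimately show ?thesis using Bochner_Integration.integral_indicator[of P "{\<omega>\<in>space P. R1 \<omega> \<in> A}"] by (simp only:)
 qed
 have H: "indicat_real A \<in> borel_measurable borel" "\<And>r. 0 \<le> indicat_real A r \<and> indicat_real A r \<le> 1"
  by (simp_all add: indicator_def)
 show "measure (kap x) A \<le> exp (3 * BB) * prob {\<omega>\<in>space P. R1 \<omega> \<in> A}" "prob {\<omega>\<in>space P. R1 \<omega> \<in> A} \<le> exp (3 * BB) * measure (kap x) A"
  using kap_mono(2,3)[OF H, of x] unfolding e kap_measure[OF A] .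
qed

text \<open>Test functions are continuous because the truncated perpetuities converge almost surely,
  which passes through continuous functions only.\<close>

lemma kap_limit:
 fixes H :: "real \<Rightarrow> real"
 assumes conv: "AE \<omega> in P. (\<lambda>N. Rt N (-1) \<omega>) \<longlonglongrightarrow> R1 \<omega>"
  and H: "continuous_on UNIV H" "\<And>r. \<bar>H r\<bar> \<le> 1"
 shows "(\<lambda>N. \<Sum>u\<in>wds N. Pc u x * (\<integral>r. H r \<partial>LJ u)) \<longlonglongrightarrow> (\<integral>r. H r \<partial>kap x)"
proof -
 have Hm [measurable]: "H \<in> borel_measurable borel" by (rule borel_measurable_continuous_onI[OF H(1)])
 have "(\<lambda>N. \<integral>\<omega>. Psi (past X \<omega>) x * H (Rt N (-1) \<omega>) \<partial>P) \<longlonglongrightarrow> (\<integral>\<omega>. Psi (past X \<omega>) x * H (R1 \<omega>) \<partial>P)"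
 proof (rule integral_dominated_convergence[where w="\<lambda>_. exp (3 * BB) * 1"])
  show "AE \<omega> in P. (\<lambda>N. Psi (past X \<omega>) x * H (Rt N (-1) \<omega>)) \<longlonglongrightarrow> Psi (past X \<omega>) x * H (R1 \<omega>)"
   using conv
  proof eventually_elim
   case (elim \<omega>)
   then show ?case using H(1) by (intro tendsto_intros) (metis UNIV_I continuous_on_tendsto_compose eventually_sequentiallyI)
  qed
  show "AE \<omega> in P. norm (Psi (past X \<omega>) x * H (Rt N (-1) \<omega>)) \<le> exp (3 * BB) * 1" for N
  proof (rule AE_I2)
   fix \<omega> show "norm (Psi (past X \<omega>) x * H (Rt N (-1) \<omega>)) \<le> exp (3 * BB) * 1"
    unfolding real_norm_def abs_mult using Psi_bounds(2)[of "past X \<omega>" x] Psi_pos[of "past X \<omega>" x] H(2)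
    by (intro mult_mono) auto
  qed
 qed simp_all
 moreover have "(\<integral>\<omega>. Psi (past X \<omega>) x * H (Rt N (-1) \<omega>) \<partial>P) = (\<Sum>u\<in>wds N. Pc u x * (\<integral>r. H r \<partial>LJ u))" for N
  using Rt_Psi[OF Hm H(2), of N x] by (simp add: mult.commute)
 ultimately show ?thesis unfolding kap_integral[OF Hm] by simp
qed

lemma affine_integrable:
 fixes H :: "real \<Rightarrow> real"
 assumes H [measurable]: "H \<in> borel_measurable borel" and b: "\<And>r. \<bar>H r\<bar> \<le> 1" and \<mu>: "prob_space \<mu>" and s [measurable_cong]: "sets \<mu> = sets borel"
 shows "integrable (lam j) (\<lambda>v. \<integral>r. H (fst v + snd v * r) \<partial>\<mu>)" "\<bar>\<integral>r. H (fst v + snd v * r) \<partial>\<mu>\<bar> \<le> 1"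
proof -
 interpret m: prob_space \<mu> by (rule \<mu>)
 interpret l: prob_space "lam j" by (rule prob_lam)
 show le: "\<bar>\<integral>r. H (fst v + snd v * r) \<partial>\<mu>\<bar> \<le> 1" for v
 proof -
  have i: "integrable \<mu> (\<lambda>r. H (fst v + snd v * r))" by (rule m.integrable_const_bound[where B=1]) (use b in auto)
  have "\<bar>\<integral>r. H (fst v + snd v * r) \<partial>\<mu>\<bar> \<le> (\<integral>r. \<bar>H (fst v + snd v * r)\<bar> \<partial>\<mu>)" by (rule integral_abs_bound)
  also have "\<dots> \<le> (\<integral>r. 1 \<partial>\<mu>)" by (intro integral_mono integrable_abs i) (use b in auto)
  finally show ?thesis by (simp add: m.prob_space)
 qed
 have st: "sets (lam j \<Otimes>\<^sub>M \<mu>) = sets (borel :: ((real \<times> real) \<times> real) measure)"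
  using sets_pair_measure_cong[OF sets_lam s] by (simp only: borel_prod)
 have "(\<lambda>z :: (real \<times> real) \<times> real. fst (fst z) + snd (fst z) * snd z) \<in> borel_measurable borel"
  by (intro borel_measurable_continuous_onI continuous_intros)
 from measurable_compose[OF this H]
 have "(\<lambda>z. H (fst (fst z) + snd (fst z) * snd z)) \<in> borel_measurable (lam j \<Otimes>\<^sub>M \<mu>)"
  using measurable_cong_sets[OF st refl] by blast
 then have "(\<lambda>v. \<integral>r. H (fst v + snd v * r) \<partial>\<mu>) \<in> borel_measurable (lam j)"
  by (intro m.borel_measurable_lebesgue_integral) (simp only: split_beta')
 then show "integrable (lam j) (\<lambda>v. \<integral>r. H (fst v + snd v * r) \<partial>\<mu>)"
  by (intro l.integrable_const_bound[where B=1]) (use le in auto)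
qed

definition FH :: "(real \<Rightarrow> real) \<Rightarrow> 'd \<Rightarrow> (nat \<Rightarrow> 'd) \<Rightarrow> real" where
 "FH H j x = (\<integral>v. (\<integral>r. H (fst v + snd v * r) \<partial>kap x) \<partial>lam j)"

lemma FH_limit:
 assumes conv: "AE \<omega> in P. (\<lambda>N. Rt N (-1) \<omega>) \<longlonglongrightarrow> R1 \<omega>"
  and H: "continuous_on UNIV H" "\<And>r. \<bar>H r\<bar> \<le> 1"
 shows "(\<lambda>N. \<Sum>u\<in>wds N. Pc u x * (\<integral>r. H r \<partial>LJ (j # u))) \<longlonglongrightarrow> FH H j x"
  and "\<bar>\<Sum>u\<in>wds N. Pc u x * (\<integral>r. H r \<partial>LJ (j # u))\<bar> \<le> 1"
proof -
 have Hm [measurable]: "H \<in> borel_measurable borel" by (rule borel_measurable_continuous_onI[OF H(1)])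
 interpret l: prob_space "lam j" by (rule prob_lam)
 define h where "h u v = (\<integral>r. H (fst v + snd v * r) \<partial>LJ u)" for u v
 have h: "integrable (lam j) (h u)" "\<bar>h u v\<bar> \<le> 1" for u v
  unfolding h_def by (rule affine_integrable[OF Hm H(2) prob_LJ sets_LJ])+
 have sb: "\<bar>\<Sum>u\<in>wds N. Pc u x * h u v\<bar> \<le> 1" for N v
 proof -
  have "\<bar>\<Sum>u\<in>wds N. Pc u x * h u v\<bar> \<le> (\<Sum>u\<in>wds N. \<bar>Pc u x * h u v\<bar>)" by (rule sum_abs)
  also have "\<dots> \<le> (\<Sum>u\<in>wds N. Pc u x * 1)"
   unfolding abs_mult using Pc_pos[of _ x] h(2) by (intro sum_mono mult_mono) (auto simp: less_imp_le)
  finally show ?thesis by (simp add: Pc_sum)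
 qed
 have e: "(\<Sum>u\<in>wds N. Pc u x * (\<integral>r. H r \<partial>LJ (j # u))) = (\<integral>v. (\<Sum>u\<in>wds N. Pc u x * h u v) \<partial>lam j)" for N
 proof -
  have "(\<integral>v. (\<Sum>u\<in>wds N. Pc u x * h u v) \<partial>lam j) = (\<Sum>u\<in>wds N. \<integral>v. Pc u x * h u v \<partial>lam j)"
   by (rule Bochner_Integration.integral_sum) (intro integrable_mult_right h)
  also have "\<dots> = (\<Sum>u\<in>wds N. Pc u x * (\<integral>r. H r \<partial>LJ (j # u)))"
   unfolding h_def LJ_integral_Cons[OF Hm H(2)] by simp
  finally show ?thesis ..
 qed
 have si: "integrable (lam j) (\<lambda>v. \<Sum>u\<in>wds N. Pc u x * h u v)" for N
  by (intro Bochner_Integration.integrable_sum integrable_mult_right h)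
 have ki: "integrable (lam j) (\<lambda>v. \<integral>r. H (fst v + snd v * r) \<partial>kap x)" by (rule affine_integrable[OF Hm H(2) prob_kap sets_kap])
 show "(\<lambda>N. \<Sum>u\<in>wds N. Pc u x * (\<integral>r. H r \<partial>LJ (j # u))) \<longlonglongrightarrow> FH H j x"
  unfolding e FH_def
 proof (rule integral_dominated_convergence[where w="\<lambda>_. 1"])
  show "AE v in lam j. (\<lambda>N. \<Sum>u\<in>wds N. Pc u x * h u v) \<longlonglongrightarrow> (\<integral>r. H (fst v + snd v * r) \<partial>kap x)"
   unfolding h_def
   by (intro AE_I2 kap_limit[OF conv]) (auto intro!: continuous_intros continuous_on_compose2[OF H(1)] H(2))
  show "AE v in lam j. norm (\<Sum>u\<in>wds N. Pc u x * h u v) \<le> 1" for N using sb by simp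
 qed (use si ki in \<open>auto dest: borel_measurable_integrable\<close>)
 show "\<bar>\<Sum>u\<in>wds N. Pc u x * (\<integral>r. H r \<partial>LJ (j # u))\<bar> \<le> 1"
 proof -
  have "\<bar>\<integral>v. (\<Sum>u\<in>wds N. Pc u x * h u v) \<partial>lam j\<bar> \<le> (\<integral>v. \<bar>\<Sum>u\<in>wds N. Pc u x * h u v\<bar> \<partial>lam j)" by (rule integral_abs_bound)
  also have "\<dots> \<le> (\<integral>v. 1 \<partial>lam j)" by (intro integral_mono integrable_abs si sb) simp
  finally show ?thesis unfolding e by (simp add: l.prob_space[simplified])
 qed
qed

text \<open>The first symbol is split off in the word sums of length \<open>N + 1\<close> by the
  chain rule, which leaves word sums of length \<open>N\<close> with the future lengthened by that
  symbol; then \<open>N\<close> tends to infinity.\<close>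

lemma kap_rec:
 assumes conv: "AE \<omega> in P. (\<lambda>N. Rt N (-1) \<omega>) \<longlonglongrightarrow> R1 \<omega>"
  and H: "continuous_on UNIV H" "\<And>r. \<bar>H r\<bar> \<le> 1"
 shows "(\<integral>r. H r \<partial>kap x) = (\<Sum>j\<in>UNIV. Pc [j] x * FH H j (cons j x))"
proof (rule LIMSEQ_unique)
 show "(\<lambda>N. \<Sum>u\<in>wds (Suc N). Pc u x * (\<integral>r. H r \<partial>LJ u)) \<longlonglongrightarrow> (\<integral>r. H r \<partial>kap x)"
  using kap_limit[OF conv H, of x] by (rule LIMSEQ_Suc)
 have "(\<Sum>u\<in>wds (Suc N). Pc u x * (\<integral>r. H r \<partial>LJ u)) = (\<Sum>j\<in>UNIV. Pc [j] x * (\<Sum>u\<in>wds N. Pc u (cons j x) * (\<integral>r. H r \<partial>LJ (j # u))))" for N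
  unfolding sum_wds_Suc sum_distrib_left by (intro sum.cong refl) (subst Pc_Cons, simp only: mult.assoc)
 then show "(\<lambda>N. \<Sum>u\<in>wds (Suc N). Pc u x * (\<integral>r. H r \<partial>LJ u)) \<longlonglongrightarrow> (\<Sum>j\<in>UNIV. Pc [j] x * FH H j (cons j x))"
  by (simp only:) (intro tendsto_sum tendsto_mult tendsto_const FH_limit(1)[OF conv H])
qed

end

section \<open>Regular versions of the conditional tail probabilities\<close>

context coeffs_chain
begin

lemma Xf_measurable: "Xf \<in> measurable P seqM"
 unfolding Xf_def[abs_def] seqM_def by (intro measurable_PiM_single') (auto simp: X_measurable)

text \<open>Two finite measures on the sequence space are compared, the images of \<open>P\<close>
  weighted by \<open>f\<close> and by \<open>f'\<close>; they agree on finite-dimensional boxes,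
  which are unions of cylinders.\<close>

lemma seqM_integral_eq:
 fixes f f' :: "'a \<Rightarrow> real"
 assumes i: "integrable P f" "integrable P f'" and nn: "\<And>\<omega>. 0 \<le> f \<omega>" "\<And>\<omega>. 0 \<le> f' \<omega>"
  and eq: "\<And>i w. (\<integral>\<omega>. indicator (cyl 0 (i # w)) \<omega> * f \<omega> \<partial>P) = (\<integral>\<omega>. indicator (cyl 0 (i # w)) \<omega> * f' \<omega> \<partial>P)"
  and B: "B \<in> sets seqM"
 shows "(\<integral>\<omega>. indicator {\<omega>\<in>space P. Xf \<omega> \<in> B} \<omega> * f \<omega> \<partial>P) = (\<integral>\<omega>. indicator {\<omega>\<in>space P. Xf \<omega> \<in> B} \<omega> * f' \<omega> \<partial>P)"
proof -
 define \<mu> where "\<mu> h = distr (density P (\<lambda>\<omega>. ennreal (h \<omega>))) seqM Xf" for h :: "'a \<Rightarrow> real"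
 have ind: "integrable P (\<lambda>\<omega>. indicator {\<omega>\<in>space P. Xf \<omega> \<in> B} \<omega> * h \<omega>)" if "integrable P h" "B \<in> sets seqM" for h :: "'a \<Rightarrow> real" and B
 proof -
  have "{\<omega>\<in>space P. Xf \<omega> \<in> B} \<in> events" using measurable_sets[OF Xf_measurable that(2)] by (simp add: vimage_def Int_def conj_commute)
  then show ?thesis using integrable_mult_indicator[OF _ that(1)] by simp
 qed
 have em: "emeasure (\<mu> h) B = ennreal (\<integral>\<omega>. indicator {\<omega>\<in>space P. Xf \<omega> \<in> B} \<omega> * h \<omega> \<partial>P)"
  if h: "integrable P h" "\<And>\<omega>. 0 \<le> h \<omega>" and B: "B \<in> sets seqM" for h B
 proof -
  have [measurable]: "h \<in> borel_measurable P" using h(1) by (rule borel_measurable_integrable)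
  have Xm: "Xf \<in> measurable (density P (\<lambda>\<omega>. ennreal (h \<omega>))) seqM" using Xf_measurable by (simp only: measurable_density_eq1)
  have ev: "Xf -` B \<inter> space P \<in> events" by (rule measurable_sets[OF Xf_measurable B])
  have "emeasure (\<mu> h) B = emeasure (density P (\<lambda>\<omega>. ennreal (h \<omega>))) (Xf -` B \<inter> space P)"
   unfolding \<mu>_def using emeasure_distr[OF Xm B] by simp
  also have "\<dots> = (\<integral>\<^sup>+\<omega>. ennreal (h \<omega>) * indicator (Xf -` B \<inter> space P) \<omega> \<partial>P)"
   by (rule emeasure_density[OF _ ev]) measurable
  also have "\<dots> = (\<integral>\<^sup>+\<omega>. ennreal (indicator {\<omega>\<in>space P. Xf \<omega> \<in> B} \<omega> * h \<omega>) \<partial>P)"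
   by (intro nn_integral_cong) (auto simp: indicator_def)
  also have "\<dots> = ennreal (\<integral>\<omega>. indicator {\<omega>\<in>space P. Xf \<omega> \<in> B} \<omega> * h \<omega> \<partial>P)"
   by (rule nn_integral_eq_integral[OF ind[OF h(1) B]]) (simp add: h(2))
  finally show ?thesis .
 qed
 have "\<mu> f = \<mu> f'"
 proof (rule measure_eqI_PiM_infinite[where I=UNIV and M="\<lambda>_. count_space UNIV"])
  show "sets (\<mu> f) = sets (PiM UNIV (\<lambda>_. count_space UNIV))" "sets (\<mu> f') = sets (PiM UNIV (\<lambda>_. count_space UNIV))"
   by (simp_all add: \<mu>_def seqM_def)
  show "finite_measure (\<mu> f)"
  proof (rule finite_measureI)
   have s: "space (\<mu> f) \<in> sets seqM" by (simp add: \<mu>_def)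
   show "emeasure (\<mu> f) (space (\<mu> f)) \<noteq> \<infinity>" unfolding em[OF i(1) nn(1) s] by simp
  qed
  fix A :: "nat \<Rightarrow> 'd set" and J :: "nat set"
  assume J: "finite J"
  define BX where "BX = prod_emb UNIV (\<lambda>_. count_space UNIV) J (Pi\<^sub>E J A)"
  have BX: "BX \<in> sets seqM" unfolding BX_def seqM_def by (rule sets_PiM_I[OF J]) auto
  have mem: "x \<in> BX \<longleftrightarrow> (\<forall>j\<in>J. x j \<in> A j)" for x
   unfolding BX_def prod_emb_def by (auto simp: restrict_def PiE_def extensional_def Pi_def)
  \<comment> \<open>The length is at least 1, so that each word has the form \<open>i # w\<close>
    covered by the hypothesis.\<close>
  obtain n where n: "\<And>j. j \<in> J \<Longrightarrow> j < Suc n"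
   using finite_nat_set_iff_bounded[THEN iffD1, OF J] less_SucI by metis
  have word: "(\<integral>\<omega>. indicator {\<omega>\<in>space P. Xf \<omega> \<in> BX} \<omega> * h \<omega> \<partial>P)
   = (\<Sum>w\<in>wds (Suc n). if \<forall>j\<in>J. w ! j \<in> A j then \<integral>\<omega>. indicator (cyl 0 w) \<omega> * h \<omega> \<partial>P else 0)" if h: "integrable P h" for h :: "'a \<Rightarrow> real"
  proof -
   have "(\<integral>\<omega>. indicator {\<omega>\<in>space P. Xf \<omega> \<in> BX} \<omega> * h \<omega> \<partial>P)
    = (\<Sum>w\<in>wds (Suc n). \<integral>\<omega>. indicator (cyl 0 w) \<omega> * (indicator {\<omega>\<in>space P. Xf \<omega> \<in> BX} \<omega> * h \<omega>) \<partial>P)"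
    by (rule integral_partition[OF ind[OF h BX]])
   also have "\<dots> = (\<Sum>w\<in>wds (Suc n). if \<forall>j\<in>J. w ! j \<in> A j then \<integral>\<omega>. indicator (cyl 0 w) \<omega> * h \<omega> \<partial>P else 0)"
   proof (intro sum.cong refl)
    fix w assume w: "w \<in> wds (Suc n)"
    have e: "indicator (cyl 0 w) \<omega> * (indicator {\<omega>\<in>space P. Xf \<omega> \<in> BX} \<omega> * h \<omega>) = (if \<forall>j\<in>J. w ! j \<in> A j then indicator (cyl 0 w) \<omega> * h \<omega> else 0)" for \<omega>
    proof (cases "\<omega> \<in> cyl 0 w")
     case True
     have "Xf \<omega> j = w ! j" if "j \<in> J" for j
      using cylD[OF True, of j] n[OF that] wds_length[OF w] by (simp add: Xf_def)
     then have "Xf \<omega> \<in> BX \<longleftrightarrow> (\<forall>j\<in>J. w ! j \<in> A j)" unfolding mem by auto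
     then show ?thesis using True cyl_space[OF True] by (simp add: indicator_def)
    qed simp
    show "(\<integral>\<omega>. indicator (cyl 0 w) \<omega> * (indicator {\<omega>\<in>space P. Xf \<omega> \<in> BX} \<omega> * h \<omega>) \<partial>P)
     = (if \<forall>j\<in>J. w ! j \<in> A j then \<integral>\<omega>. indicator (cyl 0 w) \<omega> * h \<omega> \<partial>P else 0)"
     unfolding e by (cases "\<forall>j\<in>J. w ! j \<in> A j") (simp_all only: if_P if_not_P if_False Bochner_Integration.integral_zero)
   qed
   finally show ?thesis .
  qed
  have "(\<integral>\<omega>. indicator (cyl 0 w) \<omega> * f \<omega> \<partial>P) = (\<integral>\<omega>. indicator (cyl 0 w) \<omega> * f' \<omega> \<partial>P)" if w: "w \<in> wds (Suc n)" for w
  proof (cases w)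
   case Nil then show ?thesis using wds_length[OF w] by simp
  next
   case (Cons j v) then show ?thesis using eq[of j v] by (simp only:)
  qed
  then have "(\<integral>\<omega>. indicator {\<omega>\<in>space P. Xf \<omega> \<in> BX} \<omega> * f \<omega> \<partial>P) = (\<integral>\<omega>. indicator {\<omega>\<in>space P. Xf \<omega> \<in> BX} \<omega> * f' \<omega> \<partial>P)"
   unfolding word[OF i(1)] word[OF i(2)] by (intro sum.cong refl) (simp only:)
  then show "emeasure (\<mu> f) (prod_emb UNIV (\<lambda>_. count_space UNIV) J (Pi\<^sub>E J A)) = emeasure (\<mu> f') (prod_emb UNIV (\<lambda>_. count_space UNIV) J (Pi\<^sub>E J A))"
   unfolding BX_def[symmetric] em[OF i(1) nn(1) BX] em[OF i(2) nn(2) BX] by (simp only:)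
 qed
 then have "ennreal (\<integral>\<omega>. indicator {\<omega>\<in>space P. Xf \<omega> \<in> B} \<omega> * f \<omega> \<partial>P) = ennreal (\<integral>\<omega>. indicator {\<omega>\<in>space P. Xf \<omega> \<in> B} \<omega> * f' \<omega> \<partial>P)"
  using em[OF i(1) nn(1) B] em[OF i(2) nn(2) B] by (simp only:)
 moreover have "0 \<le> (\<integral>\<omega>. indicator {\<omega>\<in>space P. Xf \<omega> \<in> B} \<omega> * f \<omega> \<partial>P)" "0 \<le> (\<integral>\<omega>. indicator {\<omega>\<in>space P. Xf \<omega> \<in> B} \<omega> * f' \<omega> \<partial>P)"
  by (intro Bochner_Integration.integral_nonneg mult_nonneg_nonneg nn; simp)+
 ultimately show ?thesis by (simp only: ennreal_inj)
qed

definition Rv :: "'a \<Rightarrow> real" where "Rv \<omega> = Qx 0 \<omega> + Mx 0 \<omega> * R1 \<omega>"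

lemma Rv_measurable [measurable]: "Rv \<in> borel_measurable P"
 unfolding Rv_def[abs_def] by measurable

lemma FH_le: "H \<in> borel_measurable borel \<Longrightarrow> (\<And>r. 0 \<le> H r \<and> H r \<le> 1) \<Longrightarrow> 0 \<le> FH H j x \<and> FH H j x \<le> 1"
proof -
 assume H: "H \<in> borel_measurable borel" "\<And>r. 0 \<le> H r \<and> H r \<le> 1"
 interpret l: prob_space "lam j" by (rule prob_lam)
 have b: "\<bar>H r\<bar> \<le> 1" for r using H(2)[of r] by simp
 note a = affine_integrable(1)[OF H(1) b prob_kap[of x] sets_kap, where j=j] affine_integrable(2)[OF H(1) b prob_kap[of x] sets_kap]
 have "FH H j x \<le> (\<integral>v. 1 \<partial>lam j)" unfolding FH_def
  using a by (intro integral_mono) (auto intro: order_trans[OF abs_ge_self])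
 moreover have "0 \<le> FH H j x" unfolding FH_def by (intro Bochner_Integration.integral_nonneg) (simp add: H(2))
 ultimately show ?thesis by (simp add: l.prob_space[simplified])
qed

definition Fs :: "real \<Rightarrow> real \<Rightarrow> (nat \<Rightarrow> 'd) \<Rightarrow> real" where
 "Fs \<eta> t x = FH (\<lambda>r. indicator {t<..} (\<eta> * r)) (x 0) x"

lemma Fs_eq: "Fs \<eta> t x = (\<integral>u. measure (kap x) {r. t < \<eta> * (fst u + snd u * r)} \<partial>lam (x 0))"
proof -
 have "(\<lambda>r. indicat_real {t<..} (\<eta> * (fst u + snd u * r))) = indicat_real {r. t < \<eta> * (fst u + snd u * r)}" for u :: "real \<times> real"
  by (auto simp: indicator_def)
 then show ?thesis unfolding Fs_def FH_def by simp
qed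

text \<open>Continuous functions increasing to the indicator of an open half line: the word
  identities are available for continuous test functions, the tails require indicators.\<close>

definition ramp :: "real \<Rightarrow> real \<Rightarrow> nat \<Rightarrow> real \<Rightarrow> real" where
 "ramp \<eta> t n r = min 1 (max 0 (real n * (\<eta> * r - t)))"

lemma ramp_props: "continuous_on UNIV (ramp \<eta> t n)" "0 \<le> ramp \<eta> t n r \<and> ramp \<eta> t n r \<le> 1" "\<bar>ramp \<eta> t n r\<bar> \<le> 1"
 by (auto simp: ramp_def[abs_def] intro!: continuous_intros)

lemma ramp_measurable [measurable]: "ramp \<eta> t n \<in> borel_measurable borel"
 by (rule borel_measurable_continuous_onI[OF ramp_props(1)])

lemma ramp_limit: "(\<lambda>n. ramp \<eta> t n r) \<longlonglongrightarrow> indicator {t<..} (\<eta> * r)"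
proof (cases "t < \<eta> * r")
 case True
 define d where "d = \<eta> * r - t"
 have d: "0 < d" using True by (simp add: d_def)
 obtain N :: nat where N: "1 / d < real N" using reals_Archimedean2 by blast
 have "ramp \<eta> t n r = 1" if "n \<ge> N" for n
 proof -
  have "1 / d \<le> real n" using N that by linarith
  then have "1 \<le> real n * d" using d by (simp add: pos_divide_le_eq)
  then show ?thesis unfolding ramp_def d_def[symmetric] by simp
 qed
 then have "\<forall>\<^sub>F n in sequentially. ramp \<eta> t n r = 1" unfolding eventually_sequentially by blast
 then show ?thesis using True by (simp add: tendsto_eventually)
next
 case False
 have "ramp \<eta> t n r = 0" for n
 proof -
  have "real n * (\<eta> * r - t) \<le> 0" using False by (intro mult_nonneg_nonpos) auto
  then show ?thesis by (simp add: ramp_def)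
 qed
 then show ?thesis using False by simp
qed

lemma FH_ramp_limit: "(\<lambda>n. FH (ramp \<eta> t n) (x 0) x) \<longlonglongrightarrow> Fs \<eta> t x"
proof -
 define I where "I r = indicat_real {t<..} (\<eta> * r)" for r
 have I [measurable]: "I \<in> borel_measurable borel" unfolding I_def by measurable
 have Ib: "\<bar>I r\<bar> \<le> 1" for r by (simp add: I_def indicator_def)
 interpret l: prob_space "lam (x 0)" by (rule prob_lam)
 interpret k: prob_space "kap x" by (rule prob_kap)
 note a1 = affine_integrable(1)[OF I Ib prob_kap[of x] sets_kap, where j="x 0"]
 note a2 = affine_integrable(1)[OF ramp_measurable ramp_props(3) prob_kap[of x] sets_kap, where j="x 0"]
  affine_integrable(2)[OF ramp_measurable ramp_props(3) prob_kap[of x] sets_kap]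
 show ?thesis unfolding Fs_def FH_def I_def[symmetric]
 proof (rule integral_dominated_convergence[where w="\<lambda>_. 1"])
  show "AE v in lam (x 0). (\<lambda>n. \<integral>r. ramp \<eta> t n (fst v + snd v * r) \<partial>kap x) \<longlonglongrightarrow> (\<integral>r. I (fst v + snd v * r) \<partial>kap x)"
  proof (rule AE_I2, rule integral_dominated_convergence[where w="\<lambda>_. 1"])
   fix v :: "real \<times> real"
   show "AE r in kap x. (\<lambda>n. ramp \<eta> t n (fst v + snd v * r)) \<longlonglongrightarrow> I (fst v + snd v * r)"
    unfolding I_def by (intro AE_I2 ramp_limit)
   show "AE r in kap x. norm (ramp \<eta> t n (fst v + snd v * r)) \<le> 1" for n using ramp_props(3) by simp
  qed simp_all
  show "AE v in lam (x 0). norm (\<integral>r. ramp \<eta> t n (fst v + snd v * r) \<partial>kap x) \<le> 1" for n using a2(2) by simp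
 qed (use a1 a2(1) in \<open>auto dest: borel_measurable_integrable\<close>)
qed

lemma FH_measurable:
 assumes conv: "AE \<omega> in P. (\<lambda>N. Rt N (-1) \<omega>) \<longlonglongrightarrow> R1 \<omega>"
  and H: "continuous_on UNIV H" "\<And>r. \<bar>H r\<bar> \<le> 1" and f: "\<And>j. (\<lambda>z. f z j) \<in> measurable M (count_space UNIV)"
 shows "(\<lambda>z. FH H (f z 0) (f z)) \<in> borel_measurable M"
proof (rule borel_measurable_LIMSEQ_real)
 show "(\<lambda>N. \<Sum>u\<in>wds N. Pc u (f z) * (\<integral>r. H r \<partial>LJ (f z 0 # u))) \<longlonglongrightarrow> FH H (f z 0) (f z)" for z
  by (rule FH_limit(1)[OF conv H])
 have "(\<lambda>z. (\<integral>r. H r \<partial>LJ (f z 0 # u))) \<in> borel_measurable M" for u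
  by (rule measurable_compose[OF f[of 0], of "\<lambda>j. \<integral>r. H r \<partial>LJ (j # u)"]) simp
 then show "(\<lambda>z. \<Sum>u\<in>wds N. Pc u (f z) * (\<integral>r. H r \<partial>LJ (f z 0 # u))) \<in> borel_measurable M" for N
  by (intro borel_measurable_sum borel_measurable_times Pc_gen_measurable f)
qed

lemma Fs_measurable:
 assumes conv: "AE \<omega> in P. (\<lambda>N. Rt N (-1) \<omega>) \<longlonglongrightarrow> R1 \<omega>"
 shows "Fs \<eta> t \<in> borel_measurable seqM"
proof (rule borel_measurable_LIMSEQ_real[OF FH_ramp_limit])
 have "(\<lambda>x. x j) \<in> measurable seqM (count_space UNIV)" for j :: nat unfolding seqM_def by measurable
 then show "(\<lambda>x. FH (ramp \<eta> t n) (x 0) x) \<in> borel_measurable seqM" for n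
  by (rule FH_measurable[OF conv ramp_props(1,3)])
qed

text \<open>Both sides are limits of one sequence, the integrals with the truncated perpetuity at
  time 0: one by the word expansion, the other by almost sure convergence. This identifies
  \<open>FH\<close> as a conditional expectation on cylinders.\<close>

lemma FH_word:
 assumes conv: "AE \<omega> in P. (\<lambda>N. Rt N (-1) \<omega>) \<longlonglongrightarrow> R1 \<omega>"
  and H: "continuous_on UNIV H" "\<And>r. \<bar>H r\<bar> \<le> 1"
 shows "(\<integral>\<omega>. indicator (cyl 0 (i # w)) \<omega> * FH H (Xf \<omega> 0) (Xf \<omega>) \<partial>P) = (\<integral>\<omega>. indicator (cyl 0 (i # w)) \<omega> * H (Rv \<omega>) \<partial>P)"
proof (rule LIMSEQ_unique)
 have Hm [measurable]: "H \<in> borel_measurable borel" by (rule borel_measurable_continuous_onI[OF H(1)])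
 define I where "I = indicat_real (cyl 0 (i # w))"
 have I [measurable]: "I \<in> borel_measurable P" unfolding I_def by measurable
 have I1: "\<bar>I \<omega>\<bar> \<le> 1" for \<omega> by (simp add: I_def indicator_def)
 define a where "a N \<omega> = (\<Sum>u\<in>wds N. Pc u (Xf \<omega>) * (\<integral>r. H r \<partial>LJ (i # u)))" for N \<omega>
 have [measurable]: "a N \<in> borel_measurable P" for N unfolding a_def[abs_def] by measurable
 have a1: "\<bar>a N \<omega>\<bar> \<le> 1" for N \<omega> unfolding a_def by (rule FH_limit(2)[OF conv H])
 have lim: "(\<lambda>N. a N \<omega>) \<longlonglongrightarrow> FH H i (Xf \<omega>)" for \<omega> unfolding a_def by (rule FH_limit(1)[OF conv H])
 have "(\<lambda>N. \<integral>\<omega>. I \<omega> * a N \<omega> \<partial>P) \<longlonglongrightarrow> (\<integral>\<omega>. I \<omega> * FH H i (Xf \<omega>) \<partial>P)"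
 proof (rule integral_dominated_convergence[where w="\<lambda>_. 1 * 1"])
  show "(\<lambda>\<omega>. I \<omega> * FH H i (Xf \<omega>)) \<in> borel_measurable P"
   by (intro borel_measurable_times I borel_measurable_LIMSEQ_real[OF lim]) measurable
  show "AE \<omega> in P. (\<lambda>N. I \<omega> * a N \<omega>) \<longlonglongrightarrow> I \<omega> * FH H i (Xf \<omega>)" by (intro AE_I2 tendsto_mult tendsto_const lim)
  show "AE \<omega> in P. norm (I \<omega> * a N \<omega>) \<le> 1 * 1" for N
   unfolding real_norm_def abs_mult by (intro AE_I2 mult_mono I1 a1) auto
 qed simp_all
 moreover have "(\<integral>\<omega>. I \<omega> * FH H i (Xf \<omega>) \<partial>P) = (\<integral>\<omega>. I \<omega> * FH H (Xf \<omega> 0) (Xf \<omega>) \<partial>P)"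
 proof (intro Bochner_Integration.integral_cong refl)
  fix \<omega> show "I \<omega> * FH H i (Xf \<omega>) = I \<omega> * FH H (Xf \<omega> 0) (Xf \<omega>)"
  proof (cases "\<omega> \<in> cyl 0 (i # w)")
   case True
   have "Xf \<omega> 0 = i" using cylD[OF True, of 0] by (simp add: Xf_def)
   then show ?thesis by simp
  qed (simp add: I_def)
 qed
 moreover have "(\<integral>\<omega>. I \<omega> * a N \<omega> \<partial>P) = (\<integral>\<omega>. I \<omega> * H (Rt (Suc N) 0 \<omega>) \<partial>P)" for N
 proof -
  have "(\<integral>\<omega>. I \<omega> * a N \<omega> \<partial>P) = (\<integral>\<omega>. (\<Sum>u\<in>wds N. (I \<omega> * Pc u (Xf \<omega>)) * (\<integral>r. H r \<partial>LJ (i # u))) \<partial>P)"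
   unfolding a_def sum_distrib_left by (simp only: mult.assoc)
  also have "\<dots> = (\<Sum>u\<in>wds N. \<integral>\<omega>. (I \<omega> * Pc u (Xf \<omega>)) * (\<integral>r. H r \<partial>LJ (i # u)) \<partial>P)"
  proof (rule Bochner_Integration.integral_sum, rule integrable_mult_left)
   fix u
   have "\<bar>I \<omega> * Pc u (Xf \<omega>)\<bar> \<le> 1 * (exp BB * pl (rev u))" for \<omega>
    unfolding abs_mult using Pc_pos[of u "Xf \<omega>"] Pc_le(1)[of u "Xf \<omega>"] I1[of \<omega>] by (intro mult_mono) auto
   then show "integrable P (\<lambda>\<omega>. I \<omega> * Pc u (Xf \<omega>))" by (intro integrable_const_bound[where B="1 * (exp BB * pl (rev u))"]) auto
  qed
  also have "\<dots> = (\<Sum>u\<in>wds N. pl (rev u @ i # w) * (\<integral>r. H r \<partial>LJ (i # u)))"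
   unfolding I_def by (simp add: cyl_Pc_Xf)
  also have "\<dots> = (\<integral>\<omega>. I \<omega> * H (Rt (Suc N) 0 \<omega>) \<partial>P)"
   unfolding I_def by (rule Rt_word[OF Hm H(2), symmetric])
  finally show ?thesis .
 qed
 ultimately show "(\<lambda>N. \<integral>\<omega>. I \<omega> * H (Rt (Suc N) 0 \<omega>) \<partial>P) \<longlonglongrightarrow> (\<integral>\<omega>. indicator (cyl 0 (i # w)) \<omega> * FH H (Xf \<omega> 0) (Xf \<omega>) \<partial>P)"
  unfolding I_def by (simp only:)
 show "(\<lambda>N. \<integral>\<omega>. I \<omega> * H (Rt (Suc N) 0 \<omega>) \<partial>P) \<longlonglongrightarrow> (\<integral>\<omega>. indicator (cyl 0 (i # w)) \<omega> * H (Rv \<omega>) \<partial>P)"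
  unfolding I_def[symmetric]
 proof (rule integral_dominated_convergence[where w="\<lambda>_. 1 * 1"])
  show "AE \<omega> in P. (\<lambda>N. I \<omega> * H (Rt (Suc N) 0 \<omega>)) \<longlonglongrightarrow> I \<omega> * H (Rv \<omega>)"
   using conv
  proof eventually_elim
   case (elim \<omega>)
   have "(\<lambda>N. Rt (Suc N) 0 \<omega>) \<longlonglongrightarrow> Rv \<omega>" unfolding Rt.simps Rv_def using elim by (intro tendsto_intros) simp
   then have "(\<lambda>N. H (Rt (Suc N) 0 \<omega>)) \<longlonglongrightarrow> H (Rv \<omega>)"
    by (rule continuous_on_tendsto_compose[OF H(1)]) simp_all
   then show ?case by (rule tendsto_mult_left)
  qed
  show "AE \<omega> in P. norm (I \<omega> * H (Rt (Suc N) 0 \<omega>)) \<le> 1 * 1" for N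
   unfolding real_norm_def abs_mult by (intro AE_I2 mult_mono I1 H(2)) auto
 qed (auto simp del: Rt.simps)
qed

text \<open>For each ramp the identity extends from cylinders to all measurable sets of futures;
  letting the ramps increase to the indicator gives the version of the tail probability.\<close>

lemma Fs_version:
 assumes conv: "AE \<omega> in P. (\<lambda>N. Rt N (-1) \<omega>) \<longlonglongrightarrow> R1 \<omega>"
  and E [measurable]: "Measurable.pred P E" and R: "AE \<omega> in P. E \<omega> \<longleftrightarrow> t < \<eta> * Rv \<omega>"
 shows "cond_prob_version P Xf seqM E (Fs \<eta> t)"
 unfolding cond_prob_version_def
proof (intro conjI ballI)
 show Fm: "Fs \<eta> t \<in> borel_measurable seqM" by (rule Fs_measurable[OF conv])
 have FX: "(\<lambda>\<omega>. Fs \<eta> t (Xf \<omega>)) \<in> borel_measurable P" by (rule measurable_compose[OF Xf_measurable Fm])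
 have Im: "(\<lambda>r. indicat_real {t<..} (\<eta> * r)) \<in> borel_measurable borel" by measurable
 have Fb: "0 \<le> Fs \<eta> t x \<and> Fs \<eta> t x \<le> 1" for x
  unfolding Fs_def by (rule FH_le[OF Im]) (simp add: indicator_def)
 show "integrable P (\<lambda>\<omega>. Fs \<eta> t (Xf \<omega>))" by (rule integrable_const_bound[where B=1]) (use Fb FX in auto)
 fix B :: "(nat \<Rightarrow> 'd) set" assume B: "B \<in> sets seqM"
 have ev [measurable]: "{\<omega>\<in>space P. Xf \<omega> \<in> B} \<in> events" using measurable_sets[OF Xf_measurable B] by (simp add: vimage_def Int_def conj_commute)
 define I where "I = indicat_real {\<omega>\<in>space P. Xf \<omega> \<in> B}"
 have I [measurable]: "I \<in> borel_measurable P" unfolding I_def by measurable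
 have I1: "\<bar>I \<omega>\<bar> \<le> 1" for \<omega> by (simp add: I_def indicator_def)
 have Xj: "(\<lambda>\<omega>. Xf \<omega> j) \<in> measurable P (count_space UNIV)" for j unfolding Xf_def by measurable
 define G where "G n \<omega> = FH (ramp \<eta> t n) (Xf \<omega> 0) (Xf \<omega>)" for n \<omega>
 have Gm [measurable]: "G n \<in> borel_measurable P" for n
  unfolding G_def[abs_def] by (rule FH_measurable[OF conv ramp_props(1,3) Xj])
 have Gb: "0 \<le> G n \<omega> \<and> G n \<omega> \<le> 1" for n \<omega> unfolding G_def by (rule FH_le[OF ramp_measurable ramp_props(2)])
 have eq: "(\<integral>\<omega>. I \<omega> * G n \<omega> \<partial>P) = (\<integral>\<omega>. I \<omega> * ramp \<eta> t n (Rv \<omega>) \<partial>P)" for n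
  unfolding I_def
 proof (rule seqM_integral_eq[OF _ _ _ _ _ B])
  show "integrable P (G n)" by (rule integrable_const_bound[where B=1]) (use Gb in auto)
  show "integrable P (\<lambda>\<omega>. ramp \<eta> t n (Rv \<omega>))" by (rule integrable_const_bound[where B=1]) (use ramp_props(3) in auto)
  show "(\<integral>\<omega>. indicator (cyl 0 (i # w)) \<omega> * G n \<omega> \<partial>P) = (\<integral>\<omega>. indicator (cyl 0 (i # w)) \<omega> * ramp \<eta> t n (Rv \<omega>) \<partial>P)" for i w
   unfolding G_def by (rule FH_word[OF conv ramp_props(1,3)])
 qed (use Gb ramp_props(2) in auto)
 have l1: "(\<lambda>n. \<integral>\<omega>. I \<omega> * G n \<omega> \<partial>P) \<longlonglongrightarrow> (\<integral>\<omega>. I \<omega> * Fs \<eta> t (Xf \<omega>) \<partial>P)"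
 proof (rule integral_dominated_convergence[where w="\<lambda>_. 1 * 1"])
  show "AE \<omega> in P. (\<lambda>n. I \<omega> * G n \<omega>) \<longlonglongrightarrow> I \<omega> * Fs \<eta> t (Xf \<omega>)"
   unfolding G_def by (intro AE_I2 tendsto_mult tendsto_const FH_ramp_limit)
  show "AE \<omega> in P. norm (I \<omega> * G n \<omega>) \<le> 1 * 1" for n
   unfolding real_norm_def abs_mult using I1 Gb by (intro AE_I2 mult_mono) auto
 qed (use FX in auto)
 have l2: "(\<lambda>n. \<integral>\<omega>. I \<omega> * ramp \<eta> t n (Rv \<omega>) \<partial>P) \<longlonglongrightarrow> (\<integral>\<omega>. I \<omega> * indicator {t<..} (\<eta> * Rv \<omega>) \<partial>P)"
 proof (rule integral_dominated_convergence[where w="\<lambda>_. 1 * 1"])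
  show "AE \<omega> in P. (\<lambda>n. I \<omega> * ramp \<eta> t n (Rv \<omega>)) \<longlonglongrightarrow> I \<omega> * indicator {t<..} (\<eta> * Rv \<omega>)"
   by (intro AE_I2 tendsto_mult tendsto_const ramp_limit)
  show "AE \<omega> in P. norm (I \<omega> * ramp \<eta> t n (Rv \<omega>)) \<le> 1 * 1" for n
   unfolding real_norm_def abs_mult using I1 ramp_props(3) by (intro AE_I2 mult_mono) auto
 qed auto
 have "(\<integral>\<omega>. I \<omega> * Fs \<eta> t (Xf \<omega>) \<partial>P) = (\<integral>\<omega>. I \<omega> * indicator {t<..} (\<eta> * Rv \<omega>) \<partial>P)"
  using LIMSEQ_unique[OF l1] l2 unfolding eq by blast
 also have "\<dots> = (\<integral>\<omega>. indicat_real {\<omega>\<in>space P. E \<omega> \<and> Xf \<omega> \<in> B} \<omega> \<partial>P)"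
 proof (rule integral_cong_AE)
  show "AE \<omega> in P. I \<omega> * indicator {t<..} (\<eta> * Rv \<omega>) = indicat_real {\<omega>\<in>space P. E \<omega> \<and> Xf \<omega> \<in> B} \<omega>"
   using R AE_space by eventually_elim (auto simp: I_def indicator_def)
  have "{\<omega>\<in>space P. E \<omega>} \<inter> {\<omega>\<in>space P. Xf \<omega> \<in> B} \<in> events" by measurable
  moreover have "{\<omega>\<in>space P. E \<omega>} \<inter> {\<omega>\<in>space P. Xf \<omega> \<in> B} = {\<omega>\<in>space P. E \<omega> \<and> Xf \<omega> \<in> B}" by blast
  ultimately show "indicat_real {\<omega>\<in>space P. E \<omega> \<and> Xf \<omega> \<in> B} \<in> borel_measurable P" by simp
 qed measurable
 also have "\<dots> = prob ({\<omega>\<in>space P. E \<omega> \<and> Xf \<omega> \<in> B} \<inter> space P)" by simp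
 also have "{\<omega>\<in>space P. E \<omega> \<and> Xf \<omega> \<in> B} \<inter> space P = {\<omega>\<in>space P. E \<omega> \<and> Xf \<omega> \<in> B}" by blast
 finally show "(\<integral>\<omega>. indicator {\<omega>\<in>space P. Xf \<omega> \<in> B} \<omega> * Fs \<eta> t (Xf \<omega>) \<partial>P) = prob {\<omega>\<in>space P. E \<omega> \<and> Xf \<omega> \<in> B}"
  unfolding I_def .
qed

end

section \<open>The chain at the critical exponent, degenerate perpetuities, and the
  conclusion\<close>

locale crit_chain = coeffs_chain P X Qc Mc q0 m0
 for P :: "'a measure" and X :: "int \<Rightarrow> 'a \<Rightarrow> 'd::finite" and Qc Mc :: "int \<Rightarrow> 'd \<Rightarrow> 'a \<Rightarrow> real" and q0 m0 :: real +
 fixes \<alpha> b2 :: real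
 assumes alpha_pos: "0 < \<alpha>" and Lam_alpha: "Lam \<alpha> = 0" and Lam_sub: "0 < \<beta> \<Longrightarrow> \<beta> < \<alpha> \<Longrightarrow> Lam \<beta> < 0"
  and Lam_b2: "0 < b2" "0 < Lam b2"
  and lattice: "\<delta> > 0 \<Longrightarrow> measure P {\<omega>\<in>space P. Mc 0 (X 0 \<omega>) \<omega> \<noteq> 0 \<and> (\<exists>k::int. ln \<bar>Mc 0 (X 0 \<omega>) \<omega>\<bar> = \<delta> * of_int k)}
         / measure P {\<omega>\<in>space P. Mc 0 (X 0 \<omega>) \<omega> \<noteq> 0} < 1"
begin

lemma conv: "AE \<omega> in P. (\<lambda>N. Rt N (-1) \<omega>) \<longlonglongrightarrow> R1 \<omega>" "AE \<omega> in P. (\<lambda>n. Pw (-1) n \<omega>) \<longlonglongrightarrow> 0"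
proof -
 have "0 < \<alpha> / 2" "Lam (\<alpha> / 2) < 0" using alpha_pos by (auto intro: Lam_sub)
 note a = R1_tail(1)[OF this]
 show "AE \<omega> in P. (\<lambda>N. Rt N (-1) \<omega>) \<longlonglongrightarrow> R1 \<omega>" using a by eventually_elim blast
 show "AE \<omega> in P. (\<lambda>n. Pw (-1) n \<omega>) \<longlonglongrightarrow> 0" using a by eventually_elim blast
qed

sublocale ak: affine_kernel "\<lambda>j x. Pc [j] x" lam kap q0 m0 \<alpha> "6 * BB" \<rho>
proof (rule affine_kernel.intro)
 fix j :: 'd and x y :: "nat \<Rightarrow> 'd" and n :: nat
 show "prob_space (lam j)" by (rule prob_lam)
 show "sets (lam j) = sets borel" by simp
 show "AE u in lam j. \<bar>fst u\<bar> \<le> q0 \<and> 1 / m0 \<le> \<bar>snd u\<bar> \<and> \<bar>snd u\<bar> \<le> m0" by (rule lam_bound)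
 show "0 < q0" "0 < m0" by (rule q0_pos m0_pos)+
 show "0 < Pc [j] x" by (rule Pc_pos)
 show "(\<Sum>j\<in>UNIV. Pc [j] x) = 1" by (rule Pc_sum1)
 show "0 \<le> 6 * BB" using BB_nonneg by simp
 show "0 < \<rho>" "\<rho> < 1" by (rule CC_rho)+
 show "Pc [j] x \<le> exp (6 * BB * \<rho> ^ n) * Pc [j] y" if "\<forall>k<n. x k = y k"
 proof -
  have "Pc [j] x \<le> exp (2 * BB * \<rho> ^ n) * Pc [j] y" by (rule Pc_ratio[OF that])
  also have "\<dots> \<le> exp (6 * BB * \<rho> ^ n) * Pc [j] y"
   using BB_nonneg CC_rho Pc_pos[of "[j]" y] by (intro mult_right_mono) (auto intro!: mult_right_mono)
  finally show ?thesis .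
 qed
 show "prob_space (kap x)" by (rule prob_kap)
 show "sets (kap x) = sets borel" by simp
 show "(\<integral>r. H r \<partial>kap x) \<le> exp (6 * BB * \<rho> ^ n) * (\<integral>r. H r \<partial>kap y)"
  if "\<forall>k<n. x k = y k" "H \<in> borel_measurable borel" "\<And>r. 0 \<le> H r \<and> H r \<le> 1" for H
  by (rule kap_mono(1)[OF that(2,3,1)])
 show "(\<integral>r. H r \<partial>kap x) = (\<Sum>j\<in>UNIV. Pc [j] x * (\<integral>u. (\<integral>r. H (fst u + snd u * r) \<partial>kap (cons j x)) \<partial>lam j))"
  if "continuous_on UNIV H" "\<And>r. \<bar>H r\<bar> \<le> 1" for H
  by (rule kap_rec[OF conv(1) that, unfolded FH_def])
qed

lemma vpow_eq: "ak.vpow \<beta> n x = (\<Sum>u\<in>wds n. Pc u x * mp \<beta> u)"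
proof (induction n arbitrary: x)
 case (Suc n)
 have "ak.mom \<beta> j = momc \<beta> j" for j unfolding ak.mom_def momc_def ..
 then have "ak.vpow \<beta> (Suc n) x = (\<Sum>j\<in>UNIV. Pc [j] x * momc \<beta> j * (\<Sum>u\<in>wds n. Pc u (cons j x) * mp \<beta> u))"
  by (simp add: Suc.IH)
 also have "\<dots> = (\<Sum>j\<in>UNIV. \<Sum>u\<in>wds n. Pc (j # u) x * mp \<beta> (j # u))"
  unfolding sum_distrib_left by (intro sum.cong refl) (subst Pc_Cons, simp only: mp_simps mult_ac)
 finally show ?case unfolding sum_wds_Suc .
qed simp

text \<open>Conditioning on the future changes word probabilities by at most \<open>exp BB\<close>,
  so the iterates of the transfer operator grow like the unconditional moments, uniformly in
  \<open>x\<close>.\<close>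

lemma vpow_bounds: "ak.vpow \<beta> n x \<le> exp BB * An \<beta> n" "An \<beta> n \<le> exp BB * ak.vpow \<beta> n x"
 unfolding vpow_eq An_def sum_distrib_left mult.assoc[symmetric]
 by (intro sum_mono mult_right_mono Pc_le less_imp_le[OF mp_pos])+

sublocale ck: critical_kernel "\<lambda>j x. Pc [j] x" lam kap q0 m0 \<alpha> "6 * BB" \<rho>
proof (rule critical_kernel.intro[OF ak.affine_kernel_axioms critical_kernel_axioms.intro])
 show "0 < \<alpha>" by (rule alpha_pos)
 show "\<exists>c C. 0 < c \<and> (\<forall>n x. c \<le> ak.vpow \<alpha> n x \<and> ak.vpow \<alpha> n x \<le> C)"
 proof (intro exI conjI allI)
  show "0 < exp (- 2 * BB)" by simp
  fix n x
  \<comment> \<open>At the critical exponent the linear term in the exponent vanishes and only the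
    constant error remains.\<close>
  have A: "An \<alpha> n \<le> exp BB" "exp (- BB) \<le> An \<alpha> n" using An_bounds(1)[of \<alpha> n] An_bounds(2)[of n \<alpha>] by (simp_all add: Lam_alpha)
  have "exp (- BB) * exp (- BB) \<le> exp (- BB) * (exp BB * ak.vpow \<alpha> n x)"
   using A(2) vpow_bounds(2)[of \<alpha> n x] by (intro mult_left_mono) auto
  then show "exp (- 2 * BB) \<le> ak.vpow \<alpha> n x" by (simp add: mult.assoc[symmetric] exp_add[symmetric])
  have "exp BB * An \<alpha> n \<le> exp BB * exp BB" using A(1) by (intro mult_left_mono) auto
  then show "ak.vpow \<alpha> n x \<le> exp (2 * BB)" using vpow_bounds(1)[of \<alpha> n x] by (simp add: exp_add[symmetric])
 qed
 show "\<exists>C r. 0 < r \<and> r < 1 \<and> (\<forall>n x. ak.vpow \<beta> n x \<le> C * r ^ n)" if "0 < \<beta>" "\<beta> < \<alpha>" for \<beta>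
 proof (intro exI conjI allI)
  show "0 < exp (Lam \<beta>)" "exp (Lam \<beta>) < 1" using Lam_sub[OF that] by simp_all
  fix n x
  have "exp BB * An \<beta> n \<le> exp BB * exp (BB + real n * Lam \<beta>)" by (intro mult_left_mono An_bounds) simp
  also have "\<dots> = exp (2 * BB) * exp (Lam \<beta>) ^ n"
   by (simp add: exp_add[symmetric] exp_of_nat_mult[symmetric])
  finally show "ak.vpow \<beta> n x \<le> exp (2 * BB) * exp (Lam \<beta>) ^ n" using vpow_bounds(1)[of \<beta> n x] by linarith
 qed
 show "\<exists>C. \<forall>x t. 0 < t \<longrightarrow> measure (kap x) {r. \<bar>r\<bar> > t} \<le> C * t powr (- \<beta>)" if \<beta>: "0 < \<beta>" "\<beta> < \<alpha>" for \<beta>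
 proof -
  obtain C where C: "\<And>t. t > 0 \<Longrightarrow> prob {\<omega>\<in>space P. t < \<bar>R1 \<omega>\<bar>} \<le> C * t powr (- \<beta>)"
   using R1_tail(2)[OF \<beta>(1) Lam_sub[OF \<beta>]] by blast
  have "measure (kap x) {r. \<bar>r\<bar> > t} \<le> exp (3 * BB) * C * t powr (- \<beta>)" if t: "0 < t" for x and t :: real
  proof -
   have "measure (kap x) {r. t < \<bar>r\<bar>} \<le> exp (3 * BB) * prob {\<omega>\<in>space P. R1 \<omega> \<in> {r. t < \<bar>r\<bar>}}"
    by (rule kap_measure_bounds(1)) simp
   also have "\<dots> \<le> exp (3 * BB) * (C * t powr (- \<beta>))" using C[OF t] by (intro mult_left_mono) auto
   finally show ?thesis by simp
  qed
  then show ?thesis by blast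
 qed
 show "\<exists>j. \<not> (AE u in lam j. \<exists>k::int. ln \<bar>snd u\<bar> = \<delta> * of_int k)" if \<delta>: "\<delta> > 0" for \<delta>
 proof (rule ccontr)
  assume "\<not> ?thesis"
  then have l: "AE u in lam j. \<exists>k::int. ln \<bar>snd u\<bar> = \<delta> * of_int k" for j by blast
  have "Measurable.pred borel (\<lambda>u :: real \<times> real. \<exists>k::int. ln \<bar>snd u\<bar> = \<delta> * of_int k)" by measurable
  from AE_coef[OF this l] AE_good
  have ae: "AE \<omega> in P. Mx 0 \<omega> \<noteq> 0 \<and> (\<exists>k::int. ln \<bar>Mx 0 \<omega>\<bar> = \<delta> * of_int k)"
  proof eventually_elim
   case (elim \<omega>)
   then show ?case using good_M_pos[OF elim(2), of 0 "X 0 \<omega>"] elim(1)[THEN spec, THEN spec, of 0 "X 0 \<omega>"] by (simp add: cf_def)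
  qed
  have "prob {\<omega>\<in>space P. Mx 0 \<omega> \<noteq> 0 \<and> (\<exists>k::int. ln \<bar>Mx 0 \<omega>\<bar> = \<delta> * of_int k)} = 1"
   by (subst prob_Collect_eq_1) (use ae in measurable)
  moreover have "AE \<omega> in P. Mx 0 \<omega> \<noteq> 0" using ae by eventually_elim blast
  then have "prob {\<omega>\<in>space P. Mx 0 \<omega> \<noteq> 0} = 1" by (subst prob_Collect_eq_1) measurable
  ultimately show False using lattice[OF \<delta>] by simp
 qed
qed

lemma Fm_Fs: "ck.Fm s t x = Fs (esgn s) t x"
 unfolding ck.Fm_def Fs_eq ..

text \<open>For each precision the negation supplies some sequence and some centre; because every
  \<open>kap x\<close> is comparable with the law of \<open>R1\<close>, it concentrates the latter
  near that centre. Centres for different precisions are close to one another, and their limit is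
  the constant.\<close>

lemma nearly_const_imp_const:
 assumes nd: "\<not> (\<exists>\<delta>>0. \<exists>k>0. \<forall>x a. k \<le> measure (kap x) {r. \<delta> < \<bar>r - a\<bar>})"
 shows "\<exists>c. AE \<omega> in P. R1 \<omega> = c"
proof -
 have ex: "\<exists>a. prob {\<omega>\<in>space P. e < \<bar>R1 \<omega> - a\<bar>} < e" if e: "0 < e" for e :: real
 proof -
  have "0 < e * exp (- (3 * BB))" using e by simp
  then obtain x a where xa: "measure (kap x) {r. e < \<bar>r - a\<bar>} < e * exp (- (3 * BB))"
   using nd e by (meson not_le)
  have "prob {\<omega>\<in>space P. R1 \<omega> \<in> {r. e < \<bar>r - a\<bar>}} \<le> exp (3 * BB) * measure (kap x) {r. e < \<bar>r - a\<bar>}"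
   by (rule kap_measure_bounds(2)) simp
  also have "\<dots> < exp (3 * BB) * (e * exp (- (3 * BB)))" using xa by simp
  also have "\<dots> = e" by (simp add: exp_minus)
  finally show ?thesis by auto
 qed
 \<comment> \<open>The offset 3 keeps each exceptional probability below one half, so two
   exceptional events cannot cover the space and the centres must be close.\<close>
 define e where "e n = 1 / (real n + 3)" for n
 have e0: "0 < e n" "e n < 1 / 2" for n by (simp_all add: e_def divide_less_eq)
 have elim: "e \<longlonglongrightarrow> 0" unfolding e_def
  by (rule real_tendsto_divide_at_top[OF tendsto_const])
   (rule filterlim_at_top_add_at_top[OF filterlim_real_sequentially, of "\<lambda>_. 3", simplified]
    filterlim_tendsto_add_at_top[OF tendsto_const filterlim_real_sequentially, of 3, unfolded add.commute[of 3]])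
 obtain a where a: "\<And>n. prob {\<omega>\<in>space P. e n < \<bar>R1 \<omega> - a n\<bar>} < e n" using ex[OF e0(1)] by metis
 have close: "\<bar>a n - a m\<bar> \<le> e n + e m" for n m
 proof (rule ccontr)
  assume far: "\<not> \<bar>a n - a m\<bar> \<le> e n + e m"
  have "1 = prob (space P)" by (simp add: prob_space)
  also have "space P = {\<omega>\<in>space P. e n < \<bar>R1 \<omega> - a n\<bar>} \<union> {\<omega>\<in>space P. e m < \<bar>R1 \<omega> - a m\<bar>}" using far by auto
  also have "prob \<dots> \<le> prob {\<omega>\<in>space P. e n < \<bar>R1 \<omega> - a n\<bar>} + prob {\<omega>\<in>space P. e m < \<bar>R1 \<omega> - a m\<bar>}"
   by (rule measure_Un_le) measurable
  finally show False using a[of n] a[of m] e0[of n] e0[of m] by linarith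
 qed
 have "Cauchy a"
 proof (rule metric_CauchyI)
  fix d :: real assume d: "0 < d"
  then have "\<forall>\<^sub>F n in sequentially. e n < d / 2" by (intro order_tendstoD(2)[OF elim]) simp
  then obtain M where M: "\<And>n. n \<ge> M \<Longrightarrow> e n < d / 2" by (auto simp: eventually_sequentially)
  have "dist (a m) (a n) < d" if "m \<ge> M" "n \<ge> M" for m n
  proof -
   have "e m < d / 2" "e n < d / 2" using M that by auto
   then show ?thesis using close[of m n] unfolding dist_real_def by linarith
  qed
  then show "\<exists>M. \<forall>m\<ge>M. \<forall>n\<ge>M. dist (a m) (a n) < d" by blast
 qed
 then obtain c where c: "a \<longlonglongrightarrow> c" using Cauchy_convergent convergent_def by blast
 have ac: "\<bar>a n - c\<bar> \<le> e n" for n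
 proof -
  have l: "(\<lambda>m. \<bar>a n - a m\<bar>) \<longlonglongrightarrow> \<bar>a n - c\<bar>" by (intro tendsto_intros c)
  have r: "(\<lambda>m. e n + e m) \<longlonglongrightarrow> e n + 0" by (intro tendsto_intros elim)
  have "\<bar>a n - c\<bar> \<le> e n + 0"
   by (rule tendsto_le[OF trivial_limit_sequentially r l]) (simp add: close)
  then show ?thesis by simp
 qed
 have "AE \<omega> in P. \<bar>R1 \<omega> - c\<bar> \<le> 1 / real (Suc m)" for m
 proof -
  define d where "d = 1 / real (Suc m)"
  have d: "0 < d" by (simp add: d_def)
  have "prob {\<omega>\<in>space P. d < \<bar>R1 \<omega> - c\<bar>} \<le> 0"
  proof (rule tendsto_lowerbound[OF elim])
   have "0 < d / 2" using d by simp
   then have "\<forall>\<^sub>F n in sequentially. e n < d / 2" by (rule order_tendstoD(2)[OF elim])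
   then show "\<forall>\<^sub>F n in sequentially. prob {\<omega>\<in>space P. d < \<bar>R1 \<omega> - c\<bar>} \<le> e n"
   proof eventually_elim
    case (elim n)
    have "\<bar>R1 \<omega> - c\<bar> \<le> d" if "\<bar>R1 \<omega> - a n\<bar> \<le> e n" for \<omega> using that ac[of n] elim by linarith
    then have "{\<omega>\<in>space P. d < \<bar>R1 \<omega> - c\<bar>} \<subseteq> {\<omega>\<in>space P. e n < \<bar>R1 \<omega> - a n\<bar>}" by (auto simp: not_le[symmetric])
    then have "prob {\<omega>\<in>space P. d < \<bar>R1 \<omega> - c\<bar>} \<le> prob {\<omega>\<in>space P. e n < \<bar>R1 \<omega> - a n\<bar>}"
     by (rule finite_measure_mono) measurable
    then show ?case using a[of n] by linarith
   qed
  qed simp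
  then have "prob {\<omega>\<in>space P. d < \<bar>R1 \<omega> - c\<bar>} = 0" by (simp add: measure_le_0_iff)
  moreover have "{\<omega>\<in>space P. d < \<bar>R1 \<omega> - c\<bar>} \<in> events" by measurable
  ultimately have "AE \<omega> in P. \<omega> \<notin> {\<omega>\<in>space P. d < \<bar>R1 \<omega> - c\<bar>}" by (simp add: prob_eq_0)
  with AE_space show ?thesis unfolding d_def[symmetric] by eventually_elim auto
 qed
 then have "AE \<omega> in P. \<forall>m. \<bar>R1 \<omega> - c\<bar> \<le> 1 / real (Suc m)" by (simp add: AE_all_countable)
 then have "AE \<omega> in P. R1 \<omega> = c"
 proof eventually_elim
  case (elim \<omega>)
  have l: "(\<lambda>m. 1 / real (Suc m)) \<longlonglongrightarrow> 0" by (rule LIMSEQ_Suc[OF lim_1_over_n])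
  have "\<bar>R1 \<omega> - c\<bar> \<le> 0" by (rule tendsto_lowerbound[OF l]) (use elim in simp_all)
  then show ?case by simp
 qed
 then show ?thesis by blast
qed

text \<open>By stationarity the perpetuity started at time 0 has the law of the one started at time
  -1, so both equal \<open>c\<close> almost surely; the affine relation between them then reads
  \<open>q + m * c = c\<close>, and it passes to each symbol.\<close>

lemma const_imp_coef:
 assumes c: "AE \<omega> in P. R1 \<omega> = c"
 shows "AE u in lam i. fst u + c * snd u = c"
proof -
 \<comment> \<open>A bounded continuous function vanishing at \<open>c\<close> only: its mean
   detects almost sure equality with \<open>c\<close> and survives the limits.\<close>
 define H where "H r = min 1 \<bar>r - c\<bar>" for r :: real
 have Hc: "continuous_on UNIV H" unfolding H_def by (intro continuous_intros)
 have H1: "\<bar>H r\<bar> \<le> 1" for r by (simp add: H_def)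
 have Hm [measurable]: "H \<in> borel_measurable borel" by (rule borel_measurable_continuous_onI[OF Hc])
 have shift: "(\<integral>\<omega>. H (Rt N 0 \<omega>) \<partial>P) = (\<integral>\<omega>. H (Rt N (-1) \<omega>) \<partial>P)" for N
  using word_sum[OF borel_measurable_const[of 1] _ Hm H1, of 1 N 0] word_sum[OF borel_measurable_const[of 1] _ Hm H1, of 1 N "-1"]
  by (simp add: prob_cyl)
 have l1: "(\<lambda>N. \<integral>\<omega>. H (Rt (Suc N) 0 \<omega>) \<partial>P) \<longlonglongrightarrow> (\<integral>\<omega>. H (Rv \<omega>) \<partial>P)"
 proof (rule integral_dominated_convergence[where w="\<lambda>_. 1"])
  show "AE \<omega> in P. (\<lambda>N. H (Rt (Suc N) 0 \<omega>)) \<longlonglongrightarrow> H (Rv \<omega>)"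
   using conv(1)
  proof eventually_elim
   case (elim \<omega>)
   have "(\<lambda>N. Rt (Suc N) 0 \<omega>) \<longlonglongrightarrow> Rv \<omega>" unfolding Rt.simps Rv_def using elim by (intro tendsto_intros) simp
   then show ?case by (rule continuous_on_tendsto_compose[OF Hc]) simp_all
  qed
 qed (auto simp: H1 simp del: Rt.simps)
 have l2: "(\<lambda>N. \<integral>\<omega>. H (Rt N (-1) \<omega>) \<partial>P) \<longlonglongrightarrow> (\<integral>\<omega>. H (R1 \<omega>) \<partial>P)"
 proof (rule integral_dominated_convergence[where w="\<lambda>_. 1"])
  show "AE \<omega> in P. (\<lambda>N. H (Rt N (-1) \<omega>)) \<longlonglongrightarrow> H (R1 \<omega>)"
   using conv(1)
  proof eventually_elim
   case (elim \<omega>)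
   then show ?case by (rule continuous_on_tendsto_compose[OF Hc]) simp_all
  qed
 qed (auto simp: H1 simp del: Rt.simps)
 have "(\<integral>\<omega>. H (Rv \<omega>) \<partial>P) = (\<integral>\<omega>. H (R1 \<omega>) \<partial>P)"
  using LIMSEQ_unique[OF l1[unfolded shift] LIMSEQ_Suc[OF l2]] .
 also have "\<dots> = (\<integral>\<omega>. 0 \<partial>P)"
 proof (rule integral_cong_AE)
  show "AE \<omega> in P. H (R1 \<omega>) = 0" using c by eventually_elim (simp add: H_def)
 qed measurable
 finally have z: "(\<integral>\<omega>. H (Rv \<omega>) \<partial>P) = 0" by simp
 have "integrable P (\<lambda>\<omega>. H (Rv \<omega>))" by (rule integrable_const_bound[where B=1]) (auto simp: H1)
 moreover have "AE \<omega> in P. 0 \<le> H (Rv \<omega>)" by (simp add: H_def)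
 ultimately have "AE \<omega> in P. H (Rv \<omega>) = 0" using z integral_nonneg_eq_0_iff_AE by blast
 with c have "AE \<omega> in P. fst (cf \<omega> (0, X 0 \<omega>)) + c * snd (cf \<omega> (0, X 0 \<omega>)) = c"
 proof eventually_elim
  case (elim \<omega>)
  then have "Rv \<omega> = c" by (auto simp: H_def min_def split: if_splits)
  then show ?case using elim(1) by (simp add: Rv_def cf_def mult.commute)
 qed
 then show ?thesis by (intro AE_lam_of_AE[where Q="\<lambda>_ _ u. fst u + c * snd u = c"]) measurable
qed

lemma coef_AE: "(\<And>i. AE u in lam i. fst u + c * snd u = c) \<Longrightarrow> AE \<omega> in P. \<forall>n i. Qc n i \<omega> + c * Mc n i \<omega> = c"
 using AE_coef[of "\<lambda>u. fst u + c * snd u = c"] by (simp add: cf_def)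

text \<open>All affine maps fix \<open>c\<close>, so the truncated perpetuity differs from
  \<open>c\<close> by \<open>\<bar>c\<bar>\<close> times the product of the moduli of the
  multipliers, which tends to zero.\<close>

lemma coef_imp_const:
 assumes coef: "\<And>i. AE u in lam i. fst u + c * snd u = c"
 shows "AE \<omega> in P. R1 \<omega> = c"
 using coef_AE[OF coef] conv
proof eventually_elim
 case (elim \<omega>)
 have Pw_Suc: "Pw k (Suc N) \<omega> = \<bar>Mx k \<omega>\<bar> * Pw (k - 1) N \<omega>" for k N
  unfolding Pw_def prod.lessThan_Suc_shift by (simp add: diff_diff_eq)
 have "\<bar>Rt N k \<omega> - c\<bar> = \<bar>c\<bar> * Pw k N \<omega>" for N k
 proof (induction N arbitrary: k)
  case 0 then show ?case by (simp add: Pw_def)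
 next
  case (Suc N)
  have "Qx k \<omega> + c * Mx k \<omega> = c" using elim(1) by blast
  then have "Rt (Suc N) k \<omega> - c = Mx k \<omega> * (Rt N (k - 1) \<omega> - c)" by (simp add: algebra_simps)
  then show ?case unfolding Pw_Suc abs_mult Suc.IH by (simp only: abs_mult Suc.IH mult_ac)
 qed
 then have "(\<lambda>N. \<bar>Rt N (-1) \<omega> - c\<bar>) \<longlonglongrightarrow> \<bar>c\<bar> * 0" using tendsto_mult_left[OF elim(3), of "\<bar>c\<bar>"] by (simp only:)
 moreover have "(\<lambda>N. \<bar>Rt N (-1) \<omega> - c\<bar>) \<longlonglongrightarrow> \<bar>R1 \<omega> - c\<bar>" by (intro tendsto_intros elim(2))
 ultimately have "\<bar>R1 \<omega> - c\<bar> = \<bar>c\<bar> * 0" using LIMSEQ_unique by blast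
 then show ?case by simp
qed

lemma Fs_zero:
 assumes "AE u in lam (x 0). AE \<omega> in P. \<eta> * (fst u + snd u * R1 \<omega>) \<le> t"
 shows "Fs \<eta> t x = 0"
 unfolding Fs_eq
proof (rule integral_eq_zero_AE)
 show "AE u in lam (x 0). measure (kap x) {r. t < \<eta> * (fst u + snd u * r)} = 0"
  using assms
 proof eventually_elim
  case (elim u)
  have "prob {\<omega>\<in>space P. R1 \<omega> \<in> {r. t < \<eta> * (fst u + snd u * r)}} = 0"
   by (subst prob_eq_0) (use elim in \<open>auto simp: not_less\<close>)
  moreover have "measure (kap x) {r. t < \<eta> * (fst u + snd u * r)} \<le> exp (3 * BB) * prob {\<omega>\<in>space P. R1 \<omega> \<in> {r. t < \<eta> * (fst u + snd u * r)}}"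
   by (rule kap_measure_bounds(1)) measurable
  ultimately show ?case by (simp add: measure_le_0_iff)
 qed
qed

definition Rx :: "'a \<Rightarrow> real" where
 "Rx \<omega> = Qx 0 \<omega> + (\<Sum>n. Qx (- int n - 1) \<omega> * (\<Prod>i<Suc n. Mx (- int i) \<omega>))"

lemma Rx_measurable [measurable]: "Rx \<in> borel_measurable P"
 unfolding Rx_def[abs_def] by measurable

lemma Rx_Rv: "AE \<omega> in P. Rx \<omega> = Rv \<omega>"
 using conv(1) by eventually_elim (simp only: Rx_def Rv_def R_series)

text \<open>Excludes the degenerate case in (c): multipliers of modulus at most 1 are incompatible
  with a positive growth rate at \<open>b2\<close>.\<close>

lemma Lam_le_0:
 assumes m: "\<And>i. AE u in lam i. \<bar>snd u\<bar> \<le> 1" and \<beta>: "0 \<le> \<beta>"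
 shows "Lam \<beta> \<le> 0"
proof -
 have "momc \<beta> j \<le> 1" for j
 proof -
  interpret l: prob_space "lam j" by (rule prob_lam)
  have "momc \<beta> j \<le> (\<integral>u. 1 \<partial>lam j)" unfolding momc_def
  proof (rule integral_mono_AE)
   show "integrable (lam j) (\<lambda>u. \<bar>snd u\<bar> powr \<beta>)" by (rule ak.powr_integrable)
   show "AE u in lam j. \<bar>snd u\<bar> powr \<beta> \<le> 1" using m[of j] by eventually_elim (use powr_mono2[OF \<beta>, of _ 1] in force)
  qed simp
  then show ?thesis by (simp add: l.prob_space[simplified])
 qed
 then have "mp \<beta> u \<le> 1" for u
  by (induction u) (simp_all add: mult_le_one less_imp_le[OF mp_pos])
 then have "An \<beta> n \<le> (\<Sum>u\<in>wds n. pl (rev u) * 1)" for n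
  unfolding An_def by (intro sum_mono mult_left_mono) (auto simp: less_imp_le[OF pl_pos])
 moreover have "(\<Sum>u\<in>wds n. pl (rev u) * 1) = 1" for n using sum_pl_suffix[of "[]" n] by (simp add: sum_wds_rev[of pl] pl_Nil)
 ultimately have "An \<beta> n \<le> 1" for n by metis
 then have "ln (An \<beta> n) / real n \<le> 0" for n
  using An_pos[of \<beta> n] by (simp add: divide_nonpos_nonneg)
 then show ?thesis by (intro tendsto_upperbound[OF Lam_lim]) auto
qed

theorem main: "\<exists>K :: real \<Rightarrow> (nat \<Rightarrow> 'd) \<Rightarrow> real.
    (\<forall>\<eta>\<in>{-1, 1}. bounded (range (K \<eta>)) \<and> (\<forall>x. K \<eta> x \<ge> 0) \<and> K \<eta> \<in> borel_measurable seqM \<and>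
     (\<exists>F :: real \<Rightarrow> (nat \<Rightarrow> 'd) \<Rightarrow> real.
       (\<forall>t. cond_prob_version P Xf seqM (\<lambda>\<omega>. \<eta> * Rx \<omega> > t) (F t)) \<and>
       (\<forall>\<epsilon>>0. \<exists>T. \<forall>t\<ge>T. \<forall>x. \<bar>t powr \<alpha> * F t x - K \<eta> x\<bar> < \<epsilon>))) \<and>
    (measure P {\<omega>\<in>space P. Mx 0 \<omega> < 0} > 0 \<longrightarrow>
     measure P {\<omega>\<in>space P. K 1 (Xf \<omega>) = K (-1) (Xf \<omega>)} = 1) \<and>
    (measure P {\<omega>\<in>space P. Qx 0 \<omega> > 0 \<and> Mx 0 \<omega> > 0} = 1 \<longrightarrow>
     measure P {\<omega>\<in>space P. K 1 (Xf \<omega>) > 0} = 1) \<and>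
    (\<forall>\<eta>\<in>{-1, 1}. measure P {\<omega>\<in>space P. K \<eta> (Xf \<omega>) > 0} > 0 \<longrightarrow>
     measure P {\<omega>\<in>space P. K \<eta> (Xf \<omega>) > 0} = 1) \<and>
    ((measure P {\<omega>\<in>space P. K 1 (Xf \<omega>) = 0 \<and> K (-1) (Xf \<omega>) = 0} = 1) \<longleftrightarrow>
     (\<exists>\<Gamma> :: 'd \<Rightarrow> real.
       measure P {\<omega>\<in>space P. Qx 0 \<omega> + \<Gamma> (X 0 \<omega>) * Mx 0 \<omega> = \<Gamma> (X 1 \<omega>)} = 1)) \<and>
    ((\<forall>q m i. measure P {\<omega>\<in>space P. Qc 0 i \<omega> = q \<and> Mc 0 i \<omega> = m} < 1) \<longrightarrow>
     ((measure P {\<omega>\<in>space P. K 1 (Xf \<omega>) = 0 \<and> K (-1) (Xf \<omega>) = 0} = 1) \<longleftrightarrow>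
      (\<exists>c::real. measure P {\<omega>\<in>space P. Qx 0 \<omega> + c * Mx 0 \<omega> = c} = 1)))"
proof -
 from ck.kernel_limits[unfolded Fm_Fs] obtain Kb :: "bool \<Rightarrow> (nat \<Rightarrow> 'd) \<Rightarrow> real" where
  kb: "(\<forall>s. bounded (range (Kb s)) \<and> (\<forall>x. 0 \<le> Kb s x) \<and> ((\<forall>x. Kb s x = 0) \<or> (\<forall>x. 0 < Kb s x)) \<and>
   (\<forall>e>0. \<exists>T. \<forall>t\<ge>T. \<forall>x. \<bar>t powr \<alpha> * Fs (esgn s) t x - Kb s x\<bar> \<le> e)) \<and>
  (ck.neg \<longrightarrow> Kb True = Kb False) \<and>
  ((\<exists>\<delta>>0. \<exists>k>0. \<forall>x a. k \<le> measure (kap x) {r. \<delta> < \<bar>r - a\<bar>}) \<longrightarrow> (\<exists>s. \<forall>x. 0 < Kb s x))" ..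
 have bd: "bounded (range (Kb s))" and nn: "0 \<le> Kb s x" and dich: "(\<forall>x. Kb s x = 0) \<or> (\<forall>x. 0 < Kb s x)"
  and lim: "0 < e \<Longrightarrow> \<exists>T. \<forall>t\<ge>T. \<forall>x. \<bar>t powr \<alpha> * Fs (esgn s) t x - Kb s x\<bar> \<le> e" for s x e
  using spec[OF conjunct1[OF kb], of s] by (elim conjE, simp only:)+
 note sym = mp[OF conjunct1[OF conjunct2[OF kb]]] and nd = mp[OF conjunct2[OF conjunct2[OF kb]]]
 define Z where "Z \<longleftrightarrow> (\<forall>s x. Kb s x = 0)"
 have zero: "Kb s x = 0" if F: "\<And>t. tz < t \<Longrightarrow> Fs (esgn s) t x = 0" for s x tz
 proof -
  have "Kb s x \<le> 0 + e" if e: "0 < e" for e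
  proof -
   obtain T where T: "\<And>t. T \<le> t \<Longrightarrow> \<bar>t powr \<alpha> * Fs (esgn s) t x - Kb s x\<bar> \<le> e" using lim[OF e, of s] by blast
   show ?thesis using T[of "max T (tz + 1)"] F[of "max T (tz + 1)"] by simp
  qed
  then have "Kb s x \<le> 0" by (rule field_le_epsilon)
  then show ?thesis using nn[of s x] by simp
 qed
 have Z_const: "\<exists>c. \<forall>i. AE u in lam i. fst u + c * snd u = c" if "Z"
 proof -
  have "\<not> (\<exists>s. \<forall>x. 0 < Kb s x)" using that unfolding Z_def by simp
  then have "\<not> (\<exists>\<delta>>0. \<exists>k>0. \<forall>x a. k \<le> measure (kap x) {r. \<delta> < \<bar>r - a\<bar>})" by (rule contrapos_nn) (rule nd)
  from nearly_const_imp_const[OF this] obtain c where "AE \<omega> in P. R1 \<omega> = c" ..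
  from const_imp_coef[OF this] show ?thesis by blast
 qed
 have const_Z: "Z" if coef: "\<And>i. AE u in lam i. fst u + c * snd u = c" for c
  unfolding Z_def
 proof (intro allI)
  fix s and x :: "nat \<Rightarrow> 'd"
  have ae: "AE u in lam (x 0). AE \<omega> in P. esgn s * (fst u + snd u * R1 \<omega>) \<le> t" if t: "\<bar>c\<bar> < t" for t
   using coef
  proof eventually_elim
   case (elim u)
   show ?case using coef_imp_const[OF coef]
   proof eventually_elim
    case (elim \<omega>)
    have "fst u + snd u * R1 \<omega> = c" using elim \<open>fst u + c * snd u = c\<close> by (simp add: mult.commute)
    then show ?case using t by (cases s) auto
   qed
  qed
  have "Fs (esgn s) t x = 0" if "\<bar>c\<bar> < t" for t using ae[OF that] by (rule Fs_zero)
  then show "Kb s x = 0" by (rule zero)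
 qed
 have Gamma_Z: "Z" if \<Gamma>: "prob {\<omega>\<in>space P. Qx 0 \<omega> + \<Gamma> (X 0 \<omega>) * Mx 0 \<omega> = \<Gamma> (X 1 \<omega>)} = 1" for \<Gamma> :: "'d \<Rightarrow> real"
 proof -
  have [measurable]: "(\<lambda>\<omega>. \<Gamma> (X k \<omega>)) \<in> borel_measurable P" for k by (rule X_comp_measurable) simp
  have "AE \<omega> in P. Qx 0 \<omega> + \<Gamma> (X 0 \<omega>) * Mx 0 \<omega> = \<Gamma> (X 1 \<omega>)"
   by (rule prob_Collect_eq_1[THEN iffD1, OF _ \<Gamma>]) measurable
  then have "AE \<omega> in P. fst (cf \<omega> (0, X 0 \<omega>)) + \<Gamma> (X 0 \<omega>) * snd (cf \<omega> (0, X 0 \<omega>)) = \<Gamma> (X 1 \<omega>)" by (simp add: cf_def)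
  then have ij: "AE u in lam i. fst u + \<Gamma> i * snd u = \<Gamma> j" for i j
   by (intro AE_lam_of_AE[where Q="\<lambda>i j u. fst u + \<Gamma> i * snd u = \<Gamma> j"]) measurable
  \<comment> \<open>The successor symbol is independent of the coefficients, so the same pair
    satisfies the equation for every successor; two different values of \<Gamma> would contradict
    each other.\<close>
  have const: "\<Gamma> i = \<Gamma> j" for i j
  proof (rule ccontr)
   assume ne: "\<Gamma> i \<noteq> \<Gamma> j"
   have "AE u in lam i. False" using ij[of i i] ij[of i j] by eventually_elim (use ne in simp)
   then show False using prob_space.AE_False[OF prob_lam] by blast
  qed
  have "AE u in lam i. fst u + \<Gamma> undefined * snd u = \<Gamma> undefined" for i
   using ij[of i i] unfolding const[of i undefined] .
  then show Z by (rule const_Z)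
 qed
 have coef_prob: "prob {\<omega>\<in>space P. Qx 0 \<omega> + c * Mx 0 \<omega> = c} = 1" if coef: "\<And>i. AE u in lam i. fst u + c * snd u = c" for c
 proof (rule prob_Collect_eq_1[THEN iffD2])
  show "AE \<omega> in P. Qx 0 \<omega> + c * Mx 0 \<omega> = c" using coef_AE[OF coef] by eventually_elim blast
 qed measurable
 define K where "K \<eta> = Kb (\<eta> = (1::real))" for \<eta>
 have K1: "K 1 = Kb True" "K (-1) = Kb False" by (simp_all add: K_def)
 have all: "prob {\<omega>\<in>space P. Pr (Xf \<omega>)} = 1" if "\<And>x. Pr x" for Pr :: "(nat \<Rightarrow> 'd) \<Rightarrow> bool"
  using that by (simp add: prob_space)
 have some: "\<exists>x. Pr x" if "0 < prob {\<omega>\<in>space P. Pr (Xf \<omega>)}" for Pr :: "(nat \<Rightarrow> 'd) \<Rightarrow> bool"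
 proof (rule ccontr)
  assume "\<nexists>x. Pr x"
  then show False using that by simp
 qed
 \<comment> \<open>The alternative of vanishing nowhere or everywhere turns an event of positive
   probability, even a single sequence, into a statement about all sequences.\<close>
 have Z_iff: "prob {\<omega>\<in>space P. K 1 (Xf \<omega>) = 0 \<and> K (-1) (Xf \<omega>) = 0} = 1 \<longleftrightarrow> Z"
 proof
  assume "prob {\<omega>\<in>space P. K 1 (Xf \<omega>) = 0 \<and> K (-1) (Xf \<omega>) = 0} = 1"
  then have "0 < prob {\<omega>\<in>space P. K 1 (Xf \<omega>) = 0 \<and> K (-1) (Xf \<omega>) = 0}" by simp
  from some[of "\<lambda>x. K 1 x = 0 \<and> K (-1) x = 0", OF this] obtain x where x: "Kb True x = 0" "Kb False x = 0" unfolding K1 by blast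
  have k0: "\<not> 0 < Kb s x" for s using x by (cases s) simp_all
  have "Kb s y = 0" for s y using dich[of s] k0[of s] by blast
  then show Z unfolding Z_def by blast
 next
  assume Z
  then show "prob {\<omega>\<in>space P. K 1 (Xf \<omega>) = 0 \<and> K (-1) (Xf \<omega>) = 0} = 1" unfolding K1 Z_def by (intro all[of "\<lambda>x. Kb True x = 0 \<and> Kb False x = 0"]) simp
 qed
 show ?thesis
 proof (rule exI[of _ K], intro conjI ballI impI)
  fix \<eta> :: real assume "\<eta> \<in> {-1, 1}"
  then have \<eta>: "\<eta> = esgn (\<eta> = 1)" by auto
  have l: "\<exists>T. \<forall>t\<ge>T. \<forall>x. \<bar>t powr \<alpha> * Fs \<eta> t x - K \<eta> x\<bar> \<le> e" if "0 < e" for e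
   using lim[OF that, of "\<eta> = 1"] unfolding K_def \<eta>[symmetric] .
  have l': "\<exists>T. \<forall>t\<ge>T. \<forall>x. \<bar>t powr \<alpha> * Fs \<eta> t x - K \<eta> x\<bar> < e" if e: "0 < e" for e
  proof -
   have "0 < e / 2" using e by simp
   from l[OF this] obtain T where T: "\<And>t x. T \<le> t \<Longrightarrow> \<bar>t powr \<alpha> * Fs \<eta> t x - K \<eta> x\<bar> \<le> e / 2" by blast
   have "\<bar>t powr \<alpha> * Fs \<eta> t x - K \<eta> x\<bar> < e" if "T \<le> t" for t x using T[OF that, of x] e by linarith
   then show ?thesis by blast
  qed
  show "bounded (range (K \<eta>))" unfolding K_def by (rule bd)
  show "\<forall>x. K \<eta> x \<ge> 0" unfolding K_def using nn by blast
  show "K \<eta> \<in> borel_measurable seqM"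
  proof (rule borel_measurable_LIMSEQ_real)
   show "(\<lambda>n. real n powr \<alpha> * Fs \<eta> (real n) x) \<longlonglongrightarrow> K \<eta> x" for x
   proof (rule LIMSEQ_I)
    fix e :: real assume "0 < e"
    from l'[OF this] obtain T where T: "\<And>t x. T \<le> t \<Longrightarrow> \<bar>t powr \<alpha> * Fs \<eta> t x - K \<eta> x\<bar> < e" by blast
    obtain N :: nat where "T \<le> real N" using real_arch_simple by blast
    then have "norm (real n powr \<alpha> * Fs \<eta> (real n) x - K \<eta> x) < e" if "N \<le> n" for n
     unfolding real_norm_def using that by (intro T) (meson of_nat_mono order_trans)
    then show "\<exists>no. \<forall>n\<ge>no. norm (real n powr \<alpha> * Fs \<eta> (real n) x - K \<eta> x) < e" by blast
   qed
   show "(\<lambda>x. real n powr \<alpha> * Fs \<eta> (real n) x) \<in> borel_measurable seqM" for n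
    by (intro borel_measurable_times borel_measurable_const Fs_measurable conv)
  qed
  have ver: "cond_prob_version P Xf seqM (\<lambda>\<omega>. \<eta> * Rx \<omega> > t) (Fs \<eta> t)" for t
  proof (rule Fs_version[OF conv(1)])
   show "AE \<omega> in P. (\<eta> * Rx \<omega> > t) = (t < \<eta> * Rv \<omega>)" using Rx_Rv by eventually_elim simp
  qed measurable
  show "\<exists>F. (\<forall>t. cond_prob_version P Xf seqM (\<lambda>\<omega>. \<eta> * Rx \<omega> > t) (F t)) \<and> (\<forall>\<epsilon>>0. \<exists>T. \<forall>t\<ge>T. \<forall>x. \<bar>t powr \<alpha> * F t x - K \<eta> x\<bar> < \<epsilon>)"
  proof (intro exI[of _ "Fs \<eta>"] conjI)
   show "\<forall>\<epsilon>>0. \<exists>T. \<forall>t\<ge>T. \<forall>x. \<bar>t powr \<alpha> * Fs \<eta> t x - K \<eta> x\<bar> < \<epsilon>" by (intro allI impI) (rule l')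
   show "\<forall>t. cond_prob_version P Xf seqM (\<lambda>\<omega>. \<eta> * Rx \<omega> > t) (Fs \<eta> t)" by (intro allI ver)
  qed
 next
  assume pos: "0 < prob {\<omega>\<in>space P. Mx 0 \<omega> < 0}"
  have "ck.neg"
  proof (rule ccontr)
   assume "\<not> ck.neg"
   then have "AE u in lam j. 0 < snd u" for j unfolding ck.neg_def by blast
   from AE_coef[OF _ this] have "AE \<omega> in P. \<forall>n i. 0 < Mc n i \<omega>" by (simp add: cf_def)
   then have ae: "AE \<omega> in P. \<omega> \<notin> {\<omega>\<in>space P. Mx 0 \<omega> < 0}" by eventually_elim (simp add: not_less less_imp_le)
   have ev: "{\<omega>\<in>space P. Mx 0 \<omega> < 0} \<in> events" by measurable
   have "prob {\<omega>\<in>space P. Mx 0 \<omega> < 0} = 0" by (rule prob_eq_0[OF ev, THEN iffD2, OF ae])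
   then show False using pos by simp
  qed
  then show "prob {\<omega>\<in>space P. K 1 (Xf \<omega>) = K (-1) (Xf \<omega>)} = 1" unfolding K1 by (intro all[of "\<lambda>x. Kb True x = Kb False x"]) (simp add: sym)
 next
  assume pos: "prob {\<omega>\<in>space P. Qx 0 \<omega> > 0 \<and> Mx 0 \<omega> > 0} = 1"
  have "AE \<omega> in P. Qx 0 \<omega> > 0 \<and> Mx 0 \<omega> > 0" by (rule prob_Collect_eq_1[THEN iffD1, OF _ pos]) measurable
  then have "AE \<omega> in P. 0 < fst (cf \<omega> (0, X 0 \<omega>)) \<and> 0 < snd (cf \<omega> (0, X 0 \<omega>))" by (simp add: cf_def)
  then have lp: "AE u in lam i. 0 < fst u \<and> 0 < snd u" for i
   by (intro AE_lam_of_AE[where Q="\<lambda>_ _ u. 0 < fst u \<and> 0 < snd u"]) measurable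
  from AE_coef[OF _ lp] have "AE \<omega> in P. \<forall>n i. 0 < Qc n i \<omega> \<and> 0 < Mc n i \<omega>" by (simp add: cf_def)
  then have R1: "AE \<omega> in P. 0 \<le> R1 \<omega>"
   using conv(1)
  proof eventually_elim
   case (elim \<omega>)
   have "0 \<le> Rt N k \<omega>" for N k using elim(1) by (induction N arbitrary: k) (simp_all add: less_imp_le)
   then show ?case by (intro tendsto_lowerbound[OF elim(2)]) auto
  qed
  have F0: "Kb False x = 0" for x
  proof -
   have ae: "AE u in lam (x 0). AE \<omega> in P. esgn False * (fst u + snd u * R1 \<omega>) \<le> t" if t: "0 < t" for t
    using lp
   proof eventually_elim
    case (elim u)
    show ?case using R1
    proof eventually_elim
     case (elim \<omega>)
     have "0 \<le> snd u * R1 \<omega>" using elim \<open>0 < fst u \<and> 0 < snd u\<close> by simp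
     then have "0 < fst u + snd u * R1 \<omega>" by (rule add_pos_nonneg[OF conjunct1[OF \<open>0 < fst u \<and> 0 < snd u\<close>]])
     then show ?case using t unfolding esgn_simps mult_minus1 by linarith
    qed
   qed
   have "Fs (esgn False) t x = 0" if "0 < t" for t using ae[OF that] by (rule Fs_zero)
   then show ?thesis by (rule zero)
  qed
  \<comment> \<open>The perpetuity is nonnegative here, so the side of minus sign contributes
    nothing; if the other limit vanished too, the degenerate case would occur.\<close>
  have K0: "Z" if "\<forall>x. Kb True x = 0" unfolding Z_def
  proof (intro allI)
   fix s x show "Kb s x = 0" using that F0 by (cases s) simp_all
  qed
  \<comment> \<open>In the degenerate case \<open>q = c * (1 - m)\<close> with \<open>q\<close>
    positive and \<open>c\<close> nonnegative, hence \<open>m < 1\<close>; with \<open>m\<close>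
    positive this bounds the modulus by 1, which the growth rate at \<open>b2\<close>
    forbids.\<close>
  have "\<not> Z"
  proof
   assume Z
   then obtain c where c: "\<And>i. AE u in lam i. fst u + c * snd u = c" using Z_const by blast
   from R1 coef_imp_const[OF c] have "AE \<omega> in P. 0 \<le> c" by eventually_elim simp
   then have c0: "0 \<le> c" by simp
   have m1: "AE u in lam i. \<bar>snd u\<bar> \<le> 1" for i
    using lp[of i] c[of i]
   proof eventually_elim
    case (elim u)
    have "c * snd u < c * 1" using elim by simp
    then have "snd u < 1" using c0 by (rule mult_left_less_imp_less)
    then show ?case using elim by simp
   qed
   have "Lam b2 \<le> 0" by (rule Lam_le_0[OF m1 less_imp_le[OF Lam_b2(1)]])
   then show False using Lam_b2 by simp
  qed
  then have "\<forall>x. 0 < Kb True x" using K0 dich[of True] by blast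
  then show "prob {\<omega>\<in>space P. K 1 (Xf \<omega>) > 0} = 1" unfolding K1 by (intro all[of "\<lambda>x. 0 < Kb True x"]) blast
 next
  fix \<eta> :: real assume "\<eta> \<in> {-1, 1}" and pos: "0 < prob {\<omega>\<in>space P. K \<eta> (Xf \<omega>) > 0}"
  from some[of "\<lambda>x. 0 < K \<eta> x", OF pos] obtain x where "0 < K \<eta> x" by blast
  then have "K \<eta> x \<noteq> 0" by simp
  then have "\<not> (\<forall>x. K \<eta> x = 0)" by blast
  then have "\<forall>x. 0 < K \<eta> x" using dich[of "\<eta> = 1"] unfolding K_def by blast
  then show "prob {\<omega>\<in>space P. K \<eta> (Xf \<omega>) > 0} = 1" by (intro all[of "\<lambda>x. 0 < K \<eta> x"]) blast
 next
  show "prob {\<omega>\<in>space P. K 1 (Xf \<omega>) = 0 \<and> K (-1) (Xf \<omega>) = 0} = 1 \<longleftrightarrow>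
   (\<exists>\<Gamma> :: 'd \<Rightarrow> real. prob {\<omega>\<in>space P. Qx 0 \<omega> + \<Gamma> (X 0 \<omega>) * Mx 0 \<omega> = \<Gamma> (X 1 \<omega>)} = 1)"
   unfolding Z_iff
  proof
   assume Z
   then obtain c where "\<And>i. AE u in lam i. fst u + c * snd u = c" using Z_const by blast
   from coef_prob[OF this] show "\<exists>\<Gamma> :: 'd \<Rightarrow> real. prob {\<omega>\<in>space P. Qx 0 \<omega> + \<Gamma> (X 0 \<omega>) * Mx 0 \<omega> = \<Gamma> (X 1 \<omega>)} = 1"
    by (intro exI[of _ "\<lambda>_. c"])
  next
   assume "\<exists>\<Gamma> :: 'd \<Rightarrow> real. prob {\<omega>\<in>space P. Qx 0 \<omega> + \<Gamma> (X 0 \<omega>) * Mx 0 \<omega> = \<Gamma> (X 1 \<omega>)} = 1"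
   then obtain \<Gamma> :: "'d \<Rightarrow> real" where "prob {\<omega>\<in>space P. Qx 0 \<omega> + \<Gamma> (X 0 \<omega>) * Mx 0 \<omega> = \<Gamma> (X 1 \<omega>)} = 1" ..
   then show Z by (rule Gamma_Z)
  qed
  show "prob {\<omega>\<in>space P. K 1 (Xf \<omega>) = 0 \<and> K (-1) (Xf \<omega>) = 0} = 1 \<longleftrightarrow>
   (\<exists>c. prob {\<omega>\<in>space P. Qx 0 \<omega> + c * Mx 0 \<omega> = c} = 1)"
   unfolding Z_iff
  proof
   assume Z
   then obtain c where "\<And>i. AE u in lam i. fst u + c * snd u = c" using Z_const by blast
   from coef_prob[OF this] show "\<exists>c. prob {\<omega>\<in>space P. Qx 0 \<omega> + c * Mx 0 \<omega> = c} = 1" ..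
  next
   assume "\<exists>c. prob {\<omega>\<in>space P. Qx 0 \<omega> + c * Mx 0 \<omega> = c} = 1"
   then obtain c where "prob {\<omega>\<in>space P. Qx 0 \<omega> + c * Mx 0 \<omega> = c} = 1" ..
   then show Z by (rule Gamma_Z[of "\<lambda>_. c"])
  qed
 qed
qed

end

theorem theorem3:
  fixes P :: "'a measure" and X :: "int \<Rightarrow> 'a \<Rightarrow> 'd::finite"
    and Qc Mc :: "int \<Rightarrow> 'd \<Rightarrow> 'a \<Rightarrow> real" and q0 m0 :: real
  defines "Q \<equiv> \<lambda>n \<omega>. Qc n (X n \<omega>) \<omega>"
      and "Mm \<equiv> \<lambda>n \<omega>. Mc n (X n \<omega>) \<omega>"
  defines "R \<equiv> \<lambda>\<omega>. Q 0 \<omega> + (\<Sum>n. Q (- int n - 1) \<omega> * (\<Prod>i<Suc n. Mm (- int i) \<omega>))"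
      and "Xf \<equiv> \<lambda>\<omega>. (\<lambda>k::nat. X (int k) \<omega>)"
  assumes "prob_space P"
      and "C_chain P X"
      and "induced_coeffs P X Qc Mc"
      and "q0 > 0" and "m0 > 0"
      and "AE \<omega> in P. \<bar>Q 0 \<omega>\<bar> < q0 \<and> 1 / m0 < \<bar>Mm 0 \<omega>\<bar> \<and> \<bar>Mm 0 \<omega>\<bar> < m0"
      and "\<exists>b1 b2. 0 < b1 \<and> 0 < b2 \<and> Lambda P X Mc b1 < 0 \<and> Lambda P X Mc b2 > 0"
      and "\<forall>\<delta>>0. measure P {\<omega>\<in>space P. Mm 0 \<omega> \<noteq> 0 \<and> (\<exists>k::int. ln \<bar>Mm 0 \<omega>\<bar> = \<delta> * of_int k)}
                  / measure P {\<omega>\<in>space P. Mm 0 \<omega> \<noteq> 0} < 1"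
  shows "(\<forall>\<beta>>0. (\<lambda>n. ereal (Lambda_seq P X Mc \<beta> n)) \<longlonglongrightarrow> Lambda P X Mc \<beta>) \<and>
    (\<exists>\<alpha>. \<alpha> > 0 \<and> Lambda P X Mc \<alpha> = 0 \<and> (\<forall>a. a > 0 \<and> Lambda P X Mc a = 0 \<longrightarrow> a = \<alpha>) \<and>
      (\<exists>K :: real \<Rightarrow> (nat \<Rightarrow> 'd) \<Rightarrow> real.
        \<comment> \<open>(a)\<close>
        (\<forall>\<eta>\<in>{-1, 1}. bounded (range (K \<eta>)) \<and> (\<forall>x. K \<eta> x \<ge> 0) \<and> K \<eta> \<in> borel_measurable seqM \<and>
           (\<exists>F :: real \<Rightarrow> (nat \<Rightarrow> 'd) \<Rightarrow> real.
              (\<forall>t. cond_prob_version P Xf seqM (\<lambda>\<omega>. \<eta> * R \<omega> > t) (F t)) \<and>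
              (\<forall>\<epsilon>>0. \<exists>T. \<forall>t\<ge>T. \<forall>x. \<bar>t powr \<alpha> * F t x - K \<eta> x\<bar> < \<epsilon>))) \<and>
        \<comment> \<open>(b)\<close>
        (measure P {\<omega>\<in>space P. Mm 0 \<omega> < 0} > 0 \<longrightarrow>
           measure P {\<omega>\<in>space P. K 1 (Xf \<omega>) = K (-1) (Xf \<omega>)} = 1) \<and>
        \<comment> \<open>(c)\<close>
        (measure P {\<omega>\<in>space P. Q 0 \<omega> > 0 \<and> Mm 0 \<omega> > 0} = 1 \<longrightarrow>
           measure P {\<omega>\<in>space P. K 1 (Xf \<omega>) > 0} = 1) \<and>
        \<comment> \<open>(d)\<close>
        (\<forall>\<eta>\<in>{-1, 1}. measure P {\<omega>\<in>space P. K \<eta> (Xf \<omega>) > 0} > 0 \<longrightarrow>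
           measure P {\<omega>\<in>space P. K \<eta> (Xf \<omega>) > 0} = 1) \<and>
        \<comment> \<open>(e)\<close>
        ((measure P {\<omega>\<in>space P. K 1 (Xf \<omega>) = 0 \<and> K (-1) (Xf \<omega>) = 0} = 1) \<longleftrightarrow>
           (\<exists>\<Gamma> :: 'd \<Rightarrow> real.
              measure P {\<omega>\<in>space P. Q 0 \<omega> + \<Gamma> (X 0 \<omega>) * Mm 0 \<omega> = \<Gamma> (X 1 \<omega>)} = 1)) \<and>
        ((\<forall>q m i. measure P {\<omega>\<in>space P. Qc 0 i \<omega> = q \<and> Mc 0 i \<omega> = m} < 1) \<longrightarrow>
           ((measure P {\<omega>\<in>space P. K 1 (Xf \<omega>) = 0 \<and> K (-1) (Xf \<omega>) = 0} = 1) \<longleftrightarrow>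
            (\<exists>c::real. measure P {\<omega>\<in>space P. Q 0 \<omega> + c * Mm 0 \<omega> = c} = 1)))))"
proof -
  have bound: "AE \<omega> in P. \<bar>Qc 0 (X 0 \<omega>) \<omega>\<bar> < q0 \<and> 1 / m0 < \<bar>Mc 0 (X 0 \<omega>) \<omega>\<bar> \<and> \<bar>Mc 0 (X 0 \<omega>) \<omega>\<bar> < m0"
    using \<open>AE \<omega> in P. \<bar>Q 0 \<omega>\<bar> < q0 \<and> 1 / m0 < \<bar>Mm 0 \<omega>\<bar> \<and> \<bar>Mm 0 \<omega>\<bar> < m0\<close> unfolding Q_def Mm_def .
  interpret cc: coeffs_chain P X Qc Mc q0 m0
    by (intro coeffs_chain.intro c_chain.intro c_chain_axioms.intro coeffs_chain_axioms.intro bound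
        \<open>prob_space P\<close> \<open>C_chain P X\<close> \<open>induced_coeffs P X Qc Mc\<close> \<open>q0 > 0\<close> \<open>m0 > 0\<close>)
  obtain b1 b2 where b: "0 < b1" "0 < b2" "cc.Lam b1 < 0" "cc.Lam b2 > 0"
    using \<open>\<exists>b1 b2. 0 < b1 \<and> 0 < b2 \<and> Lambda P X Mc b1 < 0 \<and> Lambda P X Mc b2 > 0\<close> unfolding cc.Lambda_eq by auto
  obtain \<alpha> where \<alpha>: "\<alpha> > 0" "cc.Lam \<alpha> = 0" "\<And>a. a > 0 \<Longrightarrow> cc.Lam a = 0 \<Longrightarrow> a = \<alpha>"
    "\<And>\<beta>. 0 < \<beta> \<Longrightarrow> \<beta> < \<alpha> \<Longrightarrow> cc.Lam \<beta> < 0"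
    using cc.critical_exponent[OF b] by blast
  have lat: "measure P {\<omega>\<in>space P. Mc 0 (X 0 \<omega>) \<omega> \<noteq> 0 \<and> (\<exists>k::int. ln \<bar>Mc 0 (X 0 \<omega>) \<omega>\<bar> = \<delta> * of_int k)}
      / measure P {\<omega>\<in>space P. Mc 0 (X 0 \<omega>) \<omega> \<noteq> 0} < 1" if "\<delta> > 0" for \<delta>
    using \<open>\<forall>\<delta>>0. measure P {\<omega>\<in>space P. Mm 0 \<omega> \<noteq> 0 \<and> (\<exists>k::int. ln \<bar>Mm 0 \<omega>\<bar> = \<delta> * of_int k)}
      / measure P {\<omega>\<in>space P. Mm 0 \<omega> \<noteq> 0} < 1\<close> that unfolding Mm_def by blast
  \<comment> \<open>The point \<open>b2\<close> of positive growth is carried along besides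
    \<alpha>, as the positivity claim (c) relies on it.\<close>
  interpret cr: crit_chain P X Qc Mc q0 m0 \<alpha> b2
    by (intro crit_chain.intro crit_chain_axioms.intro cc.coeffs_chain_axioms \<alpha> b(2,4) lat)
  have A: "\<forall>\<beta>>0. (\<lambda>n. ereal (Lambda_seq P X Mc \<beta> n)) \<longlonglongrightarrow> Lambda P X Mc \<beta>"
    by (intro allI impI cc.Lambda_seq_lim)
  have B: "Lambda P X Mc \<alpha> = 0" unfolding cc.Lambda_eq \<alpha>(2) by simp
  have C: "\<forall>a. a > 0 \<and> Lambda P X Mc a = 0 \<longrightarrow> a = \<alpha>"
  proof (intro allI impI)
    fix a assume a: "a > 0 \<and> Lambda P X Mc a = 0"
    then have "cc.Lam a = 0" unfolding cc.Lambda_eq by simp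
    then show "a = \<alpha>" using \<alpha>(3)[of a] a by blast
  qed
  note D = cr.main[unfolded cr.Rx_def cc.Xf_def[abs_def]]
  show ?thesis unfolding Q_def Mm_def R_def Xf_def
    by (rule conjI[OF A], rule exI[of _ \<alpha>], rule conjI[OF \<alpha>(1)], rule conjI[OF B], rule conjI[OF C]) (rule D)
qed

end
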